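(* Let $\mathcal{C}$ be a rigid 2-$C^*$-category with finite-dimensional centers. Let $X:\mathcal{N}\to\mathcal{M}$ and $\overline{X}:\mathcal{M}\to\mathcal{N}$ be conjugate 1-arrows in $\mathcal{C}$, and assume that they are connected. Let $r_X,\overline{r}_X$ be a standard solution of the conjugate equations for $X$ and $\overline{X}$, with associated left and right inverses $\varphi_X,\psi_X$. Then $$\omega_l^X(\mathbf{1}_X\otimes\varphi_X(t))=\omega_r^X(\psi_X(t)\otimes\mathbf{1}_X)\quad\text{for every }t\in\mathrm{Hom}(X,X),$$ where $\omega_l^X,\omega_r^X$ are the left and right states of $X$ (this property of a solution is called sphericality). Vice versa, every solution of the conjugate equations for $X$ and $\overline X$ fulfilling sphericality is necessarily standard.
   Context: 2-$C^*$-categories. A 2-$C^*$-category $\mathcal{C}$ is a strict 2-category with objects $\mathcal{N},\mathcal{M},\dots$, 1-arrows $X:\mathcal{N}\to\mathcal{M}$, and 2-arrows $t\in\mathrm{Hom}(X,Y)$ (for parallel $X,Y:\mathcal N\to\mathcal M$). The composite of $X:\mathcal{N}\to\mathcal{M}$ and $Y:\mathcal{M}\to\mathcal{L}$ is written $Y\otimes X:\mathcal{N}\to\mathcal{L}$; $I_{\mathcal{N}}$ is the unit 1-arrow, $\mathbf{1}_X$ the unit 2-arrow, $s\cdot r$ is vertical and $t\otimes s$ horizontal composition of 2-arrows ($\otimes$ is evaluated before $\cdot$). Each $\mathrm{Hom}(X,Y)$ is a complex Banach space, compositions are bilinear, there is an antilinear involution $*:\mathrm{Hom}(X,Y)\to\mathrm{Hom}(Y,X)$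 with $(s\cdot r)^*=r^*\cdot s^*$, $(s\otimes r)^*=s^*\otimes r^*$, $\mathbf{1}_X^*=\mathbf{1}_X$, $t^*\cdot t$ positive in $\mathrm{Hom}(X,X)$, and the norms are submultiplicative with $\|t^*\cdot t\|=\|t\|^2$. So $\mathrm{Hom}(X,X)$ is a unital $C^*$-algebra and $\mathcal{Z}(\mathcal{N}):=\mathrm{Hom}(I_{\mathcal{N}},I_{\mathcal{N}})$ is commutative. $\mathcal{C}$ is assumed closed under finite direct sums ($Z=X\oplus Y$ via isometries $v\in\mathrm{Hom}(X,Z)$, $w\in\mathrm{Hom}(Y,Z)$ with $vv^*+ww^*=\mathbf{1}_Z$) and sub-1-arrows (every projection $p\in\mathrm{Hom}(T,T)$ is $uu^*$ with $u\in\mathrm{Hom}(S,T)$, $u^*u=\mathbf{1}_S$); zero 1-arrows are allowed. $\mathcal{C}$ is rigid if every $X:\mathcal{N}\to\mathcal{M}$ has a conjugate $\overline{X}:\mathcal{M}\to\mathcal{N}$ with $r_X\in\mathrm{Hom}(I_{\mathcal{N}},\overline{X}\otimes X)$, $\overline{r}_X\in\mathrm{Hom}(I_{\mathcal{M}},X\otimes\overline{X})$ solving the conjugate equations $\overline{r}_X^*\otimes\mathbf{1}_X\cdot\mathbf{1}_X\otimes r_X=\mathbf{1}_X$, $r_X^*\otimes\mathbf{1}_{\overline{X}}\cdot\mathbf{1}_{\overline{X}}\otimes\overline{r}_X=\mathbf{1}_{\overline{X}}$. $\mathcal{C}$ has finite-dimensional centers if every $\mathcal{Z}(\mathcal{N})$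 is finite-dimensional. Left/right centers of $X:\mathcal{N}\to\mathcal{M}$: $\mathcal{Z}_l^X(\mathcal{N}):=\mathbf{1}_X\otimes\mathcal{Z}(\mathcal{N})$, $\mathcal{Z}_r^X(\mathcal{M}):=\mathcal{Z}(\mathcal{M})\otimes\mathbf{1}_X$, subalgebras of the center of $\mathrm{Hom}(X,X)$. $X$ is connected if $\mathcal{Z}_l^X(\mathcal{N})\cap\mathcal{Z}_r^X(\mathcal{M})=\mathbb{C}\mathbf{1}_X$, factorial if both left and right centers equal $\mathbb{C}\mathbf{1}_X$, simple if $\mathrm{Hom}(X,X)=\mathbb{C}\mathbf{1}_X$. Left/right inverses of a solution: $\varphi_X(t)=r_X^*\cdot\mathbf{1}_{\overline{X}}\otimes t\cdot r_X\in\mathcal{Z}(\mathcal{N})$, $\psi_X(t)=\overline{r}_X^*\cdot t\otimes\mathbf{1}_{\overline{X}}\cdot\overline{r}_X\in\mathcal{Z}(\mathcal{M})$. Dimension. For simple $Y$, a solution $r_Y,\overline{r}_Y$ is normalized if $\|\mathbf{1}_Y\otimes r_Y\|=\|\overline{r}_Y\otimes\mathbf{1}_Y\|$, and $d_Y:=\|\mathbf{1}_Y\otimes r_Y\|^2$. For factorial $Y=\oplus_hY_h$, $\overline{Y}=\oplus_h\overline{Y}_h$ with $Y_h$ simple, via isometries $u_h,\overline{u}_h$, a standard solution is $r_Y=\sum_h\overline{u}_h\otimes u_h\cdot r_h$, $\overline{r}_Y=\sum_hu_h\otimes\overline{u}_h\cdot\overline{r}_h$ with $r_h,\overline{r}_h$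 normalized solutions for $Y_h$, and $d_Y:=\|\mathbf{1}_Y\otimes r_Y\|^2=\sum_hd_{Y_h}$. For (nonzero) connected $X$, let $\mathbf{1}_X\otimes q_j$ ($j=1,\dots,n$, $q_j\in\mathcal Z(\mathcal N)$) and $p_i\otimes\mathbf{1}_X$ ($i=1,\dots,m$, $p_i\in\mathcal Z(\mathcal M)$) be the minimal projections of $\mathcal{Z}_l^X(\mathcal{N})$, $\mathcal{Z}_r^X(\mathcal{M})$, and $X_{ij}$ the sub-1-arrow of $X$ for $p_i\otimes\mathbf{1}_X\otimes q_j$ (factorial, or zero). The matrix dimension $D_X$ is the $m\times n$ matrix with entries $d_{X_{ij}}$ ($0$ if $X_{ij}$ is zero), $d_X=\|D_X\|$ ($l^2$-operator norm), and $\nu_X^{1/2},\mu_X^{1/2}$ are the unique positive $l^2$-normalized eigenvectors $D_X^tD_X\nu_X^{1/2}=d_X^2\nu_X^{1/2}$, $D_XD_X^t\mu_X^{1/2}=d_X^2\mu_X^{1/2}$ (entries $\nu_{X,j}^{1/2}$, $\mu_{X,i}^{1/2}$). Standard solution for connected $X$: any solution of the form $$r_X=\sum_{i,j}\frac{\mu_{X,i}^{1/4}}{\nu_{X,j}^{1/4}}\,\overline{v}_{ij}\otimes v_{ij}\cdot r_{ij},\qquad\overline{r}_X=\sum_{i,j}\frac{\nu_{X,j}^{1/4}}{\mu_{X,i}^{1/4}}\,v_{ij}\otimes\overline{v}_{ij}\cdot\overline{r}_{ij},$$ with $v_{ij}\in\mathrm{Hom}(X_{ij},X)$, $\overline{v}_{ij}\in\mathrm{Hom}(\overline{X}_{ij},\overline{X})$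 isometries with ranges $p_i\otimes\mathbf{1}_X\otimes q_j$, $q_j\otimes\mathbf{1}_{\overline{X}}\otimes p_i$, and $r_{ij},\overline{r}_{ij}$ a standard solution for the factorial $X_{ij},\overline{X}_{ij}$ (zero if $X_{ij}$ is zero). Left and right states for connected $X$: $\omega_l^X$ on $\mathcal{Z}_l^X(\mathcal{N})$ and $\omega_r^X$ on $\mathcal{Z}_r^X(\mathcal{M})$, defined by $\omega_l^X(\mathbf{1}_X\otimes q_j)=\nu_{X,j}$, $\omega_r^X(p_i\otimes\mathbf{1}_X)=\mu_{X,i}$. *)

theory Defs
  imports "HOL-Analysis.Analysis"
begin

class complex_normed_space = real_normed_vector +
  fixes scaleC :: "complex \<Rightarrow> 'a \<Rightarrow> 'a"  (infixr "*\<^sub>C" 75)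
  assumes scaleC_add_right: "a *\<^sub>C (x + y) = a *\<^sub>C x + a *\<^sub>C y"
    and scaleC_add_left: "(a + b) *\<^sub>C x = a *\<^sub>C x + b *\<^sub>C x"
    and scaleC_scaleC: "a *\<^sub>C (b *\<^sub>C x) = (a * b) *\<^sub>C x"
    and scaleC_of_real: "complex_of_real r *\<^sub>C x = r *\<^sub>R x"
    and norm_scaleC: "norm (a *\<^sub>C x) = cmod a * norm x"

text \<open>All spaces of 2-arrows are subspaces of one complex normed space \<open>'t\<close>, whose addition,
  scalars and norm they inherit. This is no restriction: an arbitrary family of Banach spaces embeds
  isometrically in its algebraic direct sum with the \<open>l\<^sup>1\<close>-norm, and the compositions and the
  involution extend (bi-, anti-)linearly to it, by zero where they were undefined. The operations are
  total functions, and only their values on composable arguments are constrained. The composite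
  \<open>Y \<otimes> X\<close> of 1-arrows is written \<open>Y \<otimes>\<^sub>1 X\<close>.\<close>

record ('o, 'a, 't) two_category =
  Ob :: "'o set"
  Arr :: "'a set"
  src :: "'a \<Rightarrow> 'o"
  tgt :: "'a \<Rightarrow> 'o"
  id1 :: "'o \<Rightarrow> 'a"  ("\<I>\<index>")
  comp1 :: "'a \<Rightarrow> 'a \<Rightarrow> 'a"  (infixl "\<otimes>\<^sub>1\<index>" 72)
  Hom :: "'a \<Rightarrow> 'a \<Rightarrow> 't set"
  id2 :: "'a \<Rightarrow> 't"  ("\<one>\<index>")
  vcomp :: "'t \<Rightarrow> 't \<Rightarrow> 't"  (infixl "\<cdot>\<index>" 70)
  hcomp :: "'t \<Rightarrow> 't \<Rightarrow> 't"  (infixl "\<otimes>\<index>" 72)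
  adj :: "'t \<Rightarrow> 't"

definition parallel :: "('o, 'a, 't) two_category \<Rightarrow> 'a \<Rightarrow> 'a \<Rightarrow> bool" where
  "parallel C X Y \<longleftrightarrow> X \<in> Arr C \<and> Y \<in> Arr C \<and> src C X = src C Y \<and> tgt C X = tgt C Y"

locale strict_two_category =
  fixes C :: "('o, 'a, 't) two_category" (structure)
  assumes src_closed: "X \<in> Arr C \<Longrightarrow> src C X \<in> Ob C"
    and tgt_closed: "X \<in> Arr C \<Longrightarrow> tgt C X \<in> Ob C"
    and id1_closed: "N \<in> Ob C \<Longrightarrow> \<I> N \<in> Arr C \<and> src C (\<I> N) = N \<and> tgt C (\<I> N) = N"
    and comp1_closed: "\<lbrakk>X \<in> Arr C; Y \<in> Arr C; tgt C X = src C Y\<rbrakk> \<Longrightarrow>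
      Y \<otimes>\<^sub>1 X \<in> Arr C \<and> src C (Y \<otimes>\<^sub>1 X) = src C X \<and> tgt C (Y \<otimes>\<^sub>1 X) = tgt C Y"
    and comp1_assoc: "\<lbrakk>X \<in> Arr C; Y \<in> Arr C; Z \<in> Arr C; tgt C X = src C Y; tgt C Y = src C Z\<rbrakk> \<Longrightarrow>
      (Z \<otimes>\<^sub>1 Y) \<otimes>\<^sub>1 X = Z \<otimes>\<^sub>1 (Y \<otimes>\<^sub>1 X)"
    and comp1_id_right: "X \<in> Arr C \<Longrightarrow> X \<otimes>\<^sub>1 \<I> (src C X) = X"
    and comp1_id_left: "X \<in> Arr C \<Longrightarrow> \<I> (tgt C X) \<otimes>\<^sub>1 X = X"
    and id2_closed: "X \<in> Arr C \<Longrightarrow> \<one> X \<in> Hom C X X"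
    and vcomp_closed: "\<lbrakk>parallel C X Y; parallel C Y Z; r \<in> Hom C X Y; s \<in> Hom C Y Z\<rbrakk> \<Longrightarrow>
      s \<cdot> r \<in> Hom C X Z"
    and vcomp_assoc: "\<lbrakk>parallel C X Y; parallel C Y Z; parallel C Z W;
      r \<in> Hom C X Y; s \<in> Hom C Y Z; t \<in> Hom C Z W\<rbrakk> \<Longrightarrow> (t \<cdot> s) \<cdot> r = t \<cdot> (s \<cdot> r)"
    and vcomp_id_right: "\<lbrakk>parallel C X Y; r \<in> Hom C X Y\<rbrakk> \<Longrightarrow> r \<cdot> \<one> X = r"
    and vcomp_id_left: "\<lbrakk>parallel C X Y; r \<in> Hom C X Y\<rbrakk> \<Longrightarrow> \<one> Y \<cdot> r = r"
    and hcomp_closed: "\<lbrakk>parallel C X X'; parallel C Y Y'; tgt C X = src C Y;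
      s \<in> Hom C X X'; t \<in> Hom C Y Y'\<rbrakk> \<Longrightarrow> t \<otimes> s \<in> Hom C (Y \<otimes>\<^sub>1 X) (Y' \<otimes>\<^sub>1 X')"
    and hcomp_assoc: "\<lbrakk>parallel C X X'; parallel C Y Y'; parallel C Z Z';
      tgt C X = src C Y; tgt C Y = src C Z;
      r \<in> Hom C X X'; s \<in> Hom C Y Y'; t \<in> Hom C Z Z'\<rbrakk> \<Longrightarrow> (t \<otimes> s) \<otimes> r = t \<otimes> (s \<otimes> r)"
    and hcomp_id_right: "\<lbrakk>parallel C X Y; r \<in> Hom C X Y\<rbrakk> \<Longrightarrow> r \<otimes> \<one> (\<I> (src C X)) = r"
    and hcomp_id_left: "\<lbrakk>parallel C X Y; r \<in> Hom C X Y\<rbrakk> \<Longrightarrow> \<one> (\<I> (tgt C X)) \<otimes> r = r"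
    and hcomp_id2: "\<lbrakk>X \<in> Arr C; Y \<in> Arr C; tgt C X = src C Y\<rbrakk> \<Longrightarrow> \<one> Y \<otimes> \<one> X = \<one> (Y \<otimes>\<^sub>1 X)"
    and interchange: "\<lbrakk>parallel C X X'; parallel C X' X''; parallel C Y Y'; parallel C Y' Y'';
      tgt C X = src C Y; s \<in> Hom C X X'; s' \<in> Hom C X' X''; t \<in> Hom C Y Y'; t' \<in> Hom C Y' Y''\<rbrakk> \<Longrightarrow>
      (t' \<cdot> t) \<otimes> (s' \<cdot> s) = (t' \<otimes> s') \<cdot> (t \<otimes> s)"

definition isometry :: "('o, 'a, 't) two_category \<Rightarrow> 'a \<Rightarrow> 'a \<Rightarrow> 't \<Rightarrow> bool" where
  "isometry C S T u \<longleftrightarrow> parallel C S T \<and> u \<in> Hom C S T \<and> adj C u \<cdot>\<^bsub>C\<^esub> u = \<one>\<^bsub>C\<^esub> S"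

definition isometry_onto :: "('o, 'a, 't) two_category \<Rightarrow> 'a \<Rightarrow> 'a \<Rightarrow> 't \<Rightarrow> 't \<Rightarrow> bool" where
  "isometry_onto C S T u p \<longleftrightarrow> isometry C S T u \<and> u \<cdot>\<^bsub>C\<^esub> adj C u = p"

definition projection :: "('o, 'a, 't) two_category \<Rightarrow> 'a \<Rightarrow> 't \<Rightarrow> bool" where
  "projection C T p \<longleftrightarrow> p \<in> Hom C T T \<and> p \<cdot>\<^bsub>C\<^esub> p = p \<and> adj C p = p"

text \<open>Positivity of an element \<open>a\<close> of the C*-algebra \<open>Hom X X\<close> means \<open>a = s\<^sup>* \<cdot> s\<close> for some \<open>s\<close> in the
  same algebra. Zero 1-arrows (those \<open>X\<close> with \<open>\<one> X = 0\<close>) are not excluded; they arise from the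
  projection 0.\<close>

locale two_C_star_category = strict_two_category C
  for C :: "('o, 'a, 't :: complex_normed_space) two_category" (structure) +
  assumes Hom_subspace: "parallel C X Y \<Longrightarrow> module.subspace (*\<^sub>C) (Hom C X Y)"
    and Hom_complete: "parallel C X Y \<Longrightarrow> complete (Hom C X Y)"
    and vcomp_add_left: "\<lbrakk>parallel C X Y; parallel C Y Z; r \<in> Hom C X Y; s \<in> Hom C Y Z; s' \<in> Hom C Y Z\<rbrakk> \<Longrightarrow>
      (s + s') \<cdot> r = s \<cdot> r + s' \<cdot> r"
    and vcomp_add_right: "\<lbrakk>parallel C X Y; parallel C Y Z; r \<in> Hom C X Y; r' \<in> Hom C X Y; s \<in> Hom C Y Z\<rbrakk> \<Longrightarrow>
      s \<cdot> (r + r') = s \<cdot> r + s \<cdot> r'"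
    and vcomp_scaleC_left: "\<lbrakk>parallel C X Y; parallel C Y Z; r \<in> Hom C X Y; s \<in> Hom C Y Z\<rbrakk> \<Longrightarrow>
      (a *\<^sub>C s) \<cdot> r = a *\<^sub>C (s \<cdot> r)"
    and vcomp_scaleC_right: "\<lbrakk>parallel C X Y; parallel C Y Z; r \<in> Hom C X Y; s \<in> Hom C Y Z\<rbrakk> \<Longrightarrow>
      s \<cdot> (a *\<^sub>C r) = a *\<^sub>C (s \<cdot> r)"
    and hcomp_add_left: "\<lbrakk>parallel C X X'; parallel C Y Y'; tgt C X = src C Y;
      s \<in> Hom C X X'; t \<in> Hom C Y Y'; t' \<in> Hom C Y Y'\<rbrakk> \<Longrightarrow> (t + t') \<otimes> s = t \<otimes> s + t' \<otimes> s"
    and hcomp_add_right: "\<lbrakk>parallel C X X'; parallel C Y Y'; tgt C X = src C Y;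
      s \<in> Hom C X X'; s' \<in> Hom C X X'; t \<in> Hom C Y Y'\<rbrakk> \<Longrightarrow> t \<otimes> (s + s') = t \<otimes> s + t \<otimes> s'"
    and hcomp_scaleC_left: "\<lbrakk>parallel C X X'; parallel C Y Y'; tgt C X = src C Y;
      s \<in> Hom C X X'; t \<in> Hom C Y Y'\<rbrakk> \<Longrightarrow> (a *\<^sub>C t) \<otimes> s = a *\<^sub>C (t \<otimes> s)"
    and hcomp_scaleC_right: "\<lbrakk>parallel C X X'; parallel C Y Y'; tgt C X = src C Y;
      s \<in> Hom C X X'; t \<in> Hom C Y Y'\<rbrakk> \<Longrightarrow> t \<otimes> (a *\<^sub>C s) = a *\<^sub>C (t \<otimes> s)"
    and adj_closed: "\<lbrakk>parallel C X Y; t \<in> Hom C X Y\<rbrakk> \<Longrightarrow> adj C t \<in> Hom C Y X"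
    and adj_adj: "\<lbrakk>parallel C X Y; t \<in> Hom C X Y\<rbrakk> \<Longrightarrow> adj C (adj C t) = t"
    and adj_add: "\<lbrakk>parallel C X Y; s \<in> Hom C X Y; t \<in> Hom C X Y\<rbrakk> \<Longrightarrow>
      adj C (s + t) = adj C s + adj C t"
    and adj_scaleC: "\<lbrakk>parallel C X Y; t \<in> Hom C X Y\<rbrakk> \<Longrightarrow> adj C (a *\<^sub>C t) = cnj a *\<^sub>C adj C t"
    and adj_vcomp: "\<lbrakk>parallel C X Y; parallel C Y Z; r \<in> Hom C X Y; s \<in> Hom C Y Z\<rbrakk> \<Longrightarrow>
      adj C (s \<cdot> r) = adj C r \<cdot> adj C s"
    and adj_hcomp: "\<lbrakk>parallel C X X'; parallel C Y Y'; tgt C X = src C Y;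
      s \<in> Hom C X X'; t \<in> Hom C Y Y'\<rbrakk> \<Longrightarrow> adj C (t \<otimes> s) = adj C t \<otimes> adj C s"
    and adj_id2: "X \<in> Arr C \<Longrightarrow> adj C (\<one> X) = \<one> X"
    and adj_vcomp_positive: "\<lbrakk>parallel C X Y; t \<in> Hom C X Y\<rbrakk> \<Longrightarrow>
      \<exists>s\<in>Hom C X X. adj C t \<cdot> t = adj C s \<cdot> s"
    and norm_vcomp: "\<lbrakk>parallel C X Y; parallel C Y Z; r \<in> Hom C X Y; s \<in> Hom C Y Z\<rbrakk> \<Longrightarrow>
      norm (s \<cdot> r) \<le> norm s * norm r"
    and norm_hcomp: "\<lbrakk>parallel C X X'; parallel C Y Y'; tgt C X = src C Y;
      s \<in> Hom C X X'; t \<in> Hom C Y Y'\<rbrakk> \<Longrightarrow> norm (t \<otimes> s) \<le> norm t * norm s"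
    and C_star_identity: "\<lbrakk>parallel C X Y; t \<in> Hom C X Y\<rbrakk> \<Longrightarrow> norm (adj C t \<cdot> t) = (norm t)\<^sup>2"
    and direct_sums: "parallel C X Y \<Longrightarrow>
      \<exists>Z v w. isometry C X Z v \<and> isometry C Y Z w \<and> v \<cdot> adj C v + w \<cdot> adj C w = \<one> Z"
    and sub_1_arrows: "\<lbrakk>T \<in> Arr C; projection C T p\<rbrakk> \<Longrightarrow> \<exists>S u. isometry_onto C S T u p"

definition conjugate_solution ::
  "('o, 'a, 't) two_category \<Rightarrow> 'a \<Rightarrow> 'a \<Rightarrow> 't \<Rightarrow> 't \<Rightarrow> bool" where
  "conjugate_solution C X X' r r' \<longleftrightarrow>
    X \<in> Arr C \<and> X' \<in> Arr C \<and> src C X' = tgt C X \<and> tgt C X' = src C X \<and>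
    r \<in> Hom C (\<I>\<^bsub>C\<^esub> (src C X)) (X' \<otimes>\<^sub>1\<^bsub>C\<^esub> X) \<and>
    r' \<in> Hom C (\<I>\<^bsub>C\<^esub> (tgt C X)) (X \<otimes>\<^sub>1\<^bsub>C\<^esub> X') \<and>
    (adj C r' \<otimes>\<^bsub>C\<^esub> \<one>\<^bsub>C\<^esub> X) \<cdot>\<^bsub>C\<^esub> (\<one>\<^bsub>C\<^esub> X \<otimes>\<^bsub>C\<^esub> r) = \<one>\<^bsub>C\<^esub> X \<and>
    (adj C r \<otimes>\<^bsub>C\<^esub> \<one>\<^bsub>C\<^esub> X') \<cdot>\<^bsub>C\<^esub> (\<one>\<^bsub>C\<^esub> X' \<otimes>\<^bsub>C\<^esub> r') = \<one>\<^bsub>C\<^esub> X'"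

definition conjugate_arrows :: "('o, 'a, 't) two_category \<Rightarrow> 'a \<Rightarrow> 'a \<Rightarrow> bool" where
  "conjugate_arrows C X X' \<longleftrightarrow> (\<exists>r r'. conjugate_solution C X X' r r')"

definition rigid :: "('o, 'a, 't) two_category \<Rightarrow> bool" where
  "rigid C \<longleftrightarrow> (\<forall>X\<in>Arr C. \<exists>X'. conjugate_arrows C X X')"

definition object_center :: "('o, 'a, 't) two_category \<Rightarrow> 'o \<Rightarrow> 't set" where
  "object_center C N = Hom C (\<I>\<^bsub>C\<^esub> N) (\<I>\<^bsub>C\<^esub> N)"

definition finite_dimensional_centers ::
  "('o, 'a, 't :: complex_normed_space) two_category \<Rightarrow> bool" where
  "finite_dimensional_centers C \<longleftrightarrow>
    (\<forall>N\<in>Ob C. \<exists>B. finite B \<and> object_center C N = module.span (*\<^sub>C) B)"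

definition left_center :: "('o, 'a, 't) two_category \<Rightarrow> 'a \<Rightarrow> 't set" where
  "left_center C X = {\<one>\<^bsub>C\<^esub> X \<otimes>\<^bsub>C\<^esub> z | z. z \<in> object_center C (src C X)}"

definition right_center :: "('o, 'a, 't) two_category \<Rightarrow> 'a \<Rightarrow> 't set" where
  "right_center C X = {z \<otimes>\<^bsub>C\<^esub> \<one>\<^bsub>C\<^esub> X | z. z \<in> object_center C (tgt C X)}"

definition scalars :: "('o, 'a, 't :: complex_normed_space) two_category \<Rightarrow> 'a \<Rightarrow> 't set" where
  "scalars C X = {a *\<^sub>C \<one>\<^bsub>C\<^esub> X | a. True}"

text \<open>Zero 1-arrows satisfy the next three definitions; non-vanishing is always required
  separately where it matters.\<close>

definition connected_arrow :: "('o, 'a, 't :: complex_normed_space) two_category \<Rightarrow> 'a \<Rightarrow> bool" where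
  "connected_arrow C X \<longleftrightarrow> X \<in> Arr C \<and> left_center C X \<inter> right_center C X = scalars C X"

definition factorial_arrow :: "('o, 'a, 't :: complex_normed_space) two_category \<Rightarrow> 'a \<Rightarrow> bool" where
  "factorial_arrow C X \<longleftrightarrow> X \<in> Arr C \<and> left_center C X = scalars C X \<and> right_center C X = scalars C X"

definition simple_arrow :: "('o, 'a, 't :: complex_normed_space) two_category \<Rightarrow> 'a \<Rightarrow> bool" where
  "simple_arrow C X \<longleftrightarrow> X \<in> Arr C \<and> Hom C X X = scalars C X"

definition left_inverse_map ::
  "('o, 'a, 't) two_category \<Rightarrow> 'a \<Rightarrow> 't \<Rightarrow> 't \<Rightarrow> 't" where
  "left_inverse_map C X' r t = adj C r \<cdot>\<^bsub>C\<^esub> (\<one>\<^bsub>C\<^esub> X' \<otimes>\<^bsub>C\<^esub> t) \<cdot>\<^bsub>C\<^esub> r"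

definition right_inverse_map ::
  "('o, 'a, 't) two_category \<Rightarrow> 'a \<Rightarrow> 't \<Rightarrow> 't \<Rightarrow> 't" where
  "right_inverse_map C X' r' t = adj C r' \<cdot>\<^bsub>C\<^esub> (t \<otimes>\<^bsub>C\<^esub> \<one>\<^bsub>C\<^esub> X') \<cdot>\<^bsub>C\<^esub> r'"

definition normalized_solution ::
  "('o, 'a, 't :: complex_normed_space) two_category \<Rightarrow> 'a \<Rightarrow> 'a \<Rightarrow> 't \<Rightarrow> 't \<Rightarrow> bool" where
  "normalized_solution C Y Y' r r' \<longleftrightarrow>
    conjugate_solution C Y Y' r r' \<and> norm (\<one>\<^bsub>C\<^esub> Y \<otimes>\<^bsub>C\<^esub> r) = norm (r' \<otimes>\<^bsub>C\<^esub> \<one>\<^bsub>C\<^esub> Y)"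

text \<open>For a zero 1-arrow the only standard solution is zero.\<close>

definition standard_solution_factorial ::
  "('o, 'a, 't :: complex_normed_space) two_category \<Rightarrow> 'a \<Rightarrow> 'a \<Rightarrow> 't \<Rightarrow> 't \<Rightarrow> bool" where
  "standard_solution_factorial C Y Y' r r' \<longleftrightarrow>
    factorial_arrow C Y \<and> Y' \<in> Arr C \<and> src C Y' = tgt C Y \<and> tgt C Y' = src C Y \<and>
    (\<exists>(n::nat) Yh Yh' u u' rh rh'.
      (\<forall>h<n. simple_arrow C (Yh h) \<and>
        isometry C (Yh h) Y (u h) \<and> isometry C (Yh' h) Y' (u' h) \<and>
        normalized_solution C (Yh h) (Yh' h) (rh h) (rh' h)) \<and>
      (\<Sum>h<n. u h \<cdot>\<^bsub>C\<^esub> adj C (u h)) = \<one>\<^bsub>C\<^esub> Y \<and>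
      (\<Sum>h<n. u' h \<cdot>\<^bsub>C\<^esub> adj C (u' h)) = \<one>\<^bsub>C\<^esub> Y' \<and>
      r = (\<Sum>h<n. (u' h \<otimes>\<^bsub>C\<^esub> u h) \<cdot>\<^bsub>C\<^esub> rh h) \<and>
      r' = (\<Sum>h<n. (u h \<otimes>\<^bsub>C\<^esub> u' h) \<cdot>\<^bsub>C\<^esub> rh' h))"

text \<open>The value does not depend on the choice of the conjugate and of the standard solution. For a
  simple \<open>Y\<close> the standard solutions are the normalized ones, so simple 1-arrows are covered.\<close>

definition factorial_dim :: "('o, 'a, 't :: complex_normed_space) two_category \<Rightarrow> 'a \<Rightarrow> real" where
  "factorial_dim C Y =
    (THE d. \<exists>Y' r r'. standard_solution_factorial C Y Y' r r' \<and> d = (norm (\<one>\<^bsub>C\<^esub> Y \<otimes>\<^bsub>C\<^esub> r))\<^sup>2)"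

definition minimal_projections ::
  "('o, 'a, 't :: zero) two_category \<Rightarrow> 'a \<Rightarrow> 't set \<Rightarrow> 't set" where
  "minimal_projections C X A = {p \<in> A. projection C X p \<and> p \<noteq> 0 \<and>
    (\<forall>q\<in>A. projection C X q \<and> p \<cdot>\<^bsub>C\<^esub> q = q \<longrightarrow> q = 0 \<or> q = p)}"

text \<open>Rows and columns of the matrix dimension are indexed by the minimal projections
  \<open>f = p\<^sub>i \<otimes> \<one> X\<close> of the right center and \<open>e = \<one> X \<otimes> q\<^sub>j\<close> of the left center themselves, so that no
  enumeration has to be chosen; note \<open>f \<cdot> e = p\<^sub>i \<otimes> \<one> X \<otimes> q\<^sub>j\<close>.\<close>

abbreviation left_minimal :: "('o, 'a, 't :: zero) two_category \<Rightarrow> 'a \<Rightarrow> 't set" where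
  "left_minimal C X \<equiv> minimal_projections C X (left_center C X)"

abbreviation right_minimal :: "('o, 'a, 't :: zero) two_category \<Rightarrow> 'a \<Rightarrow> 't set" where
  "right_minimal C X \<equiv> minimal_projections C X (right_center C X)"

definition matrix_dim ::
  "('o, 'a, 't :: complex_normed_space) two_category \<Rightarrow> 'a \<Rightarrow> 't \<Rightarrow> 't \<Rightarrow> real" where
  "matrix_dim C X f e =
    (if f \<cdot>\<^bsub>C\<^esub> e = 0 then 0
     else (THE d. \<exists>S u. isometry_onto C S X u (f \<cdot>\<^bsub>C\<^esub> e) \<and> d = factorial_dim C S))"

text \<open>The \<open>l\<^sup>2\<close>-operator norm of a real matrix with rows indexed by \<open>A\<close> and columns by \<open>B\<close>.\<close>

definition matrix_norm :: "('i \<Rightarrow> 'j \<Rightarrow> real) \<Rightarrow> 'i set \<Rightarrow> 'j set \<Rightarrow> real" where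
  "matrix_norm D A B = Sup {L2_set (\<lambda>i. \<Sum>j\<in>B. D i j * x j) A | x. L2_set x B \<le> 1}"

definition arrow_dim :: "('o, 'a, 't :: complex_normed_space) two_category \<Rightarrow> 'a \<Rightarrow> real" where
  "arrow_dim C X = matrix_norm (matrix_dim C X) (right_minimal C X) (left_minimal C X)"

text \<open>The positive \<open>l\<^sup>2\<close>-normalized \<open>x\<close> with \<open>D\<^sup>t D x = c x\<close>, where \<open>D\<close> has rows \<open>A\<close> and columns \<open>B\<close>
  (extended by zero outside \<open>B\<close>, to be unique as a function).\<close>

definition positive_eigenvector ::
  "('i \<Rightarrow> 'j \<Rightarrow> real) \<Rightarrow> 'i set \<Rightarrow> 'j set \<Rightarrow> real \<Rightarrow> 'j \<Rightarrow> real" where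
  "positive_eigenvector D A B c = (THE x.
    (\<forall>j\<in>B. x j > 0) \<and> (\<forall>j. j \<notin> B \<longrightarrow> x j = 0) \<and> L2_set x B = 1 \<and>
    (\<forall>j\<in>B. (\<Sum>i\<in>A. D i j * (\<Sum>k\<in>B. D i k * x k)) = c * x j))"

text \<open>The entries of \<open>\<nu>\<^sub>X\<^sup>1\<^sup>/\<^sup>2\<close> and \<open>\<mu>\<^sub>X\<^sup>1\<^sup>/\<^sup>2\<close>.\<close>

definition sqrt_nu :: "('o, 'a, 't :: complex_normed_space) two_category \<Rightarrow> 'a \<Rightarrow> 't \<Rightarrow> real" where
  "sqrt_nu C X = positive_eigenvector (matrix_dim C X)
    (right_minimal C X) (left_minimal C X) ((arrow_dim C X)\<^sup>2)"

definition sqrt_mu :: "('o, 'a, 't :: complex_normed_space) two_category \<Rightarrow> 'a \<Rightarrow> 't \<Rightarrow> real" where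
  "sqrt_mu C X = positive_eigenvector (\<lambda>e f. matrix_dim C X f e)
    (left_minimal C X) (right_minimal C X) ((arrow_dim C X)\<^sup>2)"

text \<open>In the following, \<open>q e\<close> and \<open>p f\<close> play the roles of \<open>q\<^sub>j\<close> and \<open>p\<^sub>i\<close>, and
  \<open>\<mu>\<^sup>1\<^sup>/\<^sup>4 = sqrt (sqrt_mu C X f)\<close>, \<open>\<nu>\<^sup>1\<^sup>/\<^sup>4 = sqrt (sqrt_nu C X e)\<close>.\<close>

definition standard_solution ::
  "('o, 'a, 't :: complex_normed_space) two_category \<Rightarrow> 'a \<Rightarrow> 'a \<Rightarrow> 't \<Rightarrow> 't \<Rightarrow> bool" where
  "standard_solution C X X' r r' \<longleftrightarrow>
    conjugate_solution C X X' r r' \<and>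
    (\<exists>p q Xs Xs' v v' rs rs'.
      (\<forall>f\<in>right_minimal C X. p f \<in> object_center C (tgt C X) \<and> p f \<otimes>\<^bsub>C\<^esub> \<one>\<^bsub>C\<^esub> X = f) \<and>
      (\<forall>e\<in>left_minimal C X. q e \<in> object_center C (src C X) \<and> \<one>\<^bsub>C\<^esub> X \<otimes>\<^bsub>C\<^esub> q e = e) \<and>
      (\<forall>f\<in>right_minimal C X. \<forall>e\<in>left_minimal C X.
        isometry_onto C (Xs f e) X (v f e) (p f \<otimes>\<^bsub>C\<^esub> \<one>\<^bsub>C\<^esub> X \<otimes>\<^bsub>C\<^esub> q e) \<and>
        isometry_onto C (Xs' f e) X' (v' f e) (q e \<otimes>\<^bsub>C\<^esub> \<one>\<^bsub>C\<^esub> X' \<otimes>\<^bsub>C\<^esub> p f) \<and>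
        standard_solution_factorial C (Xs f e) (Xs' f e) (rs f e) (rs' f e)) \<and>
      r = (\<Sum>f\<in>right_minimal C X. \<Sum>e\<in>left_minimal C X.
        (sqrt (sqrt_mu C X f) / sqrt (sqrt_nu C X e)) *\<^sub>R
          ((v' f e \<otimes>\<^bsub>C\<^esub> v f e) \<cdot>\<^bsub>C\<^esub> rs f e)) \<and>
      r' = (\<Sum>f\<in>right_minimal C X. \<Sum>e\<in>left_minimal C X.
        (sqrt (sqrt_nu C X e) / sqrt (sqrt_mu C X f)) *\<^sub>R
          ((v f e \<otimes>\<^bsub>C\<^esub> v' f e) \<cdot>\<^bsub>C\<^esub> rs' f e)))"

text \<open>The left and right states are the linear functionals on the centers whose values on the
  minimal projections are the entries of \<open>\<nu>\<^sub>X\<close> and \<open>\<mu>\<^sub>X\<close>.\<close>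

definition left_state ::
  "('o, 'a, 't :: complex_normed_space) two_category \<Rightarrow> 'a \<Rightarrow> 't \<Rightarrow> complex" where
  "left_state C X z = (THE w. \<exists>c. z = (\<Sum>e\<in>left_minimal C X. c e *\<^sub>C e) \<and>
    w = (\<Sum>e\<in>left_minimal C X. c e * complex_of_real ((sqrt_nu C X e)\<^sup>2)))"

definition right_state ::
  "('o, 'a, 't :: complex_normed_space) two_category \<Rightarrow> 'a \<Rightarrow> 't \<Rightarrow> complex" where
  "right_state C X z = (THE w. \<exists>c. z = (\<Sum>f\<in>right_minimal C X. c f *\<^sub>C f) \<and>
    w = (\<Sum>f\<in>right_minimal C X. c f * complex_of_real ((sqrt_mu C X f)\<^sup>2)))"

definition spherical ::
  "('o, 'a, 't :: complex_normed_space) two_category \<Rightarrow> 'a \<Rightarrow> 'a \<Rightarrow> 't \<Rightarrow> 't \<Rightarrow> bool" where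
  "spherical C X X' r r' \<longleftrightarrow> (\<forall>t\<in>Hom C X X.
    left_state C X (\<one>\<^bsub>C\<^esub> X \<otimes>\<^bsub>C\<^esub> left_inverse_map C X' r t) =
    right_state C X (right_inverse_map C X' r' t \<otimes>\<^bsub>C\<^esub> \<one>\<^bsub>C\<^esub> X))"

end

(* In a standard solution both sides of sphericality at t equal
   sum_k sqrt(mu_i) sqrt(nu_j) d_k c_k(t), where k runs over the simple constituents of X, contained
   in X_ij, d_k is their dimension and w_k^* t w_k = c_k(t) 1; indeed 1_X (x) r_k^* r_k = d_k (1_X (x) q_j).

   Conversely, write (1 (x) a) r = (a' (x) 1) r for the anti-isomorphism a -> a' of the endomorphism
   algebras of X and X', and tau = omega_l phi = omega_r psi. The functional tau is faithful, and its modular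
   automorphism, computed once with phi and once with psi, is inverse to itself and positive; hence it is
   trivial, which means that a -> a' preserves adjoints. Therefore projections Q of X below p_i (x) 1 (x) q_j are carried to
   projections Q' of X', and compressing r by Q' (x) Q for minimal Q yields solutions for the simple
   constituents; sphericality at t = Q says that they are normalized after rescaling by mu^(1/4) / nu^(1/4).

   This needs: finite dimension of Hom(X, X), proved by bounding orthonormal families in Hom(I, X' X);
   uniqueness of the dimension; and, for the positivity of mu and nu, the Perron-Frobenius theorem, where
   connectedness of X gives irreducibility of the matrix dimension. *)
theory Submission
  imports Defs "HOL-Computational_Algebra.Fundamental_Theorem_Algebra"
begin

section \<open>Finite-dimensional proper *-algebras\<close>

text \<open>Positivity is available only as \<open>t^* t\<close>, and its working form is
  properness: \<open>t^* t = 0\<close> implies \<open>t = 0\<close>. Together with roots of complex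
  polynomials it yields spectral projections, and sums of squares are reduced to it by stacking the
  terms into one column, a 2-arrow into a direct sum. Dimensions, matrix entries, eigenvectors and
  states are definite descriptions, so each must first be shown to exist and to be unique.
  Uniqueness of the dimension rests on two facts. For simple 1-arrows, an intertwiner and its mate
  relate the two solutions by two linear equations that normalization makes symmetric. For factorial
  ones, the intertwiners between the constituents of two decompositions give a matrix whose rows and
  columns sum to 1, and weights that agree wherever an entry is nonzero have equal sums; no matching
  of constituents is constructed. Statements on right inverses, right centers and
  \<open>\<mu>\<close> are the left ones in the category with reversed 1-arrows. Zero 1-arrows may
  occur as pieces, hence the separate cases for a vanishing unit 2-arrow.\<close>

global_interpretation complex_vs: vector_space "scaleC :: complex \<Rightarrow> 't \<Rightarrow> 't :: complex_normed_space"
proof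
  fix a b :: complex and x y :: 't
  \<comment> \<open>The class lists no unit law; it comes from the compatibility with real
    scalars.\<close>
  show "1 *\<^sub>C x = x"
    using scaleC_of_real[of 1 x] by simp
qed (rule scaleC_add_right scaleC_add_left scaleC_scaleC)+

lemma scaleC_one: "1 *\<^sub>C x = (x :: 't :: complex_normed_space)"
  by simp

text \<open>There are \<open>card B + 1\<close> vectors in a space spanned by \<open>card B\<close>.
  Independence is a notion for sets, so a family with a repeated member is treated apart, with
  coefficients 1 and -1.\<close>

lemma linear_relation:
  fixes f :: "nat \<Rightarrow> 't :: complex_normed_space"
  assumes B: "finite B" and f: "\<And>i. i \<le> card B \<Longrightarrow> f i \<in> complex_vs.span B"
  shows "\<exists>c. (\<exists>i\<le>card B. c i \<noteq> 0) \<and> (\<Sum>i\<le>card B. c i *\<^sub>C f i) = 0"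
proof (cases "inj_on f {..card B}")
  case True
  let ?S = "f ` {..card B}"
  have "card ?S = Suc (card B)"
    using True by (simp add: card_image)
  moreover have "?S \<subseteq> complex_vs.span B"
    using f by auto
  ultimately have "complex_vs.dependent ?S"
    using complex_vs.independent_span_bound[OF B, of ?S] by fastforce
  then obtain u v where v: "v \<in> ?S" "u v \<noteq> 0" and u: "(\<Sum>v\<in>?S. u v *\<^sub>C v) = 0"
    using complex_vs.dependent_finite[of ?S] by auto
  from v obtain i where "i \<le> card B" "u (f i) \<noteq> 0"
    by auto
  moreover have "(\<Sum>i\<le>card B. u (f i) *\<^sub>C f i) = 0"
    using u sum.reindex[OF True, of "\<lambda>v. u v *\<^sub>C v"] by simp
  ultimately show ?thesis
    by (intro exI[of _ "u \<circ> f"]) auto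
next
  case False
  then obtain i j where ij: "i \<le> card B" "j \<le> card B" "i \<noteq> j" "f i = f j"
    by (auto simp: inj_on_def)
  let ?c = "\<lambda>k. if k = i then 1 else if k = j then -1 else (0 :: complex)"
  have "(\<Sum>k\<le>card B. ?c k *\<^sub>C f k) = (\<Sum>k\<in>{i, j}. ?c k *\<^sub>C f k)"
    using ij by (intro sum.mono_neutral_right) auto
  also have "\<dots> = 0"
    using ij by simp
  finally show ?thesis
    using ij by (intro exI[of _ ?c]) auto
qed

text \<open>The algebra is a subset of one normed space with total operations, so that corners and
  centers are instances with the same operations and possibly another unit. \<open>proper\<close> is
  what remains of the C*-identity, and it passes to every *-subalgebra. The spanning set in
  \<open>finite_dim\<close> may lie outside \<open>A\<close>, so this condition passes to subsets as
  well.\<close>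

locale star_algebra =
  fixes A :: "'t :: complex_normed_space set"
    and mul :: "'t \<Rightarrow> 't \<Rightarrow> 't" (infixl "\<odot>" 70)
    and star :: "'t \<Rightarrow> 't"
    and one :: 't
  assumes subspace: "complex_vs.subspace A"
    and mul_closed [simp]: "a \<in> A \<Longrightarrow> b \<in> A \<Longrightarrow> a \<odot> b \<in> A"
    and star_closed [simp]: "a \<in> A \<Longrightarrow> star a \<in> A"
    and one_closed [simp]: "one \<in> A"
    and mul_assoc: "a \<in> A \<Longrightarrow> b \<in> A \<Longrightarrow> c \<in> A \<Longrightarrow> a \<odot> b \<odot> c = a \<odot> (b \<odot> c)"
    and add_mul: "a \<in> A \<Longrightarrow> b \<in> A \<Longrightarrow> c \<in> A \<Longrightarrow> (a + b) \<odot> c = a \<odot> c + b \<odot> c"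
    and mul_add: "a \<in> A \<Longrightarrow> b \<in> A \<Longrightarrow> c \<in> A \<Longrightarrow> a \<odot> (b + c) = a \<odot> b + a \<odot> c"
    and scale_mul: "a \<in> A \<Longrightarrow> b \<in> A \<Longrightarrow> (k *\<^sub>C a) \<odot> b = k *\<^sub>C (a \<odot> b)"
    and mul_scale: "a \<in> A \<Longrightarrow> b \<in> A \<Longrightarrow> a \<odot> (k *\<^sub>C b) = k *\<^sub>C (a \<odot> b)"
    and one_mul [simp]: "a \<in> A \<Longrightarrow> one \<odot> a = a"
    and mul_one [simp]: "a \<in> A \<Longrightarrow> a \<odot> one = a"
    and star_star [simp]: "a \<in> A \<Longrightarrow> star (star a) = a"
    and star_add: "a \<in> A \<Longrightarrow> b \<in> A \<Longrightarrow> star (a + b) = star a + star b"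
    and star_scale: "a \<in> A \<Longrightarrow> star (k *\<^sub>C a) = cnj k *\<^sub>C star a"
    and star_mul: "a \<in> A \<Longrightarrow> b \<in> A \<Longrightarrow> star (a \<odot> b) = star b \<odot> star a"
    and proper: "a \<in> A \<Longrightarrow> star a \<odot> a = 0 \<Longrightarrow> a = 0"
    and finite_dim: "\<exists>B. finite B \<and> A \<subseteq> complex_vs.span B"
begin

lemma zero_closed [simp]: "0 \<in> A"
  using subspace by (rule complex_vs.subspace_0)

lemma add_closed [simp]: "a \<in> A \<Longrightarrow> b \<in> A \<Longrightarrow> a + b \<in> A"
  using subspace by (rule complex_vs.subspace_add)

lemma diff_closed [simp]: "a \<in> A \<Longrightarrow> b \<in> A \<Longrightarrow> a - b \<in> A"
  using subspace by (rule complex_vs.subspace_diff)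

lemma scale_closed [simp]: "a \<in> A \<Longrightarrow> k *\<^sub>C a \<in> A"
  using subspace by (rule complex_vs.subspace_scale)

lemma sum_closed [simp]: "(\<And>i. i \<in> I \<Longrightarrow> f i \<in> A) \<Longrightarrow> sum f I \<in> A"
  using subspace by (rule complex_vs.subspace_sum)

lemma zero_mul [simp]: "a \<in> A \<Longrightarrow> 0 \<odot> a = 0"
  using scale_mul[of a a 0] by simp

lemma mul_zero [simp]: "a \<in> A \<Longrightarrow> a \<odot> 0 = 0"
  using mul_scale[of a a 0] by simp

lemma star_zero [simp]: "star 0 = 0"
  using star_scale[of 0 0] by simp

lemma mul_diff: "a \<in> A \<Longrightarrow> b \<in> A \<Longrightarrow> c \<in> A \<Longrightarrow> a \<odot> (b - c) = a \<odot> b - a \<odot> c"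
  using mul_add[of a "b - c" c] by (simp add: algebra_simps)

lemma diff_mul: "a \<in> A \<Longrightarrow> b \<in> A \<Longrightarrow> c \<in> A \<Longrightarrow> (a - b) \<odot> c = a \<odot> c - b \<odot> c"
  using add_mul[of "a - b" b c] by (simp add: algebra_simps)

lemma star_diff: "a \<in> A \<Longrightarrow> b \<in> A \<Longrightarrow> star (a - b) = star a - star b"
  using star_add[of "a - b" b] by (simp add: algebra_simps)

lemma sum_mul: "(\<And>i. i \<in> I \<Longrightarrow> f i \<in> A) \<Longrightarrow> a \<in> A \<Longrightarrow> sum f I \<odot> a = (\<Sum>i\<in>I. f i \<odot> a)"
  by (induction I rule: infinite_finite_induct) (auto simp: add_mul)

lemma mul_sum: "(\<And>i. i \<in> I \<Longrightarrow> f i \<in> A) \<Longrightarrow> a \<in> A \<Longrightarrow> a \<odot> sum f I = (\<Sum>i\<in>I. a \<odot> f i)"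
  by (induction I rule: infinite_finite_induct) (auto simp: mul_add)

lemma star_sum: "(\<And>i. i \<in> I \<Longrightarrow> f i \<in> A) \<Longrightarrow> star (sum f I) = (\<Sum>i\<in>I. star (f i))"
  by (induction I rule: infinite_finite_induct) (auto simp: star_add)

definition proj :: "'t \<Rightarrow> bool" where
  "proj p \<longleftrightarrow> p \<in> A \<and> p \<odot> p = p \<and> star p = p"

lemma projD: "proj p \<Longrightarrow> p \<in> A" "proj p \<Longrightarrow> p \<odot> p = p" "proj p \<Longrightarrow> star p = p"
  by (auto simp: proj_def)

lemma proj_one: "proj one"
proof -
  have "star one \<odot> one = star one"
    by simp
  from arg_cong[OF this, of star] have "star one = one"
    using star_mul[of "star one" one] by simp
  then show ?thesis
    by (simp add: proj_def)
qed

lemma proj_diff: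
  assumes "proj p" "proj q" "p \<odot> q = q"
  shows "proj (p - q)" "q \<odot> p = q"
proof -
  show "q \<odot> p = q"
    using assms star_mul[of p q] by (simp add: proj_def)
  then show "proj (p - q)"
    using assms by (simp add: proj_def mul_diff diff_mul star_diff)
qed

definition minproj :: "'t set" where
  "minproj = {p. proj p \<and> p \<noteq> 0 \<and> (\<forall>q. proj q \<longrightarrow> p \<odot> q = q \<longrightarrow> q = 0 \<or> q = p)}"

text \<open>Horner evaluation of a polynomial at an algebra element, with \<open>one\<close>
  carrying the constant term; the product and the unit are those of the locale.\<close>

definition peval :: "'t \<Rightarrow> complex poly \<Rightarrow> 't" where
  "peval a p = fold_coeffs (\<lambda>c x. c *\<^sub>C one + a \<odot> x) p 0"

lemma peval_0 [simp]: "peval a 0 = 0"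
  by (simp add: peval_def)

lemma peval_pCons: "a \<in> A \<Longrightarrow> peval a (pCons c p) = c *\<^sub>C one + a \<odot> peval a p"
  by (cases "p = 0 \<and> c = 0") (auto simp: peval_def)

lemma peval_closed [simp]: "a \<in> A \<Longrightarrow> peval a p \<in> A"
  by (induction p) (auto simp: peval_pCons)

lemma peval_add: "a \<in> A \<Longrightarrow> peval a (p + q) = peval a p + peval a q"
proof (induction p arbitrary: q)
  case (pCons c p)
  show ?case
    using pCons by (cases q) (simp add: peval_pCons mul_add scaleC_add_left add_ac)
qed auto

lemma peval_smult: "a \<in> A \<Longrightarrow> peval a (smult c p) = c *\<^sub>C peval a p"
  by (induction p) (auto simp: peval_pCons mul_scale scaleC_add_right)

lemma peval_sum: "a \<in> A \<Longrightarrow> peval a (sum f I) = (\<Sum>i\<in>I. peval a (f i))"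
  by (induction I rule: infinite_finite_induct) (auto simp: peval_add)

lemma peval_linear_mult:
  "a \<in> A \<Longrightarrow> peval a ([:- l, 1:] * p) = a \<odot> peval a p - l *\<^sub>C peval a p"
  using peval_add[of a "smult (- l) p" "pCons 0 p"] peval_smult[of a "- l" p] by (simp add: peval_pCons)

lemma mul_peval_commute:
  assumes "a \<in> A" "c \<in> A" "a \<odot> c = c \<odot> a"
  shows "peval a p \<odot> c = c \<odot> peval a p"
proof (induction p)
  case (pCons k p)
  have "(a \<odot> peval a p) \<odot> c = c \<odot> (a \<odot> peval a p)"
    using assms pCons mul_assoc[of a "peval a p" c] mul_assoc[of a c "peval a p"]
      mul_assoc[of c a "peval a p"] by simp
  then show ?case
    using assms by (simp add: peval_pCons mul_add add_mul mul_scale scale_mul)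
qed (use assms in auto)

lemma mul_peval_eigen:
  assumes "a \<in> A" "c \<in> A" "c \<odot> a = l *\<^sub>C c"
  shows "c \<odot> peval a p = poly p l *\<^sub>C c"
proof (induction p)
  case (pCons k p)
  have "c \<odot> (a \<odot> peval a p) = (l * poly p l) *\<^sub>C c"
    using assms pCons mul_assoc[of c a "peval a p"] by (simp add: scale_mul scaleC_scaleC)
  then show ?case
    using assms by (simp add: peval_pCons mul_add mul_scale scaleC_add_left)
qed (use assms in auto)

text \<open>The powers \<open>peval a (monom 1 i)\<close> lie in a finite-dimensional space, so
  finitely many of them are linearly dependent.\<close>

lemma annihilating_poly:
  assumes a: "a \<in> A"
  shows "\<exists>p. p \<noteq> 0 \<and> peval a p = 0"
proof -
  obtain B where B: "finite B" "A \<subseteq> complex_vs.span B"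
    using finite_dim by blast
  have "\<And>i. peval a (monom 1 i) \<in> complex_vs.span B"
    using B a by auto
  from linear_relation[of B "\<lambda>i. peval a (monom 1 i)", OF B(1) this] obtain c i where i: "i \<le> card B" "c i \<noteq> 0"
    and c: "(\<Sum>i\<le>card B. c i *\<^sub>C peval a (monom 1 i)) = 0"
    by auto
  let ?p = "\<Sum>i\<le>card B. smult (c i) (monom 1 i)"
  have "coeff ?p i = c i"
    using i by (simp add: coeff_sum if_distrib sum.delta cong: if_cong)
  then have "?p \<noteq> 0"
    using i by auto
  moreover have "peval a ?p = 0"
    using c a by (simp add: peval_sum peval_smult del: smult_monom)
  ultimately show ?thesis
    by blast
qed

text \<open>With \<open>b = q(a) \<noteq> 0\<close> and \<open>a b = \<lambda> b\<close>, properness replaces the functional calculus: \<open>c = b\<^sup>* b\<close>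
  satisfies \<open>c\<^sup>2 = |q(\<lambda>)|\<^sup>2 c \<noteq> 0\<close>.\<close>

lemma eigenprojection:
  assumes a: "a \<in> A" "star a = a" and one: "one \<noteq> 0"
  shows "\<exists>e l. proj e \<and> e \<noteq> 0 \<and> a \<odot> e = l *\<^sub>C e"
proof -
  \<comment> \<open>An annihilating polynomial of least degree: splitting off a linear factor leaves
    \<open>q\<close> of smaller degree, so \<open>peval a q\<close> cannot vanish.\<close>
  define m where "m = (LEAST n. \<exists>p. p \<noteq> 0 \<and> peval a p = 0 \<and> degree p = n)"
  have "\<exists>n p. p \<noteq> 0 \<and> peval a p = 0 \<and> degree p = n"
    using annihilating_poly[OF a(1)] by blast
  from LeastI_ex[OF this] obtain p where p: "p \<noteq> 0" "peval a p = 0" "degree p = m"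
    unfolding m_def by blast
  have least: "m \<le> degree q" if "q \<noteq> 0" "peval a q = 0" for q
    unfolding m_def using that by (intro Least_le) blast
  have "degree p \<noteq> 0"
  proof
    assume "degree p = 0"
    then obtain c where c: "p = [:c:]"
      by (rule degree_eq_zeroE)
    then have "c *\<^sub>C one = 0"
      using p a by (simp add: peval_pCons)
    then show False
      using c p one by simp
  qed
  then obtain l where "poly p l = 0"
    using fundamental_theorem_of_algebra[of p] constant_degree[of p] by auto
  then obtain q where q: "p = [:- l, 1:] * q"
    by (auto simp: poly_eq_0_iff_dvd elim: dvdE)
  have q0: "q \<noteq> 0"
    using p q by auto
  then have "degree p = Suc (degree q)"
    unfolding q by (subst degree_mult_eq) auto
  then have b0: "peval a q \<noteq> 0"
    using least[of q] q0 p by auto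
  define b where "b = peval a q"
  have b: "b \<in> A" "b \<noteq> 0" "a \<odot> b = l *\<^sub>C b"
    using b0 p q a peval_linear_mult[of a l q] by (auto simp: b_def)
  have comm: "a \<odot> b = b \<odot> a"
    unfolding b_def using mul_peval_commute[of a a q] a by simp
  have comm': "a \<odot> star b = star b \<odot> a"
    using arg_cong[OF comm, of star] a(2) star_mul[OF a(1) b(1)] star_mul[OF b(1) a(1)] by simp
  define c where "c = star b \<odot> b"
  have c: "c \<in> A" "star c = c" "c \<noteq> 0"
    using b proper[of b] by (auto simp: c_def star_mul)
  have ac: "a \<odot> c = l *\<^sub>C c"
    unfolding c_def using a b comm' mul_assoc[of a "star b" b] mul_assoc[of "star b" a b]
    by (simp add: mul_scale)
  have ca: "c \<odot> a = l *\<^sub>C c"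
    using ac comm comm' a b mul_assoc[of "star b" b a] mul_assoc[of "star b" a b] mul_assoc[of a "star b" b]
    unfolding c_def by simp
  have cb: "c \<odot> b = poly q l *\<^sub>C c"
    unfolding b_def using ca a c by (intro mul_peval_eigen) auto
  have bc: "star b \<odot> c = cnj (poly q l) *\<^sub>C c"
    using arg_cong[OF cb, of star] b c by (simp add: star_mul star_scale)
  have "b \<odot> c = c \<odot> b"
    unfolding b_def using mul_peval_commute[of a c q] a c ac ca by simp
  \<comment> \<open>The product \<open>b^* b c\<close> is regrouped as \<open>b^* c b\<close>; then
    \<open>bc\<close> evaluates the left pair and \<open>cb\<close> what is left.\<close>
  then have "c \<odot> c = (cnj (poly q l) * poly q l) *\<^sub>C c"
    using b c bc cb mul_assoc[of "star b" b c] unfolding c_def[symmetric]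
    by (subst c_def) (simp add: mul_assoc mul_scale scaleC_scaleC mult.commute)
  then have cc: "c \<odot> c = of_real ((cmod (poly q l))\<^sup>2) *\<^sub>C c"
    by (metis complex_norm_square mult.commute)
  define k where "k = (cmod (poly q l))\<^sup>2"
  \<comment> \<open>Since \<open>c\<close> is self-adjoint, properness applies to \<open>c\<close>
    itself.\<close>
  have "c \<odot> c \<noteq> 0"
    using proper[of c] c by auto
  then have k: "k \<noteq> 0"
    using cc unfolding k_def by auto
  define e where "e = of_real (1 / k) *\<^sub>C c"
  have "proj e"
    using c k cc unfolding proj_def e_def k_def[symmetric]
    by (auto simp: scale_mul mul_scale star_scale scaleC_scaleC)
  moreover have "e \<noteq> 0"
    using c k by (simp add: e_def)
  moreover have "a \<odot> e = l *\<^sub>C e"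
    using a c ac by (simp add: e_def mul_scale scaleC_scaleC mult.commute)
  ultimately show ?thesis
    by blast
qed

text \<open>A self-adjoint element acts as a scalar on some nonzero projection, by
  \<open>eigenprojection\<close>, and here that projection must be \<open>one\<close>. A general
  element is half the sum of \<open>a + star a\<close> and \<open>a - star a\<close>, and the
  imaginary unit makes the second self-adjoint.\<close>

lemma scalar_if_no_projections:
  assumes no: "\<And>e. proj e \<Longrightarrow> e = 0 \<or> e = one" and a: "a \<in> A"
  shows "\<exists>k. a = k *\<^sub>C one"
proof (cases "one = 0")
  case True
  then have "a = 0"
    using one_mul[OF a] a by simp
  then show ?thesis
    by (intro exI[of _ 0]) simp
next
  case False
  have sa: "\<exists>k. b = k *\<^sub>C one" if "b \<in> A" "star b = b" for b
    using eigenprojection[OF that False] no that by (metis mul_one)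
  obtain k where k: "a + star a = k *\<^sub>C one"
    using sa[of "a + star a"] a by (auto simp: star_add add.commute)
  obtain l where l: "\<i> *\<^sub>C (a - star a) = l *\<^sub>C one"
    using sa[of "\<i> *\<^sub>C (a - star a)"] a
    by (auto simp: star_diff star_scale complex_vs.scale_right_diff_distrib)
  have "a - star a = (- \<i>) *\<^sub>C (\<i> *\<^sub>C (a - star a))"
    by (simp add: scaleC_scaleC)
  also have "\<dots> = (- \<i> * l) *\<^sub>C one"
    unfolding l by (simp add: scaleC_scaleC)
  finally have l': "a - star a = (- \<i> * l) *\<^sub>C one" .
  have "a = (1/2) *\<^sub>C ((a + star a) + (a - star a))"
    using scaleC_add_left[of "1/2" "1/2" a] by (simp add: scaleC_add_right)
  also have "\<dots> = ((1/2) * (k - \<i> * l)) *\<^sub>C one"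
    unfolding k l' by (simp add: scaleC_scaleC complex_vs.scale_right_diff_distrib complex_vs.scale_left_diff_distrib
        diff_divide_distrib)
  finally show ?thesis
    by blast
qed

section \<open>Corners and decompositions into minimal projections\<close>

lemma corner: "proj p \<Longrightarrow> star_algebra {a \<in> A. p \<odot> a = a \<and> a \<odot> p = a} (\<odot>) star p"
proof (unfold_locales, goal_cases)
  case 1
  then show ?case
    by (auto simp: complex_vs.subspace_def proj_def mul_add add_mul mul_scale scale_mul)
next
  case (2 a b)
  then show ?case
    using mul_assoc[of p a b] mul_assoc[of a b p] by (auto simp: proj_def)
next
  case (3 a)
  then show ?case
    using star_mul[of p a] star_mul[of a p] by (auto simp: proj_def)
next
  case 17
  then show ?case
    using finite_dim by blast
qed (auto simp: proj_def mul_assoc mul_add add_mul mul_scale scale_mul star_add star_mul star_scale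
      proper)

text \<open>In the corner \<open>p A p\<close>, written as the set of elements fixed by
  \<open>p\<close> on both sides, a minimal \<open>p\<close> leaves no projections besides 0 and the
  unit.\<close>

lemma minproj_scalar:
  assumes p: "p \<in> minproj" and a: "a \<in> A"
  shows "\<exists>k. p \<odot> a \<odot> p = k *\<^sub>C p"
proof -
  have pp: "proj p"
    using p by (simp add: minproj_def)
  have in_corner: "p \<odot> a \<odot> p \<in> {a \<in> A. p \<odot> a = a \<and> a \<odot> p = a}"
  proof (intro CollectI conjI)
    show "p \<odot> (p \<odot> a \<odot> p) = p \<odot> a \<odot> p"
      using projD[OF pp] a by (metis mul_assoc mul_closed)
    show "p \<odot> a \<odot> p \<odot> p = p \<odot> a \<odot> p"
      using projD[OF pp] a by (simp add: mul_assoc)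
  qed (use projD[OF pp] a in simp)
  interpret c: star_algebra "{a \<in> A. p \<odot> a = a \<and> a \<odot> p = a}" "(\<odot>)" star p
    using pp by (rule corner)
  have "e = 0 \<or> e = p" if "c.proj e" for e
    using that p unfolding c.proj_def minproj_def proj_def by blast
  then show ?thesis
    using in_corner by (intro c.scalar_if_no_projections)
qed

text \<open>Orthogonal nonzero projections are linearly independent: multiplying a vanishing
  combination by one of them isolates its coefficient.\<close>

lemma orthogonal_card_bound:
  shows "\<exists>n. \<forall>S. finite S \<longrightarrow> (\<forall>p\<in>S. proj p \<and> p \<noteq> 0) \<longrightarrow> (\<forall>p\<in>S. \<forall>q\<in>S. p \<noteq> q \<longrightarrow> p \<odot> q = 0)
    \<longrightarrow> card S \<le> n"
proof -
  obtain B where B: "finite B" "A \<subseteq> complex_vs.span B"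
    using finite_dim by blast
  have "card S \<le> card B" if S: "finite S" "\<forall>p\<in>S. proj p \<and> p \<noteq> 0"
    "\<forall>p\<in>S. \<forall>q\<in>S. p \<noteq> q \<longrightarrow> p \<odot> q = 0" for S
  proof -
    have "complex_vs.independent S"
      unfolding complex_vs.dependent_finite[OF S(1)]
    proof safe
      fix u v assume v: "v \<in> S" "u v \<noteq> 0" and u: "(\<Sum>v\<in>S. u v *\<^sub>C v) = 0"
      have "0 = v \<odot> (\<Sum>w\<in>S. u w *\<^sub>C w)"
        using u v S by (simp add: proj_def)
      also have "\<dots> = (\<Sum>w\<in>S. v \<odot> (u w *\<^sub>C w))"
        using v S by (subst mul_sum) (auto simp: proj_def)
      also have "\<dots> = (\<Sum>w\<in>S. if w = v then u v *\<^sub>C v else 0)"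
        using v S by (intro sum.cong) (auto simp: proj_def mul_scale)
      also have "\<dots> = u v *\<^sub>C v"
        using v S by simp
      finally show False
        using v S by auto
    qed
    moreover have "S \<subseteq> complex_vs.span B"
      using S B by (auto simp: proj_def)
    ultimately show ?thesis
      using complex_vs.independent_span_bound[OF B(1)] by blast
  qed
  then show ?thesis
    by blast
qed

text \<open>Take an orthogonal family of nonzero projections below \<open>g\<close> with as many
  members as possible. If its sum were not \<open>g\<close>, the difference could be added; if a
  member were not minimal, a smaller projection and its complement could replace it.\<close>

lemma minproj_decomposition:
  assumes g: "proj g"
  shows "\<exists>S. finite S \<and> S \<subseteq> minproj \<and> (\<forall>p\<in>S. \<forall>q\<in>S. p \<noteq> q \<longrightarrow> p \<odot> q = 0) \<and> (\<Sum>p\<in>S. p) = g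
    \<and> (\<forall>p\<in>S. g \<odot> p = p \<and> p \<odot> g = p)"
proof -
  define P where "P S \<longleftrightarrow> finite S \<and> (\<forall>p\<in>S. proj p \<and> p \<noteq> 0 \<and> g \<odot> p = p) \<and>
    (\<forall>p\<in>S. \<forall>q\<in>S. p \<noteq> q \<longrightarrow> p \<odot> q = 0)" for S
  from orthogonal_card_bound obtain n where "\<forall>S. finite S \<longrightarrow> (\<forall>p\<in>S. proj p \<and> p \<noteq> 0) \<longrightarrow>
    (\<forall>p\<in>S. \<forall>q\<in>S. p \<noteq> q \<longrightarrow> p \<odot> q = 0) \<longrightarrow> card S \<le> n" ..
  then have n: "\<And>S. P S \<Longrightarrow> card S \<le> n"
    by (simp add: P_def)
  have "P {}"
    by (simp add: P_def)
  then obtain S where S: "P S" and max: "\<And>S'. P S' \<Longrightarrow> card S' \<le> card S"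
    using ex_has_greatest_nat[of P "{}" card "Suc n"] n le_imp_less_Suc by blast
  note Sd = S[unfolded P_def]
  define s where "s = (\<Sum>p\<in>S. p)"
  have SA: "\<And>p. p \<in> S \<Longrightarrow> p \<in> A"
    using Sd by (auto simp: proj_def)
  have gA: "g \<in> A"
    using g by (simp add: proj_def)
  have pg: "\<And>p. p \<in> S \<Longrightarrow> p \<odot> g = p"
    using Sd proj_diff(2)[OF g] by auto
  have ps: "p \<odot> s = p" if "p \<in> S" for p
  proof -
    have "p \<odot> s = (\<Sum>q\<in>S. p \<odot> q)"
      unfolding s_def using that SA by (intro mul_sum) auto
    also have "\<dots> = (\<Sum>q\<in>S. if q = p then p else 0)"
      using that Sd by (intro sum.cong) (auto simp: proj_def)
    finally show ?thesis
      using that Sd by simp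
  qed
  have sp: "proj s"
    unfolding proj_def
  proof (intro conjI)
    show "s \<in> A"
      unfolding s_def using SA by auto
    then show "s \<odot> s = s"
      using SA ps sum_mul[of S "\<lambda>p. p" s] by (simp add: s_def)
    show "star s = s"
      unfolding s_def using SA Sd by (auto simp: star_sum proj_def)
  qed
  have gs: "g \<odot> s = s"
    unfolding s_def using SA Sd gA by (simp add: mul_sum)
  have "s = g"
  proof (rule ccontr)
    assume "s \<noteq> g"
    have d: "proj (g - s)" "g - s \<noteq> 0"
      using proj_diff(1)[OF g sp gs] \<open>s \<noteq> g\<close> by auto
    have o: "p \<odot> (g - s) = 0" "(g - s) \<odot> p = 0" if "p \<in> S" for p
    proof -
      show 0: "p \<odot> (g - s) = 0"
        using that ps pg SA gA projD[OF sp] by (simp add: mul_diff)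
      show "(g - s) \<odot> p = 0"
        using arg_cong[OF 0, of star] star_mul[of p "g - s"] that Sd projD[OF d(1)] by (simp add: proj_def)
    qed
    have new: "g - s \<notin> S"
    proof
      assume "g - s \<in> S"
      from o(1)[OF this] show False
        using d by (simp add: proj_def)
    qed
    have "P (insert (g - s) S)"
      using S d o gs gA projD[OF g] projD[OF sp] unfolding P_def by (auto simp: mul_diff)
    from max[OF this] show False
      using new Sd by simp
  qed
  moreover have "S \<subseteq> minproj"
  proof
    fix p assume p: "p \<in> S"
    have pA: "p \<in> A" "proj p"
      using p SA Sd by auto
    have "q = 0 \<or> q = p" if q: "proj q" "p \<odot> q = q" for q
    proof (rule ccontr)
      assume "\<not> ?thesis"
      then have nz: "q \<noteq> 0" "p - q \<noteq> 0"
        by auto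
      have qA: "q \<in> A"
        using q by (simp add: proj_def)
      have d: "proj (p - q)" "q \<odot> p = q"
        using proj_diff[OF _ q] p Sd by auto
      have gq: "g \<odot> q = q"
        using mul_assoc[of g p q] gA pA qA Sd p q by simp
      have o: "q \<odot> r = 0" "r \<odot> q = 0" if "r \<in> S" "r \<noteq> p" for r
      proof -
        have r: "r \<in> A" "proj r" "p \<odot> r = 0" "r \<odot> p = 0"
          using that p Sd SA by auto
        show "q \<odot> r = 0"
          using mul_assoc[of q p r] r qA pA d by simp
        show "r \<odot> q = 0"
          using mul_assoc[of r p q] r qA pA q by simp
      qed
      have oo: "q \<odot> (p - q) = 0" "(p - q) \<odot> q = 0"
        using d q qA pA by (auto simp: mul_diff diff_mul proj_def)
      have "q \<notin> S - {p}"
        using o(1)[of q] nz projD(2)[OF q(1)] by auto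
      moreover have "p - q \<notin> S - {p}"
      proof
        assume "p - q \<in> S - {p}"
        then have "p \<odot> (p - q) = 0"
          using Sd p by auto
        then show False
          using nz pA qA q projD(2)[OF pA(2)] by (simp add: mul_diff)
      qed
      ultimately have nin: "q \<notin> S - {p}" "p - q \<notin> S - {p}" .
      have ne: "q \<noteq> p - q"
        using oo nz projD[OF q(1)] by auto
      have "P (insert q (insert (p - q) (S - {p})))"
        unfolding P_def
      proof (intro conjI ballI impI)
        show "finite (insert q (insert (p - q) (S - {p})))"
          using Sd by simp
        fix x assume x: "x \<in> insert q (insert (p - q) (S - {p}))"
        show "proj x" "x \<noteq> 0" "g \<odot> x = x"
          using x q d nz gq Sd p gA pA qA by (auto simp: mul_diff)
        fix y assume y: "y \<in> insert q (insert (p - q) (S - {p}))" "x \<noteq> y"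
        show "x \<odot> y = 0"
          using x y oo o Sd p pA qA SA by (auto simp: mul_diff diff_mul)
      qed
      from max[OF this] have "card (insert q (insert (p - q) (S - {p}))) \<le> card S" .
      moreover have "card (insert q (insert (p - q) (S - {p}))) = Suc (card S)"
        using nin ne Sd card_Suc_Diff1[of S p] p by simp
      ultimately show False
        by simp
    qed
    then show "p \<in> minproj"
      using p Sd by (auto simp: minproj_def)
  qed
  ultimately show ?thesis
    using Sd pg by (intro exI[of _ S]) (simp add: s_def)
qed

end

section \<open>The commutative case: minimal projections as a basis\<close>

locale commutative_star_algebra = star_algebra +
  assumes commute: "a \<in> A \<Longrightarrow> b \<in> A \<Longrightarrow> a \<odot> b = b \<odot> a"
begin

text \<open>Here the product of two projections is a projection below both. A minimal
  \<open>q\<close> is the sum of its products with the members of a decomposition of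
  \<open>one\<close>, so some product \<open>q \<odot> p\<close> is nonzero, and minimality of both
  factors gives \<open>q = p\<close>. Hence the decomposition consists of all minimal
  projections.\<close>

lemma minproj_basis:
  shows finite_minproj: "finite minproj"
    and sum_minproj: "(\<Sum>p\<in>minproj. p) = one"
    and minproj_orthogonal: "p \<in> minproj \<Longrightarrow> q \<in> minproj \<Longrightarrow> p \<noteq> q \<Longrightarrow> p \<odot> q = 0"
    and minproj_expansion: "a \<in> A \<Longrightarrow> \<exists>c. a = (\<Sum>p\<in>minproj. c p *\<^sub>C p)"
proof -
  obtain S where S: "finite S" "S \<subseteq> minproj" "\<And>p q. p \<in> S \<Longrightarrow> q \<in> S \<Longrightarrow> p \<noteq> q \<Longrightarrow> p \<odot> q = 0"
    and sum: "(\<Sum>p\<in>S. p) = one"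
    using minproj_decomposition[OF proj_one] by auto
  have SA: "\<And>p. p \<in> minproj \<Longrightarrow> p \<in> A"
    by (auto simp: minproj_def proj_def)
  have "minproj \<subseteq> S"
  proof
    fix q assume q: "q \<in> minproj"
    have "q = (\<Sum>p\<in>S. q \<odot> p)"
      using sum mul_sum[of S "\<lambda>p. p" q] S SA q by auto
    moreover have "q \<noteq> 0"
      using q by (simp add: minproj_def)
    ultimately obtain p where p: "p \<in> S" "q \<odot> p \<noteq> 0"
      by (metis sum.neutral)
    have pm: "p \<in> minproj"
      using S p by auto
    have pqA: "p \<in> A" "q \<in> A"
      using SA pm q by auto
    have idem: "p \<odot> p = p" "q \<odot> q = q" "star p = p" "star q = q"
      using pm q by (auto simp: minproj_def proj_def)
    have e1: "p \<odot> (q \<odot> p) = q \<odot> p"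
      using mul_assoc[of q p p] commute[of p "q \<odot> p"] pqA idem by simp
    have e2: "q \<odot> (q \<odot> p) = q \<odot> p"
      using mul_assoc[of q q p] pqA idem by simp
    have "proj (q \<odot> p)"
      unfolding proj_def using e1 e2 pqA idem mul_assoc[of q p "q \<odot> p"]
      by (auto simp: star_mul commute)
    then have "q \<odot> p = p" "q \<odot> p = q"
      using e1 e2 p pm q unfolding minproj_def by blast+
    then show "q \<in> S"
      using p by simp
  qed
  then have eq: "S = minproj"
    using S by blast
  show "finite minproj" "(\<Sum>p\<in>minproj. p) = one"
    using S sum eq by auto
  show "p \<in> minproj \<Longrightarrow> q \<in> minproj \<Longrightarrow> p \<noteq> q \<Longrightarrow> p \<odot> q = 0"
    using S eq by auto
  show "\<exists>c. a = (\<Sum>p\<in>minproj. c p *\<^sub>C p)" if a: "a \<in> A"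
  proof -
    obtain c where c: "\<And>p. p \<in> minproj \<Longrightarrow> p \<odot> a \<odot> p = c p *\<^sub>C p"
      using minproj_scalar[OF _ a] by metis
    have "p \<odot> a \<odot> p = a \<odot> p" if p: "p \<in> minproj" for p
      using projD[of p] p a mul_assoc[of a p p] commute[of p a] by (simp add: minproj_def)
    then have "(\<Sum>p\<in>minproj. c p *\<^sub>C p) = (\<Sum>p\<in>minproj. a \<odot> p)"
      using c by (auto intro!: sum.cong)
    also have "\<dots> = a"
      using mul_sum[of minproj "\<lambda>p. p" a] SA a sum eq by auto
    finally show ?thesis
      by metis
  qed
qed

lemma minproj_closed: "p \<in> minproj \<Longrightarrow> p \<in> A"
  by (auto simp: minproj_def proj_def)

lemma minproj_idem: "p \<in> minproj \<Longrightarrow> p \<odot> p = p"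
  by (auto simp: minproj_def proj_def)

lemma expansion_mul:
  assumes "p \<in> minproj"
  shows "(\<Sum>q\<in>minproj. c q *\<^sub>C q) \<odot> p = c p *\<^sub>C p"
proof -
  have "(\<Sum>q\<in>minproj. c q *\<^sub>C q) \<odot> p = (\<Sum>q\<in>minproj. (c q *\<^sub>C q) \<odot> p)"
    using assms minproj_closed by (intro sum_mul) auto
  also have "\<dots> = (\<Sum>q\<in>minproj. if q = p then c p *\<^sub>C p else 0)"
    using assms minproj_closed minproj_orthogonal minproj_idem
    by (intro sum.cong) (auto simp: scale_mul)
  also have "\<dots> = c p *\<^sub>C p"
    using assms finite_minproj by simp
  finally show ?thesis .
qed

lemma minproj_nonzero: "p \<in> minproj \<Longrightarrow> p \<noteq> 0"
  by (auto simp: minproj_def)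

lemma expansion_unique:
  assumes "(\<Sum>q\<in>minproj. c q *\<^sub>C q) = (\<Sum>q\<in>minproj. d q *\<^sub>C q)" "p \<in> minproj"
  shows "c p = d p"
proof -
  have "c p *\<^sub>C p = d p *\<^sub>C p"
    using expansion_mul[OF assms(2)] assms(1) by metis
  then show ?thesis
    using minproj_nonzero[OF assms(2)] complex_vs.scale_right_imp_eq by blast
qed

end

section \<open>Perron-Frobenius theory\<close>

text \<open>The last condition is irreducibility of \<open>D^t D\<close>: every proper nonempty set
  of columns shares a row with its complement. It is phrased for the rectangular \<open>D\<close>,
  whose rows and columns are indexed by the minimal projections of two different centers.\<close>

locale irreducible_matrix =
  fixes D :: "'i \<Rightarrow> 'j \<Rightarrow> real" and A :: "'i set" and B :: "'j set"
  assumes finite_rows: "finite A" and finite_cols: "finite B"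
    and nonneg: "i \<in> A \<Longrightarrow> j \<in> B \<Longrightarrow> 0 \<le> D i j"
    and nonzero: "\<exists>i\<in>A. \<exists>j\<in>B. 0 < D i j"
    and irreducible: "J \<subseteq> B \<Longrightarrow> J \<noteq> {} \<Longrightarrow> J \<noteq> B \<Longrightarrow> \<exists>i\<in>A. \<exists>j\<in>J. \<exists>k\<in>B - J. 0 < D i j \<and> 0 < D i k"
begin

definition apply_row :: "('j \<Rightarrow> real) \<Rightarrow> 'i \<Rightarrow> real" where
  "apply_row x i = (\<Sum>j\<in>B. D i j * x j)"

definition eigen :: "real \<Rightarrow> ('j \<Rightarrow> real) \<Rightarrow> bool" where
  "eigen c x \<longleftrightarrow> (\<forall>j\<in>B. (\<Sum>i\<in>A. D i j * apply_row x i) = c * x j)"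

lemma apply_row_lincomb: "apply_row (\<lambda>j. x j + t * y j) i = apply_row x i + t * apply_row y i"
  by (simp add: apply_row_def sum.distrib sum_distrib_left algebra_simps)

lemma eigen_lincomb: "eigen c x \<Longrightarrow> eigen c y \<Longrightarrow> eigen c (\<lambda>j. x j + t * y j)"
proof -
  have "(\<Sum>i\<in>A. D i j * (apply_row x i + t * apply_row y i)) =
      (\<Sum>i\<in>A. D i j * apply_row x i) + t * (\<Sum>i\<in>A. D i j * apply_row y i)" for j
    by (simp add: sum.distrib sum_distrib_left algebra_simps)
  then show "eigen c x \<Longrightarrow> eigen c y \<Longrightarrow> ?thesis"
    by (simp add: eigen_def apply_row_lincomb algebra_simps)
qed

text \<open>If \<open>y\<close> had a zero entry, some row would link a zero entry \<open>l\<close>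
  with a positive entry \<open>m\<close>; then \<open>D^t D y\<close> would be positive at
  \<open>l\<close>, where the eigenvalue equation makes it \<open>c * 0\<close>.\<close>

lemma eigen_pos:
  assumes e: "eigen c y" and y: "\<And>j. j \<in> B \<Longrightarrow> 0 \<le> y j" and k: "k \<in> B" "y k \<noteq> 0" and j: "j \<in> B"
  shows "0 < y j"
proof (rule ccontr)
  assume "\<not> 0 < y j"
  then have "y j = 0"
    using y[OF j] by simp
  define Z where "Z = {j\<in>B. y j = 0}"
  have "Z \<subseteq> B" "Z \<noteq> {}" "Z \<noteq> B"
    using k j \<open>y j = 0\<close> by (auto simp: Z_def)
  then obtain i l m where *: "i \<in> A" "l \<in> Z" "m \<in> B - Z" "0 < D i l" "0 < D i m"
    using irreducible by meson
  have row: "0 \<le> apply_row y i" if "i \<in> A" for i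
    unfolding apply_row_def using that y nonneg by (intro sum_nonneg) auto
  have "D i m * y m \<le> apply_row y i"
    unfolding apply_row_def using * y nonneg finite_cols
    by (intro member_le_sum) auto
  moreover have "0 < y m"
    using *(3) y by (force simp: Z_def less_le)
  ultimately have "0 < apply_row y i"
    using * by (smt (verit) mult_pos_pos)
  then have "0 < D i l * apply_row y i"
    using * by simp
  also have "\<dots> \<le> (\<Sum>i\<in>A. D i l * apply_row y i)"
    using * row nonneg finite_rows by (intro member_le_sum) (auto simp: Z_def)
  also have "\<dots> = 0"
    using e * by (auto simp: eigen_def Z_def)
  finally show False
    by simp
qed

text \<open>Subtract from \<open>x\<close> the largest multiple of \<open>y\<close> that leaves a
  nonnegative vector. The difference is an eigenvector with a zero entry, so it vanishes by
  \<open>eigen_pos\<close>, and the normalizations force the factor to be 1.\<close>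

lemma eigen_unique:
  assumes x: "eigen c x" "\<And>j. j \<in> B \<Longrightarrow> 0 < x j" "L2_set x B = 1"
    and y: "eigen c y" "\<And>j. j \<in> B \<Longrightarrow> 0 < y j" "L2_set y B = 1"
    and j: "j \<in> B"
  shows "x j = y j"
proof -
  define t where "t = Min ((\<lambda>j. x j / y j) ` B)"
  have "t \<in> (\<lambda>j. x j / y j) ` B"
    unfolding t_def using j finite_cols by (intro Min_in) auto
  then obtain k where k: "k \<in> B" "t = x k / y k"
    by auto
  have t: "t \<le> x j / y j" if "j \<in> B" for j
    unfolding t_def using that finite_cols by simp
  define z where "z = (\<lambda>j. x j + (- t) * y j)"
  have ez: "eigen c z"
    unfolding z_def using x y by (intro eigen_lincomb)
  have z: "0 \<le> z j" if "j \<in> B" for j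
    using t[OF that] y(2)[OF that] by (simp add: z_def field_simps)
  have "z k = 0"
    using k y(2)[of k] by (simp add: z_def)
  then have "z j = 0" if "j \<in> B" for j
    using eigen_pos[OF ez z that _ k(1)] by fastforce
  then have eq: "x j = t * y j" if "j \<in> B" for j
    using that by (simp add: z_def)
  have "0 < t"
    using k x(2)[of k] y(2)[of k] by simp
  have "L2_set x B = L2_set (\<lambda>j. t * y j) B"
    using eq by (intro L2_set_cong) auto
  also have "\<dots> = t * L2_set y B"
    using \<open>0 < t\<close> L2_set_right_distrib[of t y B] by simp
  finally show ?thesis
    using x y eq[OF j] by simp
qed

section \<open>Existence of the Perron vector by maximizing a quadratic form\<close>

definition quad :: "('j \<Rightarrow> real) \<Rightarrow> real" where
  "quad x = (\<Sum>i\<in>A. (apply_row x i)\<^sup>2)"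

text \<open>Compactness of the unit ball gives a maximizer of \<open>|D x|^2\<close>, and passing to
  absolute values of its entries cannot decrease the value because \<open>D\<close> is nonnegative.
  Homogeneity extends the bound to all vectors, and \<open>0 < M\<close> puts the maximizer on the
  unit sphere.\<close>

lemma quad_maximizer:
  shows "\<exists>x M. 0 < M \<and> quad x = M \<and> (\<Sum>j\<in>B. (x j)\<^sup>2) = 1 \<and> (\<forall>j\<in>B. 0 \<le> x j) \<and> (\<forall>j. j \<notin> B \<longrightarrow> x j = 0) \<and>
    (\<forall>y. quad y \<le> M * (\<Sum>j\<in>B. (y j)\<^sup>2))"
proof -
  \<comment> \<open>Pinning the coordinates outside \<open>B\<close> to 0 makes this a product of
    compact sets over the whole index type, so it is compact in the product topology.\<close>
  define P where "P = PiE UNIV (\<lambda>j. if j \<in> B then {-1..1} else {0 :: real})"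
  define K where "K = P \<inter> {x. (\<Sum>j\<in>B. (x j)\<^sup>2) \<le> 1}"
  have "compactin (product_topology (\<lambda>_. euclidean) UNIV) P"
    unfolding P_def by (subst compactin_PiE) auto
  then have "compact P"
    by (simp add: euclidean_product_topology)
  moreover have "closed {x :: 'j \<Rightarrow> real. (\<Sum>j\<in>B. (x j)\<^sup>2) \<le> 1}"
    by (intro closed_Collect_le continuous_intros continuous_on_product_coordinates)
  ultimately have "compact K"
    unfolding K_def by (rule compact_Int_closed)
  have in_P: "x \<in> P" if "\<And>j. j \<notin> B \<Longrightarrow> x j = 0" "(\<Sum>j\<in>B. (x j)\<^sup>2) \<le> 1" for x
  proof -
    have "(x j)\<^sup>2 \<le> 1" if "j \<in> B" for j
      using member_le_sum[of j B "\<lambda>j. (x j)\<^sup>2"] that finite_cols \<open>(\<Sum>j\<in>B. (x j)\<^sup>2) \<le> 1\<close> by auto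
    then have "-1 \<le> x j \<and> x j \<le> 1" if "j \<in> B" for j
      using that by (simp add: abs_square_le_1 abs_le_iff)
    then show ?thesis
      using that(1) by (auto simp: P_def)
  qed
  have in_K: "x \<in> K" if "\<And>j. j \<notin> B \<Longrightarrow> x j = 0" "(\<Sum>j\<in>B. (x j)\<^sup>2) \<le> 1" for x
    using in_P[OF that] that by (simp add: K_def)
  have "K \<noteq> {}"
    using in_K[of "\<lambda>_. 0"] by auto
  moreover have "continuous_on K quad"
    unfolding quad_def apply_row_def
    by (intro continuous_intros continuous_on_subset[OF continuous_on_product_coordinates]) auto
  ultimately obtain x0 where x0: "x0 \<in> K" "\<And>y. y \<in> K \<Longrightarrow> quad y \<le> quad x0"
    using continuous_attains_sup[OF \<open>compact K\<close>, of quad] by blast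
  define M where "M = quad x0"
  \<comment> \<open>Only coordinates in \<open>B\<close> matter to \<open>quad\<close>, so a vector
    can be cut off to lie in \<open>K\<close> before maximality is used.\<close>
  have quad_restrict: "quad (\<lambda>j. if j \<in> B then y j else 0) = quad y" for y
    unfolding quad_def apply_row_def by (intro sum.cong refl arg_cong[of _ _ "\<lambda>s. s\<^sup>2"]) auto
  have bound: "quad y \<le> M * (\<Sum>j\<in>B. (y j)\<^sup>2)" for y
  proof (cases "(\<Sum>j\<in>B. (y j)\<^sup>2) = 0")
    case True
    then have "\<And>j. j \<in> B \<Longrightarrow> y j = 0"
      using finite_cols by (simp add: sum_nonneg_eq_0_iff)
    then have "quad y = 0"
      by (simp add: quad_def apply_row_def)
    then show ?thesis
      using True by simp
  next
    case False
    define s where "s = sqrt (\<Sum>j\<in>B. (y j)\<^sup>2)"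
    have s: "0 < s" "s\<^sup>2 = (\<Sum>j\<in>B. (y j)\<^sup>2)"
      using False sum_nonneg[of B "\<lambda>j. (y j)\<^sup>2"] by (auto simp: s_def less_le)
    have "(\<Sum>j\<in>B. (y j / s)\<^sup>2) = 1"
      using s False by (simp add: power_divide sum_divide_distrib[symmetric])
    then have "(\<lambda>j. if j \<in> B then y j / s else 0) \<in> K"
      by (intro in_K) auto
    from x0(2)[OF this] have "quad (\<lambda>j. y j / s) \<le> M"
      using quad_restrict[of "\<lambda>j. y j / s"] by (simp add: M_def)
    moreover have "quad (\<lambda>j. y j / s) = quad y / s\<^sup>2"
      by (simp add: quad_def apply_row_def power_divide sum_divide_distrib[symmetric])
    ultimately have "quad y / s\<^sup>2 \<le> M"
      by simp
    then have "quad y \<le> M * s\<^sup>2"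
      using s(1) by (simp add: pos_divide_le_eq)
    then show ?thesis
      by (simp add: s(2))
  qed
  have M: "0 < M"
  proof -
    obtain i j where ij: "i \<in> A" "j \<in> B" "0 < D i j"
      using nonzero by blast
    define h where "h = (\<lambda>k. if k = j then 1 else 0 :: real)"
    have "apply_row h i = D i j"
      using ij finite_cols by (simp add: apply_row_def h_def if_distrib cong: if_cong)
    then have "0 < (apply_row h i)\<^sup>2"
      using ij by simp
    also have "\<dots> \<le> quad h"
      unfolding quad_def using ij finite_rows by (intro member_le_sum) auto
    also have "\<dots> \<le> M"
      using bound[of h] ij finite_cols by (simp add: h_def if_distrib[of "\<lambda>x. x\<^sup>2"] cong: if_cong)
    finally show ?thesis .
  qed
  define x where "x = (\<lambda>j. \<bar>x0 j\<bar>)"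
  have sq: "(\<Sum>j\<in>B. (x j)\<^sup>2) \<le> 1"
    using x0(1) by (simp add: x_def K_def)
  have "M \<le> quad x"
    unfolding M_def quad_def
  proof (intro sum_mono)
    fix i assume i: "i \<in> A"
    have "\<bar>apply_row x0 i\<bar> \<le> (\<Sum>j\<in>B. \<bar>D i j * x0 j\<bar>)"
      unfolding apply_row_def by (rule sum_abs)
    also have "\<dots> = apply_row x i"
      unfolding apply_row_def x_def using nonneg[OF i] by (intro sum.cong) (auto simp: abs_mult)
    finally show "(apply_row x0 i)\<^sup>2 \<le> (apply_row x i)\<^sup>2"
      by (meson abs_ge_zero abs_le_square_iff abs_of_nonneg order_trans order.refl abs_le_iff)
  qed
  moreover have "quad x \<le> M * (\<Sum>j\<in>B. (x j)\<^sup>2)"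
    by (rule bound)
  moreover have "M * (\<Sum>j\<in>B. (x j)\<^sup>2) \<le> M * 1"
    using sq M by (intro mult_left_mono) auto
  ultimately have "quad x = M" "M * (\<Sum>j\<in>B. (x j)\<^sup>2) = M"
    by linarith+
  moreover from this have "(\<Sum>j\<in>B. (x j)\<^sup>2) = 1"
    using M by simp
  moreover have "\<forall>j. j \<notin> B \<longrightarrow> x j = 0"
    using x0(1) by (auto simp: x_def K_def P_def PiE_def Pi_def split: if_splits)
  ultimately show ?thesis
    using M bound by (intro exI[of _ x] exI[of _ M]) (auto simp: x_def)
qed

text \<open>The first-order condition at a maximum. With \<open>s\<close> larger than both 0 and
  \<open>b\<close>, the test value \<open>a / s\<close> refutes a nonzero \<open>a\<close>.\<close>

lemma linear_term_zero:
  fixes a b :: real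
  assumes "\<And>t. 2 * t * a \<le> t\<^sup>2 * b"
  shows "a = 0"
proof (rule ccontr)
  assume a: "a \<noteq> 0"
  define s where "s = \<bar>b\<bar> + 1"
  have s: "0 < s" "b < s"
    by (auto simp: s_def)
  have "2 * (a / s) * a \<le> (a / s)\<^sup>2 * b"
    by (rule assms)
  then have "2 * a\<^sup>2 * s \<le> a\<^sup>2 * b"
    using s by (simp add: field_simps power2_eq_square)
  then have "a\<^sup>2 * (2 * s) \<le> a\<^sup>2 * b"
    by (simp add: mult_ac)
  then show False
    using a s by simp
qed

text \<open>This identifies the maximum of the form with the square of \<open>matrix_norm\<close>,
  which is the eigenvalue prescribed in \<open>sqrt_nu\<close>.\<close>

lemma matrix_norm_eq:
  assumes M: "0 \<le> M" and x: "quad x = M" "(\<Sum>j\<in>B. (x j)\<^sup>2) = 1" and b: "\<And>y. quad y \<le> M * (\<Sum>j\<in>B. (y j)\<^sup>2)"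
  shows "matrix_norm D A B = sqrt M"
  unfolding matrix_norm_def
proof (rule cSup_eq_maximum)
  have "L2_set (\<lambda>i. \<Sum>j\<in>B. D i j * x j) A = sqrt M"
    using x by (simp add: L2_set_def quad_def apply_row_def)
  moreover have "L2_set x B \<le> 1"
    using x by (simp add: L2_set_def)
  ultimately show "sqrt M \<in> {L2_set (\<lambda>i. \<Sum>j\<in>B. D i j * x j) A |x. L2_set x B \<le> 1}"
    by force
next
  fix s assume "s \<in> {L2_set (\<lambda>i. \<Sum>j\<in>B. D i j * x j) A |x. L2_set x B \<le> 1}"
  then obtain y where y: "s = sqrt (quad y)" "(\<Sum>j\<in>B. (y j)\<^sup>2) \<le> 1"
    by (auto simp: L2_set_def quad_def apply_row_def)
  have "quad y \<le> M * (\<Sum>j\<in>B. (y j)\<^sup>2)"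
    by (rule b)
  also have "\<dots> \<le> M"
    using y M by (simp add: mult_left_le)
  finally show "s \<le> sqrt M"
    using y by simp
qed

text \<open>A maximizer is a critical point: perturb it along one coordinate vector \<open>h\<close>
  and compare the terms linear in \<open>t\<close>. Nonnegative entries become positive by
  \<open>eigen_pos\<close>.\<close>

lemma perron_frobenius:
  "\<exists>x. eigen ((matrix_norm D A B)\<^sup>2) x \<and> (\<forall>j\<in>B. 0 < x j) \<and> (\<forall>j. j \<notin> B \<longrightarrow> x j = 0) \<and> L2_set x B = 1"
proof -
  obtain x M where M: "0 < M" and x: "quad x = M" "(\<Sum>j\<in>B. (x j)\<^sup>2) = 1" "\<And>j. j \<in> B \<Longrightarrow> 0 \<le> x j"
      "\<And>j. j \<notin> B \<Longrightarrow> x j = 0"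
    and b: "\<And>y. quad y \<le> M * (\<Sum>j\<in>B. (y j)\<^sup>2)"
    using quad_maximizer by blast
  have norm: "(matrix_norm D A B)\<^sup>2 = M"
    using matrix_norm_eq[OF _ x(1,2) b] M by simp
  have "eigen M x"
    unfolding eigen_def
  proof
    fix j assume j: "j \<in> B"
    define h where "h = (\<lambda>k. if k = j then 1 else 0 :: real)"
    have h: "apply_row h i = D i j" for i
      using j finite_cols by (simp add: apply_row_def h_def if_distrib cong: if_cong)
    have 1: "quad (\<lambda>k. x k + t * h k) = M + 2 * t * (\<Sum>i\<in>A. D i j * apply_row x i) + t\<^sup>2 * (\<Sum>i\<in>A. (D i j)\<^sup>2)" for t
      unfolding x(1)[symmetric] quad_def apply_row_lincomb h
      by (simp add: sum.distrib sum_distrib_left power2_eq_square algebra_simps)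
    have "(\<Sum>k\<in>B. x k * h k) = x j"
      using j finite_cols by (simp add: h_def if_distrib cong: if_cong)
    moreover have "(\<Sum>k\<in>B. (h k)\<^sup>2) = 1"
      using j finite_cols by (simp add: h_def if_distrib[of "\<lambda>x. x\<^sup>2"] cong: if_cong)
    moreover have "(\<Sum>k\<in>B. (x k + t * h k)\<^sup>2) = (\<Sum>k\<in>B. (x k)\<^sup>2) + 2 * t * (\<Sum>k\<in>B. x k * h k) + t\<^sup>2 * (\<Sum>k\<in>B. (h k)\<^sup>2)" for t
      by (simp add: sum.distrib sum_distrib_left power2_eq_square algebra_simps)
    ultimately have 2: "(\<Sum>k\<in>B. (x k + t * h k)\<^sup>2) = 1 + 2 * t * x j + t\<^sup>2" for t
      using x by simp
    have "2 * t * ((\<Sum>i\<in>A. D i j * apply_row x i) - M * x j) \<le> t\<^sup>2 * (M - (\<Sum>i\<in>A. (D i j)\<^sup>2))" for t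
      using b[of "\<lambda>k. x k + t * h k"] unfolding 1 2 by (simp add: algebra_simps)
    from linear_term_zero[OF this] show "(\<Sum>i\<in>A. D i j * apply_row x i) = M * x j"
      by simp
  qed
  moreover have "\<exists>k\<in>B. x k \<noteq> 0"
  proof (rule ccontr)
    assume "\<not> ?thesis"
    then have "(\<Sum>j\<in>B. (x j)\<^sup>2) = 0"
      by simp
    then show False
      using x(2) by simp
  qed
  ultimately have "0 < x j" if "j \<in> B" for j
    using eigen_pos[of M x] x(3) that by blast
  then show ?thesis
    using \<open>eigen M x\<close> x norm by (intro exI[of _ x]) (auto simp: L2_set_def)
qed

text \<open>Existence and uniqueness make the definite description meaningful. The values outside
  \<open>B\<close> are fixed to 0, so uniqueness holds for the whole function.\<close>

lemma positive_eigenvector_pos: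
  assumes "j \<in> B"
  shows "0 < positive_eigenvector D A B ((matrix_norm D A B)\<^sup>2) j"
proof -
  let ?P = "\<lambda>x. (\<forall>j\<in>B. x j > 0) \<and> (\<forall>j. j \<notin> B \<longrightarrow> x j = 0) \<and> L2_set x B = 1 \<and>
    (\<forall>j\<in>B. (\<Sum>i\<in>A. D i j * (\<Sum>k\<in>B. D i k * x k)) = (matrix_norm D A B)\<^sup>2 * x j)"
  have "\<exists>!x. ?P x"
  proof (rule ex_ex1I)
    show "\<exists>x. ?P x"
      using perron_frobenius unfolding eigen_def apply_row_def by blast
    fix x y assume "?P x" "?P y"
    then have "x j = y j" for j
      using eigen_unique[of "(matrix_norm D A B)\<^sup>2" x y j] unfolding eigen_def apply_row_def by (cases "j \<in> B") auto
    then show "x = y"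
      by auto
  qed
  from theI'[OF this] show ?thesis
    unfolding positive_eigenvector_def using assms by blast
qed

end

section \<open>The operator norm of a matrix and of its transpose\<close>

lemma L2_set_mult_le: "(\<Sum>i\<in>A. f i * g i) \<le> L2_set f A * L2_set g A" for f g :: "'i \<Rightarrow> real"
proof -
  have "(\<Sum>i\<in>A. f i * g i) \<le> (\<Sum>i\<in>A. \<bar>f i\<bar> * \<bar>g i\<bar>)"
    by (intro sum_mono) (metis abs_ge_self abs_mult)
  then show ?thesis
    using L2_set_mult_ineq order_trans by blast
qed

text \<open>The supremum in \<open>matrix_norm\<close> has its usual properties only for a bounded
  set; Cauchy-Schwarz in each row gives a bound.\<close>

lemma matrix_norm_bdd:
  fixes D :: "'i \<Rightarrow> 'j \<Rightarrow> real"
  shows "bdd_above {L2_set (\<lambda>i. \<Sum>j\<in>B. D i j * x j) A | x. L2_set x B \<le> 1}"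
proof (rule bdd_aboveI)
  fix s assume "s \<in> {L2_set (\<lambda>i. \<Sum>j\<in>B. D i j * x j) A | x. L2_set x B \<le> 1}"
  then obtain x where x: "s = L2_set (\<lambda>i. \<Sum>j\<in>B. D i j * x j) A" "L2_set x B \<le> 1"
    by auto
  have row: "\<bar>\<Sum>j\<in>B. D i j * x j\<bar> \<le> L2_set (D i) B" for i
  proof -
    have "\<bar>\<Sum>j\<in>B. D i j * x j\<bar> \<le> (\<Sum>j\<in>B. \<bar>D i j\<bar> * \<bar>x j\<bar>)"
      by (rule order_trans[OF sum_abs]) (simp add: abs_mult)
    also have "\<dots> \<le> L2_set (D i) B * L2_set x B"
      by (rule L2_set_mult_ineq)
    also have "\<dots> \<le> L2_set (D i) B"
      using x by (simp add: mult_left_le)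
    finally show ?thesis .
  qed
  have "s \<le> (\<Sum>i\<in>A. \<bar>\<Sum>j\<in>B. D i j * x j\<bar>)"
    unfolding x by (rule L2_set_le_sum_abs)
  also have "\<dots> \<le> (\<Sum>i\<in>A. L2_set (D i) B)"
    by (intro sum_mono row)
  finally show "s \<le> (\<Sum>i\<in>A. L2_set (D i) B)" .
qed

lemma matrix_norm_bound:
  fixes D :: "'i \<Rightarrow> 'j \<Rightarrow> real"
  assumes "L2_set x B \<le> 1"
  shows "L2_set (\<lambda>i. \<Sum>j\<in>B. D i j * x j) A \<le> matrix_norm D A B"
  unfolding matrix_norm_def using assms by (intro cSup_upper matrix_norm_bdd) auto

text \<open>Apply the transposed matrix to the normalized image \<open>D x / |D x|\<close>: its
  pairing with \<open>x\<close> is \<open>|D x|\<close>.\<close>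

lemma matrix_norm_transpose_le:
  fixes D :: "'i \<Rightarrow> 'j \<Rightarrow> real"
  shows "matrix_norm D A B \<le> matrix_norm (\<lambda>j i. D i j) B A"
  unfolding matrix_norm_def[of D]
proof (rule cSup_least)
  show "{L2_set (\<lambda>i. \<Sum>j\<in>B. D i j * x j) A |x. L2_set x B \<le> 1} \<noteq> {}"
    by (auto intro!: exI[of _ "\<lambda>_. 0"] simp: L2_set_def)
  fix s assume "s \<in> {L2_set (\<lambda>i. \<Sum>j\<in>B. D i j * x j) A | x. L2_set x B \<le> 1}"
  then obtain x where x: "s = L2_set (\<lambda>i. \<Sum>j\<in>B. D i j * x j) A" "L2_set x B \<le> 1"
    by auto
  define z where "z = (\<lambda>i. \<Sum>j\<in>B. D i j * x j)"
  let ?N = "matrix_norm (\<lambda>j i. D i j) B A"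
  have z: "s = L2_set z A" "0 \<le> s"
    by (auto simp: x z_def)
  show "s \<le> ?N"
  proof (cases "s = 0")
    case True
    have "0 \<le> L2_set (\<lambda>j. \<Sum>i\<in>A. D i j * 0) B"
      by simp
    also have "\<dots> \<le> ?N"
      by (rule matrix_norm_bound) (simp add: L2_set_def)
    finally show ?thesis
      using True by simp
  next
    case False
    define y where "y = (\<lambda>i. z i / s)"
    have "L2_set y A = L2_set z A / s"
      unfolding y_def using z L2_set_right_distrib[of "1 / s" z A] by simp
    then have y1: "L2_set y A = 1"
      using z False by simp
    have "s * s = (\<Sum>i\<in>A. z i * z i)"
      unfolding z(1) L2_set_def by (simp add: sum_nonneg flip: power2_eq_square)
    then have "s = (\<Sum>i\<in>A. y i * z i)"
      using False by (simp add: y_def sum_divide_distrib[symmetric] field_simps)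
    also have "\<dots> = (\<Sum>j\<in>B. (\<Sum>i\<in>A. D i j * y i) * x j)"
      unfolding z_def sum_distrib_left sum_distrib_right by (subst sum.swap) (simp add: mult_ac)
    also have "\<dots> \<le> L2_set (\<lambda>j. \<Sum>i\<in>A. D i j * y i) B * L2_set x B"
      by (rule L2_set_mult_le)
    also have "\<dots> \<le> L2_set (\<lambda>j. \<Sum>i\<in>A. D i j * y i) B"
      using x by (simp add: mult_left_le)
    also have "\<dots> \<le> ?N"
      using y1 by (intro matrix_norm_bound) simp
    finally show ?thesis .
  qed
qed

text \<open>\<open>sqrt_mu\<close> combines the transposed matrix with the eigenvalue
  \<open>arrow_dim\<close>, which is the norm of the matrix itself; this equality makes
  Perron-Frobenius applicable to it.\<close>

lemma matrix_norm_transpose: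
  fixes D :: "'i \<Rightarrow> 'j \<Rightarrow> real"
  shows "matrix_norm (\<lambda>j i. D i j) B A = matrix_norm D A B"
  using matrix_norm_transpose_le[of D A B] matrix_norm_transpose_le[of "\<lambda>j i. D i j" B A]
  by simp

section \<open>2-arrows with domain and codomain\<close>

text \<open>A 2-arrow does not determine its domain and codomain (\<open>0\<close> lies in every \<open>Hom X Y\<close>). Recording them
  makes the typing premises of the axioms decidable by rewriting.\<close>

datatype ('a, 't) cell = Cell (cdom: 'a) (cval: 't) (ccod: 'a)

context strict_two_category
begin

definition cell :: "('a, 't) cell \<Rightarrow> bool" where
  "cell c \<longleftrightarrow> parallel C (cdom c) (ccod c) \<and> cval c \<in> Hom C (cdom c) (ccod c)"

definition vc :: "('a, 't) cell \<Rightarrow> ('a, 't) cell \<Rightarrow> ('a, 't) cell" (infixl "\<bullet>" 70) where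
  "s \<bullet> r = Cell (cdom r) (cval s \<cdot> cval r) (ccod s)"

definition hc :: "('a, 't) cell \<Rightarrow> ('a, 't) cell \<Rightarrow> ('a, 't) cell" (infixl "\<star>" 72) where
  "t \<star> s = Cell (cdom t \<otimes>\<^sub>1 cdom s) (cval t \<otimes> cval s) (ccod t \<otimes>\<^sub>1 ccod s)"

definition idc :: "'a \<Rightarrow> ('a, 't) cell" where
  "idc X = Cell X (\<one> X) X"

lemma cell_sel [simp]:
  "cdom (s \<bullet> r) = cdom r" "ccod (s \<bullet> r) = ccod s" "cval (s \<bullet> r) = cval s \<cdot> cval r"
  "cdom (t \<star> u) = cdom t \<otimes>\<^sub>1 cdom u" "ccod (t \<star> u) = ccod t \<otimes>\<^sub>1 ccod u" "cval (t \<star> u) = cval t \<otimes> cval u"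
  "cdom (idc X) = X" "ccod (idc X) = X" "cval (idc X) = \<one> X"
  by (auto simp: vc_def hc_def idc_def)

lemma cell_eqI: "cdom c = cdom d \<Longrightarrow> ccod c = ccod d \<Longrightarrow> cval c = cval d \<Longrightarrow> c = d"
  by (cases c; cases d) auto

lemma cellD:
  assumes "cell c"
  shows "cdom c \<in> Arr C" "ccod c \<in> Arr C" "src C (ccod c) = src C (cdom c)" "tgt C (ccod c) = tgt C (cdom c)"
  using assms by (auto simp: cell_def parallel_def)

lemma arr_simps:
  "X \<in> Arr C \<Longrightarrow> src C X \<in> Ob C"
  "X \<in> Arr C \<Longrightarrow> tgt C X \<in> Ob C"
  "N \<in> Ob C \<Longrightarrow> \<I> N \<in> Arr C"
  "N \<in> Ob C \<Longrightarrow> src C (\<I> N) = N"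
  "N \<in> Ob C \<Longrightarrow> tgt C (\<I> N) = N"
  "X \<in> Arr C \<Longrightarrow> Y \<in> Arr C \<Longrightarrow> tgt C X = src C Y \<Longrightarrow> Y \<otimes>\<^sub>1 X \<in> Arr C"
  "X \<in> Arr C \<Longrightarrow> Y \<in> Arr C \<Longrightarrow> tgt C X = src C Y \<Longrightarrow> src C (Y \<otimes>\<^sub>1 X) = src C X"
  "X \<in> Arr C \<Longrightarrow> Y \<in> Arr C \<Longrightarrow> tgt C X = src C Y \<Longrightarrow> tgt C (Y \<otimes>\<^sub>1 X) = tgt C Y"
  using src_closed tgt_closed id1_closed comp1_closed by auto

lemma comp1_simps:
  "X \<in> Arr C \<Longrightarrow> Y \<in> Arr C \<Longrightarrow> Z \<in> Arr C \<Longrightarrow> tgt C X = src C Y \<Longrightarrow> tgt C Y = src C Z \<Longrightarrow>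
    (Z \<otimes>\<^sub>1 Y) \<otimes>\<^sub>1 X = Z \<otimes>\<^sub>1 (Y \<otimes>\<^sub>1 X)"
  "X \<in> Arr C \<Longrightarrow> src C X = N \<Longrightarrow> X \<otimes>\<^sub>1 \<I> N = X"
  "X \<in> Arr C \<Longrightarrow> tgt C X = N \<Longrightarrow> \<I> N \<otimes>\<^sub>1 X = X"
  using comp1_assoc comp1_id_right comp1_id_left by auto

lemma cell_intros:
  "X \<in> Arr C \<Longrightarrow> cell (idc X)"
  "cell s \<Longrightarrow> cell r \<Longrightarrow> ccod r = cdom s \<Longrightarrow> cell (s \<bullet> r)"
  "cell t \<Longrightarrow> cell s \<Longrightarrow> tgt C (cdom s) = src C (cdom t) \<Longrightarrow> cell (t \<star> s)"
  subgoal by (simp add: cell_def parallel_def id2_closed)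
  subgoal unfolding cell_def using vcomp_closed[of "cdom r" "cdom s" "ccod s" "cval r" "cval s"]
    by (auto simp: parallel_def)
  subgoal unfolding cell_def using hcomp_closed[of "cdom s" "ccod s" "cdom t" "ccod t" "cval s" "cval t"]
    by (auto simp: parallel_def arr_simps)
  done

lemmas cell_simps = cellD arr_simps comp1_simps cell_intros

lemma vc_assoc: "cell t \<Longrightarrow> cell s \<Longrightarrow> cell r \<Longrightarrow> ccod r = cdom s \<Longrightarrow> ccod s = cdom t \<Longrightarrow>
    t \<bullet> s \<bullet> r = t \<bullet> (s \<bullet> r)"
  unfolding vc_def cell_def by (auto intro: vcomp_assoc)

lemma vc_id:
  "cell r \<Longrightarrow> cdom r = X \<Longrightarrow> r \<bullet> idc X = r"
  "cell r \<Longrightarrow> ccod r = X \<Longrightarrow> idc X \<bullet> r = r"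
  unfolding vc_def cell_def by (auto simp: vcomp_id_left vcomp_id_right)

lemma hc_assoc: "cell t \<Longrightarrow> cell s \<Longrightarrow> cell r \<Longrightarrow> tgt C (cdom r) = src C (cdom s) \<Longrightarrow>
    tgt C (cdom s) = src C (cdom t) \<Longrightarrow> t \<star> s \<star> r = t \<star> (s \<star> r)"
  unfolding hc_def cell_def
  using hcomp_assoc[of "cdom r" "ccod r" "cdom s" "ccod s" "cdom t" "ccod t" "cval r" "cval s" "cval t"]
  by (auto simp: parallel_def comp1_simps)

lemma hc_id:
  "cell r \<Longrightarrow> src C (cdom r) = N \<Longrightarrow> r \<star> idc (\<I> N) = r"
  "cell r \<Longrightarrow> tgt C (cdom r) = N \<Longrightarrow> idc (\<I> N) \<star> r = r"
  using hcomp_id_left[of "cdom r" "ccod r" "cval r"] hcomp_id_right[of "cdom r" "ccod r" "cval r"]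
  by (auto intro!: cell_eqI simp: cell_def parallel_def comp1_simps)

lemma idc_hc: "X \<in> Arr C \<Longrightarrow> Y \<in> Arr C \<Longrightarrow> tgt C X = src C Y \<Longrightarrow> idc Y \<star> idc X = idc (Y \<otimes>\<^sub>1 X)"
  unfolding hc_def idc_def by (simp add: hcomp_id2)

lemma hc_vc: "cell t \<Longrightarrow> cell t' \<Longrightarrow> cell s \<Longrightarrow> cell s' \<Longrightarrow> tgt C (cdom s) = src C (cdom t) \<Longrightarrow>
    ccod t = cdom t' \<Longrightarrow> ccod s = cdom s' \<Longrightarrow> (t' \<star> s') \<bullet> (t \<star> s) = (t' \<bullet> t) \<star> (s' \<bullet> s)"
  unfolding hc_def vc_def cell_def
  using interchange[of "cdom s" "cdom s'" "ccod s'" "cdom t" "cdom t'" "ccod t'" "cval s" "cval s'" "cval t" "cval t'"]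
  by auto

text \<open>The interchange law in its working form: a horizontal composite may be carried out in
  either order, so 2-arrows on different legs slide past each other.\<close>

lemma hc_whisker:
  assumes "cell t" "cell s" "tgt C (cdom s) = src C (cdom t)"
  shows "t \<star> s = (t \<star> idc (ccod s)) \<bullet> (idc (cdom t) \<star> s)"
    and "t \<star> s = (idc (ccod t) \<star> s) \<bullet> (t \<star> idc (cdom s))"
  using assms by (simp_all add: hc_vc vc_id cell_simps)

end

context two_C_star_category
begin

definition st :: "('a, 't) cell \<Rightarrow> ('a, 't) cell" where
  "st c = Cell (ccod c) (adj C (cval c)) (cdom c)"

lemma st_sel [simp]: "cdom (st c) = ccod c" "ccod (st c) = cdom c" "cval (st c) = adj C (cval c)"
  by (simp_all add: st_def)

lemma st_cell: "cell c \<Longrightarrow> cell (st c)"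
  unfolding cell_def using adj_closed by (auto simp: parallel_def)

lemma st_st: "cell c \<Longrightarrow> st (st c) = c"
  unfolding cell_def by (intro cell_eqI) (auto simp: adj_adj)

lemma st_vc: "cell s \<Longrightarrow> cell r \<Longrightarrow> ccod r = cdom s \<Longrightarrow> st (s \<bullet> r) = st r \<bullet> st s"
  unfolding cell_def by (intro cell_eqI) (auto simp: adj_vcomp)

lemma st_hc: "cell t \<Longrightarrow> cell s \<Longrightarrow> tgt C (cdom s) = src C (cdom t) \<Longrightarrow> st (t \<star> s) = st t \<star> st s"
  unfolding cell_def by (intro cell_eqI) (auto simp: adj_hcomp)

lemma st_idc: "X \<in> Arr C \<Longrightarrow> st (idc X) = idc X"
  by (intro cell_eqI) (auto simp: adj_id2)

lemmas typing = cell_simps st_cell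

end

section \<open>Conjugate equations and Frobenius reciprocity\<close>

locale conjugate_pair = two_C_star_category C
  for C :: "('o, 'a, 't :: complex_normed_space) two_category" (structure) +
  fixes N M :: 'o and X X' :: 'a and r r' :: "('a, 't) cell"
  assumes X [simp]: "X \<in> Arr C" "src C X = N" "tgt C X = M"
    and X' [simp]: "X' \<in> Arr C" "src C X' = M" "tgt C X' = N"
    and r [simp]: "cell r" "cdom r = \<I> N" "ccod r = X' \<otimes>\<^sub>1 X"
    and r' [simp]: "cell r'" "cdom r' = \<I> M" "ccod r' = X \<otimes>\<^sub>1 X'"
    and conj1: "(st r' \<star> idc X) \<bullet> (idc X \<star> r) = idc X"
    and conj2: "(st r \<star> idc X') \<bullet> (idc X' \<star> r') = idc X'"
begin

lemma NM [simp]: "N \<in> Ob C" "M \<in> Ob C"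
  using src_closed[OF X(1)] tgt_closed[OF X(1)] by simp_all

lemma conj1_st: "(idc X \<star> st r) \<bullet> (r' \<star> idc X) = idc X"
  using arg_cong[OF conj1, of st] by (simp add: st_vc st_hc st_idc st_st typing)

lemma conj2_st: "(idc X' \<star> st r') \<bullet> (r \<star> idc X') = idc X'"
  using arg_cong[OF conj2, of st] by (simp add: st_vc st_hc st_idc st_st typing)

text \<open>Frobenius reciprocity: \<open>a \<mapsto> (1 \<otimes> a) r\<close> is a bijection from
  \<open>Hom X Z\<close> to \<open>Hom I (X' Z)\<close>, with inverse
  \<open>x \<mapsto> (r'^* \<otimes> 1) (1 \<otimes> x)\<close>. Here \<open>x\<close> slides past
  \<open>r\<close>, after which the adjoint of the second conjugate equation straightens the
  zigzag.\<close>

lemma frob_surj: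
  assumes [simp]: "cell x" "cdom x = \<I> N" "ccod x = X' \<otimes>\<^sub>1 Z" "Z \<in> Arr C" "src C Z = N" "tgt C Z = M"
  shows "(idc X' \<star> ((st r' \<star> idc Z) \<bullet> (idc X \<star> x))) \<bullet> r = x"
proof -
  have "idc X' \<star> ((st r' \<star> idc Z) \<bullet> (idc X \<star> x)) =
      (idc X' \<star> st r' \<star> idc Z) \<bullet> (idc (X' \<otimes>\<^sub>1 X) \<star> x)"
    using hc_vc[of "idc X'" "idc X'" "idc X \<star> x" "st r' \<star> idc Z"]
    by (simp add: typing vc_id hc_assoc flip: idc_hc)
  also have "\<dots> \<bullet> r = (idc X' \<star> st r' \<star> idc Z) \<bullet> ((idc (X' \<otimes>\<^sub>1 X) \<star> x) \<bullet> r)"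
    by (simp add: vc_assoc typing)
  also have "(idc (X' \<otimes>\<^sub>1 X) \<star> x) \<bullet> r = r \<star> x"
    using hc_whisker(2)[of r x] by (simp add: hc_id typing)
  also have "\<dots> = (r \<star> idc (X' \<otimes>\<^sub>1 Z)) \<bullet> x"
    using hc_whisker(1)[of r x] by (simp add: hc_id typing)
  also have "r \<star> idc (X' \<otimes>\<^sub>1 Z) = (r \<star> idc X') \<star> idc Z"
    by (simp add: hc_assoc idc_hc typing)
  also have "(idc X' \<star> st r' \<star> idc Z) \<bullet> ((r \<star> idc X') \<star> idc Z \<bullet> x) =
     (((idc X' \<star> st r') \<bullet> (r \<star> idc X')) \<star> idc Z) \<bullet> x"
    by (simp add: hc_vc vc_id typing flip: vc_assoc)
  also have "\<dots> = x"
    by (simp add: conj2_st idc_hc vc_id typing)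
  finally show ?thesis .
qed

lemma frob_inj:
  assumes [simp]: "cell a" "cdom a = X" "ccod a = Z"
  shows "(st r' \<star> idc Z) \<bullet> (idc X \<star> ((idc X' \<star> a) \<bullet> r)) = a"
proof -
  have [simp]: "Z \<in> Arr C" "src C Z = N" "tgt C Z = M"
    using cellD[OF assms(1)] by simp_all
  have "idc X \<star> ((idc X' \<star> a) \<bullet> r) = (idc (X \<otimes>\<^sub>1 X') \<star> a) \<bullet> (idc X \<star> r)"
    using hc_vc[of "idc X" "idc X" r "idc X' \<star> a"]
    by (simp add: typing vc_id hc_assoc flip: idc_hc)
  also have "(st r' \<star> idc Z) \<bullet> \<dots> = (st r' \<star> idc Z) \<bullet> (idc (X \<otimes>\<^sub>1 X') \<star> a) \<bullet> (idc X \<star> r)"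
    by (simp add: vc_assoc typing)
  also have "(st r' \<star> idc Z) \<bullet> (idc (X \<otimes>\<^sub>1 X') \<star> a) = a \<bullet> (st r' \<star> idc X)"
    using hc_whisker[of "st r'" a] by (simp add: hc_id typing)
  also have "\<dots> \<bullet> (idc X \<star> r) = a"
    by (simp add: vc_assoc conj1 vc_id typing)
  finally show ?thesis .
qed

text \<open>Reciprocity on the other leg: \<open>b \<mapsto> (b \<otimes> 1) r\<close> maps
  \<open>Hom X' Z\<close> onto \<open>Hom I (Z X)\<close>. Comparing the two descriptions of one
  space leads to \<open>mates\<close>.\<close>

lemma frob_surj_right:
  assumes [simp]: "cell x" "cdom x = \<I> N" "ccod x = Z \<otimes>\<^sub>1 X" "Z \<in> Arr C" "src C Z = M" "tgt C Z = N"
  shows "(((idc Z \<star> st r') \<bullet> (x \<star> idc X')) \<star> idc X) \<bullet> r = x"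
proof -
  have "((idc Z \<star> st r') \<bullet> (x \<star> idc X')) \<star> idc X =
      (idc Z \<star> st r' \<star> idc X) \<bullet> (x \<star> idc (X' \<otimes>\<^sub>1 X))"
    using hc_vc[of "x \<star> idc X'" "idc Z \<star> st r'" "idc X" "idc X"]
    by (simp add: typing vc_id hc_assoc idc_hc)
  also have "\<dots> \<bullet> r = (idc Z \<star> st r' \<star> idc X) \<bullet> ((x \<star> idc (X' \<otimes>\<^sub>1 X)) \<bullet> r)"
    by (simp add: vc_assoc typing)
  also have "(x \<star> idc (X' \<otimes>\<^sub>1 X)) \<bullet> r = x \<star> r"
    using hc_whisker(1)[of x r] by (simp add: hc_id typing)
  also have "\<dots> = (idc (Z \<otimes>\<^sub>1 X) \<star> r) \<bullet> x"
    using hc_whisker(2)[of x r] by (simp add: hc_id typing)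
  also have "idc (Z \<otimes>\<^sub>1 X) \<star> r = idc Z \<star> (idc X \<star> r)"
    by (simp add: hc_assoc typing flip: idc_hc)
  also have "(idc Z \<star> st r' \<star> idc X) \<bullet> (idc Z \<star> (idc X \<star> r) \<bullet> x) =
     (idc Z \<star> ((st r' \<star> idc X) \<bullet> (idc X \<star> r))) \<bullet> x"
    by (simp add: hc_assoc hc_vc vc_id typing flip: vc_assoc)
  also have "\<dots> = x"
    by (simp add: conj1 idc_hc vc_id typing)
  finally show ?thesis .
qed

lemma frob_inj_right:
  assumes [simp]: "cell b" "cdom b = X'" "ccod b = Z"
  shows "(idc Z \<star> st r') \<bullet> (((b \<star> idc X) \<bullet> r) \<star> idc X') = b"
proof -
  have [simp]: "Z \<in> Arr C" "src C Z = M" "tgt C Z = N"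
    using cellD[OF assms(1)] by simp_all
  have "((b \<star> idc X) \<bullet> r) \<star> idc X' = (b \<star> idc (X \<otimes>\<^sub>1 X')) \<bullet> (r \<star> idc X')"
    using hc_vc[of r "b \<star> idc X" "idc X'" "idc X'"]
    by (simp add: typing vc_id hc_assoc idc_hc)
  also have "(idc Z \<star> st r') \<bullet> \<dots> = (idc Z \<star> st r') \<bullet> (b \<star> idc (X \<otimes>\<^sub>1 X')) \<bullet> (r \<star> idc X')"
    by (simp add: vc_assoc typing)
  also have "(idc Z \<star> st r') \<bullet> (b \<star> idc (X \<otimes>\<^sub>1 X')) = b \<bullet> (idc X' \<star> st r')"
    using hc_whisker[of b "st r'"] by (simp add: hc_id typing)
  also have "\<dots> \<bullet> (r \<star> idc X') = b"
    by (simp add: vc_assoc conj2_st vc_id typing)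
  finally show ?thesis .
qed

text \<open>The conjugate equations are symmetric under exchanging \<open>X\<close>,
  \<open>r\<close> with \<open>X'\<close>, \<open>r'\<close>; this supplies the statements for
  \<open>X'\<close>.\<close>

lemma swap: "conjugate_pair C M N X' X r' r"
  by unfold_locales (simp_all add: conj1 conj2)

end


section \<open>Mates: transposes of 2-arrows along two conjugate pairs\<close>

locale conjugate_pairs = two_C_star_category C +
  P: conjugate_pair C N M X X' r r' + Q: conjugate_pair C N M Y Y' s s'
  for C :: "('o, 'a, 't :: complex_normed_space) two_category" (structure)
    and N M :: 'o and X X' Y Y' :: 'a and r r' s s' :: "('a, 't) cell"
begin

text \<open>\<open>b\<close> is the transpose of \<open>a\<close>. A relation keeps the two
  symmetric: the reciprocities give a partner for each given \<open>a\<close> and for each given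
  \<open>b\<close>.\<close>

definition mates :: "('a, 't) cell \<Rightarrow> ('a, 't) cell \<Rightarrow> bool" where
  "mates a b \<longleftrightarrow> cell a \<and> cdom a = X \<and> ccod a = Y \<and> cell b \<and> cdom b = Y' \<and> ccod b = X' \<and>
    (idc X' \<star> a) \<bullet> r = (b \<star> idc Y) \<bullet> s"

lemma mate_exists:
  assumes [simp]: "cell a" "cdom a = X" "ccod a = Y"
  shows "\<exists>b. mates a b"
proof -
  let ?x = "(idc X' \<star> a) \<bullet> r"
  have "(((idc X' \<star> st s') \<bullet> (?x \<star> idc Y')) \<star> idc Y) \<bullet> s = ?x"
    by (rule Q.frob_surj_right) (simp_all add: typing)
  then show ?thesis
    unfolding mates_def
    by (intro exI[of _ "(idc X' \<star> st s') \<bullet> (?x \<star> idc Y')"]) (simp_all add: typing)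
qed

lemma mate_exists':
  assumes [simp]: "cell b" "cdom b = Y'" "ccod b = X'"
  shows "\<exists>a. mates a b"
proof -
  let ?x = "(b \<star> idc Y) \<bullet> s"
  have "(idc X' \<star> ((st r' \<star> idc Y) \<bullet> (idc X \<star> ?x))) \<bullet> r = ?x"
    by (rule P.frob_surj) (simp_all add: typing)
  then show ?thesis
    unfolding mates_def
    by (intro exI[of _ "(st r' \<star> idc Y) \<bullet> (idc X \<star> ?x)"]) (simp_all add: typing)
qed

lemma mates_unique: "mates a b \<Longrightarrow> mates a c \<Longrightarrow> b = c"
  using Q.frob_inj_right[of b X'] Q.frob_inj_right[of c X'] unfolding mates_def by metis

text \<open>Apply \<open>(r\<^sup>* \<otimes> 1) (1 \<otimes> _)\<close>, which is injective on \<open>Hom I (X Y')\<close>, to both sides.\<close>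

lemma mates_right:
  assumes "mates a b"
  shows "(st a \<star> idc Y') \<bullet> s' = (idc X \<star> st b) \<bullet> r'"
proof -
  have [simp]: "cell a" "cdom a = X" "ccod a = Y" "cell b" "cdom b = Y'" "ccod b = X'"
    and ab: "(idc X' \<star> a) \<bullet> r = (b \<star> idc Y) \<bullet> s"
    using assms by (auto simp: mates_def)
  interpret S: conjugate_pair C M N X' X r' r
    by (rule P.swap)
  have ab': "st r \<bullet> (idc X' \<star> st a) = st s \<bullet> (st b \<star> idc Y)"
    using arg_cong[OF ab, of st] by (simp add: st_vc st_hc st_idc typing)
  have "idc X' \<star> ((st a \<star> idc Y') \<bullet> s') = ((idc X' \<star> st a) \<star> idc Y') \<bullet> (idc X' \<star> s')"
    using hc_vc[of "idc X'" "idc X'" s' "st a \<star> idc Y'"] by (simp add: typing vc_id hc_assoc)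
  then have "(st r \<star> idc Y') \<bullet> (idc X' \<star> ((st a \<star> idc Y') \<bullet> s')) =
      ((st r \<bullet> (idc X' \<star> st a)) \<star> idc Y') \<bullet> (idc X' \<star> s')"
    using hc_vc[of "idc X' \<star> st a" "st r" "idc Y'" "idc Y'"] by (simp add: vc_id typing flip: vc_assoc)
  also have "(st r \<bullet> (idc X' \<star> st a)) \<star> idc Y' = (st s \<star> idc Y') \<bullet> (st b \<star> idc (Y \<otimes>\<^sub>1 Y'))"
    unfolding ab' using hc_vc[of "st b \<star> idc Y" "st s" "idc Y'" "idc Y'"]
    by (simp add: vc_id typing hc_assoc idc_hc)
  also have "\<dots> \<bullet> (idc X' \<star> s') = (st s \<star> idc Y') \<bullet> ((st b \<star> idc (Y \<otimes>\<^sub>1 Y')) \<bullet> (idc X' \<star> s'))"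
    by (simp add: vc_assoc typing)
  also have "(st b \<star> idc (Y \<otimes>\<^sub>1 Y')) \<bullet> (idc X' \<star> s') = (idc Y' \<star> s') \<bullet> st b"
    using hc_whisker[of "st b" s'] by (simp add: hc_id typing)
  also have "(st s \<star> idc Y') \<bullet> \<dots> = st b"
    by (simp add: Q.conj2 vc_id typing flip: vc_assoc)
  finally have 1: "(st r \<star> idc Y') \<bullet> (idc X' \<star> ((st a \<star> idc Y') \<bullet> s')) = st b" .
  have "(idc X \<star> ((st r \<star> idc Y') \<bullet> (idc X' \<star> ((st a \<star> idc Y') \<bullet> s')))) \<bullet> r' = (st a \<star> idc Y') \<bullet> s'"
    by (rule S.frob_surj) (simp_all add: typing)
  then show ?thesis
    unfolding 1 by simp
qed

end

section \<open>Linearity, norms and sums of squares\<close>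

context two_C_star_category
begin

lemma parallel_simps [simp]:
  "X \<in> Arr C \<Longrightarrow> parallel C X X"
  by (simp add: parallel_def)

lemma parallel_sym: "parallel C X Y \<Longrightarrow> parallel C Y X"
  by (simp add: parallel_def)

lemma parallel_trans: "parallel C X Y \<Longrightarrow> parallel C Y Z \<Longrightarrow> parallel C X Z"
  by (simp add: parallel_def)

lemma parallel_Arr: "parallel C X Y \<Longrightarrow> X \<in> Arr C" "parallel C X Y \<Longrightarrow> Y \<in> Arr C"
  by (simp_all add: parallel_def)

lemma Hom_zero: "parallel C X Y \<Longrightarrow> 0 \<in> Hom C X Y"
  by (rule complex_vs.subspace_0[OF Hom_subspace])

lemma Hom_add: "parallel C X Y \<Longrightarrow> s \<in> Hom C X Y \<Longrightarrow> t \<in> Hom C X Y \<Longrightarrow> s + t \<in> Hom C X Y"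
  by (rule complex_vs.subspace_add[OF Hom_subspace])

lemma Hom_diff: "parallel C X Y \<Longrightarrow> s \<in> Hom C X Y \<Longrightarrow> t \<in> Hom C X Y \<Longrightarrow> s - t \<in> Hom C X Y"
  by (rule complex_vs.subspace_diff[OF Hom_subspace])

lemma Hom_scale: "parallel C X Y \<Longrightarrow> t \<in> Hom C X Y \<Longrightarrow> k *\<^sub>C t \<in> Hom C X Y"
  by (rule complex_vs.subspace_scale[OF Hom_subspace])

lemma Hom_sum: "parallel C X Y \<Longrightarrow> (\<And>i. i \<in> I \<Longrightarrow> f i \<in> Hom C X Y) \<Longrightarrow> sum f I \<in> Hom C X Y"
  by (rule complex_vs.subspace_sum[OF Hom_subspace])

lemma vcomp_zero_left: "parallel C X Y \<Longrightarrow> parallel C Y Z \<Longrightarrow> r \<in> Hom C X Y \<Longrightarrow> 0 \<cdot> r = 0"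
  using vcomp_scaleC_left[of X Y Z r 0 0] by (simp add: Hom_zero)

lemma vcomp_zero_right: "parallel C X Y \<Longrightarrow> parallel C Y Z \<Longrightarrow> s \<in> Hom C Y Z \<Longrightarrow> s \<cdot> 0 = 0"
  using vcomp_scaleC_right[of X Y Z 0 s 0] by (simp add: Hom_zero)

lemma hcomp_zero_left: "parallel C X X' \<Longrightarrow> parallel C Y Y' \<Longrightarrow> tgt C X = src C Y \<Longrightarrow>
    s \<in> Hom C X X' \<Longrightarrow> 0 \<otimes> s = 0"
  using hcomp_scaleC_left[of X X' Y Y' s 0 0] by (simp add: Hom_zero)

lemma hcomp_zero_right: "parallel C X X' \<Longrightarrow> parallel C Y Y' \<Longrightarrow> tgt C X = src C Y \<Longrightarrow>
    t \<in> Hom C Y Y' \<Longrightarrow> t \<otimes> 0 = 0"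
  using hcomp_scaleC_right[of X X' Y Y' 0 t 0] by (simp add: Hom_zero)

lemma adj_zero: "parallel C X Y \<Longrightarrow> adj C 0 = 0"
  using adj_scaleC[of X Y 0 0] by (simp add: Hom_zero)

lemma vcomp_sum_left:
  assumes "parallel C X Y" "parallel C Y Z" "r \<in> Hom C X Y" "\<And>i. i \<in> I \<Longrightarrow> f i \<in> Hom C Y Z"
  shows "(\<Sum>i\<in>I. f i) \<cdot> r = (\<Sum>i\<in>I. f i \<cdot> r)"
  using assms(4)
proof (induction I rule: infinite_finite_induct)
  case (insert i I)
  then show ?case
    using assms vcomp_add_left[of X Y Z r "f i" "sum f I"] by (simp add: Hom_sum)
qed (use assms in \<open>simp_all add: vcomp_zero_left\<close>)

lemma vcomp_sum_right:
  assumes "parallel C X Y" "parallel C Y Z" "s \<in> Hom C Y Z" "\<And>i. i \<in> I \<Longrightarrow> f i \<in> Hom C X Y"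
  shows "s \<cdot> (\<Sum>i\<in>I. f i) = (\<Sum>i\<in>I. s \<cdot> f i)"
  using assms(4)
proof (induction I rule: infinite_finite_induct)
  case (insert i I)
  then show ?case
    using assms vcomp_add_right[of X Y Z "f i" "sum f I" s] by (simp add: Hom_sum)
qed (use assms in \<open>simp_all add: vcomp_zero_right\<close>)

lemma hcomp_sum_left:
  assumes "parallel C X X'" "parallel C Y Y'" "tgt C X = src C Y" "s \<in> Hom C X X'"
    "\<And>i. i \<in> I \<Longrightarrow> f i \<in> Hom C Y Y'"
  shows "(\<Sum>i\<in>I. f i) \<otimes> s = (\<Sum>i\<in>I. f i \<otimes> s)"
  using assms(5)
proof (induction I rule: infinite_finite_induct)
  case (insert i I)
  then show ?case
    using assms hcomp_add_left[of X X' Y Y' s "f i" "sum f I"] by (simp add: Hom_sum)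
qed (use assms in \<open>simp_all add: hcomp_zero_left\<close>)

lemma hcomp_sum_right:
  assumes "parallel C X X'" "parallel C Y Y'" "tgt C X = src C Y" "t \<in> Hom C Y Y'"
    "\<And>i. i \<in> I \<Longrightarrow> f i \<in> Hom C X X'"
  shows "t \<otimes> (\<Sum>i\<in>I. f i) = (\<Sum>i\<in>I. t \<otimes> f i)"
  using assms(5)
proof (induction I rule: infinite_finite_induct)
  case (insert i I)
  then show ?case
    using assms hcomp_add_right[of X X' Y Y' "f i" "sum f I" t] by (simp add: Hom_sum)
qed (use assms in \<open>simp_all add: hcomp_zero_right\<close>)

lemma adj_sum:
  assumes "parallel C X Y" "\<And>i. i \<in> I \<Longrightarrow> f i \<in> Hom C X Y"
  shows "adj C (\<Sum>i\<in>I. f i) = (\<Sum>i\<in>I. adj C (f i))"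
  using assms(2)
proof (induction I rule: infinite_finite_induct)
  case (insert i I)
  then show ?case
    using assms adj_add[of X Y "f i" "sum f I"] by (simp add: Hom_sum)
qed (use assms in \<open>simp_all add: adj_zero\<close>)

lemma vcomp_diff_left: "\<lbrakk>parallel C X Y; parallel C Y Z; r \<in> Hom C X Y; s \<in> Hom C Y Z; s' \<in> Hom C Y Z\<rbrakk> \<Longrightarrow>
    (s - s') \<cdot> r = s \<cdot> r - s' \<cdot> r"
  using vcomp_add_left[of X Y Z r "s - s'" s'] by (simp add: Hom_diff algebra_simps)

lemma vcomp_diff_right: "\<lbrakk>parallel C X Y; parallel C Y Z; r \<in> Hom C X Y; r' \<in> Hom C X Y; s \<in> Hom C Y Z\<rbrakk> \<Longrightarrow>
    s \<cdot> (r - r') = s \<cdot> r - s \<cdot> r'"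
  using vcomp_add_right[of X Y Z "r - r'" r' s] by (simp add: Hom_diff algebra_simps)

lemma adj_diff: "\<lbrakk>parallel C X Y; s \<in> Hom C X Y; t \<in> Hom C X Y\<rbrakk> \<Longrightarrow> adj C (s - t) = adj C s - adj C t"
  using adj_add[of X Y "s - t" t] by (simp add: Hom_diff algebra_simps)

lemma star_proper: "parallel C X Y \<Longrightarrow> t \<in> Hom C X Y \<Longrightarrow> adj C t \<cdot> t = 0 \<Longrightarrow> t = 0"
  using C_star_identity[of X Y t] by simp

lemma norm_adj:
  assumes "parallel C X Y" "t \<in> Hom C X Y"
  shows "norm (adj C t) = norm t"
proof -
  have le: "norm s \<le> norm (adj C s)" if "parallel C Z W" "s \<in> Hom C Z W" for Z W s
  proof (cases "norm s = 0")
    case False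
    have "norm s * norm s \<le> norm (adj C s) * norm s"
      using C_star_identity[OF that] norm_vcomp[OF that(1) parallel_sym[OF that(1)] that(2) adj_closed[OF that]]
      by (simp add: power2_eq_square)
    then show ?thesis
      using False by simp
  qed auto
  show ?thesis
    using le[OF assms] le[OF parallel_sym[OF assms(1)] adj_closed[OF assms]] adj_adj[OF assms] by simp
qed

lemma projection_norm:
  assumes "X \<in> Arr C" "projection C X p"
  shows "norm p \<le> 1" "p \<noteq> 0 \<Longrightarrow> norm p = 1"
proof -
  have "(norm p)\<^sup>2 = norm p"
    using C_star_identity[of X X p] assms by (simp add: projection_def)
  then have "norm p = 0 \<or> norm p = 1"
    by (simp add: power2_eq_square)
  then show "norm p \<le> 1" "p \<noteq> 0 \<Longrightarrow> norm p = 1"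
    by auto
qed

lemma projection_id: "X \<in> Arr C \<Longrightarrow> projection C X (\<one> X)"
  by (simp add: projection_def id2_closed adj_id2 vcomp_id_left[of X X])

lemma norm_id_le: "X \<in> Arr C \<Longrightarrow> norm (\<one> X) \<le> 1"
  using projection_norm projection_id by blast

lemma norm_whisker_left:
  assumes "parallel C X Y" "Z \<in> Arr C" "tgt C X = src C Z" "t \<in> Hom C X Y"
  shows "norm (\<one> Z \<otimes> t) \<le> norm t"
proof -
  have "norm (\<one> Z \<otimes> t) \<le> norm (\<one> Z) * norm t"
    using assms by (intro norm_hcomp[of X Y Z Z]) (auto simp: id2_closed)
  also have "\<dots> \<le> norm t"
    using norm_id_le[OF assms(2)] by (simp add: mult_left_le_one_le)
  finally show ?thesis .
qed

lemma norm_whisker_right: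
  assumes "parallel C X Y" "Z \<in> Arr C" "tgt C Z = src C X" "t \<in> Hom C X Y"
  shows "norm (t \<otimes> \<one> Z) \<le> norm t"
proof -
  have "norm (t \<otimes> \<one> Z) \<le> norm t * norm (\<one> Z)"
    using assms by (intro norm_hcomp[of Z Z X Y]) (auto simp: id2_closed)
  also have "\<dots> \<le> norm t"
    using norm_id_le[OF assms(2)] by (simp add: mult_right_le_one_le)
  finally show ?thesis .
qed

text \<open>\<open>T\<close> is the column with entries \<open>x k\<close>, a 2-arrow into the direct sum of the \<open>W k\<close>.\<close>

lemma column:
  assumes "finite K" "X \<in> Arr C" "\<And>k. k \<in> K \<Longrightarrow> parallel C X (W k) \<and> x k \<in> Hom C X (W k)"
  shows "\<exists>Z T. parallel C X Z \<and> T \<in> Hom C X Z \<and> adj C T \<cdot> T = (\<Sum>k\<in>K. adj C (x k) \<cdot> x k) \<and>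
    (T = 0 \<longrightarrow> (\<forall>k\<in>K. x k = 0))"
  using assms(1,3)
proof (induction K)
  case empty
  then show ?case
    using assms(2) by (intro exI[of _ X] exI[of _ 0]) (simp add: Hom_zero adj_zero[of X X] vcomp_zero_left[of X X X])
next
  case (insert k K)
  then obtain Z T where T: "parallel C X Z" "T \<in> Hom C X Z" "adj C T \<cdot> T = (\<Sum>k\<in>K. adj C (x k) \<cdot> x k)"
    "T = 0 \<Longrightarrow> \<forall>k\<in>K. x k = 0"
    by auto
  have k: "parallel C X (W k)" "x k \<in> Hom C X (W k)"
    using insert by auto
  have ZW: "parallel C Z (W k)"
    using parallel_trans[OF parallel_sym[OF T(1)] k(1)] .
  obtain V v w where "isometry C Z V v" "isometry C (W k) V w" and vw: "v \<cdot> adj C v + w \<cdot> adj C w = \<one> V"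
    using direct_sums[OF ZW] by auto
  then have v: "parallel C Z V" "v \<in> Hom C Z V" "adj C v \<cdot> v = \<one> Z"
    and w: "parallel C (W k) V" "w \<in> Hom C (W k) V" "adj C w \<cdot> w = \<one> (W k)"
    by (auto simp: isometry_def)
  note par = v(1) w(1) T(1) k(1) v(1)[THEN parallel_sym] w(1)[THEN parallel_sym] T(1)[THEN parallel_sym] k(1)[THEN parallel_sym]
    parallel_trans[OF T(1) v(1)] ZW ZW[THEN parallel_sym] parallel_Arr[OF v(1)]
  have va: "adj C v \<in> Hom C V Z" "adj C w \<in> Hom C V (W k)"
    using adj_closed v w by auto
  \<comment> \<open>Multiplying \<open>v v^* + w w^* = 1\<close> by the adjoint of \<open>v\<close>
    from the left and by \<open>w\<close> from the right isolates this product.\<close>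
  have vw0: "adj C v \<cdot> w = 0"
  proof -
    have "adj C v \<cdot> (v \<cdot> adj C v + w \<cdot> adj C w) = adj C v"
      unfolding vw using va par vcomp_id_right[of V Z "adj C v"] by simp
    moreover have "adj C v \<cdot> (v \<cdot> adj C v + w \<cdot> adj C w) = adj C v \<cdot> (v \<cdot> adj C v) + adj C v \<cdot> (w \<cdot> adj C w)"
      using va v w par by (intro vcomp_add_right[of V V Z]) (auto intro: vcomp_closed[of V Z V] vcomp_closed[of V "W k" V])
    moreover have "adj C v \<cdot> (v \<cdot> adj C v) = adj C v"
      using va v par vcomp_assoc[of V Z V Z "adj C v" v "adj C v"] vcomp_id_left[of V Z "adj C v"] by simp
    moreover have "adj C v \<cdot> (w \<cdot> adj C w) = (adj C v \<cdot> w) \<cdot> adj C w"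
      using va v w par vcomp_assoc[of V "W k" V Z "adj C w" w "adj C v"] by simp
    ultimately have "(adj C v \<cdot> w) \<cdot> adj C w = 0"
      by simp
    then have "((adj C v \<cdot> w) \<cdot> adj C w) \<cdot> w = 0"
      using vcomp_zero_left[of "W k" V Z w] w par by simp
    moreover have "((adj C v \<cdot> w) \<cdot> adj C w) \<cdot> w = (adj C v \<cdot> w) \<cdot> (adj C w \<cdot> w)"
      using va v w par by (intro vcomp_assoc[of "W k" V "W k" Z]) (auto intro: vcomp_closed[of "W k" V Z])
    ultimately show ?thesis
      using vcomp_id_right[of "W k" Z "adj C v \<cdot> w"] w va par vcomp_closed[of "W k" V Z w "adj C v"] by simp
  qed
  have wv0: "adj C w \<cdot> v = 0"
    using arg_cong[OF vw0, of "adj C"] adj_vcomp[of "W k" V Z w "adj C v"] va v w par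
    by (simp add: adj_adj[of Z V] adj_zero[of "W k" Z])
  define U where "U = v \<cdot> T + w \<cdot> x k"
  have c: "v \<cdot> T \<in> Hom C X V" "w \<cdot> x k \<in> Hom C X V"
    using v w T k par by (auto intro: vcomp_closed[of X Z V] vcomp_closed[of X "W k" V])
  have XV: "parallel C X V"
    using parallel_trans[OF T(1) v(1)] .
  have U: "U \<in> Hom C X V"
    unfolding U_def using c XV by (simp add: Hom_add)
  have vU: "adj C v \<cdot> U = T"
  proof -
    have "adj C v \<cdot> U = (adj C v \<cdot> v) \<cdot> T + (adj C v \<cdot> w) \<cdot> x k"
      unfolding U_def using c va v w T k par XV vcomp_assoc[of X Z V Z T v "adj C v"]
        vcomp_assoc[of X "W k" V Z "x k" w "adj C v"]
      by (simp add: vcomp_add_right[of X V Z])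
    then show ?thesis
      using v vw0 T k par vcomp_id_left[of X Z T] vcomp_zero_left[of X "W k" Z "x k"] by simp
  qed
  have wU: "adj C w \<cdot> U = x k"
  proof -
    have "adj C w \<cdot> U = (adj C w \<cdot> v) \<cdot> T + (adj C w \<cdot> w) \<cdot> x k"
      unfolding U_def using c va v w T k par XV vcomp_assoc[of X Z V "W k" T v "adj C w"]
        vcomp_assoc[of X "W k" V "W k" "x k" w "adj C w"]
      by (simp add: vcomp_add_right[of X V "W k"])
    then show ?thesis
      using w wv0 T k par vcomp_id_left[of X "W k" "x k"] vcomp_zero_left[of X Z "W k" T] by simp
  qed
  have Ta: "adj C T \<in> Hom C Z X" "adj C (x k) \<in> Hom C (W k) X"
    using adj_closed T k by auto
  have "adj C U = adj C T \<cdot> adj C v + adj C (x k) \<cdot> adj C w"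
    unfolding U_def using c XV v w T k par adj_vcomp[of X Z V T v] adj_vcomp[of X "W k" V "x k" w]
    by (simp add: adj_add[of X V])
  then have "adj C U \<cdot> U = (adj C T \<cdot> adj C v) \<cdot> U + (adj C (x k) \<cdot> adj C w) \<cdot> U"
    using U XV va Ta par vcomp_add_left[of X V X U "adj C T \<cdot> adj C v" "adj C (x k) \<cdot> adj C w"]
      vcomp_closed[of V Z X "adj C v" "adj C T"] vcomp_closed[of V "W k" X "adj C w" "adj C (x k)"]
      parallel_sym[OF XV] by simp
  also have "(adj C T \<cdot> adj C v) \<cdot> U = adj C T \<cdot> T"
    using vcomp_assoc[of X V Z X U "adj C v" "adj C T"] U XV va Ta par vU by simp
  also have "(adj C (x k) \<cdot> adj C w) \<cdot> U = adj C (x k) \<cdot> x k"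
    using vcomp_assoc[of X V "W k" X U "adj C w" "adj C (x k)"] U XV va Ta par wU by simp
  finally have "adj C U \<cdot> U = (\<Sum>k\<in>insert k K. adj C (x k) \<cdot> x k)"
    using insert T by simp
  moreover have "x l = 0" if "U = 0" "l \<in> insert k K" for l
    using that vU wU T(4) vcomp_zero_right[of X V Z "adj C v"] vcomp_zero_right[of X V "W k" "adj C w"] XV va par
    by auto
  ultimately show ?case
    using U XV by blast
qed

text \<open>The C*-identity controls one square at a time; \<open>column\<close> turns the sum of
  squares into a single square.\<close>

lemma sum_squares_zero:
  assumes "finite K" "X \<in> Arr C" "\<And>k. k \<in> K \<Longrightarrow> parallel C X (W k) \<and> x k \<in> Hom C X (W k)"
    and "(\<Sum>k\<in>K. adj C (x k) \<cdot> x k) = 0" "k \<in> K"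
  shows "x k = 0"
proof -
  obtain Z T where T: "parallel C X Z" "T \<in> Hom C X Z" "adj C T \<cdot> T = (\<Sum>k\<in>K. adj C (x k) \<cdot> x k)"
    "T = 0 \<longrightarrow> (\<forall>k\<in>K. x k = 0)"
    using column[of K X W x, OF assms(1-3)] by blast
  then have "T = 0"
    using assms(4) by (intro star_proper[of X Z T]) auto
  then show ?thesis
    using T assms(5) by blast
qed

text \<open>Self-adjointness makes \<open>k\<close> real. If it were negative, a scaled copy of
  \<open>p\<close> would have a square cancelling that of \<open>t\<close>, against
  \<open>sum_squares_zero\<close>. This stands in for an argument with spectra.\<close>

lemma square_multiple_nonneg:
  assumes X: "X \<in> Arr C" and t: "parallel C X Y" "t \<in> Hom C X Y"
    and p: "projection C X p" "p \<noteq> 0" and eq: "adj C t \<cdot> t = k *\<^sub>C p"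
  shows "\<exists>c\<ge>0. k = complex_of_real c"
proof -
  have pH: "p \<in> Hom C X X" "p \<cdot> p = p" "adj C p = p"
    using p by (auto simp: projection_def)
  have "adj C (adj C t \<cdot> t) = adj C t \<cdot> t"
    using t X by (simp add: adj_vcomp[of X Y X] parallel_sym adj_closed adj_adj[of X Y])
  then have "cnj k *\<^sub>C p = k *\<^sub>C p"
    unfolding eq using pH X by (simp add: adj_scaleC[of X X])
  then have "cnj k = k"
    using p by simp
  then obtain c where c: "k = complex_of_real c"
    by (metis Reals_cnj_iff Reals_cases)
  have "0 \<le> c"
  proof (rule ccontr)
    assume neg: "\<not> 0 \<le> c"
    define s where "s = complex_of_real (sqrt (- c)) *\<^sub>C p"
    have s: "s \<in> Hom C X X"
      unfolding s_def using pH X by (simp add: Hom_scale)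
    have "adj C s \<cdot> s = complex_of_real (- c) *\<^sub>C p"
      unfolding s_def using pH X neg
      by (simp add: adj_scaleC[of X X] vcomp_scaleC_left[of X X X] vcomp_scaleC_right[of X X X] Hom_scale
          scaleC_scaleC flip: of_real_mult)
    then have "adj C t \<cdot> t + adj C s \<cdot> s = 0"
      unfolding eq c by (simp flip: scaleC_add_left)
    moreover have "(\<Sum>b\<in>{True, False}. adj C (if b then t else s) \<cdot> (if b then t else s)) = adj C t \<cdot> t + adj C s \<cdot> s"
      by simp
    ultimately have "s = 0"
      using sum_squares_zero[of "{True, False}" X "\<lambda>b. if b then Y else X" "\<lambda>b. if b then t else s" False] t s X
      by auto
    then show False
      using neg p by (simp add: s_def)
  qed
  then show ?thesis
    using c by blast
qed

end

section \<open>Finite dimension of the spaces of 2-arrows\<close>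

context two_C_star_category
begin

lemma Hom_I: "cell c \<Longrightarrow> cdom c = X \<Longrightarrow> ccod c = Y \<Longrightarrow> cval c \<in> Hom C X Y"
  by (auto simp: cell_def)

lemma cellI: "parallel C X Y \<Longrightarrow> t \<in> Hom C X Y \<Longrightarrow> cell (Cell X t Y)"
  by (auto simp: cell_def)

lemma center_star_algebra:
  assumes N: "N \<in> Ob C" and fin: "finite_dimensional_centers C"
  shows "commutative_star_algebra (object_center C N) (vcomp C) (adj C) (\<one> (\<I> N))"
proof -
  have I: "\<I> N \<in> Arr C" "src C (\<I> N) = N" "tgt C (\<I> N) = N"
    using id1_closed[OF N] by auto
  \<comment> \<open>Eckmann-Hilton: both vertical composites equal the horizontal composite.\<close>
  have comm: "a \<cdot> b = b \<cdot> a" if "a \<in> Hom C (\<I> N) (\<I> N)" "b \<in> Hom C (\<I> N) (\<I> N)" for a b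
  proof -
    let ?a = "Cell (\<I> N) a (\<I> N)" and ?b = "Cell (\<I> N) b (\<I> N)"
    have ab: "cell ?a" "cell ?b"
      using that I by (auto intro!: cellI)
    have "?a \<bullet> ?b = ?a \<star> ?b"
      using hc_whisker(1)[OF ab] I ab by (simp add: hc_id)
    also have "\<dots> = ?b \<bullet> ?a"
      using hc_whisker(2)[OF ab] I ab by (simp add: hc_id)
    finally show ?thesis
      using cell_sel(3)[of ?a ?b] cell_sel(3)[of ?b ?a] by simp
  qed
  obtain B where "finite B" "object_center C N = complex_vs.span B"
    using fin N by (auto simp: finite_dimensional_centers_def)
  then have "\<exists>B. finite B \<and> Hom C (\<I> N) (\<I> N) \<subseteq> complex_vs.span B"
    by (auto simp: object_center_def)
  then show ?thesis
    unfolding object_center_def using I comm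
    by unfold_locales (auto simp: id2_closed Hom_subspace vcomp_assoc[of "\<I> N" "\<I> N" "\<I> N" "\<I> N"]
        vcomp_add_left[of "\<I> N" "\<I> N" "\<I> N"] vcomp_add_right[of "\<I> N" "\<I> N" "\<I> N"]
        vcomp_scaleC_left[of "\<I> N" "\<I> N" "\<I> N"] vcomp_scaleC_right[of "\<I> N" "\<I> N" "\<I> N"]
        vcomp_id_left[of "\<I> N" "\<I> N"] vcomp_id_right[of "\<I> N" "\<I> N"]
        adj_adj[of "\<I> N" "\<I> N"] adj_add[of "\<I> N" "\<I> N"] adj_scaleC[of "\<I> N" "\<I> N"]
        adj_vcomp[of "\<I> N" "\<I> N" "\<I> N"]
        intro: vcomp_closed[of "\<I> N" "\<I> N" "\<I> N"] adj_closed[of "\<I> N" "\<I> N"] star_proper[of "\<I> N" "\<I> N"])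
qed

lemma Hom_star_algebra:
  assumes X: "X \<in> Arr C" and fin: "\<exists>B. finite B \<and> Hom C X X \<subseteq> complex_vs.span B"
  shows "star_algebra (Hom C X X) (vcomp C) (adj C) (\<one> X)"
  using X fin
  by unfold_locales (auto simp: id2_closed Hom_subspace vcomp_assoc[of X X X X]
      vcomp_add_left[of X X X] vcomp_add_right[of X X X] vcomp_scaleC_left[of X X X] vcomp_scaleC_right[of X X X]
      vcomp_id_left[of X X] vcomp_id_right[of X X] adj_adj[of X X] adj_add[of X X] adj_scaleC[of X X] adj_vcomp[of X X X]
      intro: vcomp_closed[of X X X] adj_closed[of X X] star_proper[of X X])

end

section \<open>Frobenius reciprocity for endomorphisms, with norm bounds\<close>

context conjugate_pair
begin

lemma parallel_IXX [simp]: "parallel C (\<I> N) (X' \<otimes>\<^sub>1 X)" "parallel C (X' \<otimes>\<^sub>1 X) (\<I> N)"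
  by (simp_all add: parallel_def typing)

text \<open>\<open>frob\<close> and \<open>unfrob\<close> are the two directions of reciprocity
  between \<open>Hom X X\<close> and \<open>Hom I (X' X)\<close>. They act on bare 2-arrows, where
  linearity and norms are available.\<close>

definition to_arrow :: "'t \<Rightarrow> ('a, 't) cell" where
  "to_arrow x = (st r' \<star> idc X) \<bullet> (idc X \<star> Cell (\<I> N) x (X' \<otimes>\<^sub>1 X))"

definition frob :: "'t \<Rightarrow> 't" where
  "frob x = cval (to_arrow x)"

definition unfrob :: "'t \<Rightarrow> 't" where
  "unfrob a = (\<one> X' \<otimes> a) \<cdot> cval r"

lemma parallel_conj1 [simp]: "parallel C X (X \<otimes>\<^sub>1 (X' \<otimes>\<^sub>1 X))" "parallel C (X \<otimes>\<^sub>1 (X' \<otimes>\<^sub>1 X)) X"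
    "parallel C (X' \<otimes>\<^sub>1 X) (X' \<otimes>\<^sub>1 X)"
  by (simp_all add: parallel_def typing)

lemma cval_r [simp]: "cval r \<in> Hom C (\<I> N) (X' \<otimes>\<^sub>1 X)"
  by (rule Hom_I) simp_all

lemma cval_r' [simp]: "cval r' \<in> Hom C (\<I> M) (X \<otimes>\<^sub>1 X')"
  by (rule Hom_I) simp_all

lemma whisk_r' : "adj C (cval r') \<otimes> \<one> X \<in> Hom C (X \<otimes>\<^sub>1 (X' \<otimes>\<^sub>1 X)) X"
  using Hom_I[of "st r' \<star> idc X" "X \<otimes>\<^sub>1 (X' \<otimes>\<^sub>1 X)" X] by (simp add: typing)

lemma whisk_x: "x \<in> Hom C (\<I> N) (X' \<otimes>\<^sub>1 X) \<Longrightarrow> \<one> X \<otimes> x \<in> Hom C X (X \<otimes>\<^sub>1 (X' \<otimes>\<^sub>1 X))"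
  using Hom_I[of "idc X \<star> Cell (\<I> N) x (X' \<otimes>\<^sub>1 X)" X "X \<otimes>\<^sub>1 (X' \<otimes>\<^sub>1 X)"] by (simp add: typing cellI)

lemma whisk_a: "a \<in> Hom C X X \<Longrightarrow> \<one> X' \<otimes> a \<in> Hom C (X' \<otimes>\<^sub>1 X) (X' \<otimes>\<^sub>1 X)"
  using Hom_I[of "idc X' \<star> Cell X a X" "X' \<otimes>\<^sub>1 X" "X' \<otimes>\<^sub>1 X"] by (simp add: typing cellI)

lemma frob_eq: "frob x = (adj C (cval r') \<otimes> \<one> X) \<cdot> (\<one> X \<otimes> x)"
  by (simp add: frob_def to_arrow_def)

lemma frob_closed [simp]: "x \<in> Hom C (\<I> N) (X' \<otimes>\<^sub>1 X) \<Longrightarrow> frob x \<in> Hom C X X"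
  unfolding frob_eq by (rule vcomp_closed[OF _ _ whisk_x whisk_r']) simp_all

lemma unfrob_closed [simp]: "a \<in> Hom C X X \<Longrightarrow> unfrob a \<in> Hom C (\<I> N) (X' \<otimes>\<^sub>1 X)"
  unfolding unfrob_def by (rule vcomp_closed[OF _ _ cval_r whisk_a]) simp_all

lemma unfrob_frob:
  assumes "x \<in> Hom C (\<I> N) (X' \<otimes>\<^sub>1 X)"
  shows "unfrob (frob x) = x"
  using arg_cong[OF frob_surj[of "Cell (\<I> N) x (X' \<otimes>\<^sub>1 X)" X], of cval] assms
  by (simp add: cellI unfrob_def frob_eq)

lemma frob_unfrob:
  assumes "a \<in> Hom C X X"
  shows "frob (unfrob a) = a"
  using arg_cong[OF frob_inj[of "Cell X a X" X], of cval] assms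
  by (simp add: cellI unfrob_def frob_eq)

lemma frob_sum:
  assumes "\<And>i. i \<in> I \<Longrightarrow> f i \<in> Hom C (\<I> N) (X' \<otimes>\<^sub>1 X)"
  shows "frob (\<Sum>i\<in>I. f i) = (\<Sum>i\<in>I. frob (f i))"
proof -
  have "\<one> X \<otimes> (\<Sum>i\<in>I. f i) = (\<Sum>i\<in>I. \<one> X \<otimes> f i)"
    using assms by (intro hcomp_sum_right[of "\<I> N" "X' \<otimes>\<^sub>1 X" X X]) (simp_all add: typing id2_closed)
  then show ?thesis
    unfolding frob_eq using assms
    by (simp add: vcomp_sum_right[OF _ _ whisk_r' whisk_x])
qed

lemma frob_scale:
  assumes "x \<in> Hom C (\<I> N) (X' \<otimes>\<^sub>1 X)"
  shows "frob (k *\<^sub>C x) = k *\<^sub>C frob x"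
proof -
  have "\<one> X \<otimes> (k *\<^sub>C x) = k *\<^sub>C (\<one> X \<otimes> x)"
    using assms by (intro hcomp_scaleC_right[of "\<I> N" "X' \<otimes>\<^sub>1 X" X X]) (simp_all add: typing id2_closed)
  then show ?thesis
    unfolding frob_eq using assms
    by (simp add: vcomp_scaleC_right[OF _ _ whisk_x whisk_r'])
qed

lemma norm_frob_le:
  assumes "x \<in> Hom C (\<I> N) (X' \<otimes>\<^sub>1 X)"
  shows "norm (frob x) \<le> norm (cval r') * norm x"
proof -
  have "norm (frob x) \<le> norm (adj C (cval r') \<otimes> \<one> X) * norm (\<one> X \<otimes> x)"
    unfolding frob_eq using assms by (intro norm_vcomp[OF _ _ whisk_x whisk_r']) simp_all
  also have "\<dots> \<le> norm (cval r') * norm x"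
  proof (intro mult_mono)
    have p: "parallel C (\<I> M) (X \<otimes>\<^sub>1 X')"
      by (simp add: parallel_def typing)
    then show "norm (adj C (cval r') \<otimes> \<one> X) \<le> norm (cval r')"
      using norm_whisker_right[of "X \<otimes>\<^sub>1 X'" "\<I> M" X "adj C (cval r')"] norm_adj[OF p] adj_closed[OF p] parallel_sym[OF p]
      by (simp add: typing)
    show "norm (\<one> X \<otimes> x) \<le> norm x"
      using assms norm_whisker_left[of "\<I> N" "X' \<otimes>\<^sub>1 X" X x] by (simp add: typing)
  qed auto
  finally show ?thesis .
qed

lemma norm_unfrob_le:
  assumes "a \<in> Hom C X X"
  shows "norm (unfrob a) \<le> norm a * norm (cval r)"
proof -
  have "norm (unfrob a) \<le> norm (\<one> X' \<otimes> a) * norm (cval r)"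
    unfolding unfrob_def using assms by (intro norm_vcomp[OF _ _ cval_r whisk_a]) simp_all
  also have "norm (\<one> X' \<otimes> a) \<le> norm a"
    using assms norm_whisker_left[of X X X' a] by simp
  finally show ?thesis
    by (simp add: mult_right_mono)
qed

text \<open>\<open>Hom I (X' X)\<close> is a right module over the center of \<open>N\<close>, and
  \<open>frob\<close> carries its action to multiplication by the left center.\<close>

lemma frob_mul_center:
  assumes "x \<in> Hom C (\<I> N) (X' \<otimes>\<^sub>1 X)" "z \<in> Hom C (\<I> N) (\<I> N)"
  shows "frob (x \<cdot> z) = frob x \<cdot> (\<one> X \<otimes> z)"
proof -
  let ?x = "Cell (\<I> N) x (X' \<otimes>\<^sub>1 X)" and ?z = "Cell (\<I> N) z (\<I> N)"
  have [simp]: "cell ?x" "cell ?z"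
    using assms by (auto intro!: cellI simp: typing)
  have "idc X \<star> (?x \<bullet> ?z) = (idc X \<star> ?x) \<bullet> (idc X \<star> ?z)"
    using hc_vc[of "idc X" "idc X" ?z ?x] by (simp add: typing vc_id)
  then have "(st r' \<star> idc X) \<bullet> (idc X \<star> (?x \<bullet> ?z)) = (st r' \<star> idc X) \<bullet> (idc X \<star> ?x) \<bullet> (idc X \<star> ?z)"
    by (simp add: vc_assoc typing)
  from arg_cong[OF this, of cval] show ?thesis
    by (simp add: frob_eq)
qed

lemma center_commutes:
  assumes "a \<in> Hom C X X" "z \<in> Hom C (\<I> N) (\<I> N)"
  shows "a \<cdot> (\<one> X \<otimes> z) = (\<one> X \<otimes> z) \<cdot> a"
proof -
  let ?a = "Cell X a X" and ?z = "Cell (\<I> N) z (\<I> N)"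
  have [simp]: "cell ?a" "cell ?z"
    using assms by (auto intro!: cellI simp: typing)
  have "?a \<bullet> (idc X \<star> ?z) = (idc X \<star> ?z) \<bullet> ?a"
    using hc_whisker[of ?a ?z] by (simp add: typing hc_id)
  from arg_cong[OF this, of cval] show ?thesis
    by simp
qed

lemma adj_frob:
  assumes "x \<in> Hom C (\<I> N) (X' \<otimes>\<^sub>1 X)"
  shows "adj C (frob x) = (\<one> X \<otimes> adj C x) \<cdot> (cval r' \<otimes> \<one> X)"
proof -
  let ?x = "Cell (\<I> N) x (X' \<otimes>\<^sub>1 X)"
  have [simp]: "cell ?x"
    using assms by (auto intro!: cellI simp: typing)
  have "st ((st r' \<star> idc X) \<bullet> (idc X \<star> ?x)) = (idc X \<star> st ?x) \<bullet> (r' \<star> idc X)"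
    by (simp add: st_vc st_hc st_idc st_st typing)
  from arg_cong[OF this, of cval] show ?thesis
    by (simp add: frob_eq)
qed

text \<open>This places \<open>x x^*\<close> between two whiskered copies of \<open>r'\<close>, so
  that a sum over \<open>x\<close> can be taken inside.\<close>

lemma frob_adj_frob:
  assumes x: "x \<in> Hom C (\<I> N) (X' \<otimes>\<^sub>1 X)"
  shows "frob x \<cdot> adj C (frob x) = (adj C (cval r') \<otimes> \<one> X) \<cdot> ((\<one> X \<otimes> (x \<cdot> adj C x)) \<cdot> (cval r' \<otimes> \<one> X))"
proof -
  let ?x = "Cell (\<I> N) x (X' \<otimes>\<^sub>1 X)"
  have [simp]: "cell ?x"
    using x by (auto intro!: cellI simp: typing)
  have "((st r' \<star> idc X) \<bullet> (idc X \<star> ?x)) \<bullet> ((idc X \<star> st ?x) \<bullet> (r' \<star> idc X)) =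
      (st r' \<star> idc X) \<bullet> (((idc X \<star> ?x) \<bullet> (idc X \<star> st ?x)) \<bullet> (r' \<star> idc X))"
    by (simp add: vc_assoc typing)
  also have "(idc X \<star> ?x) \<bullet> (idc X \<star> st ?x) = idc X \<star> (?x \<bullet> st ?x)"
    by (simp add: hc_vc vc_id typing)
  finally show ?thesis
    using adj_frob[OF x] by (auto simp: frob_eq dest!: arg_cong[of _ _ cval])
qed

end

section \<open>Orthonormal families in \<open>Hom I (X' X)\<close>\<close>

context conjugate_pair
begin

abbreviation H :: "'t set" where
  "H \<equiv> Hom C (\<I> N) (X' \<otimes>\<^sub>1 X)"

lemma parallel_IN [simp]: "parallel C (\<I> N) (\<I> N)"
  by (simp add: typing)

lemma adj_mul_closed [simp]: "x \<in> H \<Longrightarrow> y \<in> H \<Longrightarrow> adj C x \<cdot> y \<in> Hom C (\<I> N) (\<I> N)"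
  by (intro vcomp_closed[of "\<I> N" "X' \<otimes>\<^sub>1 X" "\<I> N"] adj_closed) simp_all

lemma mul_adj_closed [simp]: "x \<in> H \<Longrightarrow> y \<in> H \<Longrightarrow> x \<cdot> adj C y \<in> Hom C (X' \<otimes>\<^sub>1 X) (X' \<otimes>\<^sub>1 X)"
  by (intro vcomp_closed[of "X' \<otimes>\<^sub>1 X" "\<I> N" "X' \<otimes>\<^sub>1 X"] adj_closed) simp_all

lemma H_center_closed [simp]: "x \<in> H \<Longrightarrow> z \<in> Hom C (\<I> N) (\<I> N) \<Longrightarrow> x \<cdot> z \<in> H"
  by (rule vcomp_closed[of "\<I> N" "\<I> N"]) simp_all

lemma adj_H [simp]: "x \<in> H \<Longrightarrow> adj C x \<in> Hom C (X' \<otimes>\<^sub>1 X) (\<I> N)"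
  by (rule adj_closed) simp_all

text \<open>For a minimal projection \<open>z\<close> of the center, the vectors with
  \<open>x \<cdot> z = x\<close> form an inner product space: \<open>adj C x \<cdot> y\<close> is a
  multiple of \<open>z\<close>. These are its finite orthonormal sets.\<close>

definition orthonormal :: "'t \<Rightarrow> 't set \<Rightarrow> bool" where
  "orthonormal z S \<longleftrightarrow> finite S \<and> S \<subseteq> {x \<in> H. x \<cdot> z = x} \<and>
    (\<forall>x\<in>S. \<forall>y\<in>S. adj C x \<cdot> y = (if x = y then z else 0))"

text \<open>By orthonormality the sum of the \<open>x x^*\<close> is idempotent and self-adjoint: it
  is the projection onto the range of the family.\<close>

lemma range_projection:
  assumes S: "orthonormal z S" and z: "projection C (\<I> N) z"
  shows "norm (\<Sum>x\<in>S. x \<cdot> adj C x) \<le> 1"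
proof -
  have SH: "\<And>x. x \<in> S \<Longrightarrow> x \<in> H" "\<And>x. x \<in> S \<Longrightarrow> x \<cdot> z = x" "finite S"
    and o: "\<And>x y. x \<in> S \<Longrightarrow> y \<in> S \<Longrightarrow> adj C x \<cdot> y = (if x = y then z else 0)"
    using S by (auto simp: orthonormal_def)
  define P where "P = (\<Sum>x\<in>S. x \<cdot> adj C x)"
  have XX: "X' \<otimes>\<^sub>1 X \<in> Arr C"
    by (simp add: typing)
  have P: "P \<in> Hom C (X' \<otimes>\<^sub>1 X) (X' \<otimes>\<^sub>1 X)"
    unfolding P_def using SH XX by (intro Hom_sum) auto
  have xP: "adj C x \<cdot> P = adj C x" if x: "x \<in> S" for x
  proof -
    have "adj C x \<cdot> P = (\<Sum>y\<in>S. adj C x \<cdot> (y \<cdot> adj C y))"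
      unfolding P_def using SH x XX by (intro vcomp_sum_right[of "X' \<otimes>\<^sub>1 X" "X' \<otimes>\<^sub>1 X" "\<I> N"]) auto
    also have "\<dots> = (\<Sum>y\<in>S. if y = x then adj C x else 0)"
    proof (intro sum.cong refl)
      fix y assume y: "y \<in> S"
      have "adj C x \<cdot> (y \<cdot> adj C y) = (adj C x \<cdot> y) \<cdot> adj C y"
        using SH x y XX by (intro vcomp_assoc[of "X' \<otimes>\<^sub>1 X" "\<I> N" "X' \<otimes>\<^sub>1 X" "\<I> N", symmetric]) auto
      moreover have "z \<cdot> adj C x = adj C x"
        using arg_cong[OF SH(2)[OF x], of "adj C"] adj_vcomp[of "\<I> N" "\<I> N" "X' \<otimes>\<^sub>1 X" z x] SH(1)[OF x] z
        by (simp add: projection_def)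
      ultimately show "adj C x \<cdot> (y \<cdot> adj C y) = (if y = x then adj C x else 0)"
        using o[OF x y] SH y vcomp_zero_left[of "X' \<otimes>\<^sub>1 X" "\<I> N" "\<I> N" "adj C y"] by auto
    qed
    also have "\<dots> = adj C x"
      using SH x by simp
    finally show ?thesis .
  qed
  have PP: "P \<cdot> P = P"
  proof -
    have "P \<cdot> P = (\<Sum>x\<in>S. (x \<cdot> adj C x) \<cdot> P)"
      using P XX SH vcomp_sum_left[of "X' \<otimes>\<^sub>1 X" "X' \<otimes>\<^sub>1 X" "X' \<otimes>\<^sub>1 X" P S "\<lambda>x. x \<cdot> adj C x"]
      by (simp flip: P_def)
    also have "\<dots> = (\<Sum>x\<in>S. x \<cdot> adj C x)"
    proof (intro sum.cong refl)
      fix x assume x: "x \<in> S"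
      have "(x \<cdot> adj C x) \<cdot> P = x \<cdot> (adj C x \<cdot> P)"
        using SH x P XX by (intro vcomp_assoc[of "X' \<otimes>\<^sub>1 X" "X' \<otimes>\<^sub>1 X" "\<I> N" "X' \<otimes>\<^sub>1 X"]) auto
      then show "(x \<cdot> adj C x) \<cdot> P = x \<cdot> adj C x"
        using xP[OF x] by simp
    qed
    finally show ?thesis
      by (simp add: P_def)
  qed
  have "adj C (x \<cdot> adj C x) = x \<cdot> adj C x" if "x \<in> S" for x
    using that SH adj_vcomp[of "X' \<otimes>\<^sub>1 X" "\<I> N" "X' \<otimes>\<^sub>1 X" "adj C x" x]
    by (simp add: adj_adj[of "\<I> N" "X' \<otimes>\<^sub>1 X"])
  then have "adj C P = P"
    unfolding P_def using SH XX by (subst adj_sum[of "X' \<otimes>\<^sub>1 X" "X' \<otimes>\<^sub>1 X"]) auto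
  then have "projection C (X' \<otimes>\<^sub>1 X) P"
    using P PP by (simp add: projection_def)
  then show ?thesis
    using projection_norm(1)[OF XX] by (simp add: P_def)
qed

lemma parallel_r' [simp]: "parallel C X ((X \<otimes>\<^sub>1 X') \<otimes>\<^sub>1 X)" "parallel C (\<I> M) (X \<otimes>\<^sub>1 X')"
  by (simp_all add: parallel_def typing)

text \<open>The sum is the range projection of \<open>S\<close> sandwiched between whiskered copies
  of \<open>r'\<close>, so the bound is the same for families of every size.\<close>

lemma frob_square_sum_le:
  assumes S: "orthonormal z S" and z: "projection C (\<I> N) z"
  shows "norm (\<Sum>x\<in>S. frob x \<cdot> adj C (frob x)) \<le> (norm (cval r'))\<^sup>2"
proof -
  let ?W = "X \<otimes>\<^sub>1 (X' \<otimes>\<^sub>1 X)"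
  have SH: "\<And>x. x \<in> S \<Longrightarrow> x \<in> H"
    using S by (auto simp: orthonormal_def)
  define P where "P = (\<Sum>x\<in>S. x \<cdot> adj C x)"
  have XX: "X' \<otimes>\<^sub>1 X \<in> Arr C" "?W \<in> Arr C"
    by (simp_all add: typing)
  have P: "P \<in> Hom C (X' \<otimes>\<^sub>1 X) (X' \<otimes>\<^sub>1 X)"
    unfolding P_def using SH XX by (intro Hom_sum) auto
  have w: "\<one> X \<otimes> y \<in> Hom C ?W ?W" if "y \<in> Hom C (X' \<otimes>\<^sub>1 X) (X' \<otimes>\<^sub>1 X)" for y
    using Hom_I[of "idc X \<star> Cell (X' \<otimes>\<^sub>1 X) y (X' \<otimes>\<^sub>1 X)" ?W ?W] that by (simp add: typing cellI)
  have R: "cval r' \<otimes> \<one> X \<in> Hom C X ?W"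
    using Hom_I[of "r' \<star> idc X" X ?W] by (simp add: typing)
  have "(\<Sum>x\<in>S. frob x \<cdot> adj C (frob x)) =
      (\<Sum>x\<in>S. (adj C (cval r') \<otimes> \<one> X) \<cdot> ((\<one> X \<otimes> (x \<cdot> adj C x)) \<cdot> (cval r' \<otimes> \<one> X)))"
    using SH by (simp add: frob_adj_frob)
  also have "\<dots> = (adj C (cval r') \<otimes> \<one> X) \<cdot> (\<Sum>x\<in>S. (\<one> X \<otimes> (x \<cdot> adj C x)) \<cdot> (cval r' \<otimes> \<one> X))"
    using SH w XX whisk_r' by (intro vcomp_sum_right[of X ?W X, symmetric]) (auto intro!: vcomp_closed[OF _ _ R w])
  also have "(\<Sum>x\<in>S. (\<one> X \<otimes> (x \<cdot> adj C x)) \<cdot> (cval r' \<otimes> \<one> X)) = (\<Sum>x\<in>S. \<one> X \<otimes> (x \<cdot> adj C x)) \<cdot> (cval r' \<otimes> \<one> X)"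
    using SH w XX R by (intro vcomp_sum_left[of X ?W ?W, symmetric]) auto
  also have "(\<Sum>x\<in>S. \<one> X \<otimes> (x \<cdot> adj C x)) = \<one> X \<otimes> P"
    unfolding P_def using SH XX
    by (intro hcomp_sum_right[of "X' \<otimes>\<^sub>1 X" "X' \<otimes>\<^sub>1 X" X X, symmetric]) (auto simp: typing id2_closed)
  finally have eq: "(\<Sum>x\<in>S. frob x \<cdot> adj C (frob x)) =
      (adj C (cval r') \<otimes> \<one> X) \<cdot> ((\<one> X \<otimes> P) \<cdot> (cval r' \<otimes> \<one> X))" .
  have p: "parallel C (\<I> M) (X \<otimes>\<^sub>1 X')"
    by simp
  have n1: "norm (adj C (cval r') \<otimes> \<one> X) \<le> norm (cval r')"
    using norm_whisker_right[of "X \<otimes>\<^sub>1 X'" "\<I> M" X "adj C (cval r')"] norm_adj[OF p] adj_closed[OF p] parallel_sym[OF p]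
    by (simp add: typing)
  have n2: "norm (cval r' \<otimes> \<one> X) \<le> norm (cval r')"
    using norm_whisker_right[of "\<I> M" "X \<otimes>\<^sub>1 X'" X "cval r'"] by (simp add: typing)
  have n3: "norm (\<one> X \<otimes> P) \<le> 1"
    using norm_whisker_left[of "X' \<otimes>\<^sub>1 X" "X' \<otimes>\<^sub>1 X" X P] P XX range_projection[OF S z]
    by (simp add: typing flip: P_def)
  have "norm ((\<one> X \<otimes> P) \<cdot> (cval r' \<otimes> \<one> X)) \<le> norm (\<one> X \<otimes> P) * norm (cval r' \<otimes> \<one> X)"
    using P w XX by (intro norm_vcomp[OF _ _ R]) auto
  also have "\<dots> \<le> 1 * norm (cval r')"
    using n2 n3 by (intro mult_mono) auto
  finally have "norm ((\<one> X \<otimes> P) \<cdot> (cval r' \<otimes> \<one> X)) \<le> norm (cval r')"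
    by simp
  moreover have "norm (\<Sum>x\<in>S. frob x \<cdot> adj C (frob x)) \<le>
      norm (adj C (cval r') \<otimes> \<one> X) * norm ((\<one> X \<otimes> P) \<cdot> (cval r' \<otimes> \<one> X))"
    unfolding eq using P w XX whisk_r'
    by (intro norm_vcomp[of X ?W X]) (auto intro!: vcomp_closed[OF _ _ R])
  ultimately show ?thesis
    using n1 by (smt (verit) mult_mono norm_ge_zero power2_eq_square)
qed

text \<open>The right-hand side is linear in \<open>a a^*\<close>, so that a sum over several
  \<open>a\<close> can be taken inside before norms are estimated.\<close>

lemma unfrob_sum_sq:
  assumes "a \<in> Hom C X X"
  shows "adj C (unfrob (adj C a)) \<cdot> unfrob (adj C a) = adj C (cval r) \<cdot> ((\<one> X' \<otimes> (a \<cdot> adj C a)) \<cdot> cval r)"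
proof -
  let ?a = "Cell X a X"
  have [simp]: "cell ?a"
    using assms by (auto intro!: cellI)
  have "st ((idc X' \<star> st ?a) \<bullet> r) \<bullet> ((idc X' \<star> st ?a) \<bullet> r) = st r \<bullet> (((idc X' \<star> ?a) \<bullet> (idc X' \<star> st ?a)) \<bullet> r)"
    by (simp add: st_vc st_hc st_idc st_st typing vc_assoc)
  also have "(idc X' \<star> ?a) \<bullet> (idc X' \<star> st ?a) = idc X' \<star> (?a \<bullet> st ?a)"
    by (simp add: hc_vc vc_id typing)
  finally show ?thesis
    by (auto simp: unfrob_def dest!: arg_cong[of _ _ cval])
qed

text \<open>The involution \<open>x = (1 \<otimes> a) r \<mapsto> (1 \<otimes> a\<^sup>*) r\<close> is bounded below and, by
  the previous lemma, Hilbert-Schmidt; this bounds the size of orthonormal families.\<close>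

lemma orthonormal_card_le:
  assumes S: "orthonormal z S" and z: "projection C (\<I> N) z" "z \<noteq> 0"
    and scalar: "\<And>a. a \<in> Hom C (\<I> N) (\<I> N) \<Longrightarrow> \<exists>k. z \<cdot> a \<cdot> z = k *\<^sub>C z"
  shows "card S \<le> (norm (cval r) * norm (cval r')) ^ 4"
proof -
  have SH: "\<And>x. x \<in> S \<Longrightarrow> x \<in> H" "\<And>x. x \<in> S \<Longrightarrow> x \<cdot> z = x" "finite S"
    and o: "\<And>x. x \<in> S \<Longrightarrow> adj C x \<cdot> x = z"
    using S by (auto simp: orthonormal_def)
  have IA: "\<I> N \<in> Arr C"
    by (simp add: typing)
  have zH: "z \<in> Hom C (\<I> N) (\<I> N)" "adj C z = z" "z \<cdot> z = z"
    using z by (auto simp: projection_def)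
  have nz: "norm z = 1"
    using projection_norm[OF IA z(1)] z(2) by blast
  define R where "R = norm (cval r) * norm (cval r')"
  have fH: "frob x \<in> Hom C X X" "adj C (frob x) \<in> Hom C X X" if "x \<in> S" for x
    using frob_closed[OF SH(1)[OF that]] adj_closed[of X X] by auto
  \<comment> \<open>The image of \<open>x\<close> under the involution, cut down by
    \<open>z\<close>; its square is \<open>c' x\<close> times \<open>z\<close>.\<close>
  define y where "y x = unfrob (adj C (frob x)) \<cdot> z" for x
  have yH: "y x \<in> H" if "x \<in> S" for x
    unfolding y_def using fH[OF that] zH by simp
  have "\<exists>c. z \<cdot> (adj C (unfrob (adj C (frob x))) \<cdot> unfrob (adj C (frob x))) \<cdot> z = c *\<^sub>C z" if "x \<in> S" for x
    using fH[OF that] by (intro scalar) simp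
  moreover have yy: "adj C (y x) \<cdot> y x = z \<cdot> (adj C (unfrob (adj C (frob x))) \<cdot> unfrob (adj C (frob x))) \<cdot> z"
    if "x \<in> S" for x
  proof -
    let ?u = "unfrob (adj C (frob x))"
    let ?U = "Cell (\<I> N) ?u (X' \<otimes>\<^sub>1 X)" and ?Z = "Cell (\<I> N) z (\<I> N)"
    have [simp]: "cell ?U" "cell ?Z"
      using fH[OF that] zH by (auto intro!: cellI)
    have "st (?U \<bullet> ?Z) \<bullet> (?U \<bullet> ?Z) = st ?Z \<bullet> (st ?U \<bullet> ?U) \<bullet> ?Z"
      by (simp add: st_vc typing vc_assoc)
    from arg_cong[OF this, of cval] show ?thesis
      using zH by (simp add: y_def)
  qed
  ultimately have "\<exists>c. adj C (y x) \<cdot> y x = c *\<^sub>C z" if "x \<in> S" for x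
    using that by simp
  then obtain c' where c': "\<And>x. x \<in> S \<Longrightarrow> adj C (y x) \<cdot> y x = c' x *\<^sub>C z"
    by metis
  have "\<exists>c\<ge>0. c' x = complex_of_real c" if "x \<in> S" for x
    using square_multiple_nonneg[OF IA _ yH[OF that] z c'[OF that]] by simp
  then obtain c where c: "\<And>x. x \<in> S \<Longrightarrow> c' x = complex_of_real (c x)" "\<And>x. x \<in> S \<Longrightarrow> 0 \<le> c x"
    by metis
  have cn: "c x = (norm (y x))\<^sup>2" if "x \<in> S" for x
    using C_star_identity[OF _ yH[OF that]] c'[OF that] c[OF that] nz by (simp add: norm_scaleC)
  \<comment> \<open>Boundedness from below: \<open>1 \<otimes> z\<close> is central and absorbed by
    \<open>frob x\<close>, so \<open>frob (y x)\<close> is the adjoint of \<open>frob x\<close>,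
    which is not small because \<open>x\<close> is a unit vector.\<close>
  have low: "1 \<le> R\<^sup>2 * c x" if x: "x \<in> S" for x
  proof -
    have I: "\<one> X \<otimes> z \<in> Hom C X X" "adj C (\<one> X \<otimes> z) = \<one> X \<otimes> z"
      using Hom_I[of "idc X \<star> Cell (\<I> N) z (\<I> N)" X X] zH adj_hcomp[of "\<I> N" "\<I> N" X X z "\<one> X"]
      by (simp_all add: typing cellI id2_closed adj_id2)
    have "frob (y x) = adj C (frob x) \<cdot> (\<one> X \<otimes> z)"
      unfolding y_def using fH[OF x] zH by (simp add: frob_mul_center frob_unfrob)
    also have "\<dots> = (\<one> X \<otimes> z) \<cdot> adj C (frob x)"
      using fH[OF x] zH by (intro center_commutes)
    also have "\<dots> = adj C (frob x \<cdot> (\<one> X \<otimes> z))"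
      using fH[OF x] I adj_vcomp[of X X X "\<one> X \<otimes> z" "frob x"] by simp
    also have "frob x \<cdot> (\<one> X \<otimes> z) = frob x"
      using frob_mul_center[OF SH(1)[OF x] zH(1)] SH(2)[OF x] by simp
    finally have "norm (frob x) = norm (frob (y x))"
      using norm_adj[of X X "frob x"] fH[OF x] by simp
    also have "\<dots> \<le> norm (cval r') * norm (y x)"
      by (rule norm_frob_le[OF yH[OF x]])
    finally have 1: "norm (frob x) \<le> norm (cval r') * norm (y x)" .
    have "(norm x)\<^sup>2 = 1"
      using C_star_identity[OF _ SH(1)[OF x]] o[OF x] nz by simp
    then have "norm x = 1"
      by (simp add: power2_eq_1_iff) (smt (verit) norm_ge_zero)
    then have "1 \<le> norm (frob x) * norm (cval r)"
      using norm_unfrob_le[OF fH(1)[OF x]] unfrob_frob[OF SH(1)[OF x]] by simp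
    also have "\<dots> \<le> norm (cval r') * norm (y x) * norm (cval r)"
      using 1 by (intro mult_right_mono) auto
    finally have "1 \<le> R * norm (y x)"
      by (simp add: R_def mult_ac)
    then have "1\<^sup>2 \<le> (R * norm (y x))\<^sup>2"
      by (intro power_mono) auto
    then show ?thesis
      using cn[OF x] by (simp add: power_mult_distrib)
  qed
  \<comment> \<open>The Hilbert-Schmidt bound: the squares of the \<open>frob x\<close> are summed
    first, where \<open>frob_square_sum_le\<close> applies, and compressing by \<open>z\<close> does
    not increase the norm.\<close>
  have sumc: "(\<Sum>x\<in>S. c x) \<le> R\<^sup>2"
  proof -
    let ?a = "\<Sum>x\<in>S. frob x \<cdot> adj C (frob x)"
    have aH: "frob x \<cdot> adj C (frob x) \<in> Hom C X X" if "x \<in> S" for x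
      using fH[OF that] by (auto intro: vcomp_closed[of X X X])
    have AH: "?a \<in> Hom C X X"
      using aH by (intro Hom_sum) auto
    have XX: "X' \<otimes>\<^sub>1 X \<in> Arr C"
      by (simp add: typing)
    have in1: "(\<one> X' \<otimes> a) \<cdot> cval r \<in> H" if "a \<in> Hom C X X" for a
      using unfrob_closed[OF that] by (simp add: unfrob_def)
    have w: "(\<Sum>x\<in>S. (\<one> X' \<otimes> (frob x \<cdot> adj C (frob x))) \<cdot> cval r) = (\<one> X' \<otimes> ?a) \<cdot> cval r"
      using aH whisk_a XX vcomp_sum_left[of "\<I> N" "X' \<otimes>\<^sub>1 X" "X' \<otimes>\<^sub>1 X" "cval r" S "\<lambda>x. \<one> X' \<otimes> (frob x \<cdot> adj C (frob x))"]
        hcomp_sum_right[of X X X' X' "\<one> X'" S "\<lambda>x. frob x \<cdot> adj C (frob x)"] by (simp add: id2_closed)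
    have uu: "adj C (unfrob (adj C (frob x))) \<cdot> unfrob (adj C (frob x)) =
        adj C (cval r) \<cdot> ((\<one> X' \<otimes> (frob x \<cdot> adj C (frob x))) \<cdot> cval r)" if "x \<in> S" for x
      by (rule unfrob_sum_sq[OF fH(1)[OF that]])
    have "(\<Sum>x\<in>S. adj C (unfrob (adj C (frob x))) \<cdot> unfrob (adj C (frob x))) =
        adj C (cval r) \<cdot> (\<Sum>x\<in>S. (\<one> X' \<otimes> (frob x \<cdot> adj C (frob x))) \<cdot> cval r)"
      using uu aH in1 vcomp_sum_right[of "\<I> N" "X' \<otimes>\<^sub>1 X" "\<I> N" "adj C (cval r)" S "\<lambda>x. (\<one> X' \<otimes> (frob x \<cdot> adj C (frob x))) \<cdot> cval r"]
      by simp
    then have U: "(\<Sum>x\<in>S. adj C (unfrob (adj C (frob x))) \<cdot> unfrob (adj C (frob x))) =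
        adj C (cval r) \<cdot> ((\<one> X' \<otimes> ?a) \<cdot> cval r)" (is "?U = _")
      unfolding w .
    have uIH: "adj C (unfrob (adj C (frob x))) \<cdot> unfrob (adj C (frob x)) \<in> Hom C (\<I> N) (\<I> N)" if "x \<in> S" for x
      using fH[OF that] by simp
    have UH: "?U \<in> Hom C (\<I> N) (\<I> N)"
      using uIH by (intro Hom_sum) auto
    have "norm ?U \<le> norm (adj C (cval r)) * norm ((\<one> X' \<otimes> ?a) \<cdot> cval r)"
      unfolding U using in1[OF AH] by (intro norm_vcomp[of "\<I> N" "X' \<otimes>\<^sub>1 X" "\<I> N"]) auto
    also have "\<dots> \<le> norm (cval r) * (norm ?a * norm (cval r))"
      using norm_adj[of "\<I> N" "X' \<otimes>\<^sub>1 X" "cval r"] norm_unfrob_le[OF AH]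
      by (simp add: unfrob_def mult_left_mono)
    also have "\<dots> \<le> norm (cval r) * ((norm (cval r'))\<^sup>2 * norm (cval r))"
      by (intro mult_left_mono mult_right_mono frob_square_sum_le[OF S z(1)]) auto
    finally have nU: "norm ?U \<le> R\<^sup>2"
      by (simp add: R_def power2_eq_square mult_ac)
    have "(\<Sum>x\<in>S. c' x *\<^sub>C z) = (\<Sum>x\<in>S. z \<cdot> (adj C (unfrob (adj C (frob x))) \<cdot> unfrob (adj C (frob x))) \<cdot> z)"
      using c' yy by simp
    also have "\<dots> = (\<Sum>x\<in>S. z \<cdot> (adj C (unfrob (adj C (frob x))) \<cdot> unfrob (adj C (frob x)))) \<cdot> z"
      using uIH zH by (intro vcomp_sum_left[of "\<I> N" "\<I> N" "\<I> N", symmetric]) (auto intro: vcomp_closed[of "\<I> N" "\<I> N" "\<I> N"])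
    also have "(\<Sum>x\<in>S. z \<cdot> (adj C (unfrob (adj C (frob x))) \<cdot> unfrob (adj C (frob x)))) = z \<cdot> ?U"
      using uIH zH by (intro vcomp_sum_right[of "\<I> N" "\<I> N" "\<I> N", symmetric]) auto
    finally have zUz: "(\<Sum>x\<in>S. c' x *\<^sub>C z) = z \<cdot> ?U \<cdot> z" .
    have zU: "z \<cdot> ?U \<in> Hom C (\<I> N) (\<I> N)"
      using zH UH by (auto intro: vcomp_closed[of "\<I> N" "\<I> N" "\<I> N"])
    have "norm (z \<cdot> ?U \<cdot> z) \<le> norm (z \<cdot> ?U) * norm z"
      using zU zH by (intro norm_vcomp[of "\<I> N" "\<I> N" "\<I> N"]) auto
    also have "\<dots> \<le> norm ?U"
      using norm_vcomp[of "\<I> N" "\<I> N" "\<I> N" ?U z] UH zH nz by simp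
    finally have "norm (\<Sum>x\<in>S. c' x *\<^sub>C z) \<le> R\<^sup>2"
      unfolding zUz using nU by simp
    moreover have "(\<Sum>x\<in>S. c' x *\<^sub>C z) = complex_of_real (\<Sum>x\<in>S. c x) *\<^sub>C z"
      using c by (simp add: complex_vs.scale_sum_left)
    ultimately have "\<bar>\<Sum>x\<in>S. c x\<bar> \<le> R\<^sup>2"
      using nz by (simp add: norm_scaleC del: of_real_sum)
    then show ?thesis
      by simp
  qed
  \<comment> \<open>Each vector contributes at least \<open>1 / R^2\<close> to a sum that is at most
    \<open>R^2\<close>.\<close>
  have "real (card S) = (\<Sum>x\<in>S. 1)"
    by simp
  also have "\<dots> \<le> (\<Sum>x\<in>S. R\<^sup>2 * c x)"
    using low by (intro sum_mono)
  also have "\<dots> = R\<^sup>2 * (\<Sum>x\<in>S. c x)"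
    by (simp add: sum_distrib_left)
  also have "\<dots> \<le> R\<^sup>2 * R\<^sup>2"
    using sumc by (intro mult_left_mono) auto
  also have "\<dots> = R ^ 4"
    by (simp add: power_numeral_reduce)
  finally show ?thesis
    unfolding R_def .
qed

text \<open>For each minimal projection \<open>z\<close> of the center, the bound gives an
  orthonormal set of largest size. It spans the vectors fixed by \<open>z\<close>, since a vector
  outside its span would leave an orthogonal residue that could be normalized and added. Summing
  over \<open>z\<close> spans \<open>H\<close>, and \<open>frob\<close> carries the spanning set to
  \<open>Hom X X\<close>.\<close>

lemma Hom_finite_dim:
  assumes fin: "finite_dimensional_centers C"
  shows "\<exists>B. finite B \<and> Hom C X X \<subseteq> complex_vs.span B"
proof -
  interpret Z: commutative_star_algebra "object_center C N" "vcomp C" "adj C" "\<one> (\<I> N)"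
    using fin by (intro center_star_algebra) simp_all
  have IA: "\<I> N \<in> Arr C"
    by (simp add: typing)
  have Z: "object_center C N = Hom C (\<I> N) (\<I> N)"
    by (simp add: object_center_def)
  have "\<exists>S. finite S \<and> S \<subseteq> H \<and> (\<forall>y\<in>H. y \<cdot> z = y \<longrightarrow> y \<in> complex_vs.span S)" if zm: "z \<in> Z.minproj" for z
  proof -
    have zp: "projection C (\<I> N) z" "z \<noteq> 0"
      using zm unfolding Z.minproj_def Z.proj_def projection_def by (auto simp: Z)
    have zH: "z \<in> Hom C (\<I> N) (\<I> N)" "adj C z = z" "z \<cdot> z = z"
      using zp by (auto simp: projection_def)
    have sc: "\<exists>k. z \<cdot> a \<cdot> z = k *\<^sub>C z" if "a \<in> Hom C (\<I> N) (\<I> N)" for a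
      using Z.minproj_scalar[OF zm] that by (simp add: Z)
    have sc': "\<exists>k. adj C x \<cdot> y = k *\<^sub>C z" if "x \<in> H" "x \<cdot> z = x" "y \<in> H" "y \<cdot> z = y" for x y
    proof -
      have "adj C x = z \<cdot> adj C x"
        using adj_vcomp[of "\<I> N" "\<I> N" "X' \<otimes>\<^sub>1 X" z x] that zH by simp
      then have "adj C x \<cdot> y = (z \<cdot> adj C x) \<cdot> (y \<cdot> z)"
        using that by simp
      also have "\<dots> = (z \<cdot> adj C x) \<cdot> y \<cdot> z"
        using that zH by (intro vcomp_assoc[of "\<I> N" "\<I> N" "X' \<otimes>\<^sub>1 X" "\<I> N", symmetric])
          (auto intro: vcomp_closed[of "X' \<otimes>\<^sub>1 X" "\<I> N" "\<I> N"])
      also have "(z \<cdot> adj C x) \<cdot> y = z \<cdot> (adj C x \<cdot> y)"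
        using that zH by (intro vcomp_assoc[of "\<I> N" "X' \<otimes>\<^sub>1 X" "\<I> N" "\<I> N"]) auto
      finally show ?thesis
        using sc[of "adj C x \<cdot> y"] that by simp
    qed
    obtain n :: nat where n: "(norm (cval r) * norm (cval r')) ^ 4 < real n"
      using reals_Archimedean2 by blast
    have bound: "card S < n" if "orthonormal z S" for S
      using orthonormal_card_le[OF that zp sc] n by simp
    have "orthonormal z {}"
      by (simp add: orthonormal_def)
    then obtain S where S: "orthonormal z S" and max: "\<And>S'. orthonormal z S' \<Longrightarrow> card S' \<le> card S"
      using ex_has_greatest_nat[of "orthonormal z" "{}" card n] bound by blast
    have SH: "\<And>x. x \<in> S \<Longrightarrow> x \<in> H" "\<And>x. x \<in> S \<Longrightarrow> x \<cdot> z = x" "finite S"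
      and o: "\<And>x y. x \<in> S \<Longrightarrow> y \<in> S \<Longrightarrow> adj C x \<cdot> y = (if x = y then z else 0)"
      using S by (auto simp: orthonormal_def)
    have "y \<in> complex_vs.span S" if y: "y \<in> H" "y \<cdot> z = y" for y
    proof -
      have "\<exists>k. adj C x \<cdot> y = k *\<^sub>C z" if "x \<in> S" for x
        using sc' SH(1,2)[OF that] y by blast
      then obtain k where k: "\<And>x. x \<in> S \<Longrightarrow> adj C x \<cdot> y = k x *\<^sub>C z"
        by metis
      define p where "p = (\<Sum>x\<in>S. k x *\<^sub>C x)"
      have pH: "p \<in> H"
        unfolding p_def using SH by (auto intro!: Hom_sum Hom_scale)
      have pz: "p \<cdot> z = p"
        unfolding p_def using SH zH
        by (subst vcomp_sum_left[of "\<I> N" "\<I> N" "X' \<otimes>\<^sub>1 X"])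
          (auto intro!: Hom_scale sum.cong simp: vcomp_scaleC_left[of "\<I> N" "\<I> N" "X' \<otimes>\<^sub>1 X"])
      define w where "w = y - p"
      have wH: "w \<in> H"
        unfolding w_def using y pH by (simp add: Hom_diff)
      have wz: "w \<cdot> z = w"
        unfolding w_def using y pH pz zH by (simp add: vcomp_diff_left[of "\<I> N" "\<I> N" "X' \<otimes>\<^sub>1 X"])
      have xw: "adj C x \<cdot> w = 0" if x: "x \<in> S" for x
      proof -
        have "adj C x \<cdot> p = (\<Sum>v\<in>S. adj C x \<cdot> (k v *\<^sub>C v))"
          unfolding p_def using SH x by (intro vcomp_sum_right[of "\<I> N" "X' \<otimes>\<^sub>1 X" "\<I> N"]) (auto intro!: Hom_scale)
        also have "\<dots> = (\<Sum>v\<in>S. if v = x then k x *\<^sub>C z else 0)"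
          using SH x o by (intro sum.cong) (auto simp: vcomp_scaleC_right[of "\<I> N" "X' \<otimes>\<^sub>1 X" "\<I> N"])
        also have "\<dots> = k x *\<^sub>C z"
          using x SH by simp
        finally show ?thesis
          unfolding w_def using y pH SH x k by (simp add: vcomp_diff_right[of "\<I> N" "X' \<otimes>\<^sub>1 X" "\<I> N"])
      qed
      have "w = 0"
      proof (rule ccontr)
        assume w0: "w \<noteq> 0"
        obtain l' where l': "adj C w \<cdot> w = l' *\<^sub>C z"
          using sc'[OF wH wz wH wz] by blast
        obtain l where l: "l' = complex_of_real l" "0 \<le> l"
          using square_multiple_nonneg[OF IA _ wH zp l'] by auto
        have "l \<noteq> 0"
          using star_proper[OF _ wH] w0 l' l by auto
        define m where "m = 1 / sqrt l"
        have m: "m * m * l = 1" "m \<noteq> 0"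
          using l \<open>l \<noteq> 0\<close> by (simp_all add: m_def field_simps)
        define u where "u = complex_of_real m *\<^sub>C w"
        have uH: "u \<in> H" "u \<cdot> z = u" "u \<noteq> 0"
          unfolding u_def using wH wz w0 zH m
          by (auto simp: Hom_scale vcomp_scaleC_left[of "\<I> N" "\<I> N" "X' \<otimes>\<^sub>1 X"])
        have xu: "adj C x \<cdot> u = 0" "adj C u \<cdot> x = 0" if x: "x \<in> S" for x
        proof -
          show 0: "adj C x \<cdot> u = 0"
            unfolding u_def using xw[OF x] SH x wH by (simp add: vcomp_scaleC_right[of "\<I> N" "X' \<otimes>\<^sub>1 X" "\<I> N"])
          show "adj C u \<cdot> x = 0"
            using arg_cong[OF 0, of "adj C"] adj_vcomp[of "\<I> N" "X' \<otimes>\<^sub>1 X" "\<I> N" u "adj C x"] SH(1)[OF x] uH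
            by (simp add: adj_adj[of "\<I> N" "X' \<otimes>\<^sub>1 X"] adj_zero[of "\<I> N" "\<I> N"])
        qed
        have uu: "adj C u \<cdot> u = z"
        proof -
          have "adj C u \<cdot> u = complex_of_real (m * m) *\<^sub>C (adj C w \<cdot> w)"
            unfolding u_def using wH
            by (simp add: adj_scaleC[of "\<I> N" "X' \<otimes>\<^sub>1 X"] vcomp_scaleC_left[of "\<I> N" "X' \<otimes>\<^sub>1 X" "\<I> N"]
                vcomp_scaleC_right[of "\<I> N" "X' \<otimes>\<^sub>1 X" "\<I> N"] Hom_scale scaleC_scaleC)
          also have "\<dots> = complex_of_real (m * m * l) *\<^sub>C z"
            unfolding l' l by (simp add: scaleC_scaleC)
          finally show ?thesis
            by (simp only: m of_real_1 scaleC_one)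
        qed
        have "u \<notin> S"
          using xu(1)[of u] uu zp by auto
        moreover have "orthonormal z (insert u S)"
          unfolding orthonormal_def using SH o uH xu uu \<open>u \<notin> S\<close> by auto
        ultimately show False
          using max[of "insert u S"] SH by simp
      qed
      then have "y = p"
        by (simp add: w_def)
      moreover have "p \<in> complex_vs.span S"
        unfolding p_def by (intro complex_vs.span_sum complex_vs.span_scale complex_vs.span_base)
      ultimately show ?thesis
        by simp
    qed
    then show ?thesis
      using SH by blast
  qed
  then obtain S where S: "\<And>z. z \<in> Z.minproj \<Longrightarrow> finite (S z) \<and> S z \<subseteq> H \<and> (\<forall>y\<in>H. y \<cdot> z = y \<longrightarrow> y \<in> complex_vs.span (S z))"
    by metis
  define T where "T = (\<Union>z\<in>Z.minproj. S z)"
  have zZ: "z \<in> Hom C (\<I> N) (\<I> N)" if "z \<in> Z.minproj" for z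
    using Z.minproj_closed[OF that] by (simp add: Z)
  have T: "finite T" "T \<subseteq> H"
    unfolding T_def using S Z.finite_minproj by auto
  have span: "y \<in> complex_vs.span T" if y: "y \<in> H" for y
  proof -
    have "y = y \<cdot> (\<Sum>z\<in>Z.minproj. z)"
      using y Z.sum_minproj vcomp_id_right[of "\<I> N" "X' \<otimes>\<^sub>1 X" y] by simp
    also have "\<dots> = (\<Sum>z\<in>Z.minproj. y \<cdot> z)"
      using y zZ by (intro vcomp_sum_right[of "\<I> N" "\<I> N" "X' \<otimes>\<^sub>1 X"]) auto
    finally have eq: "y = (\<Sum>z\<in>Z.minproj. y \<cdot> z)" .
    have "y \<cdot> z \<in> complex_vs.span T" if z: "z \<in> Z.minproj" for z
    proof -
      have "y \<cdot> z \<cdot> z = y \<cdot> z"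
        using y z zZ Z.minproj_idem[OF z] vcomp_assoc[of "\<I> N" "\<I> N" "\<I> N" "X' \<otimes>\<^sub>1 X" z z y] by simp
      then have "y \<cdot> z \<in> complex_vs.span (S z)"
        using S[OF z] y zZ[OF z] by simp
      then show ?thesis
        using complex_vs.span_mono[of "S z" T] z by (auto simp: T_def)
    qed
    then show ?thesis
      by (subst eq) (intro complex_vs.span_sum)
  qed
  have "Hom C X X \<subseteq> complex_vs.span (frob ` T)"
  proof
    fix a assume a: "a \<in> Hom C X X"
    have "unfrob a \<in> complex_vs.span T"
      using span a by simp
    then obtain u where u: "unfrob a = (\<Sum>x\<in>T. u x *\<^sub>C x)"
      using complex_vs.span_finite[OF T(1)] by auto
    have "a = frob (\<Sum>x\<in>T. u x *\<^sub>C x)"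
      using frob_unfrob[OF a] u by simp
    also have "\<dots> = (\<Sum>x\<in>T. u x *\<^sub>C frob x)"
      using T by (subst frob_sum) (auto intro!: sum.cong simp: frob_scale Hom_scale subset_iff)
    also have "\<dots> \<in> complex_vs.span (frob ` T)"
      by (intro complex_vs.span_sum complex_vs.span_scale complex_vs.span_base imageI)
    finally show "a \<in> complex_vs.span (frob ` T)" .
  qed
  then show ?thesis
    using T by blast
qed

end

section \<open>Horizontal reversal and conjugation of endomorphisms\<close>

text \<open>Reversing 1-arrows exchanges left and right in all statements below.\<close>

definition hop :: "('o, 'a, 't) two_category \<Rightarrow> ('o, 'a, 't) two_category" where
  "hop C = C\<lparr>src := tgt C, tgt := src C, comp1 := \<lambda>X Y. comp1 C Y X, hcomp := \<lambda>t s. hcomp C s t\<rparr>"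

lemma hop_simps [simp]:
  "Ob (hop C) = Ob C" "Arr (hop C) = Arr C" "src (hop C) = tgt C" "tgt (hop C) = src C"
  "id1 (hop C) = id1 C" "comp1 (hop C) X Y = comp1 C Y X" "Hom (hop C) = Hom C" "id2 (hop C) = id2 C"
  "vcomp (hop C) = vcomp C" "hcomp (hop C) t s = hcomp C s t" "adj (hop C) = adj C"
  by (simp_all add: hop_def)

lemma hop_defs [simp]:
  "parallel (hop C) X Y = parallel C X Y"
  "isometry (hop C) = isometry C"
  "isometry_onto (hop C) = isometry_onto C"
  "projection (hop C) = projection C"
  "object_center (hop C) = object_center C"
  by (auto simp: fun_eq_iff parallel_def isometry_def isometry_onto_def projection_def object_center_def)

lemma hop_minimal_projections [simp]: "minimal_projections (hop C) = minimal_projections C"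
  by (auto simp: fun_eq_iff minimal_projections_def)

lemma hop_scalars [simp]: "scalars (hop C) = scalars C"
  by (auto simp: fun_eq_iff scalars_def)

lemma hop_simple [simp]: "simple_arrow (hop C) = simple_arrow C"
  by (auto simp: fun_eq_iff simple_arrow_def)

lemma hop_centers [simp]:
  "left_center (hop C) = right_center C" "right_center (hop C) = left_center C"
  by (auto simp: fun_eq_iff left_center_def right_center_def)

lemma (in two_C_star_category) hop_category: "two_C_star_category (hop C)"
proof -
  have par: "parallel C X Y \<Longrightarrow> src C Y = src C X \<and> tgt C Y = tgt C X" for X Y
    by (simp add: parallel_def)
  show ?thesis
  proof (unfold_locales, unfold hop_simps hop_defs, goal_cases)
    \<comment> \<open>The two associativity laws are read backwards, and in the norm bound the
      factors are exchanged; the remaining axioms are self-dual or exchanged in pairs.\<close>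
    case (5 X Y Z)
    then show ?case
      by (auto simp: comp1_assoc[symmetric])
  next
    case (14 X X' Y Y' Z Z' r s t)
    then show ?case
      using hcomp_assoc[of Z Z' Y Y' X X' t s r] by auto
  next
    case (38 X X' Y Y' s t)
    then show ?case
      using norm_hcomp[of Y Y' X X' t s] by (auto simp: mult.commute)
  qed (fact src_closed tgt_closed vcomp_closed vcomp_assoc vcomp_id_right vcomp_id_left id2_closed
      Hom_subspace Hom_complete vcomp_add_left vcomp_add_right vcomp_scaleC_left vcomp_scaleC_right
      adj_closed adj_adj adj_add adj_scaleC adj_vcomp adj_id2 adj_vcomp_positive norm_vcomp C_star_identity
      direct_sums sub_1_arrows |
      (auto simp: src_closed tgt_closed id1_closed comp1_closed comp1_id_left comp1_id_right hcomp_id2 par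
        hcomp_id_left hcomp_id_right
        intro: hcomp_closed interchange hcomp_add_left hcomp_add_right hcomp_scaleC_left hcomp_scaleC_right
          adj_hcomp)[1])+
qed

locale rigid_category = two_C_star_category C
  for C :: "('o, 'a, 't :: complex_normed_space) two_category" (structure) +
  assumes rigid: "rigid C" and fin: "finite_dimensional_centers C"



lemma conjugate_solution_pair:
  assumes "two_C_star_category C" "conjugate_solution C X X' r r'" and N: "N = src C X" and M: "M = tgt C X"
  shows "conjugate_pair C N M X X' (Cell (id1 C N) r (comp1 C X' X)) (Cell (id1 C M) r' (comp1 C X X'))"
proof -
  interpret two_C_star_category C
    by fact
  have X: "X \<in> Arr C" "X' \<in> Arr C" "src C X' = tgt C X" "tgt C X' = src C X"
    and r: "r \<in> Hom C (id1 C (src C X)) (comp1 C X' X)" "r' \<in> Hom C (id1 C (tgt C X)) (comp1 C X X')"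
    and eqs: "vcomp C (hcomp C (adj C r') (id2 C X)) (hcomp C (id2 C X) r) = id2 C X"
      "vcomp C (hcomp C (adj C r) (id2 C X')) (hcomp C (id2 C X') r') = id2 C X'"
    using assms(2) by (auto simp: conjugate_solution_def)
  show ?thesis
  proof unfold_locales
    show "cell (Cell (id1 C N) r (comp1 C X' X))" "cell (Cell (id1 C M) r' (comp1 C X X'))"
      using X r unfolding N M by (auto intro!: cellI simp: parallel_def typing)
  qed (use X eqs in \<open>auto intro!: cell_eqI simp: typing N M\<close>)
qed

lemma (in conjugate_pair) solution: "conjugate_solution C X X' (cval r) (cval r')"
  using arg_cong[OF conj1, of cval] arg_cong[OF conj2, of cval] by (simp add: conjugate_solution_def)

text \<open>Reversal exchanges \<open>X' \<otimes> X\<close> with \<open>X \<otimes> X'\<close>, so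
  \<open>r\<close> and \<open>r'\<close> trade places while \<open>X'\<close> remains the conjugate
  of \<open>X\<close>.\<close>

lemma (in conjugate_pair) hop_pair: "conjugate_pair (hop C) M N X X' r' r"
proof -
  interpret h: two_C_star_category "hop C"
    by (rule hop_category)
  have [simp]: "h.cell c = cell c" "h.st c = st c" "h.hc c d = d \<star> c" "h.vc c d = c \<bullet> d" "h.idc Y = idc Y" for c d Y
    by (simp_all add: h.cell_def cell_def h.st_def st_def h.hc_def hc_def h.vc_def vc_def h.idc_def idc_def)
  show ?thesis
    by unfold_locales (simp_all add: conj1_st conj2_st)
qed

lemma hop_conjugate_solution:
  assumes "two_C_star_category C" "conjugate_solution C X X' r r'"
  shows "conjugate_solution (hop C) X X' r' r"
proof -
  define N M where NM: "N = src C X" "M = tgt C X"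
  interpret conjugate_pair C N M X X' "Cell (id1 C N) r (comp1 C X' X)" "Cell (id1 C M) r' (comp1 C X X')"
    by (rule conjugate_solution_pair) (use assms NM in auto)
  interpret h: conjugate_pair "hop C" M N X X' "Cell (id1 C M) r' (comp1 C X X')" "Cell (id1 C N) r (comp1 C X' X)"
    by (rule hop_pair)
  show ?thesis
    using h.solution by simp
qed

lemma (in rigid_category) hop_rigid: "rigid_category (hop C)"
proof -
  have "\<exists>X'. conjugate_arrows (hop C) X X'" if X: "X \<in> Arr C" for X
  proof -
    obtain X' r r' where "conjugate_solution C X X' r r'"
      using rigid X by (auto simp: rigid_def conjugate_arrows_def)
    from hop_conjugate_solution[OF two_C_star_category_axioms this] show ?thesis
      unfolding conjugate_arrows_def by blast
  qed
  then have "rigid (hop C)"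
    by (simp add: rigid_def)
  moreover have "finite_dimensional_centers (hop C)"
    using fin by (simp add: finite_dimensional_centers_def)
  ultimately show ?thesis
    by (intro rigid_category.intro hop_category rigid_category_axioms.intro)
qed

context conjugate_pair
begin

sublocale self: conjugate_pairs C N M X X' X X' r r' r r' ..

text \<open>\<open>bullet a\<close> is the endomorphism \<open>b\<close> of \<open>X'\<close> with \<open>(1 \<otimes> a) r = (b \<otimes> 1) r\<close>.\<close>

definition bullet :: "'t \<Rightarrow> 't" where
  "bullet a = cval (THE b. self.mates (Cell X a X) b)"

lemma bullet_mates:
  assumes "a \<in> Hom C X X"
  shows "self.mates (Cell X a X) (Cell X' (bullet a) X')"
proof -
  have "\<exists>b. self.mates (Cell X a X) b"
    using assms by (intro self.mate_exists) (auto intro: cellI)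
  then have m: "self.mates (Cell X a X) (THE b. self.mates (Cell X a X) b)"
    using self.mates_unique by (rule theI'[OF ex_ex1I])
  define B where "B = (THE b. self.mates (Cell X a X) b)"
  have "bullet a = cval B"
    by (simp add: bullet_def B_def)
  moreover have "cdom B = X'" "ccod B = X'"
    using m unfolding B_def[symmetric] by (simp_all add: self.mates_def)
  ultimately have "B = Cell X' (bullet a) X'"
    by (intro cell_eqI) simp_all
  then show ?thesis
    using m by (simp flip: B_def)
qed

lemma bullet_closed [simp]: "a \<in> Hom C X X \<Longrightarrow> bullet a \<in> Hom C X' X'"
  using bullet_mates[of a] by (auto simp: self.mates_def cell_def)

lemma bullet_eq: "a \<in> Hom C X X \<Longrightarrow> (\<one> X' \<otimes> a) \<cdot> cval r = (bullet a \<otimes> \<one> X) \<cdot> cval r"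
  using bullet_mates[of a] by (auto simp: self.mates_def dest!: arg_cong[of _ _ cval])

lemma bullet_unique:
  assumes "a \<in> Hom C X X" "b \<in> Hom C X' X'" "(\<one> X' \<otimes> a) \<cdot> cval r = (b \<otimes> \<one> X) \<cdot> cval r"
  shows "bullet a = b"
proof -
  have "self.mates (Cell X a X) (Cell X' b X')"
    using assms unfolding self.mates_def by (auto intro: cellI cell_eqI)
  from self.mates_unique[OF bullet_mates[OF assms(1)] this] show ?thesis
    by simp
qed

lemma bullet_surj:
  assumes "b \<in> Hom C X' X'"
  shows "\<exists>a\<in>Hom C X X. bullet a = b"
proof -
  obtain a where a: "self.mates a (Cell X' b X')"
    using self.mate_exists'[of "Cell X' b X'"] assms cellI[of X' X' b] by auto
  then have aa: "a = Cell X (cval a) X" "cval a \<in> Hom C X X"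
    by (cases a; auto simp: self.mates_def cell_def)+
  then have "Cell X' (bullet (cval a)) X' = Cell X' b X'"
    using self.mates_unique[OF bullet_mates[OF aa(2)], of "Cell X' b X'"] a by simp
  then show ?thesis
    using aa by auto
qed

text \<open>Along \<open>r'\<close> it is the adjoint of \<open>a\<close> that passes to the adjoint
  of \<open>bullet a\<close>. Thus \<open>r\<close> and \<open>r'\<close> define the same
  anti-isomorphism exactly when \<open>bullet\<close> commutes with adjoints.\<close>

lemma bullet_right:
  assumes "a \<in> Hom C X X"
  shows "(adj C a \<otimes> \<one> X') \<cdot> cval r' = (\<one> X \<otimes> adj C (bullet a)) \<cdot> cval r'"
  using arg_cong[OF self.mates_right[OF bullet_mates[OF assms]], of cval] by simp

lemma whisk_b: "b \<in> Hom C X' X' \<Longrightarrow> b \<otimes> \<one> X \<in> Hom C (X' \<otimes>\<^sub>1 X) (X' \<otimes>\<^sub>1 X)"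
  using Hom_I[of "Cell X' b X' \<star> idc X" "X' \<otimes>\<^sub>1 X" "X' \<otimes>\<^sub>1 X"] by (simp add: typing cellI)

lemma bullet_scale:
  assumes "a \<in> Hom C X X"
  shows "bullet (k *\<^sub>C a) = k *\<^sub>C bullet a"
proof (rule bullet_unique)
  have "(\<one> X' \<otimes> (k *\<^sub>C a)) \<cdot> cval r = k *\<^sub>C ((\<one> X' \<otimes> a) \<cdot> cval r)"
    using assms whisk_a[OF assms] by (simp add: hcomp_scaleC_right[of X X X' X'] id2_closed
        vcomp_scaleC_left[of "\<I> N" "X' \<otimes>\<^sub>1 X" "X' \<otimes>\<^sub>1 X"])
  also have "\<dots> = (k *\<^sub>C bullet a \<otimes> \<one> X) \<cdot> cval r"
    using assms whisk_b[of "bullet a"] by (simp add: bullet_eq hcomp_scaleC_left[of X X X' X'] id2_closed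
        vcomp_scaleC_left[of "\<I> N" "X' \<otimes>\<^sub>1 X" "X' \<otimes>\<^sub>1 X"])
  finally show "(\<one> X' \<otimes> (k *\<^sub>C a)) \<cdot> cval r = (k *\<^sub>C bullet a \<otimes> \<one> X) \<cdot> cval r" .
qed (use assms in \<open>auto intro: Hom_scale\<close>)

lemma bullet_add:
  assumes "a \<in> Hom C X X" "b \<in> Hom C X X"
  shows "bullet (a + b) = bullet a + bullet b"
proof (rule bullet_unique)
  have "(\<one> X' \<otimes> (a + b)) \<cdot> cval r = (\<one> X' \<otimes> a) \<cdot> cval r + (\<one> X' \<otimes> b) \<cdot> cval r"
    using assms whisk_a[OF assms(1)] whisk_a[OF assms(2)]
    by (simp add: hcomp_add_right[of X X X' X'] id2_closed
        vcomp_add_left[of "\<I> N" "X' \<otimes>\<^sub>1 X" "X' \<otimes>\<^sub>1 X"])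
  also have "\<dots> = ((bullet a + bullet b) \<otimes> \<one> X) \<cdot> cval r"
    using assms whisk_b[of "bullet a"] whisk_b[of "bullet b"] by (simp add: bullet_eq hcomp_add_left[of X X X' X'] id2_closed
        vcomp_add_left[of "\<I> N" "X' \<otimes>\<^sub>1 X" "X' \<otimes>\<^sub>1 X"])
  finally show "(\<one> X' \<otimes> (a + b)) \<cdot> cval r = ((bullet a + bullet b) \<otimes> \<one> X) \<cdot> cval r" .
qed (use assms in \<open>auto intro: Hom_add\<close>)

lemma bullet_zero: "bullet 0 = 0"
  using bullet_scale[of 0 0] by (simp add: Hom_zero)

lemma bullet_sum: "(\<And>i. i \<in> I \<Longrightarrow> f i \<in> Hom C X X) \<Longrightarrow> bullet (sum f I) = (\<Sum>i\<in>I. bullet (f i))"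
  by (induction I rule: infinite_finite_induct) (auto simp: bullet_zero bullet_add Hom_sum)

lemma bullet_diff: "a \<in> Hom C X X \<Longrightarrow> b \<in> Hom C X X \<Longrightarrow> bullet (a - b) = bullet a - bullet b"
  using bullet_add[of "a - b" b] by (simp add: Hom_diff algebra_simps)

lemma bullet_one: "bullet (\<one> X) = \<one> X'"
  by (rule bullet_unique) (simp_all add: id2_closed)

text \<open>\<open>1 \<otimes> a\<close> and \<open>bullet b \<otimes> 1\<close> act on different
  legs of \<open>r\<close> and commute, so the factor that is moved across first ends up on the
  left.\<close>

lemma bullet_mult:
  assumes "a \<in> Hom C X X" "b \<in> Hom C X X"
  shows "bullet (a \<cdot> b) = bullet b \<cdot> bullet a"
proof (rule bullet_unique)
  let ?a = "Cell X a X" and ?b = "Cell X b X" and ?ba = "Cell X' (bullet a) X'" and ?bb = "Cell X' (bullet b) X'"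
  have [simp]: "cell ?a" "cell ?b" "cell ?ba" "cell ?bb"
    using assms by (auto intro!: cellI)
  have ea: "(idc X' \<star> ?a) \<bullet> r = (?ba \<star> idc X) \<bullet> r" and eb: "(idc X' \<star> ?b) \<bullet> r = (?bb \<star> idc X) \<bullet> r"
    using bullet_mates[OF assms(1)] bullet_mates[OF assms(2)] by (auto simp: self.mates_def)
  have "(idc X' \<star> (?a \<bullet> ?b)) \<bullet> r = (idc X' \<star> ?a) \<bullet> ((idc X' \<star> ?b) \<bullet> r)"
    using hc_vc[of "idc X'" "idc X'" ?b ?a] by (simp add: typing vc_id flip: vc_assoc)
  also have "\<dots> = ((idc X' \<star> ?a) \<bullet> (?bb \<star> idc X)) \<bullet> r"
    unfolding eb by (simp add: typing vc_assoc)
  also have "(idc X' \<star> ?a) \<bullet> (?bb \<star> idc X) = (?bb \<star> idc X) \<bullet> (idc X' \<star> ?a)"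
    using hc_whisker[of ?bb ?a] by simp
  also have "\<dots> \<bullet> r = (?bb \<star> idc X) \<bullet> ((?ba \<star> idc X) \<bullet> r)"
    by (simp add: typing vc_assoc flip: ea)
  also have "\<dots> = ((?bb \<bullet> ?ba) \<star> idc X) \<bullet> r"
    using hc_vc[of ?ba ?bb "idc X" "idc X"] by (simp add: typing vc_id flip: vc_assoc)
  finally show "(\<one> X' \<otimes> (a \<cdot> b)) \<cdot> cval r = ((bullet b \<cdot> bullet a) \<otimes> \<one> X) \<cdot> cval r"
    by (auto dest!: arg_cong[of _ _ cval])
qed (use assms in \<open>auto intro: vcomp_closed[of X X X] vcomp_closed[of X' X' X']\<close>)

text \<open>\<open>z\<close> slides through \<open>r\<close> from the right end of
  \<open>X' X\<close> to the unit 1-arrow, and from there to the left end.\<close>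

lemma bullet_left_center:
  assumes "z \<in> Hom C (\<I> N) (\<I> N)"
  shows "bullet (\<one> X \<otimes> z) = z \<otimes> \<one> X'"
proof (rule bullet_unique)
  let ?z = "Cell (\<I> N) z (\<I> N)"
  have [simp]: "cell ?z"
    using assms by (auto intro!: cellI)
  have "(idc X' \<star> (idc X \<star> ?z)) \<bullet> r = r \<star> ?z"
    using hc_whisker(2)[of r ?z] by (simp add: typing hc_id hc_assoc flip: idc_hc)
  also have "r \<star> ?z = r \<bullet> ?z"
    using hc_whisker(1)[of r ?z] by (simp add: typing hc_id)
  also have "\<dots> = ?z \<star> r"
    using hc_whisker(2)[of ?z r] by (simp add: typing hc_id)
  also have "\<dots> = (?z \<star> idc X' \<star> idc X) \<bullet> r"
    using hc_whisker(1)[of ?z r] by (simp add: typing hc_id hc_assoc flip: idc_hc)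
  finally show "(\<one> X' \<otimes> (\<one> X \<otimes> z)) \<cdot> cval r = (z \<otimes> \<one> X' \<otimes> \<one> X) \<cdot> cval r"
    by (auto dest!: arg_cong[of _ _ cval])
  show "\<one> X \<otimes> z \<in> Hom C X X" "z \<otimes> \<one> X' \<in> Hom C X' X'"
    using Hom_I[of "idc X \<star> ?z" X X] Hom_I[of "?z \<star> idc X'" X' X'] by (simp_all add: typing)
qed

lemma parallel_IM [simp]: "parallel C (\<I> M) (\<I> M)"
  by (simp add: typing)

lemma bullet_right_center:
  assumes "z \<in> Hom C (\<I> M) (\<I> M)"
  shows "bullet (z \<otimes> \<one> X) = \<one> X' \<otimes> z"
proof (rule bullet_unique)
  let ?z = "Cell (\<I> M) z (\<I> M)"
  have [simp]: "cell ?z"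
    using assms by (auto intro!: cellI)
  have "idc X' \<star> (?z \<star> idc X) = (idc X' \<star> ?z) \<star> idc X"
    by (simp add: typing hc_assoc)
  from arg_cong[OF this, of cval] show "(\<one> X' \<otimes> (z \<otimes> \<one> X)) \<cdot> cval r = (\<one> X' \<otimes> z \<otimes> \<one> X) \<cdot> cval r"
    by simp
  show "z \<otimes> \<one> X \<in> Hom C X X" "\<one> X' \<otimes> z \<in> Hom C X' X'"
    using Hom_I[of "?z \<star> idc X" X X] Hom_I[of "idc X' \<star> ?z" X' X'] by (simp_all add: typing)
qed

end

section \<open>Centers and simple 1-arrows\<close>

context two_C_star_category
begin

lemma whisker_center:
  assumes X: "X \<in> Arr C" and z: "z \<in> object_center C (src C X)"
  shows whisker_center_closed: "\<one> X \<otimes> z \<in> Hom C X X"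
    and whisker_center_adj: "adj C (\<one> X \<otimes> z) = \<one> X \<otimes> adj C z"
    and whisker_center_mult: "w \<in> object_center C (src C X) \<Longrightarrow> (\<one> X \<otimes> z) \<cdot> (\<one> X \<otimes> w) = \<one> X \<otimes> (z \<cdot> w)"
    and whisker_center_natural: "parallel C X Y \<Longrightarrow> t \<in> Hom C X Y \<Longrightarrow> t \<cdot> (\<one> X \<otimes> z) = (\<one> Y \<otimes> z) \<cdot> t"
proof -
  define N where N: "N = src C X"
  have I: "src C X = N" "N \<in> Ob C" "\<I> N \<in> Arr C" "src C (\<I> N) = N" "tgt C (\<I> N) = N"
    using X by (auto simp: N arr_simps)
  let ?z = "Cell (\<I> N) z (\<I> N)"
  have zc: "cell ?z"
    using z I by (auto simp: object_center_def intro!: cellI)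
  show "\<one> X \<otimes> z \<in> Hom C X X"
    using Hom_I[of "idc X \<star> ?z" X X] X I zc by (simp add: typing)
  show "adj C (\<one> X \<otimes> z) = \<one> X \<otimes> adj C z"
    using st_hc[of "idc X" ?z] X I zc by (auto simp: typing st_idc dest!: arg_cong[of _ _ cval])
  show "(\<one> X \<otimes> z) \<cdot> (\<one> X \<otimes> w) = \<one> X \<otimes> (z \<cdot> w)" if "w \<in> object_center C (src C X)"
  proof -
    have "cell (Cell (\<I> N) w (\<I> N))"
      using that I by (auto simp: object_center_def intro!: cellI)
    then have "(idc X \<star> ?z) \<bullet> (idc X \<star> Cell (\<I> N) w (\<I> N)) = idc X \<star> (?z \<bullet> Cell (\<I> N) w (\<I> N))"
      using X I zc by (simp add: typing hc_vc vc_id)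
    then show ?thesis
      by (auto dest!: arg_cong[of _ _ cval])
  qed
  show "t \<cdot> (\<one> X \<otimes> z) = (\<one> Y \<otimes> z) \<cdot> t" if t: "parallel C X Y" "t \<in> Hom C X Y"
  proof -
    have Y: "Y \<in> Arr C" "src C Y = N"
      using t(1) I by (auto simp: parallel_def)
    have "cell (Cell X t Y)"
      using t by (intro cellI)
    then have "Cell X t Y \<bullet> (idc X \<star> ?z) = (idc Y \<star> ?z) \<bullet> Cell X t Y"
      using hc_whisker[of "Cell X t Y" ?z] X Y I zc by (simp add: typing hc_id)
    then show ?thesis
      by (auto dest!: arg_cong[of _ _ cval])
  qed
qed

lemma whisker_center_linear:
  assumes X: "X \<in> Arr C"
  shows "z \<in> object_center C (src C X) \<Longrightarrow> w \<in> object_center C (src C X) \<Longrightarrow>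
      \<one> X \<otimes> (z + w) = \<one> X \<otimes> z + \<one> X \<otimes> w"
    and "z \<in> object_center C (src C X) \<Longrightarrow> \<one> X \<otimes> (k *\<^sub>C z) = k *\<^sub>C (\<one> X \<otimes> z)"
    and "(\<And>i. i \<in> I \<Longrightarrow> f i \<in> object_center C (src C X)) \<Longrightarrow> \<one> X \<otimes> sum f I = (\<Sum>i\<in>I. \<one> X \<otimes> f i)"
  using X unfolding object_center_def
  by (auto simp: id2_closed arr_simps intro!: hcomp_add_right[of "\<I> (src C X)" "\<I> (src C X)" X X]
      hcomp_scaleC_right[of "\<I> (src C X)" "\<I> (src C X)" X X]
      hcomp_sum_right[of "\<I> (src C X)" "\<I> (src C X)" X X])

lemma whisker_one: "X \<in> Arr C \<Longrightarrow> \<one> X \<otimes> \<one> (\<I> (src C X)) = \<one> X"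
  using hcomp_id_right[of X X "\<one> X"] by (simp add: id2_closed)

lemma left_center_subset: "X \<in> Arr C \<Longrightarrow> left_center C X \<subseteq> Hom C X X"
  using whisker_center_closed by (auto simp: left_center_def)

lemma left_center_algebra:
  assumes X: "X \<in> Arr C" and fin: "finite_dimensional_centers C"
  shows "commutative_star_algebra (left_center C X) (vcomp C) (adj C) (\<one> X)"
proof -
  let ?N = "src C X"
  interpret Z: commutative_star_algebra "object_center C ?N" "vcomp C" "adj C" "\<one> (\<I> ?N)"
    using X fin by (intro center_star_algebra) (simp_all add: arr_simps)
  have "\<one> X \<otimes> 0 = 0"
    using whisker_center_linear(2)[OF X, of 0 0] by simp
  then have "0 \<in> left_center C X"
    using Z.zero_closed by (auto simp: left_center_def)
  moreover have "a + b \<in> left_center C X" if ab: "a \<in> left_center C X" "b \<in> left_center C X" for a b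
  proof -
    obtain z w where zw: "a = \<one> X \<otimes> z" "b = \<one> X \<otimes> w" "z \<in> object_center C ?N" "w \<in> object_center C ?N"
      using ab by (auto simp: left_center_def)
    show ?thesis
      unfolding zw whisker_center_linear(1)[OF X zw(3,4), symmetric] left_center_def
      using Z.add_closed[OF zw(3,4)] by blast
  qed
  moreover have "k *\<^sub>C a \<in> left_center C X" if a: "a \<in> left_center C X" for a k
  proof -
    obtain z where z: "a = \<one> X \<otimes> z" "z \<in> object_center C ?N"
      using a by (auto simp: left_center_def)
    show ?thesis
      unfolding z(1) whisker_center_linear(2)[OF X z(2), symmetric] left_center_def
      using Z.scale_closed[OF z(2)] by blast
  qed
  ultimately have sub: "complex_vs.subspace (left_center C X)"
    by (auto simp: complex_vs.subspace_def)
  have mul: "a \<cdot> b \<in> left_center C X" "a \<cdot> b = b \<cdot> a" if ab: "a \<in> left_center C X" "b \<in> left_center C X" for a b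
  proof -
    obtain z w where zw: "a = \<one> X \<otimes> z" "b = \<one> X \<otimes> w" "z \<in> object_center C ?N" "w \<in> object_center C ?N"
      using ab by (auto simp: left_center_def)
    show "a \<cdot> b \<in> left_center C X"
      unfolding zw whisker_center_mult[OF X zw(3,4)] left_center_def using zw Z.mul_closed by blast
    show "a \<cdot> b = b \<cdot> a"
      unfolding zw whisker_center_mult[OF X zw(3,4)] whisker_center_mult[OF X zw(4,3)]
      using Z.commute[OF zw(3,4)] by simp
  qed
  have adj: "adj C a \<in> left_center C X" if a: "a \<in> left_center C X" for a
  proof -
    obtain z where z: "a = \<one> X \<otimes> z" "z \<in> object_center C ?N"
      using a by (auto simp: left_center_def)
    show ?thesis
      unfolding z(1) whisker_center_adj[OF X z(2)] left_center_def
      using Z.star_closed[OF z(2)] by blast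
  qed
  have one: "\<one> X \<in> left_center C X"
    unfolding left_center_def using whisker_one[OF X] Z.one_closed
    by (intro CollectI exI[of _ "\<one> (\<I> ?N)"]) simp
  obtain B where B: "finite B" "object_center C ?N \<subseteq> complex_vs.span B" "B \<subseteq> object_center C ?N"
  proof -
    obtain B where B: "finite B" "object_center C ?N = complex_vs.span B"
      using fin arr_simps(1)[OF X] unfolding finite_dimensional_centers_def by blast
    then show ?thesis
      using that[of B] complex_vs.span_superset by auto
  qed
  have "left_center C X \<subseteq> complex_vs.span ((\<lambda>z. \<one> X \<otimes> z) ` B)"
  proof
    fix a assume "a \<in> left_center C X"
    then obtain z where z: "a = \<one> X \<otimes> z" "z \<in> object_center C ?N"
      by (auto simp: left_center_def)
    obtain u where u: "z = (\<Sum>x\<in>B. u x *\<^sub>C x)"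
      using complex_vs.span_finite[OF B(1)] B z by auto
    have "a = (\<Sum>x\<in>B. \<one> X \<otimes> (u x *\<^sub>C x))"
      unfolding z u using B by (intro whisker_center_linear(3)[OF X]) auto
    also have "\<dots> = (\<Sum>x\<in>B. u x *\<^sub>C (\<one> X \<otimes> x))"
      using B by (intro sum.cong refl whisker_center_linear(2)[OF X]) auto
    also have "\<dots> \<in> complex_vs.span ((\<lambda>z. \<one> X \<otimes> z) ` B)"
      by (intro complex_vs.span_sum complex_vs.span_scale complex_vs.span_base imageI)
    finally show "a \<in> complex_vs.span ((\<lambda>z. \<one> X \<otimes> z) ` B)" .
  qed
  then have fd: "\<exists>B. finite B \<and> left_center C X \<subseteq> complex_vs.span B"
    using B(1) by blast
  have LX: "\<And>a. a \<in> left_center C X \<Longrightarrow> a \<in> Hom C X X"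
    using left_center_subset[OF X] by auto
  show ?thesis
    using X LX
    by unfold_locales (auto simp: sub mul(1) one adj fd vcomp_assoc[of X X X X]
      vcomp_add_left[of X X X] vcomp_add_right[of X X X] vcomp_scaleC_left[of X X X] vcomp_scaleC_right[of X X X]
      vcomp_id_left[of X X] vcomp_id_right[of X X] adj_adj[of X X] adj_add[of X X] adj_scaleC[of X X] adj_vcomp[of X X X]
      intro: mul(2) star_proper[of X X])
qed

lemma minimal_projections_eq:
  assumes "star_algebra A (vcomp C) (adj C) u" "A \<subseteq> Hom C X X"
  shows "minimal_projections C X A = star_algebra.minproj A (vcomp C) (adj C)"
proof -
  interpret star_algebra A "vcomp C" "adj C" u
    by fact
  have "proj p \<longleftrightarrow> p \<in> A \<and> projection C X p" for p
    using assms(2) by (auto simp: proj_def projection_def)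
  then show ?thesis
    unfolding minimal_projections_def minproj_def by blast
qed

lemma whisker_square:
  assumes Y: "Y \<in> Arr C" and W: "W \<in> Arr C" "src C W = tgt C Y" "tgt C W = src C Y"
    and r: "r \<in> Hom C (\<I> (src C Y)) (W \<otimes>\<^sub>1 Y)"
  shows "parallel C Y (Y \<otimes>\<^sub>1 (W \<otimes>\<^sub>1 Y))" "\<one> Y \<otimes> r \<in> Hom C Y (Y \<otimes>\<^sub>1 (W \<otimes>\<^sub>1 Y))"
    "adj C (\<one> Y \<otimes> r) \<cdot> (\<one> Y \<otimes> r) = \<one> Y \<otimes> (adj C r \<cdot> r)"
proof -
  define N where N: "N = src C Y"
  have I: "src C Y = N" "N \<in> Ob C" "\<I> N \<in> Arr C" "src C (\<I> N) = N" "tgt C (\<I> N) = N"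
    using Y by (auto simp: N arr_simps)
  note W' = W[unfolded I]
  let ?r = "Cell (\<I> N) r (W \<otimes>\<^sub>1 Y)" and ?T = "Y \<otimes>\<^sub>1 (W \<otimes>\<^sub>1 Y)"
  have rc: "cell ?r"
    using r I W' Y by (auto intro!: cellI simp: parallel_def typing)
  show "parallel C Y ?T"
    using I W' Y by (simp add: parallel_def typing)
  show "\<one> Y \<otimes> r \<in> Hom C Y ?T"
    using Hom_I[of "idc Y \<star> ?r" Y ?T] rc I W' Y by (simp add: typing)
  have "st (idc Y \<star> ?r) \<bullet> (idc Y \<star> ?r) = idc Y \<star> (st ?r \<bullet> ?r)"
    using rc I W' Y by (simp add: typing st_hc st_idc hc_vc vc_id)
  then show "adj C (\<one> Y \<otimes> r) \<cdot> (\<one> Y \<otimes> r) = \<one> Y \<otimes> (adj C r \<cdot> r)"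
    by (auto dest!: arg_cong[of _ _ cval])
qed

lemma norm_whisker_square:
  assumes "Y \<in> Arr C" "W \<in> Arr C" "src C W = tgt C Y" "tgt C W = src C Y"
    and "r \<in> Hom C (\<I> (src C Y)) (W \<otimes>\<^sub>1 Y)"
  shows "(norm (\<one> Y \<otimes> r))\<^sup>2 = norm (\<one> Y \<otimes> (adj C r \<cdot> r))"
  using C_star_identity[OF whisker_square(1,2)[OF assms]] whisker_square(3)[OF assms] by simp

text \<open>For a zero 1-arrow both sides vanish.\<close>

lemma simple_square:
  assumes Y: "simple_arrow C Y" and W: "W \<in> Arr C" "src C W = tgt C Y" "tgt C W = src C Y"
    and r: "r \<in> Hom C (\<I> (src C Y)) (W \<otimes>\<^sub>1 Y)"
  shows "\<one> Y \<otimes> (adj C r \<cdot> r) = complex_of_real ((norm (\<one> Y \<otimes> r))\<^sup>2) *\<^sub>C \<one> Y"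
proof -
  have YA: "Y \<in> Arr C" and sc: "Hom C Y Y = scalars C Y"
    using Y by (auto simp: simple_arrow_def)
  note t = whisker_square[OF YA W r]
  have "adj C (\<one> Y \<otimes> r) \<cdot> (\<one> Y \<otimes> r) \<in> Hom C Y Y"
    by (rule vcomp_closed[OF t(1) parallel_sym[OF t(1)] t(2) adj_closed[OF t(1,2)]])
  then obtain k where k: "adj C (\<one> Y \<otimes> r) \<cdot> (\<one> Y \<otimes> r) = k *\<^sub>C \<one> Y"
    unfolding sc scalars_def by auto
  show ?thesis
  proof (cases "\<one> Y = 0")
    case True
    then show ?thesis
      using k t(3) by simp
  next
    case False
    obtain c where c: "0 \<le> c" "k = complex_of_real c"
      using square_multiple_nonneg[OF YA t(1,2) projection_id[OF YA] False k] by auto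
    have "norm (\<one> Y) = 1"
      using projection_norm[OF YA projection_id[OF YA]] False by simp
    then have "(norm (\<one> Y \<otimes> r))\<^sup>2 = c"
      using C_star_identity[OF t(1,2)] k c by (simp add: norm_scaleC)
    then show ?thesis
      using k c t(3) by simp
  qed
qed

lemma isometryD:
  assumes "isometry C S X v"
  shows "parallel C S X" "v \<in> Hom C S X" "adj C v \<cdot> v = \<one> S" "parallel C X S" "adj C v \<in> Hom C X S"
    "S \<in> Arr C" "X \<in> Arr C"
  using assms adj_closed by (auto simp: isometry_def parallel_def)

text \<open>Compressing \<open>p\<close> by \<open>u l\<close> writes the unit as the sum of the
  squares of all \<open>adj C (u j) \<cdot> u l\<close>. The term \<open>j = l\<close> is already
  the unit, so the others form a vanishing sum of squares.\<close>

lemma isometries_orthogonal: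
  assumes "finite K" and u: "\<And>k. k \<in> K \<Longrightarrow> isometry C (S k) X (u k)"
    and sum: "(\<Sum>k\<in>K. u k \<cdot> adj C (u k)) = p" and p: "\<And>k. k \<in> K \<Longrightarrow> p \<cdot> u k = u k"
    and kl: "k \<in> K" "l \<in> K" "k \<noteq> l"
  shows "adj C (u k) \<cdot> u l = 0"
proof -
  note U = isometryD[OF u]
  have uu: "u j \<cdot> adj C (u j) \<in> Hom C X X" if "j \<in> K" for j
    using U[OF that] by (auto intro: vcomp_closed[of X "S j" X])
  have a: "adj C (u j) \<cdot> u l \<in> Hom C (S l) (S j)" "parallel C (S l) (S j)" if "j \<in> K" for j
    using U[OF that] U[OF kl(2)] parallel_trans[of "S l" X "S j"] by (auto intro: vcomp_closed[of "S l" X "S j"])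
  have "p \<cdot> u l = (\<Sum>j\<in>K. (u j \<cdot> adj C (u j)) \<cdot> u l)"
    unfolding sum[symmetric] using U[OF kl(2)] uu by (intro vcomp_sum_left[of "S l" X X]) auto
  then have 1: "adj C (u l) \<cdot> u l = adj C (u l) \<cdot> (\<Sum>j\<in>K. (u j \<cdot> adj C (u j)) \<cdot> u l)"
    using p[OF kl(2)] by simp
  also have "\<dots> = (\<Sum>j\<in>K. adj C (u l) \<cdot> ((u j \<cdot> adj C (u j)) \<cdot> u l))"
    using U[OF kl(2)] uu by (intro vcomp_sum_right[of "S l" X "S l"]) (auto intro: vcomp_closed[of "S l" X X])
  also have "\<dots> = (\<Sum>j\<in>K. adj C (adj C (u j) \<cdot> u l) \<cdot> (adj C (u j) \<cdot> u l))"
  proof (intro sum.cong refl)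
    fix j assume j: "j \<in> K"
    let ?uj = "Cell (S j) (u j) X" and ?ul = "Cell (S l) (u l) X"
    have "cell ?uj" "cell ?ul"
      using U[OF j] U[OF kl(2)] by (auto intro: cellI)
    then have "st ?ul \<bullet> ((?uj \<bullet> st ?uj) \<bullet> ?ul) = st (st ?uj \<bullet> ?ul) \<bullet> (st ?uj \<bullet> ?ul)"
      by (simp add: vc_assoc st_vc st_st typing)
    then show "adj C (u l) \<cdot> ((u j \<cdot> adj C (u j)) \<cdot> u l) = adj C (adj C (u j) \<cdot> u l) \<cdot> (adj C (u j) \<cdot> u l)"
      by (auto dest!: arg_cong[of _ _ cval])
  qed
  also have "\<dots> = adj C (adj C (u l) \<cdot> u l) \<cdot> (adj C (u l) \<cdot> u l) +
      (\<Sum>j\<in>K - {l}. adj C (adj C (u j) \<cdot> u l) \<cdot> (adj C (u j) \<cdot> u l))"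
    using assms(1) kl by (intro sum.remove)
  also have "adj C (adj C (u l) \<cdot> u l) \<cdot> (adj C (u l) \<cdot> u l) = adj C (u l) \<cdot> u l"
    using U[OF kl(2)] by (simp add: adj_id2 vcomp_id_left[of "S l" "S l"] id2_closed)
  finally have "(\<Sum>j\<in>K - {l}. adj C (adj C (u j) \<cdot> u l) \<cdot> (adj C (u j) \<cdot> u l)) = 0"
    by simp
  then show ?thesis
    using sum_squares_zero[of "K - {l}" "S l" S "\<lambda>j. adj C (u j) \<cdot> u l" k] a assms(1) kl U[OF kl(2)] by auto
qed

end

section \<open>Endomorphism algebras and decomposition into simple 1-arrows\<close>

context rigid_category
begin

lemma End_algebra:
  assumes X: "X \<in> Arr C"
  shows "star_algebra (Hom C X X) (vcomp C) (adj C) (\<one> X)"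
proof -
  obtain X' r r' where "conjugate_solution C X X' r r'"
    using rigid X by (auto simp: rigid_def conjugate_arrows_def)
  moreover define N M where "N = src C X" "M = tgt C X"
  ultimately interpret conjugate_pair C N M X X' "Cell (\<I> N) r (X' \<otimes>\<^sub>1 X)" "Cell (\<I> M) r' (X \<otimes>\<^sub>1 X')"
    by (intro conjugate_solution_pair two_C_star_category_axioms)
  show ?thesis
    by (rule Hom_star_algebra[OF assms Hom_finite_dim[OF fin]])
qed

text \<open>An endomorphism \<open>a\<close> of \<open>S\<close> corresponds to
  \<open>w \<cdot> a \<cdot> adj C w\<close> in the corner of \<open>P\<close>, which consists of
  multiples of \<open>P\<close>; compressing by \<open>w\<close> again recovers \<open>a\<close> as
  a scalar.\<close>

lemma minimal_simple:
  assumes X: "X \<in> Arr C" and P: "P \<in> star_algebra.minproj (Hom C X X) (vcomp C) (adj C)"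
    and w: "isometry_onto C S X w P"
  shows "simple_arrow C S" "\<one> S \<noteq> 0"
proof -
  interpret A: star_algebra "Hom C X X" "vcomp C" "adj C" "\<one> X"
    by (rule End_algebra[OF X])
  have wi: "isometry C S X w" and wP: "w \<cdot> adj C w = P"
    using w by (auto simp: isometry_onto_def)
  note W = isometryD[OF wi]
  have P0: "P \<noteq> 0"
    using P by (simp add: A.minproj_def)
  show "\<one> S \<noteq> 0"
  proof
    assume "\<one> S = 0"
    then have "w = 0"
      using W star_proper[of S X w] by simp
    then show False
      using wP P0 W vcomp_zero_left[of X S X] by simp
  qed
  have "\<exists>k. a = k *\<^sub>C \<one> S" if a: "a \<in> Hom C S S" for a
  proof -
    let ?w = "Cell S w X" and ?a = "Cell S a S"
    have c: "cell ?w" "cell ?a"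
      using W a by (auto intro: cellI)
    have e: "st ?w \<bullet> ?w = idc S"
      using W by (intro cell_eqI) auto
    have "w \<cdot> a \<cdot> adj C w \<in> Hom C X X"
      using Hom_I[of "?w \<bullet> ?a \<bullet> st ?w" X X] c by (simp add: typing)
    then obtain k where k: "P \<cdot> (w \<cdot> a \<cdot> adj C w) \<cdot> P = k *\<^sub>C P"
      using A.minproj_scalar[OF P] by blast
    have "st ?w \<bullet> ((?w \<bullet> st ?w) \<bullet> (?w \<bullet> ?a \<bullet> st ?w) \<bullet> (?w \<bullet> st ?w)) \<bullet> ?w =
        (st ?w \<bullet> ?w) \<bullet> ((st ?w \<bullet> ?w) \<bullet> (?a \<bullet> ((st ?w \<bullet> ?w) \<bullet> (st ?w \<bullet> ?w))))"
      using c by (simp add: vc_assoc typing)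
    also have "\<dots> = ?a"
      using c W by (simp add: e vc_id typing)
    finally have 1: "adj C w \<cdot> (P \<cdot> (w \<cdot> a \<cdot> adj C w) \<cdot> P) \<cdot> w = a"
      by (auto simp: wP dest!: arg_cong[of _ _ cval])
    have "st ?w \<bullet> (?w \<bullet> st ?w) \<bullet> ?w = (st ?w \<bullet> ?w) \<bullet> (st ?w \<bullet> ?w)"
      using c by (simp add: vc_assoc typing)
    then have 2: "adj C w \<cdot> P \<cdot> w = \<one> S"
      using W by (auto simp: wP vcomp_id_left[of S S] id2_closed dest!: arg_cong[of _ _ cval])
    have PH: "P \<in> Hom C X X"
      using P by (simp add: A.minproj_def A.proj_def)
    have "adj C w \<cdot> (k *\<^sub>C P) \<cdot> w = k *\<^sub>C (adj C w \<cdot> P \<cdot> w)"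
      using W PH by (simp add: vcomp_scaleC_right[of X X S] vcomp_scaleC_left[of S X S] vcomp_closed[of X X S])
    moreover have "a = adj C w \<cdot> (k *\<^sub>C P) \<cdot> w"
      using 1 k by simp
    ultimately show ?thesis
      using 2 by auto
  qed
  then show "simple_arrow C S"
    using W Hom_scale[of S S] by (auto simp: simple_arrow_def scalars_def id2_closed)
qed

lemma simple_decomposition:
  assumes X: "X \<in> Arr C" and g: "projection C X g"
  shows "\<exists>(n::nat) Y w. (\<forall>h<n. simple_arrow C (Y h) \<and> \<one> (Y h) \<noteq> 0 \<and> isometry C (Y h) X (w h) \<and> g \<cdot> w h = w h) \<and>
    (\<Sum>h<n. w h \<cdot> adj C (w h)) = g"
proof -
  interpret A: star_algebra "Hom C X X" "vcomp C" "adj C" "\<one> X"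
    by (rule End_algebra[OF X])
  have "A.proj g"
    using g by (auto simp: A.proj_def projection_def)
  then obtain S where S: "finite S" "S \<subseteq> A.minproj" "(\<Sum>p\<in>S. p) = g" "\<And>p. p \<in> S \<Longrightarrow> g \<cdot> p = p"
    using A.minproj_decomposition[of g] by auto
  have "\<exists>Y w. isometry_onto C Y X w p" if "p \<in> S" for p
    using that S X sub_1_arrows[of X p] by (auto simp: A.minproj_def A.proj_def projection_def)
  then obtain Y w where Yw: "\<And>p. p \<in> S \<Longrightarrow> isometry_onto C (Y p) X (w p) p"
    by metis
  \<comment> \<open>The constituents are renumbered by natural numbers, the index type in
    \<open>standard_solution_factorial\<close>.\<close>
  obtain b where b: "bij_betw b {..<card S} S"
    using ex_bij_betw_nat_finite[OF S(1)] by (auto simp: atLeast0LessThan)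
  have bS: "b h \<in> S" if "h < card S" for h
    using b that by (auto simp: bij_betw_def)
  have gw: "g \<cdot> w p = w p" if "p \<in> S" for p
  proof -
    have i: "isometry C (Y p) X (w p)" and wp: "w p \<cdot> adj C (w p) = p"
      using Yw[OF that] by (auto simp: isometry_onto_def)
    note W = isometryD[OF i]
    have pw: "p \<cdot> w p = w p"
      using W vcomp_assoc[of "Y p" X "Y p" X "w p" "adj C (w p)" "w p"] wp vcomp_id_right[of "Y p" X "w p"] by simp
    have "g \<cdot> (p \<cdot> w p) = (g \<cdot> p) \<cdot> w p"
      using W g S(2) that vcomp_assoc[of "Y p" X X X "w p" p g]
      by (auto simp: projection_def A.minproj_def A.proj_def)
    then show ?thesis
      using S(4)[OF that] pw by simp
  qed
  have "(\<Sum>h<card S. w (b h) \<cdot> adj C (w (b h))) = (\<Sum>p\<in>S. w p \<cdot> adj C (w p))"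
    by (rule sum.reindex_bij_betw[OF b])
  also have "\<dots> = g"
    using Yw S(3) by (simp add: isometry_onto_def)
  finally have sum: "(\<Sum>h<card S. w (b h) \<cdot> adj C (w (b h))) = g" .
  have "simple_arrow C (Y (b h)) \<and> \<one> (Y (b h)) \<noteq> 0 \<and> isometry C (Y (b h)) X (w (b h)) \<and> g \<cdot> w (b h) = w (b h)"
    if "h < card S" for h
    using bS[OF that] Yw minimal_simple[OF X] S(2) gw by (fastforce simp: isometry_onto_def)
  then show ?thesis
    using sum by (intro exI[of _ "card S"] exI[of _ "Y \<circ> b"] exI[of _ "w \<circ> b"]) auto
qed

end

section \<open>Left inverses of direct sums and Schur's lemma\<close>

context two_C_star_category
begin

text \<open>A cross term of indices \<open>k\<close> and \<open>j\<close> carries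
  \<open>adj C (v' k) \<cdot> v' j\<close> on its left leg, which vanishes; on the diagonal this
  factor is the unit. Hence orthogonality is required of the \<open>v'\<close> alone.\<close>

lemma left_inverse_map_sum:
  assumes K: "finite K" and X: "X \<in> Arr C" "X' \<in> Arr C" "src C X' = tgt C X" "tgt C X' = src C X"
    and v: "\<And>k. k \<in> K \<Longrightarrow> parallel C (Y k) X \<and> v k \<in> Hom C (Y k) X"
    and v': "\<And>k. k \<in> K \<Longrightarrow> isometry C (Y' k) X' (v' k)"
    and orth: "\<And>k l. k \<in> K \<Longrightarrow> l \<in> K \<Longrightarrow> k \<noteq> l \<Longrightarrow> adj C (v' k) \<cdot> v' l = 0"
    and rk: "\<And>k. k \<in> K \<Longrightarrow> rk k \<in> Hom C (\<I> (src C X)) (Y' k \<otimes>\<^sub>1 Y k)"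
    and r: "r = (\<Sum>k\<in>K. complex_of_real (l k) *\<^sub>C ((v' k \<otimes> v k) \<cdot> rk k))"
    and t: "t \<in> Hom C X X"
  shows "left_inverse_map C X' r t =
    (\<Sum>k\<in>K. complex_of_real ((l k)\<^sup>2) *\<^sub>C left_inverse_map C (Y' k) (rk k) (adj C (v k) \<cdot> t \<cdot> v k))"
proof -
  define N where N: "N = src C X"
  have N': "src C X = N" "tgt C X' = N" "N \<in> Ob C" "\<I> N \<in> Arr C" "src C (\<I> N) = N" "tgt C (\<I> N) = N"
    using X by (auto simp: N arr_simps)
  note V = isometryD[OF v']
  have Yk: "Y k \<in> Arr C" "src C (Y k) = N" "tgt C (Y k) = tgt C X" if "k \<in> K" for k
    using v[OF that] N' by (auto simp: parallel_def)
  have Yk': "Y' k \<in> Arr C" "src C (Y' k) = tgt C X" "tgt C (Y' k) = N" if "k \<in> K" for k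
    using V(1)[OF that] N' X by (auto simp: parallel_def)
  let ?H = "Hom C (\<I> N) (X' \<otimes>\<^sub>1 X)"
  define x where "x k = (v' k \<otimes> v k) \<cdot> rk k" for k
  have XX: "X' \<otimes>\<^sub>1 X \<in> Arr C"
    using X by (simp add: arr_simps)
  have p: "parallel C (\<I> N) (X' \<otimes>\<^sub>1 X)"
    using X N' by (simp add: parallel_def arr_simps)
  have vc: "cell (Cell (Y k) (v k) X)" "cell (Cell (Y' k) (v' k) X')" "cell (Cell (\<I> N) (rk k) (Y' k \<otimes>\<^sub>1 Y k))"
    if "k \<in> K" for k
    using v[OF that] V[OF that] rk[OF that] N' Yk[OF that] Yk'[OF that]
    by (auto intro!: cellI simp: parallel_def arr_simps)
  have tc: "cell (Cell X t X)"
    using t X by (auto intro: cellI)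
  have tX: "\<one> X' \<otimes> t \<in> Hom C (X' \<otimes>\<^sub>1 X) (X' \<otimes>\<^sub>1 X)"
    using Hom_I[of "idc X' \<star> Cell X t X" "X' \<otimes>\<^sub>1 X" "X' \<otimes>\<^sub>1 X"] tc X by (simp add: typing)
  have xH: "x k \<in> ?H" if "k \<in> K" for k
    using Hom_I[of "(Cell (Y' k) (v' k) X' \<star> Cell (Y k) (v k) X) \<bullet> Cell (\<I> N) (rk k) (Y' k \<otimes>\<^sub>1 Y k)" "\<I> N" "X' \<otimes>\<^sub>1 X"]
      vc[OF that] Yk[OF that] Yk'[OF that] by (simp add: typing x_def)
  have pair_term: "adj C (x k) \<cdot> (\<one> X' \<otimes> t) \<cdot> x j =
      adj C (rk k) \<cdot> ((adj C (v' k) \<cdot> v' j) \<otimes> (adj C (v k) \<cdot> t \<cdot> v j)) \<cdot> rk j" if kj: "k \<in> K" "j \<in> K" for k j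
  proof -
    let ?vk = "Cell (Y k) (v k) X" and ?vk' = "Cell (Y' k) (v' k) X'" and ?rk = "Cell (\<I> N) (rk k) (Y' k \<otimes>\<^sub>1 Y k)"
    let ?vj = "Cell (Y j) (v j) X" and ?vj' = "Cell (Y' j) (v' j) X'" and ?rj = "Cell (\<I> N) (rk j) (Y' j \<otimes>\<^sub>1 Y j)"
    let ?t = "Cell X t X"
    note c = vc[OF kj(1)] vc[OF kj(2)] tc
    note y = Yk[OF kj(1)] Yk'[OF kj(1)] Yk[OF kj(2)] Yk'[OF kj(2)]
    have "st ((?vk' \<star> ?vk) \<bullet> ?rk) \<bullet> (idc X' \<star> ?t) \<bullet> ((?vj' \<star> ?vj) \<bullet> ?rj) =
        st ?rk \<bullet> (((st ?vk' \<star> st ?vk) \<bullet> (idc X' \<star> ?t) \<bullet> (?vj' \<star> ?vj)) \<bullet> ?rj)"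
      using c y X N' by (simp add: typing st_vc st_hc vc_assoc)
    also have "(st ?vk' \<star> st ?vk) \<bullet> (idc X' \<star> ?t) \<bullet> (?vj' \<star> ?vj) = (st ?vk' \<bullet> ?vj') \<star> (st ?vk \<bullet> ?t \<bullet> ?vj)"
      using c y X N' by (simp add: typing hc_vc vc_id)
    also have "st ?rk \<bullet> ((st ?vk' \<bullet> ?vj') \<star> (st ?vk \<bullet> ?t \<bullet> ?vj) \<bullet> ?rj) =
        st ?rk \<bullet> ((st ?vk' \<bullet> ?vj') \<star> (st ?vk \<bullet> ?t \<bullet> ?vj)) \<bullet> ?rj"
      using c y X N' by (simp add: typing vc_assoc)
    finally show ?thesis
      by (auto simp: x_def dest!: arg_cong[of _ _ cval])
  qed
  have pair_term': "adj C (x k) \<cdot> (\<one> X' \<otimes> t) \<cdot> x j = (if j = k then left_inverse_map C (Y' k) (rk k) (adj C (v k) \<cdot> t \<cdot> v k) else 0)"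
    if kj: "k \<in> K" "j \<in> K" for k j
  proof (cases "j = k")
    case True
    then show ?thesis
      using pair_term[OF kj] V(3)[OF kj(1)] by (simp add: left_inverse_map_def)
  next
    case False
    let ?s = "adj C (v k) \<cdot> t \<cdot> v j"
    have pp: "parallel C (Y j) (Y k)" "parallel C (Y' j) (Y' k)"
      using Yk[OF kj(1)] Yk'[OF kj(1)] Yk[OF kj(2)] Yk'[OF kj(2)] by (auto simp: parallel_def)
    have s: "?s \<in> Hom C (Y j) (Y k)"
      using Hom_I[of "st (Cell (Y k) (v k) X) \<bullet> Cell X t X \<bullet> Cell (Y j) (v j) X" "Y j" "Y k"] vc[OF kj(1)] vc[OF kj(2)] tc
      by (simp add: typing)
    have p': "parallel C (\<I> N) (Y' j \<otimes>\<^sub>1 Y j)" "parallel C (Y' j \<otimes>\<^sub>1 Y j) (Y' k \<otimes>\<^sub>1 Y k)" "parallel C (Y' k \<otimes>\<^sub>1 Y k) (\<I> N)"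
      using N' Yk[OF kj(1)] Yk'[OF kj(1)] Yk[OF kj(2)] Yk'[OF kj(2)] by (auto simp: parallel_def arr_simps)
    have rr: "adj C (rk k) \<in> Hom C (Y' k \<otimes>\<^sub>1 Y k) (\<I> N)"
      using adj_closed[OF parallel_sym[OF p'(3)]] rk[OF kj(1)] N' by simp
    have "0 \<otimes> ?s = 0"
      using hcomp_zero_left[OF pp(1,2) _ s] Yk[OF kj(2)] Yk'[OF kj(2)] by simp
    moreover have "adj C (rk k) \<cdot> 0 = 0"
      using vcomp_zero_right[OF p'(2,3) rr] .
    moreover have "0 \<cdot> rk j = 0"
      using vcomp_zero_left[OF p'(1) parallel_trans[OF p'(2,3)]] rk[OF kj(2)] N' by simp
    ultimately show ?thesis
      using pair_term[OF kj] orth[OF kj] False by simp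
  qed
  have r': "r = (\<Sum>k\<in>K. complex_of_real (l k) *\<^sub>C x k)"
    unfolding r x_def ..
  have lx: "complex_of_real (l k) *\<^sub>C x k \<in> ?H" if "k \<in> K" for k
    using xH[OF that] p by (simp add: Hom_scale)
  have ax: "adj C (x k) \<in> Hom C (X' \<otimes>\<^sub>1 X) (\<I> N)" if "k \<in> K" for k
    using adj_closed[OF p xH[OF that]] .
  have axt: "adj C (x k) \<cdot> (\<one> X' \<otimes> t) \<in> Hom C (X' \<otimes>\<^sub>1 X) (\<I> N)" if "k \<in> K" for k
    using vcomp_closed[OF _ parallel_sym[OF p] tX ax[OF that]] XX by simp
  have ps: "parallel C (X' \<otimes>\<^sub>1 X) (\<I> N)"
    by (rule parallel_sym[OF p])
  have "adj C r = (\<Sum>k\<in>K. complex_of_real (l k) *\<^sub>C adj C (x k))"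
    unfolding r' using lx xH by (subst adj_sum[OF p]) (auto simp: adj_scaleC[OF p])
  then have "adj C r \<cdot> (\<one> X' \<otimes> t) = (\<Sum>k\<in>K. (complex_of_real (l k) *\<^sub>C adj C (x k)) \<cdot> (\<one> X' \<otimes> t))"
    using ax XX ps by (simp add: vcomp_sum_left[OF _ ps tX] Hom_scale)
  also have "\<dots> = (\<Sum>k\<in>K. complex_of_real (l k) *\<^sub>C (adj C (x k) \<cdot> (\<one> X' \<otimes> t)))"
    using ax XX ps tX by (intro sum.cong refl vcomp_scaleC_left[of "X' \<otimes>\<^sub>1 X" "X' \<otimes>\<^sub>1 X" "\<I> N"]) auto
  finally have 1: "adj C r \<cdot> (\<one> X' \<otimes> t) = (\<Sum>k\<in>K. complex_of_real (l k) *\<^sub>C (adj C (x k) \<cdot> (\<one> X' \<otimes> t)))" .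
  have "adj C r \<cdot> (\<one> X' \<otimes> t) \<cdot> x j = complex_of_real (l j) *\<^sub>C left_inverse_map C (Y' j) (rk j) (adj C (v j) \<cdot> t \<cdot> v j)"
    if j: "j \<in> K" for j
  proof -
    have "adj C r \<cdot> (\<one> X' \<otimes> t) \<cdot> x j = (\<Sum>k\<in>K. (complex_of_real (l k) *\<^sub>C (adj C (x k) \<cdot> (\<one> X' \<otimes> t))) \<cdot> x j)"
      unfolding 1 using axt ps by (intro vcomp_sum_left[OF p ps xH[OF j]]) (auto intro: Hom_scale)
    also have "\<dots> = (\<Sum>k\<in>K. complex_of_real (l k) *\<^sub>C (adj C (x k) \<cdot> (\<one> X' \<otimes> t) \<cdot> x j))"
      using axt xH[OF j] p ps by (intro sum.cong refl vcomp_scaleC_left[of "\<I> N" "X' \<otimes>\<^sub>1 X" "\<I> N"]) auto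
    also have "\<dots> = (\<Sum>k\<in>K. if k = j then complex_of_real (l j) *\<^sub>C left_inverse_map C (Y' j) (rk j) (adj C (v j) \<cdot> t \<cdot> v j) else 0)"
      using pair_term'[OF _ j] by (intro sum.cong) auto
    finally show ?thesis
      using j K by simp
  qed
  note 2 = this
  have 3: "adj C r \<cdot> (\<one> X' \<otimes> t) \<in> Hom C (X' \<otimes>\<^sub>1 X) (\<I> N)"
    unfolding 1 using axt ps by (auto intro!: Hom_sum Hom_scale)
  have "left_inverse_map C X' r t = adj C r \<cdot> (\<one> X' \<otimes> t) \<cdot> (\<Sum>k\<in>K. complex_of_real (l k) *\<^sub>C x k)"
    unfolding left_inverse_map_def using r' by simp
  also have "\<dots> = (\<Sum>k\<in>K. adj C r \<cdot> (\<one> X' \<otimes> t) \<cdot> (complex_of_real (l k) *\<^sub>C x k))"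
    using 3 lx by (intro vcomp_sum_right[OF p ps]) auto
  also have "\<dots> = (\<Sum>k\<in>K. complex_of_real (l k) *\<^sub>C (adj C r \<cdot> (\<one> X' \<otimes> t) \<cdot> x k))"
    using 3 xH by (intro sum.cong refl vcomp_scaleC_right[OF p ps]) auto
  also have "\<dots> = (\<Sum>k\<in>K. complex_of_real ((l k)\<^sup>2) *\<^sub>C left_inverse_map C (Y' k) (rk k) (adj C (v k) \<cdot> t \<cdot> v k))"
    using 2 by (intro sum.cong refl) (simp add: scaleC_scaleC power2_eq_square)
  finally show ?thesis .
qed

lemma simple_scalar: "simple_arrow C Y \<Longrightarrow> a \<in> Hom C Y Y \<Longrightarrow> \<exists>k. a = k *\<^sub>C \<one> Y"
  by (auto simp: simple_arrow_def scalars_def)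

lemma simple_Arr: "simple_arrow C Y \<Longrightarrow> Y \<in> Arr C"
  by (simp add: simple_arrow_def)

text \<open>Schur's lemma. The two scalars agree because each of them multiplies \<open>s\<close> in
  \<open>s s^* s\<close>.\<close>

lemma simple_intertwiner:
  assumes Y: "simple_arrow C Y" and Z: "simple_arrow C Z" and s: "parallel C Y Z" "s \<in> Hom C Y Z"
  shows "\<exists>m. adj C s \<cdot> s = m *\<^sub>C \<one> Y \<and> s \<cdot> adj C s = m *\<^sub>C \<one> Z \<and> (m = 0 \<longleftrightarrow> s = 0)"
proof -
  note A = simple_Arr[OF Y] simple_Arr[OF Z] parallel_sym[OF s(1)] adj_closed[OF s]
  have "adj C s \<cdot> s \<in> Hom C Y Y" "s \<cdot> adj C s \<in> Hom C Z Z"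
    using s A by (auto intro: vcomp_closed[of Y Z Y] vcomp_closed[of Z Y Z])
  then obtain m m' where m: "adj C s \<cdot> s = m *\<^sub>C \<one> Y" "s \<cdot> adj C s = m' *\<^sub>C \<one> Z"
    using simple_scalar Y Z by metis
  show ?thesis
  proof (cases "s = 0")
    case True
    then have "adj C s \<cdot> s = 0" "s \<cdot> adj C s = 0"
      using s A vcomp_zero_right[of Y Z Y "adj C s"] vcomp_zero_left[of Z Y Z "adj C s"] by auto
    then show ?thesis
      using True by (intro exI[of _ 0]) simp
  next
    case False
    have "m *\<^sub>C s = s \<cdot> (m *\<^sub>C \<one> Y)"
      using s A by (simp add: vcomp_scaleC_right[of Y Y Z] id2_closed vcomp_id_right[of Y Z])
    also have "\<dots> = (s \<cdot> adj C s) \<cdot> s"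
      using s A vcomp_assoc[of Y Z Y Z s "adj C s" s] by (simp flip: m(1))
    also have "\<dots> = m' *\<^sub>C s"
      using s A unfolding m(2) by (simp add: vcomp_scaleC_left[of Y Z Z] id2_closed vcomp_id_left[of Y Z])
    finally have "m = m'"
      using False by simp
    moreover have "m \<noteq> 0"
      using m False star_proper[OF s] by auto
    ultimately show ?thesis
      using m False by auto
  qed
qed

end

lemma (in conjugate_pair) simple_conjugate:
  assumes "simple_arrow C X"
  shows "simple_arrow C X'"
proof -
  have "\<exists>k. b = k *\<^sub>C \<one> X'" if b: "b \<in> Hom C X' X'" for b
  proof -
    obtain a where a: "a \<in> Hom C X X" "bullet a = b"
      using bullet_surj[OF b] by auto
    obtain k where "a = k *\<^sub>C \<one> X"
      using simple_scalar[OF assms a(1)] by auto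
    then show ?thesis
      using a bullet_scale[of "\<one> X" k] bullet_one by (auto simp: id2_closed)
  qed
  then show ?thesis
    using Hom_scale[of X' X'] by (auto simp: simple_arrow_def scalars_def id2_closed)
qed

context two_C_star_category
begin

lemma whiskered_square_left:
  assumes "cell R" "cell S" "W \<in> Arr C" "tgt C (cdom S) = src C W" "ccod R = W \<otimes>\<^sub>1 cdom S"
  shows "st R \<bullet> ((idc W \<star> (st S \<bullet> S)) \<bullet> R) = st ((idc W \<star> S) \<bullet> R) \<bullet> ((idc W \<star> S) \<bullet> R)"
proof -
  have "idc W \<star> (st S \<bullet> S) = (idc W \<star> st S) \<bullet> (idc W \<star> S)"
    using assms by (simp add: typing hc_vc vc_id)
  then show ?thesis
    using assms by (simp add: typing st_vc st_hc st_idc vc_assoc)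
qed

lemma whiskered_square_right:
  assumes "cell R" "cell S" "W \<in> Arr C" "tgt C W = src C (cdom S)" "ccod R = cdom S \<otimes>\<^sub>1 W"
  shows "st R \<bullet> (((st S \<bullet> S) \<star> idc W) \<bullet> R) = st ((S \<star> idc W) \<bullet> R) \<bullet> ((S \<star> idc W) \<bullet> R)"
proof -
  have "(st S \<bullet> S) \<star> idc W = (st S \<star> idc W) \<bullet> (S \<star> idc W)"
    using assms by (simp add: typing hc_vc vc_id)
  then show ?thesis
    using assms by (simp add: typing st_vc st_hc st_idc vc_assoc)
qed

text \<open>Whiskering by a central element is natural, so \<open>s\<close> intertwines its actions
  on \<open>Y\<close> and \<open>Z\<close>, and a nonzero \<open>s\<close> forces equal
  scalars.\<close>

lemma center_transport:
  assumes YZ: "parallel C Y Z" "s \<in> Hom C Y Z" "s \<noteq> 0" and Z: "simple_arrow C Z"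
    and z: "z \<in> object_center C (src C Y)" and a: "\<one> Y \<otimes> z = a *\<^sub>C \<one> Y"
  shows "\<one> Z \<otimes> z = a *\<^sub>C \<one> Z"
proof -
  note A = parallel_Arr[OF YZ(1)]
  have "src C Z = src C Y"
    using YZ(1) by (simp add: parallel_def)
  then have zZ: "\<one> Z \<otimes> z \<in> Hom C Z Z"
    using whisker_center_closed[OF A(2)] z by simp
  obtain b where b: "\<one> Z \<otimes> z = b *\<^sub>C \<one> Z"
    using simple_scalar[OF Z zZ] by auto
  have "b *\<^sub>C s = (\<one> Z \<otimes> z) \<cdot> s"
    unfolding b using YZ A by (simp add: vcomp_scaleC_left[of Y Z Z] id2_closed vcomp_id_left[of Y Z])
  also have "\<dots> = s \<cdot> (\<one> Y \<otimes> z)"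
    using whisker_center_natural[OF A(1) z YZ(1,2)] by simp
  also have "\<dots> = a *\<^sub>C s"
    unfolding a using YZ A by (simp add: vcomp_scaleC_right[of Y Y Z] id2_closed vcomp_id_right[of Y Z])
  finally show ?thesis
    using b YZ(3) by simp
qed

lemma conjugate_solution_square:
  assumes "conjugate_solution C Y Y' r r'"
  shows "adj C r \<cdot> r \<in> object_center C (src C Y)" "adj C r' \<cdot> r' \<in> object_center C (tgt C Y)"
proof -
  have Y: "Y \<in> Arr C" "Y' \<in> Arr C" "src C Y' = tgt C Y" "tgt C Y' = src C Y"
    and r: "r \<in> Hom C (\<I> (src C Y)) (Y' \<otimes>\<^sub>1 Y)" "r' \<in> Hom C (\<I> (tgt C Y)) (Y \<otimes>\<^sub>1 Y')"
    using assms by (auto simp: conjugate_solution_def)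
  have p: "parallel C (\<I> (src C Y)) (Y' \<otimes>\<^sub>1 Y)" "parallel C (\<I> (tgt C Y)) (Y \<otimes>\<^sub>1 Y')"
    using Y by (auto simp: parallel_def arr_simps)
  show "adj C r \<cdot> r \<in> object_center C (src C Y)" "adj C r' \<cdot> r' \<in> object_center C (tgt C Y)"
    unfolding object_center_def
    using vcomp_closed[OF p(1) parallel_sym[OF p(1)] r(1) adj_closed[OF p(1) r(1)]]
      vcomp_closed[OF p(2) parallel_sym[OF p(2)] r(2) adj_closed[OF p(2) r(2)]] by auto
qed

text \<open>Let \<open>T\<close> be the mate of \<open>s\<close>, and let \<open>m\<close> and
  \<open>c\<close> be the scalars of their squares. Moving \<open>s\<close> through \<open>r\<close>
  and its adjoint through \<open>q'\<close> gives \<open>m r^* r = c q^* q\<close> and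
  \<open>m q'^* q' = c r'^* r'\<close>. Normalization turns these into \<open>m a = c b\<close> and
  \<open>m b = c a\<close> for the two squared norms \<open>a\<close> and \<open>b\<close>;
  eliminating \<open>c\<close> with \<open>m\<close> nonzero gives \<open>a = b\<close>.\<close>

lemma simple_norm_unique:
  assumes Y: "simple_arrow C Y" and Z: "simple_arrow C Z" and s: "parallel C Y Z" "s \<in> Hom C Y Z" "s \<noteq> 0"
    and r: "normalized_solution C Y Y' r r'" and q: "normalized_solution C Z Z' q q'"
  shows "norm (\<one> Y \<otimes> r) = norm (\<one> Z \<otimes> q)"
proof -
  define N M where NM: "N = src C Y" "M = tgt C Y"
  have NM': "N = src C Z" "M = tgt C Z"
    using s(1) NM by (auto simp: parallel_def)
  have sr: "conjugate_solution C Y Y' r r'" and sq: "conjugate_solution C Z Z' q q'"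
    using r q by (auto simp: normalized_solution_def)
  let ?r = "Cell (\<I> N) r (Y' \<otimes>\<^sub>1 Y)" and ?r' = "Cell (\<I> M) r' (Y \<otimes>\<^sub>1 Y')"
  let ?q = "Cell (\<I> N) q (Z' \<otimes>\<^sub>1 Z)" and ?q' = "Cell (\<I> M) q' (Z \<otimes>\<^sub>1 Z')"
  interpret P: conjugate_pair C N M Y Y' ?r ?r'
    using sr NM by (intro conjugate_solution_pair two_C_star_category_axioms)
  interpret Q: conjugate_pair C N M Z Z' ?q ?q'
    using sq NM' by (intro conjugate_solution_pair two_C_star_category_axioms)
  interpret PQ: conjugate_pairs C N M Y Y' Z Z' ?r ?r' ?q ?q' ..
  interpret h: two_C_star_category "hop C"
    by (rule hop_category)
  let ?s = "Cell Y s Z"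
  have sc: "cell ?s"
    using s by (intro cellI)
  obtain T where T: "PQ.mates ?s T"
    using PQ.mate_exists[OF sc] by auto
  have Tc [simp]: "cell T" "cdom T = Z'" "ccod T = Y'"
    and E1: "(idc Y' \<star> ?s) \<bullet> ?r = (T \<star> idc Z) \<bullet> ?q"
    using T by (auto simp: PQ.mates_def)
  have E2: "(st ?s \<star> idc Z') \<bullet> ?q' = (idc Y \<star> st T) \<bullet> ?r'"
    by (rule PQ.mates_right[OF T])
  let ?t = "cval T"
  have t: "parallel C Z' Y'" "?t \<in> Hom C Z' Y'"
    using Tc(1) unfolding cell_def Tc(2,3) by auto
  obtain m where m: "adj C s \<cdot> s = m *\<^sub>C \<one> Y" "s \<cdot> adj C s = m *\<^sub>C \<one> Z" "m \<noteq> 0"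
    using simple_intertwiner[OF Y Z s(1,2)] s(3) by auto
  obtain c where c: "adj C ?t \<cdot> ?t = c *\<^sub>C \<one> Z'" "?t \<cdot> adj C ?t = c *\<^sub>C \<one> Y'"
    using simple_intertwiner[OF Q.simple_conjugate[OF Z] P.simple_conjugate[OF Y] t] by auto
  have "st ?r \<bullet> ((idc Y' \<star> (st ?s \<bullet> ?s)) \<bullet> ?r) = st ((idc Y' \<star> ?s) \<bullet> ?r) \<bullet> ((idc Y' \<star> ?s) \<bullet> ?r)"
    using sc by (intro whiskered_square_left) simp_all
  also have "\<dots> = st ?q \<bullet> (((st T \<bullet> T) \<star> idc Z) \<bullet> ?q)"
    unfolding E1 by (intro whiskered_square_right[symmetric]) simp_all
  finally have "adj C r \<cdot> ((\<one> Y' \<otimes> (adj C s \<cdot> s)) \<cdot> r) = adj C q \<cdot> (((adj C ?t \<cdot> ?t) \<otimes> \<one> Z) \<cdot> q)"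
    by (auto dest!: arg_cong[of _ _ cval])
  moreover have "adj C r \<cdot> ((\<one> Y' \<otimes> (m *\<^sub>C \<one> Y)) \<cdot> r) = m *\<^sub>C (adj C r \<cdot> r)"
    using P.cval_r by (simp add: hcomp_scaleC_right[of Y Y Y' Y'] id2_closed vcomp_scaleC_left[of "\<I> N" "Y' \<otimes>\<^sub>1 Y" "Y' \<otimes>\<^sub>1 Y"]
      vcomp_scaleC_right[of "\<I> N" "Y' \<otimes>\<^sub>1 Y" "\<I> N"] hcomp_id2 vcomp_id_left[of "\<I> N" "Y' \<otimes>\<^sub>1 Y"] P.adj_H arr_simps)
  moreover have "adj C q \<cdot> (((c *\<^sub>C \<one> Z') \<otimes> \<one> Z) \<cdot> q) = c *\<^sub>C (adj C q \<cdot> q)"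
    using Q.cval_r by (simp add: hcomp_scaleC_left[of Z Z Z' Z'] id2_closed vcomp_scaleC_left[of "\<I> N" "Z' \<otimes>\<^sub>1 Z" "Z' \<otimes>\<^sub>1 Z"]
      vcomp_scaleC_right[of "\<I> N" "Z' \<otimes>\<^sub>1 Z" "\<I> N"] hcomp_id2 vcomp_id_left[of "\<I> N" "Z' \<otimes>\<^sub>1 Z"] Q.adj_H arr_simps)
  ultimately have F1: "m *\<^sub>C (adj C r \<cdot> r) = c *\<^sub>C (adj C q \<cdot> q)"
    by (simp add: m c)
  have "st ?q' \<bullet> (((?s \<bullet> st ?s) \<star> idc Z') \<bullet> ?q') = st ((st ?s \<star> idc Z') \<bullet> ?q') \<bullet> ((st ?s \<star> idc Z') \<bullet> ?q')"
    using whiskered_square_right[of ?q' "st ?s" Z'] sc by (simp add: st_st typing)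
  also have "\<dots> = st ?r' \<bullet> ((idc Y \<star> (T \<bullet> st T)) \<bullet> ?r')"
    unfolding E2 using whiskered_square_left[of ?r' "st T" Y] by (simp add: st_st typing)
  finally have "adj C q' \<cdot> (((s \<cdot> adj C s) \<otimes> \<one> Z') \<cdot> q') = adj C r' \<cdot> ((\<one> Y \<otimes> (?t \<cdot> adj C ?t)) \<cdot> r')"
    by (auto dest!: arg_cong[of _ _ cval])
  moreover have "adj C q' \<cdot> (((m *\<^sub>C \<one> Z) \<otimes> \<one> Z') \<cdot> q') = m *\<^sub>C (adj C q' \<cdot> q')"
    using Q.cval_r' adj_closed[OF Q.parallel_r'(2) Q.cval_r'] parallel_sym[OF Q.parallel_r'(2)]
    by (simp add: hcomp_scaleC_left[of Z' Z' Z Z] id2_closed vcomp_scaleC_left[of "\<I> M" "Z \<otimes>\<^sub>1 Z'" "Z \<otimes>\<^sub>1 Z'"]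
      vcomp_scaleC_right[of "\<I> M" "Z \<otimes>\<^sub>1 Z'" "\<I> M"] hcomp_id2 vcomp_id_left[of "\<I> M" "Z \<otimes>\<^sub>1 Z'"] arr_simps)
  moreover have "adj C r' \<cdot> ((\<one> Y \<otimes> (c *\<^sub>C \<one> Y')) \<cdot> r') = c *\<^sub>C (adj C r' \<cdot> r')"
    using P.cval_r' adj_closed[OF P.parallel_r'(2) P.cval_r'] parallel_sym[OF P.parallel_r'(2)]
    by (simp add: hcomp_scaleC_right[of Y' Y' Y Y] id2_closed vcomp_scaleC_left[of "\<I> M" "Y \<otimes>\<^sub>1 Y'" "Y \<otimes>\<^sub>1 Y'"]
      vcomp_scaleC_right[of "\<I> M" "Y \<otimes>\<^sub>1 Y'" "\<I> M"] hcomp_id2 vcomp_id_left[of "\<I> M" "Y \<otimes>\<^sub>1 Y'"] arr_simps)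
  ultimately have F2: "m *\<^sub>C (adj C q' \<cdot> q') = c *\<^sub>C (adj C r' \<cdot> r')"
    by (simp add: m c)
  let ?a = "complex_of_real ((norm (\<one> Y \<otimes> r))\<^sup>2)" and ?b = "complex_of_real ((norm (\<one> Z \<otimes> q))\<^sup>2)"
  have Zn: "\<one> Z \<noteq> 0"
  proof
    assume "\<one> Z = 0"
    then show False
      using s vcomp_id_left[OF s(1,2)] vcomp_zero_left[of Y Z Z s] parallel_Arr[OF s(1)] by simp
  qed
  note sqr = conjugate_solution_square[OF sr] and sqq = conjugate_solution_square[OF sq]
  have "\<one> Y \<otimes> (adj C r \<cdot> r) = ?a *\<^sub>C \<one> Y"
    using Y sr by (intro simple_square) (auto simp: conjugate_solution_def)
  then have L1: "\<one> Z \<otimes> (adj C r \<cdot> r) = ?a *\<^sub>C \<one> Z"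
    by (intro center_transport[OF s Z sqr(1)])
  have L2: "\<one> Z \<otimes> (adj C q \<cdot> q) = ?b *\<^sub>C \<one> Z"
    using Z sq by (intro simple_square) (auto simp: conjugate_solution_def)
  have "(adj C r' \<cdot> r') \<otimes> \<one> Y = complex_of_real ((norm (r' \<otimes> \<one> Y))\<^sup>2) *\<^sub>C \<one> Y"
    using h.simple_square[of Y Y' r'] Y sr by (auto simp: conjugate_solution_def)
  also have "norm (r' \<otimes> \<one> Y) = norm (\<one> Y \<otimes> r)"
    using r by (simp add: normalized_solution_def)
  finally have R1: "(adj C r' \<cdot> r') \<otimes> \<one> Z = ?a *\<^sub>C \<one> Z"
    using h.center_transport[of Y Z s "adj C r' \<cdot> r'" ?a] s Z sqr(2) by simp
  have "(adj C q' \<cdot> q') \<otimes> \<one> Z = complex_of_real ((norm (q' \<otimes> \<one> Z))\<^sup>2) *\<^sub>C \<one> Z"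
    using h.simple_square[of Z Z' q'] Z sq by (auto simp: conjugate_solution_def)
  also have "norm (q' \<otimes> \<one> Z) = norm (\<one> Z \<otimes> q)"
    using q by (simp add: normalized_solution_def)
  finally have R2: "(adj C q' \<cdot> q') \<otimes> \<one> Z = ?b *\<^sub>C \<one> Z" .
  have sZ: "src C Z = src C Y" "tgt C Z = tgt C Y" "Z \<in> Arr C"
    using s(1) by (auto simp: parallel_def)
  have ab: "m * ?a = c * ?b"
    using arg_cong[OF F1, of "\<lambda>z. \<one> Z \<otimes> z"] sqr(1) sqq(1) sZ L1 L2 Zn
      whisker_center_linear(2)[of Z "adj C r \<cdot> r" m] whisker_center_linear(2)[of Z "adj C q \<cdot> q" c]
    by (simp add: scaleC_scaleC)
  have ba: "m * ?b = c * ?a"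
    using arg_cong[OF F2, of "\<lambda>z. z \<otimes> \<one> Z"] sqr(2) sqq(2) sZ R1 R2 Zn
      h.whisker_center_linear(2)[of Z "adj C r' \<cdot> r'" c] h.whisker_center_linear(2)[of Z "adj C q' \<cdot> q'" m]
    by (simp add: scaleC_scaleC)
  have "m * (?a * ?a) = (m * ?a) * ?a"
    by (simp only: mult.assoc)
  also have "\<dots> = (c * ?a) * ?b"
    unfolding ab by (simp only: mult_ac)
  also have "\<dots> = m * (?b * ?b)"
    unfolding ba[symmetric] by (simp only: mult.assoc)
  finally have "m * (?a * ?a) = m * (?b * ?b)" .
  then have "((norm (\<one> Y \<otimes> r))\<^sup>2)\<^sup>2 = ((norm (\<one> Z \<otimes> q))\<^sup>2)\<^sup>2"
    using m(3) by (simp add: power2_eq_square flip: of_real_mult)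
  then show ?thesis
    by (simp add: power_eq_iff_eq_base)
qed

end

section \<open>Dimensions of factorial 1-arrows\<close>

context two_C_star_category
begin

text \<open>If the unit 2-arrow of \<open>Y\<close> vanishes, so does that of
  \<open>W \<otimes>\<^sub>1 Y\<close>, and with it every 2-arrow into this composite.\<close>

lemma zero_arrow_solution:
  assumes Y: "Y \<in> Arr C" "\<one> Y = 0" and W: "W \<in> Arr C" "src C W = tgt C Y" "tgt C W = src C Y"
    and r: "r \<in> Hom C (\<I> (src C Y)) (W \<otimes>\<^sub>1 Y)"
  shows "r = 0"
proof -
  have "\<one> (W \<otimes>\<^sub>1 Y) = 0"
    using hcomp_id2[of Y W] hcomp_zero_right[of Y Y W W "\<one> W"] Y W by (simp add: id2_closed)
  moreover have p: "parallel C (\<I> (src C Y)) (W \<otimes>\<^sub>1 Y)"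
    using Y W by (simp add: parallel_def arr_simps)
  ultimately show ?thesis
    using vcomp_id_left[OF p r] vcomp_zero_left[OF p parallel_simps[OF parallel_Arr(2)[OF p]] r] by simp
qed

lemma left_inverse_map_one:
  assumes Y: "Y \<in> Arr C" and W: "W \<in> Arr C" "src C W = tgt C Y" "tgt C W = src C Y"
    and r: "r \<in> Hom C (\<I> (src C Y)) (W \<otimes>\<^sub>1 Y)"
  shows "left_inverse_map C W r (\<one> Y) = adj C r \<cdot> r"
proof -
  have p: "parallel C (\<I> (src C Y)) (W \<otimes>\<^sub>1 Y)"
    using Y W by (simp add: parallel_def arr_simps)
  then show ?thesis
    using hcomp_id2[of Y W] Y W vcomp_id_right[OF parallel_sym[OF p] adj_closed[OF p r]]
    by (simp add: left_inverse_map_def)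
qed

lemma left_inverse_map_scale:
  assumes Y: "Y \<in> Arr C" and W: "W \<in> Arr C" "src C W = tgt C Y" "tgt C W = src C Y"
    and r: "r \<in> Hom C (\<I> (src C Y)) (W \<otimes>\<^sub>1 Y)" and t: "t \<in> Hom C Y Y"
  shows "left_inverse_map C W r (k *\<^sub>C t) = k *\<^sub>C left_inverse_map C W r t"
proof -
  let ?WY = "W \<otimes>\<^sub>1 Y"
  have p: "parallel C (\<I> (src C Y)) ?WY" "?WY \<in> Arr C"
    using Y W by (simp_all add: parallel_def arr_simps)
  have t': "\<one> W \<otimes> t \<in> Hom C ?WY ?WY"
    using Hom_I[of "idc W \<star> Cell Y t Y" ?WY ?WY] cellI[of Y Y t] Y W t by (simp add: typing)
  note ra = adj_closed[OF p(1) r] parallel_sym[OF p(1)]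
  show ?thesis
    unfolding left_inverse_map_def
    using hcomp_scaleC_right[of Y Y W W t "\<one> W" k] Y W t t' p ra r
      vcomp_scaleC_right[of ?WY ?WY "\<I> (src C Y)" "\<one> W \<otimes> t" "adj C r" k]
      vcomp_scaleC_left[of "\<I> (src C Y)" ?WY "\<I> (src C Y)" r "adj C r \<cdot> (\<one> W \<otimes> t)" k]
      vcomp_closed[of ?WY ?WY "\<I> (src C Y)" "\<one> W \<otimes> t" "adj C r"]
    by (simp add: id2_closed)
qed

text \<open>The 2-arrows \<open>adj C (w j) \<cdot> s \<cdot> u h\<close> between constituents have
  scalar squares \<open>c h j\<close>, and unitarity of \<open>s\<close> makes the row and column
  sums of \<open>c\<close> equal to 1. So the sum of \<open>k\<close> is the sum of all
  \<open>k h * c h j\<close>, where \<open>k h\<close> may be replaced by \<open>l j\<close>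
  wherever \<open>c h j\<close> is nonzero.\<close>

lemma simple_decompositions_agree:
  fixes k l :: "nat \<Rightarrow> real"
  assumes Y: "\<And>h. h < n \<Longrightarrow> simple_arrow C (Y h) \<and> isometry C (Y h) S (u h)"
    and uu: "(\<Sum>h<n. u h \<cdot> adj C (u h)) = \<one> S"
    and Z: "\<And>j. j < m \<Longrightarrow> simple_arrow C (Z j) \<and> isometry C (Z j) T (w j)"
    and ww: "(\<Sum>j<m. w j \<cdot> adj C (w j)) = \<one> T"
    and s: "isometry C S T s" "s \<cdot> adj C s = \<one> T"
    and k0: "\<And>h. h < n \<Longrightarrow> \<one> (Y h) = 0 \<Longrightarrow> k h = 0" and l0: "\<And>j. j < m \<Longrightarrow> \<one> (Z j) = 0 \<Longrightarrow> l j = 0"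
    and kl: "\<And>h j t. h < n \<Longrightarrow> j < m \<Longrightarrow> parallel C (Y h) (Z j) \<Longrightarrow> t \<in> Hom C (Y h) (Z j) \<Longrightarrow> t \<noteq> 0 \<Longrightarrow> k h = l j"
  shows "(\<Sum>h<n. k h) = (\<Sum>j<m. l j)"
proof -
  have U: "isometry C (Y h) S (u h)" if "h < n" for h
    using Y that by auto
  have W: "isometry C (Z j) T (w j)" if "j < m" for j
    using Z that by auto
  note U' = isometryD[OF U] and W' = isometryD[OF W] and s' = isometryD[OF s(1)]
  define t where "t h j = adj C (w j) \<cdot> s \<cdot> u h" for h j
  let ?u = "\<lambda>h. Cell (Y h) (u h) S" and ?w = "\<lambda>j. Cell (Z j) (w j) T" and ?s = "Cell S s T"
  have uc: "cell (?u h)" if "h < n" for h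
    using U'[OF that] by (intro cellI)
  have wc: "cell (?w j)" if "j < m" for j
    using W'[OF that] by (intro cellI)
  have sc: "cell ?s"
    using s' by (intro cellI)
  have pt: "parallel C (Y h) (Z j)" if "h < n" "j < m" for h j
    using U'(1)[OF that(1)] W'(1)[OF that(2)] s'(1) by (simp add: parallel_def)
  have t: "t h j \<in> Hom C (Y h) (Z j)" if "h < n" "j < m" for h j
    using Hom_I[of "st (?w j) \<bullet> ?s \<bullet> ?u h" "Y h" "Z j"] uc[OF that(1)] wc[OF that(2)] sc
    by (simp add: typing t_def)
  have "\<exists>c. adj C (t h j) \<cdot> t h j = c *\<^sub>C \<one> (Y h) \<and> t h j \<cdot> adj C (t h j) = c *\<^sub>C \<one> (Z j) \<and> (c = 0 \<longleftrightarrow> t h j = 0)"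
    if "h < n" "j < m" for h j
    using simple_intertwiner[of "Y h" "Z j" "t h j"] pt[OF that] t[OF that] Y Z that by blast
  then obtain c where c: "\<And>h j. h < n \<Longrightarrow> j < m \<Longrightarrow> adj C (t h j) \<cdot> t h j = c h j *\<^sub>C \<one> (Y h) \<and>
      t h j \<cdot> adj C (t h j) = c h j *\<^sub>C \<one> (Z j) \<and> (c h j = 0 \<longleftrightarrow> t h j = 0)"
    by metis
  have row: "(\<Sum>j<m. adj C (t h j) \<cdot> t h j) = \<one> (Y h)" if h: "h < n" for h
  proof -
    let ?su = "s \<cdot> u h"
    have su: "?su \<in> Hom C (Y h) T" "parallel C (Y h) T"
      using U'[OF h] s' parallel_trans[of "Y h" S T] by (auto intro: vcomp_closed[of "Y h" S T])
    have wwT: "w j \<cdot> adj C (w j) \<in> Hom C T T" if "j < m" for j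
      using W'[OF that] by (auto intro: vcomp_closed[of T "Z j" T])
    have e: "adj C (t h j) \<cdot> t h j = adj C ?su \<cdot> ((w j \<cdot> adj C (w j)) \<cdot> ?su)" if j: "j < m" for j
    proof -
      have "st (st (?w j) \<bullet> ?s \<bullet> ?u h) \<bullet> (st (?w j) \<bullet> ?s \<bullet> ?u h) = st (?s \<bullet> ?u h) \<bullet> ((?w j \<bullet> st (?w j)) \<bullet> (?s \<bullet> ?u h))"
        using uc[OF h] wc[OF j] sc by (simp add: typing st_vc st_st vc_assoc)
      then show ?thesis
        by (auto simp: t_def dest!: arg_cong[of _ _ cval])
    qed
    have asu: "adj C ?su \<in> Hom C T (Y h)" "parallel C T (Y h)"
      using adj_closed[OF su(2,1)] parallel_sym[OF su(2)] by auto
    have "(\<Sum>j<m. adj C (t h j) \<cdot> t h j) = (\<Sum>j<m. adj C ?su \<cdot> ((w j \<cdot> adj C (w j)) \<cdot> ?su))"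
      using e by simp
    also have "\<dots> = adj C ?su \<cdot> (\<Sum>j<m. (w j \<cdot> adj C (w j)) \<cdot> ?su)"
      using wwT su asu s' by (intro vcomp_sum_right[of "Y h" T "Y h", symmetric]) (auto intro: vcomp_closed[of "Y h" T T])
    also have "(\<Sum>j<m. (w j \<cdot> adj C (w j)) \<cdot> ?su) = (\<Sum>j<m. w j \<cdot> adj C (w j)) \<cdot> ?su"
      using wwT su s' by (intro vcomp_sum_left[of "Y h" T T, symmetric]) auto
    also have "\<dots> = ?su"
      using ww su vcomp_id_left by simp
    also have "adj C ?su \<cdot> ?su = \<one> (Y h)"
    proof -
      have ss: "st ?s \<bullet> ?s = idc S" and uu: "st (?u h) \<bullet> ?u h = idc (Y h)"
        using s' U'[OF h] by (auto intro!: cell_eqI)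
      have "st (?s \<bullet> ?u h) \<bullet> (?s \<bullet> ?u h) = st (?u h) \<bullet> ((st ?s \<bullet> ?s) \<bullet> ?u h)"
        using uc[OF h] sc by (simp add: typing st_vc vc_assoc)
      also have "\<dots> = idc (Y h)"
        using uc[OF h] by (simp add: ss uu vc_id)
      finally show ?thesis
        by (auto dest!: arg_cong[of _ _ cval])
    qed
    finally show ?thesis .
  qed
  have col: "(\<Sum>h<n. t h j \<cdot> adj C (t h j)) = \<one> (Z j)" if j: "j < m" for j
  proof -
    let ?sw = "adj C s \<cdot> w j"
    have sw: "?sw \<in> Hom C (Z j) S" "parallel C (Z j) S"
      using W'[OF j] s' parallel_trans[of "Z j" T S] by (auto intro: vcomp_closed[of "Z j" T S])
    have uuS: "u h \<cdot> adj C (u h) \<in> Hom C S S" if "h < n" for h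
      using U'[OF that] by (auto intro: vcomp_closed[of S "Y h" S])
    have e: "t h j \<cdot> adj C (t h j) = adj C ?sw \<cdot> ((u h \<cdot> adj C (u h)) \<cdot> ?sw)" if h: "h < n" for h
    proof -
      have "(st (?w j) \<bullet> ?s \<bullet> ?u h) \<bullet> st (st (?w j) \<bullet> ?s \<bullet> ?u h) = st (st ?s \<bullet> ?w j) \<bullet> ((?u h \<bullet> st (?u h)) \<bullet> (st ?s \<bullet> ?w j))"
        using uc[OF h] wc[OF j] sc by (simp add: typing st_vc st_st vc_assoc)
      then show ?thesis
        by (auto simp: t_def dest!: arg_cong[of _ _ cval])
    qed
    have asw: "adj C ?sw \<in> Hom C S (Z j)" "parallel C S (Z j)"
      using adj_closed[OF sw(2,1)] parallel_sym[OF sw(2)] by auto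
    have "(\<Sum>h<n. t h j \<cdot> adj C (t h j)) = (\<Sum>h<n. adj C ?sw \<cdot> ((u h \<cdot> adj C (u h)) \<cdot> ?sw))"
      using e by simp
    also have "\<dots> = adj C ?sw \<cdot> (\<Sum>h<n. (u h \<cdot> adj C (u h)) \<cdot> ?sw)"
      using uuS sw asw s' by (intro vcomp_sum_right[of "Z j" S "Z j", symmetric]) (auto intro: vcomp_closed[of "Z j" S S])
    also have "(\<Sum>h<n. (u h \<cdot> adj C (u h)) \<cdot> ?sw) = (\<Sum>h<n. u h \<cdot> adj C (u h)) \<cdot> ?sw"
      using uuS sw s' by (intro vcomp_sum_left[of "Z j" S S, symmetric]) auto
    also have "\<dots> = ?sw"
      using uu sw vcomp_id_left by simp
    also have "adj C ?sw \<cdot> ?sw = \<one> (Z j)"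
    proof -
      have ss: "?s \<bullet> st ?s = idc T" and wj: "st (?w j) \<bullet> ?w j = idc (Z j)"
        using s' s(2) W'[OF j] by (auto intro!: cell_eqI)
      have "st (st ?s \<bullet> ?w j) \<bullet> (st ?s \<bullet> ?w j) = st (?w j) \<bullet> ((?s \<bullet> st ?s) \<bullet> ?w j)"
        using wc[OF j] sc by (simp add: typing st_vc st_st vc_assoc)
      also have "\<dots> = idc (Z j)"
        using wc[OF j] by (simp add: ss wj vc_id)
      finally show ?thesis
        by (auto dest!: arg_cong[of _ _ cval])
    qed
    finally show ?thesis .
  qed
  \<comment> \<open>For a zero constituent the row sum is undetermined, but then \<open>k h\<close>
    is 0.\<close>
  have k: "complex_of_real (k h) = (\<Sum>j<m. complex_of_real (k h) * c h j)" if h: "h < n" for h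
  proof (cases "\<one> (Y h) = 0")
    case False
    have "(\<Sum>j<m. c h j) *\<^sub>C \<one> (Y h) = (\<Sum>j<m. adj C (t h j) \<cdot> t h j)"
      unfolding complex_vs.scale_sum_left using c h by (intro sum.cong) auto
    then have "(\<Sum>j<m. c h j) *\<^sub>C \<one> (Y h) = 1 *\<^sub>C \<one> (Y h)"
      using row[OF h] by simp
    then have "(\<Sum>j<m. c h j) = 1"
      using False complex_vs.scale_right_imp_eq by blast
    then show ?thesis
      by (simp flip: sum_distrib_left)
  qed (use k0 h in simp)
  have l: "complex_of_real (l j) = (\<Sum>h<n. complex_of_real (l j) * c h j)" if j: "j < m" for j
  proof (cases "\<one> (Z j) = 0")
    case False
    have "(\<Sum>h<n. c h j) *\<^sub>C \<one> (Z j) = (\<Sum>h<n. t h j \<cdot> adj C (t h j))"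
      unfolding complex_vs.scale_sum_left using c j by (intro sum.cong) auto
    then have "(\<Sum>h<n. c h j) *\<^sub>C \<one> (Z j) = 1 *\<^sub>C \<one> (Z j)"
      using col[OF j] by simp
    then have "(\<Sum>h<n. c h j) = 1"
      using False complex_vs.scale_right_imp_eq by blast
    then show ?thesis
      by (simp flip: sum_distrib_left)
  qed (use l0 j in simp)
  have "complex_of_real (\<Sum>h<n. k h) = (\<Sum>h<n. \<Sum>j<m. complex_of_real (k h) * c h j)"
    using k by simp
  also have "\<dots> = (\<Sum>h<n. \<Sum>j<m. complex_of_real (l j) * c h j)"
  proof (intro sum.cong refl)
    fix h j assume hj: "h \<in> {..<n}" "j \<in> {..<m}"
    show "complex_of_real (k h) * c h j = complex_of_real (l j) * c h j"
    proof (cases "t h j = 0")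
      case True
      then show ?thesis
        using c[of h j] hj by simp
    next
      case False
      then show ?thesis
        using kl[of h j "t h j"] pt[of h j] t[of h j] hj by simp
    qed
  qed
  also have "\<dots> = (\<Sum>j<m. \<Sum>h<n. complex_of_real (l j) * c h j)"
    by (rule sum.swap)
  also have "\<dots> = complex_of_real (\<Sum>j<m. l j)"
    using l by simp
  finally show ?thesis
    using of_real_eq_iff by blast
qed

lemma object_center_scale: "N \<in> Ob C \<Longrightarrow> z \<in> object_center C N \<Longrightarrow> k *\<^sub>C z \<in> object_center C N"
  unfolding object_center_def by (rule Hom_scale) (auto simp: arr_simps)

lemma tensor_isometry_Hom:
  assumes u: "isometry C A Y u" and u': "isometry C A' Y' u'" and Y': "src C Y' = tgt C Y" "tgt C Y' = src C Y"
    and x: "x \<in> Hom C (\<I> (src C Y)) (A' \<otimes>\<^sub>1 A)"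
  shows "(u' \<otimes> u) \<cdot> x \<in> Hom C (\<I> (src C Y)) (Y' \<otimes>\<^sub>1 Y)"
proof -
  note U = isometryD[OF u] and U' = isometryD[OF u']
  define N where N: "N = src C Y"
  have "N \<in> Ob C" "src C A = N" "tgt C A' = N" "src C A' = tgt C A" "tgt C Y = tgt C A"
    using U(1) U'(1) Y' by (auto simp: N parallel_def arr_simps)
  moreover from this have "cell (Cell (\<I> N) x (A' \<otimes>\<^sub>1 A))"
    using x U U' by (intro cellI) (auto simp: parallel_def N[symmetric] arr_simps)
  ultimately show ?thesis
    using Hom_I[of "(Cell A' u' Y' \<star> Cell A u Y) \<bullet> Cell (\<I> N) x (A' \<otimes>\<^sub>1 A)" "\<I> N" "Y' \<otimes>\<^sub>1 Y"]
      cellI[OF U'(1,2)] cellI[OF U(1,2)] U U' Y' by (simp add: typing N[symmetric])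
qed

lemma standard_factorial_Hom:
  assumes "standard_solution_factorial C Y Y' r r'"
  shows "r \<in> Hom C (\<I> (src C Y)) (Y' \<otimes>\<^sub>1 Y)" "r' \<in> Hom C (\<I> (tgt C Y)) (Y \<otimes>\<^sub>1 Y')"
proof -
  interpret h: two_C_star_category "hop C"
    by (rule hop_category)
  have Y: "Y \<in> Arr C" "Y' \<in> Arr C" "src C Y' = tgt C Y" "tgt C Y' = src C Y"
    using assms by (auto simp: standard_solution_factorial_def factorial_arrow_def)
  obtain n :: nat and Yh Yh' u u' rh rh' where
    s: "\<And>h. h < n \<Longrightarrow> isometry C (Yh h) Y (u h)" "\<And>h. h < n \<Longrightarrow> isometry C (Yh' h) Y' (u' h)"
      "\<And>h. h < n \<Longrightarrow> normalized_solution C (Yh h) (Yh' h) (rh h) (rh' h)"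
    and r: "r = (\<Sum>h<n. (u' h \<otimes> u h) \<cdot> rh h)" "r' = (\<Sum>h<n. (u h \<otimes> u' h) \<cdot> rh' h)"
    using assms unfolding standard_solution_factorial_def by blast
  have rh: "rh h \<in> Hom C (\<I> (src C Y)) (Yh' h \<otimes>\<^sub>1 Yh h)" "rh' h \<in> Hom C (\<I> (tgt C Y)) (Yh h \<otimes>\<^sub>1 Yh' h)" if "h < n" for h
    using s(3)[OF that] isometryD(1)[OF s(1)[OF that]] by (auto simp: normalized_solution_def conjugate_solution_def parallel_def)
  have p: "parallel C (\<I> (src C Y)) (Y' \<otimes>\<^sub>1 Y)" "parallel C (\<I> (tgt C Y)) (Y \<otimes>\<^sub>1 Y')"
    using Y by (simp_all add: parallel_def arr_simps)
  show "r \<in> Hom C (\<I> (src C Y)) (Y' \<otimes>\<^sub>1 Y)"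
    unfolding r using tensor_isometry_Hom[OF s(1,2) Y(3,4) rh(1)] by (intro Hom_sum[OF p(1)]) auto
  show "r' \<in> Hom C (\<I> (tgt C Y)) (Y \<otimes>\<^sub>1 Y')"
    unfolding r
  proof (intro Hom_sum[OF p(2)])
    fix h assume "h \<in> {..<n}"
    then show "(u h \<otimes> u' h) \<cdot> rh' h \<in> Hom C (\<I> (tgt C Y)) (Y \<otimes>\<^sub>1 Y')"
      using h.tensor_isometry_Hom[of "Yh h" Y "u h" "Yh' h" Y' "u' h" "rh' h"] s(1,2)[of h] Y rh(2)[of h] by simp
  qed
qed

text \<open>Orthogonality splits \<open>r^* r\<close> into the contributions of the constituents.
  Factoriality makes each of them a scalar on all of \<open>Y\<close>, and comparison along
  \<open>u h\<close> identifies this scalar with the squared norm on the simple constituent.\<close>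

lemma standard_factorial_pieces:
  assumes st: "standard_solution_factorial C Y Y' r r'" and nz: "\<one> Y \<noteq> 0"
  shows "\<exists>(n::nat) Yh u k. (\<forall>h<n. simple_arrow C (Yh h) \<and> isometry C (Yh h) Y (u h) \<and>
      (\<exists>W q q'. normalized_solution C (Yh h) W q q' \<and> k h = (norm (\<one> (Yh h) \<otimes> q))\<^sup>2)) \<and>
    (\<Sum>h<n. u h \<cdot> adj C (u h)) = \<one> Y \<and> (norm (\<one> Y \<otimes> r))\<^sup>2 = (\<Sum>h<n. k h)"
proof -
  have Y: "Y \<in> Arr C" "left_center C Y = scalars C Y" "Y' \<in> Arr C" "src C Y' = tgt C Y" "tgt C Y' = src C Y"
    using st by (auto simp: standard_solution_factorial_def factorial_arrow_def)
  obtain n :: nat and Yh Yh' u u' rh rh' where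
    s: "\<And>h. h < n \<Longrightarrow> simple_arrow C (Yh h)" "\<And>h. h < n \<Longrightarrow> isometry C (Yh h) Y (u h)"
      "\<And>h. h < n \<Longrightarrow> isometry C (Yh' h) Y' (u' h)"
      "\<And>h. h < n \<Longrightarrow> normalized_solution C (Yh h) (Yh' h) (rh h) (rh' h)"
    and uu: "(\<Sum>h<n. u h \<cdot> adj C (u h)) = \<one> Y" and uu': "(\<Sum>h<n. u' h \<cdot> adj C (u' h)) = \<one> Y'"
    and r: "r = (\<Sum>h<n. (u' h \<otimes> u h) \<cdot> rh h)"
    using st unfolding standard_solution_factorial_def by blast
  note U = isometryD[OF s(2)] and U' = isometryD[OF s(3)]
  have sY: "src C (Yh h) = src C Y" "tgt C (Yh h) = tgt C Y" if "h < n" for h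
    using U(1)[OF that] by (auto simp: parallel_def)
  have sol: "conjugate_solution C (Yh h) (Yh' h) (rh h) (rh' h)" if "h < n" for h
    using s(4)[OF that] by (simp add: normalized_solution_def)
  have rh: "rh h \<in> Hom C (\<I> (src C Y)) (Yh' h \<otimes>\<^sub>1 Yh h)" "Yh' h \<in> Arr C" "src C (Yh' h) = tgt C (Yh h)"
    "tgt C (Yh' h) = src C (Yh h)" if "h < n" for h
    using sol[OF that] sY[OF that] by (auto simp: conjugate_solution_def)
  define k where "k h = (norm (\<one> (Yh h) \<otimes> rh h))\<^sup>2" for h
  have "\<one> Y' \<cdot> u' h = u' h" if "h < n" for h
    using vcomp_id_left[OF U'(1,2)[OF that]] .
  then have orth: "adj C (u' h) \<cdot> u' j = 0" if "h < n" "j < n" "h \<noteq> j" for h j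
    using isometries_orthogonal[of "{..<n}" Yh' Y' u' "\<one> Y'" h j] that s(3) uu' by simp
  have "left_inverse_map C Y' r (\<one> Y) =
      (\<Sum>h<n. complex_of_real (1\<^sup>2) *\<^sub>C left_inverse_map C (Yh' h) (rh h) (adj C (u h) \<cdot> \<one> Y \<cdot> u h))"
    using Y U s(3) orth rh by (intro left_inverse_map_sum) (auto simp: r id2_closed)
  also have "\<dots> = (\<Sum>h<n. adj C (rh h) \<cdot> rh h)"
  proof (intro sum.cong refl)
    fix h assume "h \<in> {..<n}"
    then have h: "h < n"
      by simp
    have "adj C (u h) \<cdot> \<one> Y \<cdot> u h = \<one> (Yh h)"
      using U[OF h] by (simp add: vcomp_id_right[of Y "Yh h"])
    then show "complex_of_real (1\<^sup>2) *\<^sub>C left_inverse_map C (Yh' h) (rh h) (adj C (u h) \<cdot> \<one> Y \<cdot> u h) = adj C (rh h) \<cdot> rh h"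
      using left_inverse_map_one[of "Yh h" "Yh' h" "rh h"] rh[OF h] U[OF h] sY[OF h] by simp
  qed
  finally have 1: "left_inverse_map C Y' r (\<one> Y) = (\<Sum>h<n. adj C (rh h) \<cdot> rh h)" .
  note rH = standard_factorial_Hom(1)[OF st]
  have 2: "adj C r \<cdot> r = (\<Sum>h<n. adj C (rh h) \<cdot> rh h)"
    using 1 left_inverse_map_one[of Y Y' r] Y rH by simp
  have zc: "adj C (rh h) \<cdot> rh h \<in> object_center C (src C Y)" if "h < n" for h
    using conjugate_solution_square(1)[OF sol[OF that]] sY[OF that] by simp
  have piece: "\<one> Y \<otimes> (adj C (rh h) \<cdot> rh h) = complex_of_real (k h) *\<^sub>C \<one> Y" if h: "h < n" for h
  proof (cases "\<one> (Yh h) = 0")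
    case True
    then have 0: "rh h = 0"
      using zero_arrow_solution[of "Yh h" "Yh' h" "rh h"] U[OF h] rh[OF h] sY[OF h] by simp
    have p: "parallel C (\<I> (src C Y)) (Yh' h \<otimes>\<^sub>1 Yh h)"
      using U[OF h] rh[OF h] sY[OF h] by (simp add: parallel_def arr_simps)
    have "adj C (rh h) \<cdot> rh h = 0"
      using vcomp_zero_right[OF p parallel_sym[OF p]] adj_closed[OF p rh(1)[OF h]] by (simp add: 0)
    moreover have "k h = 0"
      unfolding k_def using hcomp_zero_right[OF p, of "Yh h" "Yh h" "\<one> (Yh h)"] U[OF h] sY[OF h] rh[OF h]
      by (simp add: 0 id2_closed arr_simps)
    ultimately show ?thesis
      using whisker_center_linear(2)[of Y 0 0] zc[OF h] Y by simp
  next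
    case False
    have "\<one> Y \<otimes> (adj C (rh h) \<cdot> rh h) \<in> left_center C Y"
      using zc[OF h] by (auto simp: left_center_def)
    then obtain c where c: "\<one> Y \<otimes> (adj C (rh h) \<cdot> rh h) = c *\<^sub>C \<one> Y"
      unfolding Y(2) by (auto simp: scalars_def)
    have "u h \<noteq> 0"
      using False U[OF h] vcomp_zero_right[of "Yh h" Y "Yh h" "adj C (u h)"] by auto
    have "complex_of_real (k h) *\<^sub>C u h = u h \<cdot> (\<one> (Yh h) \<otimes> (adj C (rh h) \<cdot> rh h))"
      unfolding k_def using simple_square[OF s(1)[OF h], of "Yh' h" "rh h"] rh[OF h] sY[OF h] U[OF h]
      by (simp add: vcomp_scaleC_right[of "Yh h" "Yh h" Y] id2_closed vcomp_id_right[of "Yh h" Y])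
    also have "\<dots> = (\<one> Y \<otimes> (adj C (rh h) \<cdot> rh h)) \<cdot> u h"
      using zc[OF h] sY[OF h] U[OF h] by (intro whisker_center_natural) auto
    also have "\<dots> = c *\<^sub>C u h"
      unfolding c using U[OF h] by (simp add: vcomp_scaleC_left[of "Yh h" Y Y] id2_closed vcomp_id_left[of "Yh h" Y])
    finally show ?thesis
      using c \<open>u h \<noteq> 0\<close> by simp
  qed
  have "\<one> Y \<otimes> (adj C r \<cdot> r) = (\<Sum>h<n. complex_of_real (k h) *\<^sub>C \<one> Y)"
    unfolding 2 using Y zc piece by (subst whisker_center_linear(3)) auto
  also have "\<dots> = complex_of_real (\<Sum>h<n. k h) *\<^sub>C \<one> Y"
    by (simp add: complex_vs.scale_sum_left)
  finally have "norm (\<one> Y \<otimes> (adj C r \<cdot> r)) = \<bar>\<Sum>h<n. k h\<bar>"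
    using projection_norm(2)[OF Y(1) projection_id[OF Y(1)] nz] by (simp add: norm_scaleC del: of_real_sum)
  then have "(norm (\<one> Y \<otimes> r))\<^sup>2 = (\<Sum>h<n. k h)"
    using norm_whisker_square[of Y Y' r] Y rH by (simp add: k_def sum_nonneg)
  then show ?thesis
    using s uu k_def by blast
qed

lemma standard_factorial_norm_unique:
  assumes S: "standard_solution_factorial C S S' r r'" and T: "standard_solution_factorial C T T' q q'"
    and s: "isometry C S T s" "s \<cdot> adj C s = \<one> T" and nz: "\<one> S \<noteq> 0"
  shows "(norm (\<one> S \<otimes> r))\<^sup>2 = (norm (\<one> T \<otimes> q))\<^sup>2"
proof -
  note s' = isometryD[OF s(1)]
  have nzT: "\<one> T \<noteq> 0"
  proof
    assume "\<one> T = 0"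
    then have "s = 0"
      using vcomp_id_left[OF s'(1,2)] vcomp_zero_left[OF s'(1) parallel_simps[OF s'(7)] s'(2)] by simp
    then show False
      using s' nz vcomp_zero_right[of S T S "adj C s"] by simp
  qed
  obtain n :: nat and Y u k where Y: "\<And>h. h < n \<Longrightarrow> simple_arrow C (Y h) \<and> isometry C (Y h) S (u h) \<and>
      (\<exists>W q q'. normalized_solution C (Y h) W q q' \<and> k h = (norm (\<one> (Y h) \<otimes> q))\<^sup>2)"
    and uu: "(\<Sum>h<n. u h \<cdot> adj C (u h)) = \<one> S" and k: "(norm (\<one> S \<otimes> r))\<^sup>2 = (\<Sum>h<n. k h)"
    using standard_factorial_pieces[OF S nz] by blast
  obtain m :: nat and Z w l where Z: "\<And>h. h < m \<Longrightarrow> simple_arrow C (Z h) \<and> isometry C (Z h) T (w h) \<and>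
      (\<exists>W q q'. normalized_solution C (Z h) W q q' \<and> l h = (norm (\<one> (Z h) \<otimes> q))\<^sup>2)"
    and ww: "(\<Sum>h<m. w h \<cdot> adj C (w h)) = \<one> T" and l: "(norm (\<one> T \<otimes> q))\<^sup>2 = (\<Sum>h<m. l h)"
    using standard_factorial_pieces[OF T nzT] by blast
  have zero: "norm (\<one> V \<otimes> a) = 0" if "normalized_solution C V W a a'" "\<one> V = 0" for V W a a'
  proof -
    have c: "V \<in> Arr C" "W \<in> Arr C" "src C W = tgt C V" "tgt C W = src C V" "a \<in> Hom C (\<I> (src C V)) (W \<otimes>\<^sub>1 V)"
      using that by (auto simp: normalized_solution_def conjugate_solution_def)
    then have "a = 0"
      using zero_arrow_solution that by blast
    moreover have "parallel C (\<I> (src C V)) (W \<otimes>\<^sub>1 V)"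
      using c by (simp add: parallel_def arr_simps)
    ultimately show ?thesis
      using c hcomp_zero_right[of "\<I> (src C V)" "W \<otimes>\<^sub>1 V" V V "\<one> V"] by (simp add: id2_closed arr_simps)
  qed
  have "(\<Sum>h<n. k h) = (\<Sum>j<m. l j)"
  proof (rule simple_decompositions_agree[of n Y S u m Z T w s])
    show "k h = 0" if "h < n" "\<one> (Y h) = 0" for h
      using Y[OF that(1)] zero that(2) by fastforce
    show "l h = 0" if "h < m" "\<one> (Z h) = 0" for h
      using Z[OF that(1)] zero that(2) by fastforce
    show "k h = l j" if "h < n" "j < m" "parallel C (Y h) (Z j)" "t \<in> Hom C (Y h) (Z j)" "t \<noteq> 0" for h j t
      using Y[OF that(1)] Z[OF that(2)] simple_norm_unique[OF _ _ that(3,4,5)] by metis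
  qed (use Y Z uu ww s in auto)
  then show ?thesis
    using k l by simp
qed

end

section \<open>Rescaling, direct sums and existence of standard solutions\<close>

context conjugate_pair
begin

text \<open>The conjugate on \<open>k\<close> compensates for the antilinear adjoint.\<close>

lemma scale_conj1:
  assumes "k * l = 1"
  shows "(adj C (cnj k *\<^sub>C cval r') \<otimes> \<one> X) \<cdot> (\<one> X \<otimes> (l *\<^sub>C cval r)) = \<one> X"
proof -
  have p: "parallel C (\<I> M) (X \<otimes>\<^sub>1 X')"
    by simp
  have "adj C (cnj k *\<^sub>C cval r') \<otimes> \<one> X = k *\<^sub>C (adj C (cval r') \<otimes> \<one> X)"
    using adj_scaleC[OF p cval_r'] hcomp_scaleC_left[of X X "X \<otimes>\<^sub>1 X'" "\<I> M" "\<one> X" "adj C (cval r')" k]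
      adj_closed[OF p cval_r'] parallel_sym[OF p] by (simp add: id2_closed arr_simps)
  moreover have "\<one> X \<otimes> (l *\<^sub>C cval r) = l *\<^sub>C (\<one> X \<otimes> cval r)"
    by (intro hcomp_scaleC_right[of "\<I> N" "X' \<otimes>\<^sub>1 X" X X]) (simp_all add: typing id2_closed)
  moreover have "(k *\<^sub>C (adj C (cval r') \<otimes> \<one> X)) \<cdot> (l *\<^sub>C (\<one> X \<otimes> cval r)) =
      (k * l) *\<^sub>C ((adj C (cval r') \<otimes> \<one> X) \<cdot> (\<one> X \<otimes> cval r))"
    using whisk_r' whisk_x[OF cval_r]
    by (simp add: vcomp_scaleC_left[of X "X \<otimes>\<^sub>1 (X' \<otimes>\<^sub>1 X)" X] vcomp_scaleC_right[of X "X \<otimes>\<^sub>1 (X' \<otimes>\<^sub>1 X)" X]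
        Hom_scale scaleC_scaleC)
  ultimately show ?thesis
    using assms solution by (simp add: conjugate_solution_def)
qed

end

context two_C_star_category
begin

lemma scale_solution:
  assumes s: "conjugate_solution C X X' r r'" and kl: "k * l = (1 :: real)"
  shows "conjugate_solution C X X' (complex_of_real l *\<^sub>C r) (complex_of_real k *\<^sub>C r')"
proof -
  define N M where NM: "N = src C X" "M = tgt C X"
  interpret P: conjugate_pair C N M X X' "Cell (\<I> N) r (X' \<otimes>\<^sub>1 X)" "Cell (\<I> M) r' (X \<otimes>\<^sub>1 X')"
    using s NM by (intro conjugate_solution_pair two_C_star_category_axioms)
  interpret Q: conjugate_pair C M N X' X "Cell (\<I> M) r' (X \<otimes>\<^sub>1 X')" "Cell (\<I> N) r (X' \<otimes>\<^sub>1 X)"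
    by (rule P.swap)
  have kl': "complex_of_real k * complex_of_real l = 1" "complex_of_real l * complex_of_real k = 1"
    using kl by (simp_all add: mult.commute flip: of_real_mult)
  show ?thesis
    unfolding conjugate_solution_def
    using P.scale_conj1[OF kl'(1)] Q.scale_conj1[OF kl'(2)] P.cval_r P.cval_r' P.parallel_IXX P.parallel_r'
    by (simp add: Hom_scale)
qed

text \<open>If either whiskered 2-arrow were 0, a conjugate equation or its adjoint would give
  \<open>\<one> X = 0\<close>.\<close>

lemma solution_nonzero:
  assumes s: "conjugate_solution C X X' r r'" and nz: "\<one> X \<noteq> 0"
  shows "\<one> X \<otimes> r \<noteq> 0" "r' \<otimes> \<one> X \<noteq> 0"
proof -
  define N M where NM: "N = src C X" "M = tgt C X"
  interpret P: conjugate_pair C N M X X' "Cell (\<I> N) r (X' \<otimes>\<^sub>1 X)" "Cell (\<I> M) r' (X \<otimes>\<^sub>1 X')"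
    using s NM by (intro conjugate_solution_pair two_C_star_category_axioms)
  have eq: "(adj C r' \<otimes> \<one> X) \<cdot> (\<one> X \<otimes> r) = \<one> X"
    using s by (simp add: conjugate_solution_def)
  show "\<one> X \<otimes> r \<noteq> 0"
    using eq nz P.whisk_r' vcomp_zero_right[of X "X \<otimes>\<^sub>1 (X' \<otimes>\<^sub>1 X)" X "adj C r' \<otimes> \<one> X"] by auto
  have "(\<one> X \<otimes> adj C r) \<cdot> (r' \<otimes> \<one> X) = \<one> X"
    using arg_cong[OF P.conj1_st, of cval] by simp
  moreover have "\<one> X \<otimes> adj C r \<in> Hom C (X \<otimes>\<^sub>1 (X' \<otimes>\<^sub>1 X)) X"
    using Hom_I[of "idc X \<star> st (Cell (\<I> N) r (X' \<otimes>\<^sub>1 X))" "X \<otimes>\<^sub>1 (X' \<otimes>\<^sub>1 X)" X] by (simp add: typing)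
  ultimately show "r' \<otimes> \<one> X \<noteq> 0"
    using nz vcomp_zero_right[of X "X \<otimes>\<^sub>1 (X' \<otimes>\<^sub>1 X)" X "\<one> X \<otimes> adj C r"] by auto
qed

lemma norm_scale_whisker:
  assumes s: "conjugate_solution C X X' r r'"
  shows "norm (\<one> X \<otimes> (complex_of_real l *\<^sub>C r)) = \<bar>l\<bar> * norm (\<one> X \<otimes> r)"
    and "norm ((complex_of_real l *\<^sub>C r') \<otimes> \<one> X) = \<bar>l\<bar> * norm (r' \<otimes> \<one> X)"
proof -
  have X: "X \<in> Arr C" "X' \<in> Arr C" "src C X' = tgt C X" "tgt C X' = src C X"
    and r: "r \<in> Hom C (\<I> (src C X)) (X' \<otimes>\<^sub>1 X)" "r' \<in> Hom C (\<I> (tgt C X)) (X \<otimes>\<^sub>1 X')"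
    using s by (auto simp: conjugate_solution_def)
  have p: "parallel C (\<I> (src C X)) (X' \<otimes>\<^sub>1 X)" "parallel C (\<I> (tgt C X)) (X \<otimes>\<^sub>1 X')"
    using X by (simp_all add: parallel_def arr_simps)
  show "norm (\<one> X \<otimes> (complex_of_real l *\<^sub>C r)) = \<bar>l\<bar> * norm (\<one> X \<otimes> r)"
    using hcomp_scaleC_right[OF p(1), of X X r "\<one> X" "complex_of_real l"] X r by (simp add: arr_simps id2_closed norm_scaleC)
  show "norm ((complex_of_real l *\<^sub>C r') \<otimes> \<one> X) = \<bar>l\<bar> * norm (r' \<otimes> \<one> X)"
    using hcomp_scaleC_left[of X X, OF _ p(2), of "\<one> X" r' "complex_of_real l"] X r by (simp add: arr_simps id2_closed norm_scaleC)
qed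

lemma normalize_solution:
  assumes s: "conjugate_solution C X X' r r'" and nz: "\<one> X \<noteq> 0"
  shows "\<exists>q q'. normalized_solution C X X' q q'"
proof -
  define a b where ab: "a = norm (\<one> X \<otimes> r)" "b = norm (r' \<otimes> \<one> X)"
  have pos: "0 < a" "0 < b"
    using solution_nonzero[OF s nz] by (auto simp: ab)
  \<comment> \<open>The factor that balances the two norms: \<open>l * a = b / l\<close>.\<close>
  define l where "l = sqrt (b / a)"
  have l: "0 < l" "l * l = b / a"
    using pos by (auto simp: l_def)
  then have "l * a = 1 / l * b"
    using pos by (simp add: field_simps)
  then have "norm (\<one> X \<otimes> (complex_of_real l *\<^sub>C r)) = norm ((complex_of_real (1 / l) *\<^sub>C r') \<otimes> \<one> X)"
    using norm_scale_whisker[OF s] l by (simp only: ab) simp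
  then show ?thesis
    using scale_solution[OF s, of "1 / l" l] l unfolding normalized_solution_def by auto
qed

lemma isometry_comp:
  assumes "isometry C S T u" "isometry C T V v"
  shows "isometry C S V (v \<cdot> u)" "(v \<cdot> u) \<cdot> adj C (v \<cdot> u) = v \<cdot> (u \<cdot> adj C u) \<cdot> adj C v"
proof -
  note U = isometryD[OF assms(1)] and V = isometryD[OF assms(2)]
  let ?u = "Cell S u T" and ?v = "Cell T v V"
  have c: "cell ?u" "cell ?v" "st ?u \<bullet> ?u = idc S" "st ?v \<bullet> ?v = idc T"
    using U V by (auto intro!: cell_eqI cellI)
  have "st (?v \<bullet> ?u) \<bullet> (?v \<bullet> ?u) = st ?u \<bullet> ((st ?v \<bullet> ?v) \<bullet> ?u)"
    using c(1,2) by (simp add: typing st_vc vc_assoc)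
  also have "\<dots> = idc S"
    using c by (simp add: vc_id)
  finally have "adj C (v \<cdot> u) \<cdot> (v \<cdot> u) = \<one> S"
    by (auto dest!: arg_cong[of _ _ cval])
  then show "isometry C S V (v \<cdot> u)"
    using U V parallel_trans[of S T V] vcomp_closed[of S T V] by (auto simp: isometry_def)
  have "(?v \<bullet> ?u) \<bullet> st (?v \<bullet> ?u) = ?v \<bullet> (?u \<bullet> st ?u) \<bullet> st ?v"
    using c(1,2) by (simp add: typing st_vc vc_assoc)
  then show "(v \<cdot> u) \<cdot> adj C (v \<cdot> u) = v \<cdot> (u \<cdot> adj C u) \<cdot> adj C v"
    by (auto dest!: arg_cong[of _ _ cval])
qed

lemma vcomp_sandwich_sum:
  assumes v: "isometry C T V v" and x: "\<And>i. i \<in> I \<Longrightarrow> x i \<in> Hom C T T"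
  shows "v \<cdot> (\<Sum>i\<in>I. x i) \<cdot> adj C v = (\<Sum>i\<in>I. v \<cdot> x i \<cdot> adj C v)"
proof -
  note V = isometryD[OF v]
  have vx: "v \<cdot> x i \<in> Hom C T V" if "i \<in> I" for i
    using V x[OF that] by (auto intro: vcomp_closed[of T T V])
  have "v \<cdot> (\<Sum>i\<in>I. x i) = (\<Sum>i\<in>I. v \<cdot> x i)"
    using V x by (intro vcomp_sum_right[of T T V]) auto
  then show ?thesis
    using V vx vcomp_sum_left[of V T V "adj C v" I "\<lambda>i. v \<cdot> x i"] by simp
qed

text \<open>Indices below \<open>Suc n\<close> keep the family nonempty: the empty direct sum would
  have to be a zero 1-arrow, whereas the induction can start from \<open>Y 0\<close> itself.\<close>

lemma direct_sum_family:
  assumes "\<And>h. h < Suc n \<Longrightarrow> parallel C (Y 0) (Y h)"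
  shows "\<exists>Z u. (\<forall>h<Suc n. isometry C (Y h) Z (u h)) \<and> (\<Sum>h<Suc n. u h \<cdot> adj C (u h)) = \<one> Z"
  using assms
proof (induction n)
  case 0
  have "Y 0 \<in> Arr C"
    using 0[of 0] by (simp add: parallel_def)
  then show ?case
    by (intro exI[of _ "Y 0"] exI[of _ "\<lambda>_. \<one> (Y 0)"])
      (simp add: isometry_def id2_closed adj_id2 vcomp_id_left[of "Y 0" "Y 0"])
next
  case (Suc n)
  then obtain Z u where Zu: "\<And>h. h < Suc n \<Longrightarrow> isometry C (Y h) Z (u h)" "(\<Sum>h<Suc n. u h \<cdot> adj C (u h)) = \<one> Z"
    by force
  have "parallel C Z (Y (Suc n))"
    using isometryD(4)[OF Zu(1)[of 0]] Suc(2)[of "Suc n"] parallel_trans by auto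
  from direct_sums[OF this] obtain V v w where v: "isometry C Z V v" and w: "isometry C (Y (Suc n)) V w"
    and vw: "v \<cdot> adj C v + w \<cdot> adj C w = \<one> V"
    by blast
  define u' where "u' h = (if h = Suc n then w else v \<cdot> u h)" for h
  have i: "isometry C (Y h) V (u' h)" if "h < Suc (Suc n)" for h
    using isometry_comp(1)[OF Zu(1)[of h] v] w that by (auto simp: u'_def less_Suc_eq)
  have uuZ: "u h \<cdot> adj C (u h) \<in> Hom C Z Z" if "h < Suc n" for h
    using isometryD[OF Zu(1)[OF that]] by (auto intro: vcomp_closed[of Z "Y h" Z])
  have "(\<Sum>h<Suc n. u' h \<cdot> adj C (u' h)) = (\<Sum>h<Suc n. v \<cdot> (u h \<cdot> adj C (u h)) \<cdot> adj C v)"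
    using isometry_comp(2)[OF Zu(1) v] by (intro sum.cong refl) (auto simp: u'_def)
  also have "\<dots> = v \<cdot> (\<Sum>h<Suc n. u h \<cdot> adj C (u h)) \<cdot> adj C v"
    using uuZ by (intro vcomp_sandwich_sum[OF v, symmetric]) auto
  also have "\<dots> = v \<cdot> adj C v"
    using Zu(2) isometryD[OF v] vcomp_id_right[of Z V v] by simp
  finally have "(\<Sum>h<Suc (Suc n). u' h \<cdot> adj C (u' h)) = \<one> V"
    using vw by (simp add: u'_def)
  then show ?case
    using i by blast
qed

end

context rigid_category
begin

lemma standard_factorial_exists:
  assumes Y: "factorial_arrow C Y" and nz: "\<one> Y \<noteq> 0"
  shows "\<exists>Y' r r'. standard_solution_factorial C Y Y' r r'"
proof -
  have YA: "Y \<in> Arr C"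
    using Y by (simp add: factorial_arrow_def)
  obtain n :: nat and Yh w where w: "\<And>h. h < n \<Longrightarrow> simple_arrow C (Yh h) \<and> \<one> (Yh h) \<noteq> 0 \<and> isometry C (Yh h) Y (w h)"
    and sum: "(\<Sum>h<n. w h \<cdot> adj C (w h)) = \<one> Y"
    using simple_decomposition[OF YA projection_id[OF YA]] by blast
  \<comment> \<open>A nonzero \<open>Y\<close> has at least one constituent, as
    \<open>direct_sum_family\<close> requires.\<close>
  obtain m where n: "n = Suc m"
    using sum nz by (cases n) auto
  have "\<exists>V q q'. normalized_solution C (Yh h) V q q'" if h: "h < n" for h
  proof -
    obtain V q q' where "conjugate_solution C (Yh h) V q q'"
      using rigid w[OF h] simple_Arr[of "Yh h"] unfolding rigid_def conjugate_arrows_def by blast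
    then show ?thesis
      using normalize_solution w[OF h] by blast
  qed
  then obtain V q q' where V: "\<And>h. h < n \<Longrightarrow> normalized_solution C (Yh h) (V h) (q h) (q' h)"
    by metis
  have VV: "V h \<in> Arr C" "src C (V h) = tgt C Y" "tgt C (V h) = src C Y" if "h < n" for h
    using V[OF that] isometryD(1)[of "Yh h" Y "w h"] w[OF that]
    by (auto simp: normalized_solution_def conjugate_solution_def parallel_def)
  have "parallel C (V 0) (V h)" if "h < Suc m" for h
    using VV[of h] VV[of 0] that n by (simp add: parallel_def)
  from direct_sum_family[of m V, OF this] obtain Z u where u: "\<And>h. h < n \<Longrightarrow> isometry C (V h) Z (u h)"
    and uu: "(\<Sum>h<n. u h \<cdot> adj C (u h)) = \<one> Z"
    unfolding n by blast
  have Z: "Z \<in> Arr C" "src C Z = tgt C Y" "tgt C Z = src C Y"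
    using isometryD(1)[OF u[of 0]] VV[of 0] n by (auto simp: parallel_def)
  have "standard_solution_factorial C Y Z (\<Sum>h<n. (u h \<otimes> w h) \<cdot> q h) (\<Sum>h<n. (w h \<otimes> u h) \<cdot> q' h)"
    unfolding standard_solution_factorial_def
  proof (intro conjI)
    show "\<exists>(n'::nat) Yh Yh' u' u'' rh rh'.
      (\<forall>h<n'. simple_arrow C (Yh h) \<and> isometry C (Yh h) Y (u' h) \<and> isometry C (Yh' h) Z (u'' h) \<and>
        normalized_solution C (Yh h) (Yh' h) (rh h) (rh' h)) \<and>
      (\<Sum>h<n'. u' h \<cdot> adj C (u' h)) = \<one> Y \<and> (\<Sum>h<n'. u'' h \<cdot> adj C (u'' h)) = \<one> Z \<and>
      (\<Sum>h<n. (u h \<otimes> w h) \<cdot> q h) = (\<Sum>h<n'. (u'' h \<otimes> u' h) \<cdot> rh h) \<and>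
      (\<Sum>h<n. (w h \<otimes> u h) \<cdot> q' h) = (\<Sum>h<n'. (u' h \<otimes> u'' h) \<cdot> rh' h)"
      by (rule exI[of _ n], rule exI[of _ Yh], rule exI[of _ V], rule exI[of _ w], rule exI[of _ u],
          rule exI[of _ q], rule exI[of _ q']) (use w u V sum uu in simp)
  qed (use Y Z in auto)
  then show ?thesis
    by blast
qed

lemma standard_factorial_nonzero:
  assumes "standard_solution_factorial C Y Y' r r'" "\<one> Y \<noteq> 0"
  shows "0 < (norm (\<one> Y \<otimes> r))\<^sup>2"
proof -
  obtain n :: nat and Yh u k where p: "\<And>h. h < n \<Longrightarrow> simple_arrow C (Yh h) \<and> isometry C (Yh h) Y (u h) \<and>
      (\<exists>W q q'. normalized_solution C (Yh h) W q q' \<and> k h = (norm (\<one> (Yh h) \<otimes> q))\<^sup>2)"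
    and uu: "(\<Sum>h<n. u h \<cdot> adj C (u h)) = \<one> Y" and k: "(norm (\<one> Y \<otimes> r))\<^sup>2 = (\<Sum>h<n. k h)"
    using standard_factorial_pieces[OF assms] by blast
  have "\<exists>h<n. u h \<cdot> adj C (u h) \<noteq> 0"
  proof (rule ccontr)
    assume "\<not> ?thesis"
    then have "(\<Sum>h<n. u h \<cdot> adj C (u h)) = 0"
      by simp
    then show False
      using uu assms(2) by simp
  qed
  then obtain h where h: "h < n" "u h \<cdot> adj C (u h) \<noteq> 0"
    by blast
  note U = isometryD[of "Yh h" Y "u h"]
  have i: "isometry C (Yh h) Y (u h)"
    using p[OF h(1)] by simp
  have "\<one> (Yh h) \<noteq> 0"
  proof
    assume "\<one> (Yh h) = 0"
    then have "u h = 0"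
      using U[OF i] star_proper[of "Yh h" Y "u h"] by simp
    then show False
      using h U[OF i] vcomp_zero_left[of Y "Yh h" Y] by simp
  qed
  then have "0 < k h"
    using p[OF h(1)] solution_nonzero(1) unfolding normalized_solution_def by (metis zero_less_norm_iff zero_less_power)
  moreover have "0 \<le> k j" if "j < n" for j
    using p[OF that] by auto
  ultimately have "0 < (\<Sum>h<n. k h)"
    using h(1) by (intro sum_pos2[of _ h]) auto
  then show ?thesis
    using k by simp
qed

lemma unitary_id: "Y \<in> Arr C \<Longrightarrow> isometry C Y Y (\<one> Y)" "Y \<in> Arr C \<Longrightarrow> \<one> Y \<cdot> adj C (\<one> Y) = \<one> Y"
  by (simp_all add: isometry_def id2_closed adj_id2 vcomp_id_left[of Y Y])

text \<open>Two standard solutions of the same \<open>Y\<close> are compared by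
  \<open>standard_factorial_norm_unique\<close> with the identity as unitary, so the description is
  definite.\<close>

lemma factorial_dim_eq:
  assumes st: "standard_solution_factorial C Y Y' r r'" and nz: "\<one> Y \<noteq> 0"
  shows "factorial_dim C Y = (norm (\<one> Y \<otimes> r))\<^sup>2"
proof -
  have YA: "Y \<in> Arr C"
    using st by (simp add: standard_solution_factorial_def factorial_arrow_def)
  show ?thesis
    unfolding factorial_dim_def
    using st standard_factorial_norm_unique[OF _ st unitary_id(1,2)[OF YA] nz] by (intro the_equality) blast+
qed

lemma factorial_dim_pos:
  assumes "factorial_arrow C Y" "\<one> Y \<noteq> 0"
  shows "0 < factorial_dim C Y"
  using standard_factorial_exists[OF assms] factorial_dim_eq standard_factorial_nonzero assms(2) by metis

lemma factorial_dim_unitary: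
  assumes S: "factorial_arrow C S" "\<one> S \<noteq> 0" and T: "factorial_arrow C T" "\<one> T \<noteq> 0"
    and s: "isometry C S T s" "s \<cdot> adj C s = \<one> T"
  shows "factorial_dim C S = factorial_dim C T"
  using standard_factorial_exists[OF S] standard_factorial_exists[OF T] factorial_dim_eq S(2) T(2)
    standard_factorial_norm_unique[OF _ _ s S(2)] by metis

end

section \<open>The matrix dimension\<close>

locale category_arrow = rigid_category C
  for C :: "('o, 'a, 't :: complex_normed_space) two_category" (structure) +
  fixes X :: 'a
  assumes XA: "X \<in> Arr C" and nz: "\<one> X \<noteq> 0"
begin

lemma hop_arrow: "category_arrow (hop C) X"
  using hop_rigid XA nz by (simp add: category_arrow_def category_arrow_axioms_def)

sublocale L: commutative_star_algebra "left_center C X" "vcomp C" "adj C" "\<one> X"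
  by (rule left_center_algebra[OF XA fin])

sublocale R: commutative_star_algebra "right_center C X" "vcomp C" "adj C" "\<one> X"
proof -
  interpret h: rigid_category "hop C"
    by (rule hop_rigid)
  show "commutative_star_algebra (right_center C X) (vcomp C) (adj C) (\<one> X)"
    using h.left_center_algebra[of X] XA h.fin by simp
qed

lemma left_minimal_eq: "left_minimal C X = L.minproj"
  by (rule minimal_projections_eq[OF L.star_algebra_axioms left_center_subset[OF XA]])

lemma right_center_subset: "right_center C X \<subseteq> Hom C X X"
proof -
  interpret h: rigid_category "hop C"
    by (rule hop_rigid)
  show ?thesis
    using h.left_center_subset[of X] XA by simp
qed

lemma right_minimal_eq: "right_minimal C X = R.minproj"
  by (rule minimal_projections_eq[OF R.star_algebra_axioms right_center_subset])

lemma minimalD: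
  assumes "e \<in> left_minimal C X"
  shows "e \<in> left_center C X" "e \<in> Hom C X X" "e \<cdot> e = e" "adj C e = e" "e \<noteq> 0" "projection C X e"
  using assms left_center_subset[OF XA] by (auto simp: minimal_projections_def projection_def)

lemma right_minimalD:
  assumes "f \<in> right_minimal C X"
  shows "f \<in> right_center C X" "f \<in> Hom C X X" "f \<cdot> f = f" "adj C f = f" "f \<noteq> 0" "projection C X f"
  using assms right_center_subset by (auto simp: minimal_projections_def projection_def)

lemma left_center_central:
  assumes "a \<in> left_center C X" "t \<in> Hom C X X"
  shows "t \<cdot> a = a \<cdot> t"
  using assms whisker_center_natural[OF XA _ _ assms(2)] XA by (auto simp: left_center_def)

lemma product_projection:
  assumes f: "f \<in> right_minimal C X" and e: "e \<in> left_minimal C X"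
  shows "f \<cdot> e = e \<cdot> f" "f \<cdot> e \<in> Hom C X X" "projection C X (f \<cdot> e)"
    "f \<cdot> (f \<cdot> e) = f \<cdot> e" "e \<cdot> (f \<cdot> e) = f \<cdot> e"
proof -
  note E = minimalD[OF e] and F = right_minimalD[OF f]
  show c: "f \<cdot> e = e \<cdot> f"
    using left_center_central[OF E(1) F(2)] .
  show H: "f \<cdot> e \<in> Hom C X X"
    using E F XA by (auto intro: vcomp_closed[of X X X])
  show 1: "f \<cdot> (f \<cdot> e) = f \<cdot> e"
    using E F XA vcomp_assoc[of X X X X e f f] by simp
  show 2: "e \<cdot> (f \<cdot> e) = f \<cdot> e"
    using E F XA c vcomp_assoc[of X X X X f e e] by simp
  have "(f \<cdot> e) \<cdot> (f \<cdot> e) = f \<cdot> e"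
    using E F H XA 1 2 vcomp_assoc[of X X X X "f \<cdot> e" e f] by simp
  moreover have "adj C (f \<cdot> e) = f \<cdot> e"
    using E F XA c adj_vcomp[of X X X e f] by simp
  ultimately show "projection C X (f \<cdot> e)"
    using H by (simp add: projection_def)
qed

text \<open>A central element acts on \<open>X\<close> as a combination of minimal projections, and
  below \<open>e\<close> only the coefficient of \<open>e\<close> survives.\<close>

lemma sub_left_center:
  assumes v: "isometry C S X v" and e: "e \<in> left_minimal C X" "e \<cdot> v = v"
  shows "left_center C S = scalars C S"
proof
  note V = isometryD[OF v] and E = minimalD[OF e(1)]
  have sS: "src C S = src C X"
    using V(1) by (simp add: parallel_def)
  show "left_center C S \<subseteq> scalars C S"
  proof
    fix a assume "a \<in> left_center C S"
    then obtain z where z: "a = \<one> S \<otimes> z" "z \<in> object_center C (src C S)"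
      by (auto simp: left_center_def)
    have zX: "\<one> X \<otimes> z \<in> left_center C X" "\<one> X \<otimes> z \<in> Hom C X X"
      using z sS whisker_center_closed[OF XA, of z] by (auto simp: left_center_def)
    obtain c where c: "\<one> X \<otimes> z = (\<Sum>e\<in>L.minproj. c e *\<^sub>C e)"
      using L.minproj_expansion[OF zX(1)] by auto
    have ce: "(\<one> X \<otimes> z) \<cdot> e = c e *\<^sub>C e"
      unfolding c using e(1) by (intro L.expansion_mul) (simp flip: left_minimal_eq)
    have aH: "a \<in> Hom C S S"
      using z whisker_center_closed V by simp
    have "v \<cdot> a = (\<one> X \<otimes> z) \<cdot> (e \<cdot> v)"
      using whisker_center_natural[OF V(6) z(2) V(1,2)] e by (simp add: z)
    also have "\<dots> = (c e *\<^sub>C e) \<cdot> v"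
      using vcomp_assoc[of S X X X v e "\<one> X \<otimes> z"] V E zX ce by simp
    also have "\<dots> = c e *\<^sub>C v"
      using V E e by (simp add: vcomp_scaleC_left[of S X X])
    finally have "adj C v \<cdot> (v \<cdot> a) = c e *\<^sub>C \<one> S"
      using V by (simp add: vcomp_scaleC_right[of S X S])
    then have "a = c e *\<^sub>C \<one> S"
      using V aH vcomp_assoc[of S S X S a v "adj C v"] vcomp_id_left[of S S a] by simp
    then show "a \<in> scalars C S"
      by (auto simp: scalars_def)
  qed
  show "scalars C S \<subseteq> left_center C S"
  proof
    fix a assume "a \<in> scalars C S"
    then obtain k where "a = k *\<^sub>C \<one> S"
      by (auto simp: scalars_def)
    moreover have I: "\<one> (\<I> (src C S)) \<in> object_center C (src C S)"
      using V by (simp add: object_center_def id2_closed arr_simps)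
    ultimately have "a = \<one> S \<otimes> (k *\<^sub>C \<one> (\<I> (src C S)))"
      using whisker_center_linear(2)[OF V(6) I, of k] whisker_one[OF V(6)] by simp
    moreover have "k *\<^sub>C \<one> (\<I> (src C S)) \<in> object_center C (src C S)"
      using I V Hom_scale[of "\<I> (src C S)" "\<I> (src C S)"] by (simp add: object_center_def arr_simps)
    ultimately show "a \<in> left_center C S"
      by (auto simp: left_center_def)
  qed
qed

lemma isometry_onto_absorb:
  assumes "isometry_onto C S X v p"
  shows "p \<cdot> v = v" "(p = 0 \<longleftrightarrow> \<one> S = 0)" "p \<in> Hom C X X"
proof -
  have v: "isometry C S X v" and p: "p = v \<cdot> adj C v"
    using assms by (auto simp: isometry_onto_def)
  note V = isometryD[OF v]
  show "p \<cdot> v = v"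
    unfolding p using V vcomp_assoc[of S X S X v "adj C v" v] vcomp_id_right[of S X v] by simp
  then show "p = 0 \<longleftrightarrow> \<one> S = 0"
    using V p vcomp_zero_left[of S X X v] vcomp_zero_right[of S X S "adj C v"]
      star_proper[of S X v] vcomp_zero_left[of X S X "adj C v"] by auto
  show "p \<in> Hom C X X"
    unfolding p using V by (auto intro: vcomp_closed[of X S X])
qed

lemma sub_absorb:
  assumes f: "f \<in> right_minimal C X" and e: "e \<in> left_minimal C X" and v: "isometry_onto C S X v (f \<cdot> e)"
  shows "f \<cdot> v = v" "e \<cdot> v = v"
proof -
  have i: "isometry C S X v"
    using v by (simp add: isometry_onto_def)
  note V = isometryD[OF i] and P = product_projection[OF f e] and E = minimalD[OF e] and F = right_minimalD[OF f]
  have fev: "(f \<cdot> e) \<cdot> v = v"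
    by (rule isometry_onto_absorb(1)[OF v])
  show "f \<cdot> v = v"
    using fev P(4) V E F P(2) vcomp_assoc[of S X X X v "f \<cdot> e" f] by simp
  show "e \<cdot> v = v"
    using fev P(5) V E F P(2) vcomp_assoc[of S X X X v "f \<cdot> e" e] by simp
qed

lemma sub_factorial:
  assumes f: "f \<in> right_minimal C X" and e: "e \<in> left_minimal C X" and v: "isometry_onto C S X v (f \<cdot> e)"
  shows "factorial_arrow C S"
proof -
  interpret h: category_arrow "hop C" X
    by (rule hop_arrow)
  have i: "isometry C S X v"
    using v by (simp add: isometry_onto_def)
  have "right_center C S = scalars C S"
    using h.sub_left_center[of S v f] i f sub_absorb(1)[OF f e v] by simp
  then show ?thesis
    using sub_left_center[OF i e sub_absorb(2)[OF f e v]] isometryD[OF i] by (simp add: factorial_arrow_def)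
qed

lemma matrix_dim_pos:
  assumes f: "f \<in> right_minimal C X" and e: "e \<in> left_minimal C X" and fe: "f \<cdot> e \<noteq> 0"
  shows "0 < matrix_dim C X f e"
proof -
  obtain S v where v: "isometry_onto C S X v (f \<cdot> e)"
    using sub_1_arrows[OF XA product_projection(3)[OF f e]] by auto
  have S: "factorial_arrow C S" "\<one> S \<noteq> 0"
    using sub_factorial[OF f e v] isometry_onto_absorb(2)[OF v] fe by auto
  \<comment> \<open>Two sub-1-arrows with the same range are related by the unitary
    \<open>adj C w \<cdot> v\<close>, so their dimensions agree and the description in
    \<open>matrix_dim\<close> is definite.\<close>
  have uniq: "d = factorial_dim C S" if "isometry_onto C T X w (f \<cdot> e)" "d = factorial_dim C T" for T w d
  proof -
    have T: "factorial_arrow C T" "\<one> T \<noteq> 0"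
      using sub_factorial[OF f e that(1)] isometry_onto_absorb(2)[OF that(1)] fe by auto
    have i: "isometry C S X v" "isometry C T X w" and vv: "v \<cdot> adj C v = w \<cdot> adj C w"
      using v that(1) by (auto simp: isometry_onto_def)
    note V = isometryD[OF i(1)] and W = isometryD[OF i(2)]
    let ?v = "Cell S v X" and ?w = "Cell T w X"
    have c: "cell ?v" "cell ?w"
      using V W by (auto intro!: cellI)
    have u: "st ?v \<bullet> ?v = idc S" "st ?w \<bullet> ?w = idc T" "?v \<bullet> st ?v = ?w \<bullet> st ?w"
      using V W vv by (auto intro!: cell_eqI)
    have "st (st ?w \<bullet> ?v) \<bullet> (st ?w \<bullet> ?v) = st ?v \<bullet> (?w \<bullet> st ?w) \<bullet> ?v"
      using c by (simp add: typing st_vc st_st vc_assoc)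
    also have "\<dots> = (st ?v \<bullet> ?v) \<bullet> (st ?v \<bullet> ?v)"
      unfolding u(3)[symmetric] using c by (simp add: typing vc_assoc)
    also have "\<dots> = idc S"
      unfolding u using V by (simp add: typing vc_id)
    finally have 1: "adj C (adj C w \<cdot> v) \<cdot> (adj C w \<cdot> v) = \<one> S"
      by (auto dest!: arg_cong[of _ _ cval])
    have "(st ?w \<bullet> ?v) \<bullet> st (st ?w \<bullet> ?v) = st ?w \<bullet> (?v \<bullet> st ?v) \<bullet> ?w"
      using c by (simp add: typing st_vc st_st vc_assoc)
    also have "\<dots> = (st ?w \<bullet> ?w) \<bullet> (st ?w \<bullet> ?w)"
      unfolding u(3) using c by (simp add: typing vc_assoc)
    also have "\<dots> = idc T"
      unfolding u using W by (simp add: typing vc_id)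
    finally have 2: "(adj C w \<cdot> v) \<cdot> adj C (adj C w \<cdot> v) = \<one> T"
      by (auto dest!: arg_cong[of _ _ cval])
    have "isometry C S T (adj C w \<cdot> v)"
      using 1 V W parallel_trans[OF V(1) W(4)] vcomp_closed[of S X T v "adj C w"] by (simp add: isometry_def)
    then show ?thesis
      using factorial_dim_unitary[OF S T _ 2] that(2) by simp
  qed
  have "(THE d. \<exists>S u. isometry_onto C S X u (f \<cdot> e) \<and> d = factorial_dim C S) = factorial_dim C S"
    using v uniq by (intro the_equality) blast+
  then have "matrix_dim C X f e = factorial_dim C S"
    using fe by (simp add: matrix_dim_def)
  then show ?thesis
    using factorial_dim_pos[OF S] by simp
qed

lemma matrix_dim_zero: "f \<cdot> e = 0 \<Longrightarrow> matrix_dim C X f e = 0"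
  by (simp add: matrix_dim_def)

text \<open>Suppose no row links \<open>J\<close> to its complement. Then the sum \<open>g\<close>
  of \<open>J\<close> equals the sum of the rows that meet \<open>J\<close>, so it lies in both
  centers and is a scalar by connectedness; but \<open>g\<close> acts as 1 on the members of
  \<open>J\<close> and as 0 on the other columns.\<close>

lemma minimal_linked:
  assumes con: "connected_arrow C X" and J: "J \<subseteq> left_minimal C X" "J \<noteq> {}" "J \<noteq> left_minimal C X"
  shows "\<exists>f\<in>right_minimal C X. \<exists>e\<in>J. \<exists>e'\<in>left_minimal C X - J. f \<cdot> e \<noteq> 0 \<and> f \<cdot> e' \<noteq> 0"
proof (rule ccontr)
  assume no: "\<not> ?thesis"
  define g where "g = (\<Sum>e\<in>J. e)"
  define F where "F = {f \<in> right_minimal C X. \<exists>e\<in>J. f \<cdot> e \<noteq> 0}"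
  have finE: "finite (left_minimal C X)" "finite (right_minimal C X)" and sumE: "(\<Sum>e\<in>left_minimal C X. e) = \<one> X"
    "(\<Sum>f\<in>right_minimal C X. f) = \<one> X"
    unfolding left_minimal_eq right_minimal_eq
    by (rule L.finite_minproj R.finite_minproj L.sum_minproj R.sum_minproj)+
  have JH: "e \<in> Hom C X X" if "e \<in> left_minimal C X" for e
    using minimalD[OF that] by simp
  have gL: "g \<in> left_center C X"
    unfolding g_def using J minimalD by (intro L.sum_closed) auto
  have gH: "g \<in> Hom C X X"
    using gL left_center_subset[OF XA] by auto
  have fg: "f \<cdot> g = (if f \<in> F then f else 0)" if f: "f \<in> right_minimal C X" for f
  proof -
    have fH: "f \<in> Hom C X X"
      using right_minimalD[OF f] by simp
    have s: "f \<cdot> (\<Sum>e\<in>I. e) = (\<Sum>e\<in>I. f \<cdot> e)" if "I \<subseteq> left_minimal C X" for I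
      using that JH fH XA by (intro vcomp_sum_right[of X X X]) auto
    show ?thesis
    proof (cases "f \<in> F")
      case True
      have "f = f \<cdot> (\<Sum>e\<in>left_minimal C X. e)"
        using sumE fH vcomp_id_right[of X X f] XA by simp
      also have "\<dots> = (\<Sum>e\<in>left_minimal C X. f \<cdot> e)"
        by (rule s) simp
      also have "\<dots> = (\<Sum>e\<in>J. f \<cdot> e)"
        using True no J f finE unfolding F_def by (intro sum.mono_neutral_right) auto
      also have "\<dots> = f \<cdot> g"
        unfolding g_def using s[OF J(1)] by simp
      finally show ?thesis
        using True by simp
    next
      case False
      then have "(\<Sum>e\<in>J. f \<cdot> e) = 0"
        using f by (auto simp: F_def intro!: sum.neutral)
      then show ?thesis
        using False s[OF J(1)] by (simp add: g_def)
    qed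
  qed
  have "g = (\<Sum>f\<in>right_minimal C X. f) \<cdot> g"
    using sumE gH vcomp_id_left[of X X g] XA by simp
  also have "\<dots> = (\<Sum>f\<in>right_minimal C X. f \<cdot> g)"
    using gH XA right_minimalD by (intro vcomp_sum_left[of X X X]) auto
  also have "\<dots> = (\<Sum>f\<in>right_minimal C X. if f \<in> F then f else 0)"
    using fg by (intro sum.cong) auto
  also have "\<dots> \<in> right_center C X"
    using right_minimalD by (intro R.sum_closed) auto
  finally have "g \<in> right_center C X" .
  then obtain c where c: "g = c *\<^sub>C \<one> X"
    using con gL by (auto simp: connected_arrow_def scalars_def)
  have ge: "g \<cdot> e = c *\<^sub>C e" if "e \<in> left_minimal C X" for e
    unfolding c using JH[OF that] XA by (simp add: vcomp_scaleC_left[of X X X] id2_closed vcomp_id_left[of X X])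
  have ge': "g \<cdot> e = (\<Sum>e'\<in>J. if e' = e then e else 0)" if e: "e \<in> left_minimal C X" for e
  proof -
    have "g \<cdot> e = (\<Sum>e'\<in>J. e' \<cdot> e)"
      unfolding g_def using J JH e XA by (intro vcomp_sum_left[of X X X]) auto
    also have "\<dots> = (\<Sum>e'\<in>J. if e' = e then e else 0)"
      using J e L.minproj_orthogonal minimalD(3)[OF e] unfolding left_minimal_eq by (intro sum.cong) auto
    finally show ?thesis .
  qed
  have finJ: "finite J"
    using finE J finite_subset by blast
  obtain e where e: "e \<in> J" "e \<in> left_minimal C X"
    using J by auto
  obtain e' where e': "e' \<notin> J" "e' \<in> left_minimal C X"
    using J by auto
  have "c *\<^sub>C e = e"
    using ge[OF e(2)] ge'[OF e(2)] finJ e by simp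
  then have "c = 1"
    using minimalD(5)[OF e(2)] complex_vs.scale_right_imp_eq[of e c 1] by simp
  moreover have "c *\<^sub>C e' = 0"
    using ge[OF e'(2)] ge'[OF e'(2)] finJ e' by simp
  ultimately show False
    using minimalD(5)[OF e'(2)] by simp
qed

lemma connected_hop: "connected_arrow C X \<Longrightarrow> connected_arrow (hop C) X"
  by (auto simp: connected_arrow_def)

text \<open>Otherwise each row, being the sum of its products with the columns, would vanish, and
  \<open>\<one> X\<close> would be 0.\<close>

lemma product_nonzero: "\<exists>f\<in>right_minimal C X. \<exists>e\<in>left_minimal C X. f \<cdot> e \<noteq> 0"
proof (rule ccontr)
  assume no: "\<not> ?thesis"
  have sum: "(\<Sum>e\<in>left_minimal C X. e) = \<one> X" "(\<Sum>f\<in>right_minimal C X. f) = \<one> X"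
    unfolding left_minimal_eq right_minimal_eq by (rule L.sum_minproj R.sum_minproj)+
  have "f = 0" if f: "f \<in> right_minimal C X" for f
  proof -
    have "f = f \<cdot> (\<Sum>e\<in>left_minimal C X. e)"
      using sum right_minimalD(2)[OF f] vcomp_id_right[of X X f] XA by simp
    also have "\<dots> = (\<Sum>e\<in>left_minimal C X. f \<cdot> e)"
      using right_minimalD(2)[OF f] minimalD XA by (intro vcomp_sum_right[of X X X]) auto
    also have "\<dots> = 0"
      using no f by (intro sum.neutral) auto
    finally show ?thesis .
  qed
  then have "right_minimal C X = {}"
    using right_minimalD(5) by blast
  then show False
    using sum(2) nz by simp
qed

lemma irreducible_dim:
  assumes "connected_arrow C X"
  shows "irreducible_matrix (matrix_dim C X) (right_minimal C X) (left_minimal C X)"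
    and "irreducible_matrix (\<lambda>e f. matrix_dim C X f e) (left_minimal C X) (right_minimal C X)"
proof -
  interpret h: category_arrow "hop C" X
    by (rule hop_arrow)
  have fin: "finite (left_minimal C X)" "finite (right_minimal C X)"
    unfolding left_minimal_eq right_minimal_eq by (rule L.finite_minproj R.finite_minproj)+
  have nn: "0 \<le> matrix_dim C X f e" if "f \<in> right_minimal C X" "e \<in> left_minimal C X" for f e
    using matrix_dim_pos[OF that] matrix_dim_zero[of f e] by (cases "f \<cdot> e = 0") auto
  have ex: "\<exists>f\<in>right_minimal C X. \<exists>e\<in>left_minimal C X. 0 < matrix_dim C X f e"
    using product_nonzero matrix_dim_pos by blast
  show "irreducible_matrix (matrix_dim C X) (right_minimal C X) (left_minimal C X)"
  proof
    fix J assume J: "J \<subseteq> left_minimal C X" "J \<noteq> {}" "J \<noteq> left_minimal C X"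
    obtain f e e' where *: "f \<in> right_minimal C X" "e \<in> J" "e' \<in> left_minimal C X - J" "f \<cdot> e \<noteq> 0" "f \<cdot> e' \<noteq> 0"
      using minimal_linked[OF assms J] by blast
    have "0 < matrix_dim C X f e" "0 < matrix_dim C X f e'"
      using * J matrix_dim_pos by (auto simp: subset_iff)
    then show "\<exists>i\<in>right_minimal C X. \<exists>j\<in>J. \<exists>k\<in>left_minimal C X - J. 0 < matrix_dim C X i j \<and> 0 < matrix_dim C X i k"
      using * by blast
  qed (use fin nn ex in auto)
  show "irreducible_matrix (\<lambda>e f. matrix_dim C X f e) (left_minimal C X) (right_minimal C X)"
  proof
    fix J assume J: "J \<subseteq> right_minimal C X" "J \<noteq> {}" "J \<noteq> right_minimal C X"
    obtain e f f' where *: "e \<in> left_minimal C X" "f \<in> J" "f' \<in> right_minimal C X - J" "e \<cdot> f \<noteq> 0" "e \<cdot> f' \<noteq> 0"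
      using h.minimal_linked[OF connected_hop[OF assms], of J] J by auto
    have "0 < matrix_dim C X f e" "0 < matrix_dim C X f' e"
      using * J matrix_dim_pos product_projection(1) by (auto simp: subset_iff)
    then show "\<exists>i\<in>left_minimal C X. \<exists>j\<in>J. \<exists>k\<in>right_minimal C X - J. 0 < matrix_dim C X j i \<and> 0 < matrix_dim C X k i"
      using * by blast
  qed (use fin nn ex in auto)
qed

lemma sqrt_nu_pos:
  assumes "connected_arrow C X" "e \<in> left_minimal C X"
  shows "0 < sqrt_nu C X e"
  unfolding sqrt_nu_def arrow_dim_def
  by (rule irreducible_matrix.positive_eigenvector_pos[OF irreducible_dim(1)[OF assms(1)] assms(2)])

lemma sqrt_mu_pos:
  assumes "connected_arrow C X" "f \<in> right_minimal C X"
  shows "0 < sqrt_mu C X f"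
  unfolding sqrt_mu_def arrow_dim_def
  using irreducible_matrix.positive_eigenvector_pos[OF irreducible_dim(2)[OF assms(1)] assms(2)]
  by (simp only: matrix_norm_transpose[of "matrix_dim C X" "left_minimal C X" "right_minimal C X"])

text \<open>Minimal projections are linearly independent, so the coefficients in the definition of
  \<open>left_state\<close> are determined.\<close>

lemma left_state_expansion:
  "left_state C X (\<Sum>e\<in>left_minimal C X. c e *\<^sub>C e) =
    (\<Sum>e\<in>left_minimal C X. c e * complex_of_real ((sqrt_nu C X e)\<^sup>2))"
  unfolding left_state_def
proof (rule the_equality)
  fix w assume "\<exists>d. (\<Sum>e\<in>left_minimal C X. c e *\<^sub>C e) = (\<Sum>e\<in>left_minimal C X. d e *\<^sub>C e) \<and>
    w = (\<Sum>e\<in>left_minimal C X. d e * complex_of_real ((sqrt_nu C X e)\<^sup>2))"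
  then obtain d where d: "(\<Sum>e\<in>left_minimal C X. c e *\<^sub>C e) = (\<Sum>e\<in>left_minimal C X. d e *\<^sub>C e)"
    "w = (\<Sum>e\<in>left_minimal C X. d e * complex_of_real ((sqrt_nu C X e)\<^sup>2))"
    by blast
  have "c e = d e" if "e \<in> left_minimal C X" for e
    using L.expansion_unique[of c d e] d(1) that by (simp add: left_minimal_eq)
  then show "w = (\<Sum>e\<in>left_minimal C X. c e * complex_of_real ((sqrt_nu C X e)\<^sup>2))"
    using d(2) by simp
qed blast

lemma right_state_expansion:
  "right_state C X (\<Sum>f\<in>right_minimal C X. c f *\<^sub>C f) =
    (\<Sum>f\<in>right_minimal C X. c f * complex_of_real ((sqrt_mu C X f)\<^sup>2))"
  unfolding right_state_def
proof (rule the_equality)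
  fix w assume "\<exists>d. (\<Sum>f\<in>right_minimal C X. c f *\<^sub>C f) = (\<Sum>f\<in>right_minimal C X. d f *\<^sub>C f) \<and>
    w = (\<Sum>f\<in>right_minimal C X. d f * complex_of_real ((sqrt_mu C X f)\<^sup>2))"
  then obtain d where d: "(\<Sum>f\<in>right_minimal C X. c f *\<^sub>C f) = (\<Sum>f\<in>right_minimal C X. d f *\<^sub>C f)"
    "w = (\<Sum>f\<in>right_minimal C X. d f * complex_of_real ((sqrt_mu C X f)\<^sup>2))"
    by blast
  have "c f = d f" if "f \<in> right_minimal C X" for f
    using R.expansion_unique[of c d f] d(1) that by (simp add: right_minimal_eq)
  then show "w = (\<Sum>f\<in>right_minimal C X. c f * complex_of_real ((sqrt_mu C X f)\<^sup>2))"
    using d(2) by simp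
qed blast

end

section \<open>Modular identities and compressed solutions\<close>

context conjugate_pair
begin

text \<open>Through \<open>r\<close> the factor \<open>a\<close> becomes \<open>bullet a\<close> on
  the other leg, where it commutes with \<open>1 \<otimes> t\<close>; it returns through the adjoint
  of \<open>r\<close> as the adjoint of \<open>b\<close>. This is the modular identity of
  \<open>\<phi>\<close>.\<close>

lemma left_inverse_modular:
  assumes a: "a \<in> Hom C X X" and b: "b \<in> Hom C X X" and t: "t \<in> Hom C X X" and ab: "bullet b = adj C (bullet a)"
  shows "left_inverse_map C X' (cval r) (t \<cdot> a) = left_inverse_map C X' (cval r) (adj C b \<cdot> t)"
proof -
  let ?a = "Cell X a X" and ?b = "Cell X b X" and ?t = "Cell X t X" and ?A = "Cell X' (bullet a) X'"
  have c [simp]: "cell ?a" "cell ?b" "cell ?t" "cell ?A"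
    using a b t by (auto intro!: cellI)
  have split: "idc X' \<star> (y \<bullet> x) = (idc X' \<star> y) \<bullet> (idc X' \<star> x)"
    if "cell x" "cell y" "cdom x = X" "ccod x = X" "cdom y = X" for x y
    using that hc_vc[of "idc X'" "idc X'" x y] by (simp add: typing vc_id)
  have ea: "(idc X' \<star> ?a) \<bullet> r = (?A \<star> idc X) \<bullet> r"
    using bullet_mates[OF a] by (simp add: self.mates_def)
  have eb: "(idc X' \<star> ?b) \<bullet> r = (st ?A \<star> idc X) \<bullet> r"
    using bullet_mates[OF b] by (simp add: self.mates_def ab st_def)
  have eb': "st r \<bullet> (idc X' \<star> st ?b) = st r \<bullet> (?A \<star> idc X)"
    using arg_cong[OF eb, of st] by (simp add: st_vc st_hc st_idc st_st typing)
  have "st r \<bullet> (idc X' \<star> (?t \<bullet> ?a)) \<bullet> r = st r \<bullet> ((idc X' \<star> ?t) \<bullet> ((idc X' \<star> ?a) \<bullet> r))"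
    by (simp add: split typing vc_assoc)
  also have "\<dots> = st r \<bullet> (((idc X' \<star> ?t) \<bullet> (?A \<star> idc X)) \<bullet> r)"
    unfolding ea by (simp add: typing vc_assoc)
  also have "(idc X' \<star> ?t) \<bullet> (?A \<star> idc X) = (?A \<star> idc X) \<bullet> (idc X' \<star> ?t)"
    using hc_whisker[of ?A ?t] by simp
  also have "st r \<bullet> ((?A \<star> idc X) \<bullet> (idc X' \<star> ?t) \<bullet> r) = (st r \<bullet> (?A \<star> idc X)) \<bullet> ((idc X' \<star> ?t) \<bullet> r)"
    by (simp add: typing vc_assoc)
  also have "\<dots> = st r \<bullet> (idc X' \<star> (st ?b \<bullet> ?t)) \<bullet> r"
    unfolding eb'[symmetric] by (simp add: split typing vc_assoc)
  finally show ?thesis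
    by (auto simp: left_inverse_map_def dest!: arg_cong[of _ _ cval])
qed

text \<open>Along \<open>r'\<close> the anti-isomorphism is
  \<open>a \<mapsto> adj C (bullet (adj C a))\<close>, which explains the condition on
  \<open>b\<close>; otherwise the factor makes the same round trip as for
  \<open>\<phi>\<close>.\<close>

lemma right_inverse_modular:
  assumes a: "a \<in> Hom C X X" and b: "b \<in> Hom C X X" and t: "t \<in> Hom C X X" and ab: "bullet b = adj C (bullet (adj C a))"
  shows "right_inverse_map C X' (cval r') (t \<cdot> a) = right_inverse_map C X' (cval r') (b \<cdot> t)"
proof -
  let ?a = "Cell X a X" and ?b = "Cell X b X" and ?t = "Cell X t X" and ?B = "Cell X' (bullet b) X'"
  have c [simp]: "cell ?a" "cell ?b" "cell ?t" "cell ?B"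
    using a b t by (auto intro!: cellI)
  have aa: "adj C a \<in> Hom C X X"
    using a adj_closed[of X X] by simp
 have split: "(y \<bullet> x) \<star> idc X' = (y \<star> idc X') \<bullet> (x \<star> idc X')"
    if "cell x" "cell y" "cdom x = X" "ccod x = X" "cdom y = X" for x y
    using that hc_vc[of x y "idc X'" "idc X'"] by (simp add: typing vc_id)
  have ea: "(?a \<star> idc X') \<bullet> r' = (idc X \<star> ?B) \<bullet> r'"
    using self.mates_right[OF bullet_mates[OF aa]] a by (simp add: ab st_def adj_adj[of X X])
  have eb: "(st ?b \<star> idc X') \<bullet> r' = (idc X \<star> st ?B) \<bullet> r'"
    using self.mates_right[OF bullet_mates[OF b]] by simp
  have eb': "st r' \<bullet> (?b \<star> idc X') = st r' \<bullet> (idc X \<star> ?B)"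
    using arg_cong[OF eb, of st] by (simp add: st_vc st_hc st_idc st_st typing)
  have "st r' \<bullet> ((?t \<bullet> ?a) \<star> idc X') \<bullet> r' = st r' \<bullet> ((?t \<star> idc X') \<bullet> ((?a \<star> idc X') \<bullet> r'))"
    by (simp add: split typing vc_assoc)
  also have "\<dots> = st r' \<bullet> (((?t \<star> idc X') \<bullet> (idc X \<star> ?B)) \<bullet> r')"
    unfolding ea by (simp add: typing vc_assoc)
  also have "(?t \<star> idc X') \<bullet> (idc X \<star> ?B) = (idc X \<star> ?B) \<bullet> (?t \<star> idc X')"
    using hc_whisker[of ?t ?B] by simp
  also have "st r' \<bullet> ((idc X \<star> ?B) \<bullet> (?t \<star> idc X') \<bullet> r') = (st r' \<bullet> (idc X \<star> ?B)) \<bullet> ((?t \<star> idc X') \<bullet> r')"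
    by (simp add: typing vc_assoc)
  also have "\<dots> = st r' \<bullet> ((?b \<bullet> ?t) \<star> idc X') \<bullet> r'"
    unfolding eb'[symmetric] by (simp add: split typing vc_assoc)
  finally show ?thesis
    by (auto simp: right_inverse_map_def dest!: arg_cong[of _ _ cval])
qed

section \<open>Compressing a solution by a projection and its image\<close>

context
  fixes w w' Q Q' :: "('a, 't) cell" and Y Y' :: 'a
  assumes w: "cell w" "cdom w = Y" "ccod w = X" "st w \<bullet> w = idc Y" "w \<bullet> st w = Q"
    and w': "cell w'" "cdom w' = Y'" "ccod w' = X'" "st w' \<bullet> w' = idc Y'" "w' \<bullet> st w' = Q'"
    and QQ: "(idc X' \<star> Q) \<bullet> r = (Q' \<star> idc X) \<bullet> r"
begin

lemma compress_arr: "Y \<in> Arr C" "src C Y = N" "tgt C Y = M" "Y' \<in> Arr C" "src C Y' = M" "tgt C Y' = N"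
  "cell Q" "cdom Q = X" "ccod Q = X" "cell Q'" "cdom Q' = X'" "ccod Q' = X'"
  using cellD[OF w(1)] cellD[OF w'(1)] w(1-3,5) w'(1-3,5) by (auto simp: typing)

lemma compress_whisker: "Q \<bullet> w = w" "st w \<bullet> Q = st w" "Q' \<bullet> w' = w'" "Q \<bullet> Q = Q"
proof -
  have "w \<bullet> st w \<bullet> w = w \<bullet> (st w \<bullet> w)"
    using w(1-3) by (simp add: typing vc_assoc)
  then show 1: "Q \<bullet> w = w"
    using w by (simp add: vc_id)
  have "st w \<bullet> (w \<bullet> st w) = (st w \<bullet> w) \<bullet> st w"
    using w(1-3) by (simp add: typing vc_assoc)
  then show "st w \<bullet> Q = st w"
    using w by (simp add: vc_id typing)
  have "w' \<bullet> st w' \<bullet> w' = w' \<bullet> (st w' \<bullet> w')"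
    using w'(1-3) by (simp add: typing vc_assoc)
  then show "Q' \<bullet> w' = w'"
    using w' by (simp add: vc_id)
  have "Q \<bullet> (w \<bullet> st w) = (Q \<bullet> w) \<bullet> st w"
    using w(1-3) compress_arr by (simp add: typing vc_assoc)
  then show "Q \<bullet> Q = Q"
    using 1 w by simp
qed

text \<open>On \<open>r\<close> the 2-arrows \<open>1 \<otimes> Q\<close> and
  \<open>Q' \<otimes> 1\<close> coincide, so their product acts as the idempotent
  \<open>1 \<otimes> Q\<close> applied twice.\<close>

lemma compress_both: "(Q' \<star> Q) \<bullet> r = (idc X' \<star> Q) \<bullet> r"
proof -
  note c = compress_arr compress_whisker
  have "(Q' \<star> Q) \<bullet> r = (idc X' \<star> Q) \<bullet> ((Q' \<star> idc X) \<bullet> r)"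
    using hc_whisker(2)[of Q' Q] c by (simp add: typing vc_assoc)
  also have "\<dots> = ((idc X' \<star> Q) \<bullet> (idc X' \<star> Q)) \<bullet> r"
    unfolding QQ[symmetric] using c by (simp add: typing vc_assoc)
  also have "(idc X' \<star> Q) \<bullet> (idc X' \<star> Q) = idc X' \<star> Q"
    using hc_vc[of "idc X'" "idc X'" Q Q] c by (simp add: typing vc_id)
  finally show ?thesis .
qed

lemma compress_expand: "(w' \<star> w) \<bullet> ((st w' \<star> st w) \<bullet> r) = (idc X' \<star> Q) \<bullet> r"
proof -
  note c = compress_arr
  have "(w' \<star> w) \<bullet> ((st w' \<star> st w) \<bullet> r) = ((w' \<bullet> st w') \<star> (w \<bullet> st w)) \<bullet> r"
    using w(1-3) w'(1-3) c by (simp add: typing hc_vc flip: vc_assoc)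
  then show ?thesis
    using compress_both w w' by simp
qed

lemma compress_square: "st ((st w' \<star> st w) \<bullet> r) \<bullet> ((st w' \<star> st w) \<bullet> r) = st r \<bullet> ((idc X' \<star> Q) \<bullet> r)"
proof -
  note c = compress_arr
  have "st ((st w' \<star> st w) \<bullet> r) \<bullet> ((st w' \<star> st w) \<bullet> r) = st r \<bullet> ((w' \<star> w) \<bullet> ((st w' \<star> st w) \<bullet> r))"
    using w(1-3) w'(1-3) c by (simp add: typing st_vc st_hc st_st vc_assoc)
  then show ?thesis
    using compress_expand by simp
qed

text \<open>Once the isometries into \<open>X'\<close> meet, \<open>Q'\<close> acts on
  \<open>r\<close> and may be traded for \<open>Q\<close>, which \<open>st w\<close> absorbs. What
  remains is \<open>frob_inj\<close> for \<open>st w\<close>, followed by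
  \<open>st w \<bullet> w\<close>.\<close>

lemma compress_conj:
  "(st ((st w \<star> st w') \<bullet> r') \<star> idc Y) \<bullet> (idc Y \<star> ((st w' \<star> st w) \<bullet> r)) = idc Y"
proof -
  note c = compress_arr compress_whisker(2) w(1-3) w'(1-3)
  let ?x = "(idc X' \<star> st w) \<bullet> r"
  have x: "cell ?x" "cdom ?x = \<I> N" "ccod ?x = X' \<otimes>\<^sub>1 Y"
    using c by (auto simp: typing)
  have "(Q' \<star> st w) \<bullet> r = (idc X' \<star> st w) \<bullet> ((Q' \<star> idc X) \<bullet> r)"
    using hc_whisker(2)[of Q' "st w"] c by (simp add: typing vc_assoc)
  also have "\<dots> = ((idc X' \<star> st w) \<bullet> (idc X' \<star> Q)) \<bullet> r"
    unfolding QQ[symmetric] using c by (simp add: typing vc_assoc)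
  also have "(idc X' \<star> st w) \<bullet> (idc X' \<star> Q) = idc X' \<star> st w"
    using hc_vc[of "idc X'" "idc X'" Q "st w"] c by (simp add: typing vc_id)
  finally have 1: "(Q' \<star> st w) \<bullet> r = ?x" .
  have "st ((st w \<star> st w') \<bullet> r') \<star> idc Y = (st r' \<star> idc Y) \<bullet> (w \<star> (w' \<star> idc Y))"
    using c hc_vc[of "w \<star> w'" "st r'" "idc Y" "idc Y"] by (simp add: typing st_vc st_hc st_st vc_id hc_assoc)
  moreover have "idc Y \<star> ((st w' \<star> st w) \<bullet> r) = (idc Y \<star> (st w' \<star> st w)) \<bullet> (idc Y \<star> r)"
    using c by (simp add: typing hc_vc vc_id)
  ultimately have "(st ((st w \<star> st w') \<bullet> r') \<star> idc Y) \<bullet> (idc Y \<star> ((st w' \<star> st w) \<bullet> r)) =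
      (st r' \<star> idc Y) \<bullet> ((w \<star> (w' \<star> idc Y)) \<bullet> (idc Y \<star> (st w' \<star> st w)) \<bullet> (idc Y \<star> r))"
    using c by (simp add: typing vc_assoc)
  also have "(w \<star> (w' \<star> idc Y)) \<bullet> (idc Y \<star> (st w' \<star> st w)) = w \<star> ((w' \<bullet> st w') \<star> st w)"
    using c by (simp add: typing hc_vc vc_id)
  also have "\<dots> \<bullet> (idc Y \<star> r) = w \<star> ((Q' \<star> st w) \<bullet> r)"
    using c by (simp add: typing hc_vc vc_id w'(5))
  also have "\<dots> = (idc X \<star> ?x) \<bullet> w"
    unfolding 1 using hc_whisker(2)[OF w(1) x(1)] x c by (simp add: hc_id typing)
  also have "(st r' \<star> idc Y) \<bullet> ((idc X \<star> ?x) \<bullet> w) = ((st r' \<star> idc Y) \<bullet> (idc X \<star> ?x)) \<bullet> w"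
    using c by (simp add: typing vc_assoc)
  also have "(st r' \<star> idc Y) \<bullet> (idc X \<star> ?x) = st w"
    using c by (intro frob_inj) (simp_all add: typing)
  finally show ?thesis
    using w by simp
qed

end

end

context two_C_star_category
begin

text \<open>Through this equation every statement on left inverses yields one on right
  inverses.\<close>

lemma right_inverse_map_hop: "right_inverse_map C X' r' t = left_inverse_map (hop C) X' r' t"
  by (simp add: right_inverse_map_def left_inverse_map_def)

text \<open>\<open>B\<close> is the image of the projection \<open>Q\<close> under the anti-isomorphism of the algebras of \<open>X\<close> and \<open>X'\<close>.\<close>

lemma compressed_solution:
  assumes s: "conjugate_solution C X X' r r'" and w: "isometry_onto C Y X w Q" and w': "isometry_onto C Y' X' w' B"
    and B: "(\<one> X' \<otimes> Q) \<cdot> r = (B \<otimes> \<one> X) \<cdot> r" "(Q \<otimes> \<one> X') \<cdot> r' = (\<one> X \<otimes> B) \<cdot> r'"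
  defines "q \<equiv> (adj C w' \<otimes> adj C w) \<cdot> r" and "q' \<equiv> (adj C w \<otimes> adj C w') \<cdot> r'"
  shows "conjugate_solution C Y Y' q q'"
    "(w' \<otimes> w) \<cdot> q = (\<one> X' \<otimes> Q) \<cdot> r" "(w \<otimes> w') \<cdot> q' = (Q \<otimes> \<one> X') \<cdot> r'"
    "adj C q \<cdot> q = left_inverse_map C X' r Q" "adj C q' \<cdot> q' = right_inverse_map C X' r' Q"
proof -
  define N M where NM: "N = src C X" "M = tgt C X"
  let ?r = "Cell (\<I> N) r (X' \<otimes>\<^sub>1 X)" and ?r' = "Cell (\<I> M) r' (X \<otimes>\<^sub>1 X')"
  interpret P: conjugate_pair C N M X X' ?r ?r'
    using s NM by (intro conjugate_solution_pair two_C_star_category_axioms)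
  interpret P': conjugate_pair C M N X' X ?r' ?r
    by (rule P.swap)
  have i: "isometry C Y X w" "w \<cdot> adj C w = Q" "isometry C Y' X' w'" "w' \<cdot> adj C w' = B"
    using w w' by (auto simp: isometry_onto_def)
  note W = isometryD[OF i(1)] and W' = isometryD[OF i(3)]
  let ?w = "Cell Y w X" and ?w' = "Cell Y' w' X'" and ?Q = "Cell X Q X" and ?B = "Cell X' B X'"
  have c: "cell ?w" "cdom ?w = Y" "ccod ?w = X" "st ?w \<bullet> ?w = idc Y" "?w \<bullet> st ?w = ?Q"
    using W i by (auto intro!: cellI cell_eqI)
  have c': "cell ?w'" "cdom ?w' = Y'" "ccod ?w' = X'" "st ?w' \<bullet> ?w' = idc Y'" "?w' \<bullet> st ?w' = ?B"
    using W' i by (auto intro!: cellI cell_eqI)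
  have QB: "(idc X' \<star> ?Q) \<bullet> ?r = (?B \<star> idc X) \<bullet> ?r"
    using B by (intro cell_eqI) auto
  have QB': "(idc X \<star> ?B) \<bullet> ?r' = (?Q \<star> idc X') \<bullet> ?r'"
    using B by (intro cell_eqI) auto
  let ?q = "(st ?w' \<star> st ?w) \<bullet> ?r" and ?q' = "(st ?w \<star> st ?w') \<bullet> ?r'"
  note arr = P.compress_arr[OF c c' QB]
  have pair: "conjugate_pair C N M Y Y' ?q ?q'"
    using arr c(1) c'(1) P.compress_conj[OF c c' QB] P'.compress_conj[OF c' c QB'] by unfold_locales (simp_all add: typing)
  have q: "?q = Cell (\<I> N) q (Y' \<otimes>\<^sub>1 Y)" "?q' = Cell (\<I> M) q' (Y \<otimes>\<^sub>1 Y')"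
    by (auto intro!: cell_eqI simp: q_def q'_def)
  show "conjugate_solution C Y Y' q q'"
    using conjugate_pair.solution[OF pair] by (simp add: q)
  show "(w' \<otimes> w) \<cdot> q = (\<one> X' \<otimes> Q) \<cdot> r"
    using arg_cong[OF P.compress_expand[OF c c' QB], of cval] by (simp add: q_def)
  show "(w \<otimes> w') \<cdot> q' = (Q \<otimes> \<one> X') \<cdot> r'"
    using arg_cong[OF P'.compress_expand[OF c' c QB'], of cval] B by (simp add: q'_def)
  have "st ?r \<bullet> ((idc X' \<star> ?Q) \<bullet> ?r) = st ?r \<bullet> (idc X' \<star> ?Q) \<bullet> ?r"
    using arr by (simp add: typing vc_assoc)
  then show "adj C q \<cdot> q = left_inverse_map C X' r Q"
    using arg_cong[OF P.compress_square[OF c c' QB], of cval] by (auto simp: q_def left_inverse_map_def dest!: arg_cong[of _ _ cval])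
  have "st ?r' \<bullet> ((?Q \<star> idc X') \<bullet> ?r') = st ?r' \<bullet> (?Q \<star> idc X') \<bullet> ?r'"
    using arr by (simp add: typing vc_assoc)
  then show "adj C q' \<cdot> q' = right_inverse_map C X' r' Q"
    using arg_cong[OF P'.compress_square[OF c' c QB'], of cval] B
    by (auto simp: q'_def right_inverse_map_def dest!: arg_cong[of _ _ cval])
qed

end

section \<open>Standard solutions are spherical\<close>

lemma (in two_C_star_category) left_inverse_map_closed:
  assumes Y: "Y \<in> Arr C" and W: "W \<in> Arr C" "src C W = tgt C Y" "tgt C W = src C Y"
    and r: "r \<in> Hom C (\<I> (src C Y)) (W \<otimes>\<^sub>1 Y)" and t: "t \<in> Hom C Y Y"
  shows "left_inverse_map C W r t \<in> object_center C (src C Y)"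
proof -
  define N where N: "N = src C Y"
  have "N \<in> Ob C"
    using Y by (simp add: N arr_simps)
  moreover have "cell (Cell (\<I> N) r (W \<otimes>\<^sub>1 Y))" "cell (Cell Y t Y)"
    using Y W r t \<open>N \<in> Ob C\<close> by (auto intro!: cellI simp: N[symmetric] parallel_def arr_simps)
  ultimately show ?thesis
    using Hom_I[of "st (Cell (\<I> N) r (W \<otimes>\<^sub>1 Y)) \<bullet> (idc W \<star> Cell Y t Y) \<bullet> Cell (\<I> N) r (W \<otimes>\<^sub>1 Y)" "\<I> N" "\<I> N"] Y W
    by (simp add: typing left_inverse_map_def object_center_def N[symmetric])
qed

context two_C_star_category
begin

lemma orthogonal_ranges:
  assumes "isometry_onto C S X v p" "isometry_onto C T X w q" "p \<cdot> q = 0"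
  shows "adj C v \<cdot> w = 0"
proof -
  have i: "isometry C S X v" "v \<cdot> adj C v = p" "isometry C T X w" "w \<cdot> adj C w = q"
    using assms by (auto simp: isometry_onto_def)
  note V = isometryD[OF i(1)] and W = isometryD[OF i(3)]
  let ?v = "Cell S v X" and ?w = "Cell T w X"
  have c: "cell ?v" "cell ?w"
    using V W by (auto intro: cellI)
  have u: "st ?v \<bullet> ?v = idc S" "st ?w \<bullet> ?w = idc T"
    using V W by (auto intro!: cell_eqI)
  have "st ?v \<bullet> ((?v \<bullet> st ?v) \<bullet> (?w \<bullet> st ?w)) \<bullet> ?w = (st ?v \<bullet> ?v) \<bullet> ((st ?v \<bullet> ?w) \<bullet> (st ?w \<bullet> ?w))"
    using c by (simp add: vc_assoc typing)
  also have "\<dots> = st ?v \<bullet> ?w"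
    unfolding u using c by (simp add: vc_id typing)
  finally have "adj C v \<cdot> (p \<cdot> q) \<cdot> w = adj C v \<cdot> w"
    using i by (auto dest!: arg_cong[of _ _ cval])
  moreover have "adj C v \<cdot> 0 = 0" "0 \<cdot> w = 0"
    using vcomp_zero_right[of X X S "adj C v"] vcomp_zero_left[of T X S w] V W by auto
  ultimately show ?thesis
    using assms(3) by simp
qed

end

context category_arrow
begin

lemma finite_minimal: "finite (left_minimal C X)" "finite (right_minimal C X)"
  unfolding left_minimal_eq right_minimal_eq by (rule L.finite_minproj R.finite_minproj)+

lemma sum_minimal: "(\<Sum>e\<in>left_minimal C X. e) = \<one> X" "(\<Sum>f\<in>right_minimal C X. f) = \<one> X"
  unfolding left_minimal_eq right_minimal_eq by (rule L.sum_minproj R.sum_minproj)+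

lemma minimal_orthogonal:
  "e \<in> left_minimal C X \<Longrightarrow> e' \<in> left_minimal C X \<Longrightarrow> e \<noteq> e' \<Longrightarrow> e \<cdot> e' = 0"
  "f \<in> right_minimal C X \<Longrightarrow> f' \<in> right_minimal C X \<Longrightarrow> f \<noteq> f' \<Longrightarrow> f \<cdot> f' = 0"
  unfolding left_minimal_eq right_minimal_eq by (rule L.minproj_orthogonal R.minproj_orthogonal; assumption)+

text \<open>Several pieces may lie under the same minimal projection, while the states are given by
  one coefficient per projection.\<close>

lemma group_sum:
  assumes "finite K" "finite E" "\<And>k. k \<in> K \<Longrightarrow> e k \<in> E"
  shows "(\<Sum>k\<in>K. a k *\<^sub>C e k) = (\<Sum>x\<in>E. (\<Sum>k\<in>{k\<in>K. e k = x}. a k) *\<^sub>C x)"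
    and "(\<Sum>k\<in>K. a k * h (e k)) = (\<Sum>x\<in>E. (\<Sum>k\<in>{k\<in>K. e k = x}. a k) * h x)"
proof -
  have "(\<Sum>k\<in>K. a k *\<^sub>C e k) = (\<Sum>x\<in>E. \<Sum>k\<in>{k\<in>K. e k = x}. a k *\<^sub>C e k)"
    using assms by (intro sum.group[symmetric]) auto
  also have "\<dots> = (\<Sum>x\<in>E. (\<Sum>k\<in>{k\<in>K. e k = x}. a k) *\<^sub>C x)"
    by (intro sum.cong refl) (simp add: complex_vs.scale_sum_left)
  finally show "(\<Sum>k\<in>K. a k *\<^sub>C e k) = (\<Sum>x\<in>E. (\<Sum>k\<in>{k\<in>K. e k = x}. a k) *\<^sub>C x)" .
  have "(\<Sum>k\<in>K. a k * h (e k)) = (\<Sum>x\<in>E. \<Sum>k\<in>{k\<in>K. e k = x}. a k * h (e k))"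
    using assms by (intro sum.group[symmetric]) auto
  also have "\<dots> = (\<Sum>x\<in>E. (\<Sum>k\<in>{k\<in>K. e k = x}. a k) * h x)"
    by (intro sum.cong refl) (simp add: sum_distrib_right)
  finally show "(\<Sum>k\<in>K. a k * h (e k)) = (\<Sum>x\<in>E. (\<Sum>k\<in>{k\<in>K. e k = x}. a k) * h x)" .
qed

lemma left_state_sum:
  assumes "finite K" "\<And>k. k \<in> K \<Longrightarrow> e k \<in> left_minimal C X"
  shows "left_state C X (\<Sum>k\<in>K. a k *\<^sub>C e k) = (\<Sum>k\<in>K. a k * complex_of_real ((sqrt_nu C X (e k))\<^sup>2))"
  using group_sum(1)[OF assms(1) finite_minimal(1) assms(2), where a = a]
    group_sum(2)[OF assms(1) finite_minimal(1) assms(2), where a = a and h = "\<lambda>e. complex_of_real ((sqrt_nu C X e)\<^sup>2)"]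
  by (simp add: left_state_expansion)

lemma right_state_sum:
  assumes "finite K" "\<And>k. k \<in> K \<Longrightarrow> f k \<in> right_minimal C X"
  shows "right_state C X (\<Sum>k\<in>K. a k *\<^sub>C f k) = (\<Sum>k\<in>K. a k * complex_of_real ((sqrt_mu C X (f k))\<^sup>2))"
  using group_sum(1)[OF assms(1) finite_minimal(2) assms(2), where a = a]
    group_sum(2)[OF assms(1) finite_minimal(2) assms(2), where a = a and h = "\<lambda>f. complex_of_real ((sqrt_mu C X f)\<^sup>2)"]
  by (simp add: right_state_expansion)

text \<open>Expand the left side in the minimal projections. If one of them,
  \<open>1 \<otimes> q\<close>, differs from \<open>e\<close>, then \<open>q\<close> vanishes on
  \<open>Y\<close>; sliding \<open>q\<close> through \<open>r\<close> gives
  \<open>r \<cdot> q = 0\<close>, so its coefficient is 0. The coefficient of \<open>e\<close> is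
  read off along \<open>w\<close>.\<close>

lemma simple_piece:
  assumes Y: "simple_arrow C Y" and w: "isometry C Y X w" and e: "e \<in> left_minimal C X" "e \<cdot> w = w"
    and W: "W \<in> Arr C" "src C W = tgt C Y" "tgt C W = src C Y"
    and r: "r \<in> Hom C (\<I> (src C X)) (W \<otimes>\<^sub>1 Y)"
  shows "\<one> X \<otimes> (adj C r \<cdot> r) = complex_of_real ((norm (\<one> Y \<otimes> r))\<^sup>2) *\<^sub>C e"
proof -
  note V = isometryD[OF w]
  have sY: "src C Y = src C X"
    using V(1) by (simp add: parallel_def)
  define N where N: "N = src C X"
  have I: "N \<in> Ob C" "\<I> N \<in> Arr C" "src C (\<I> N) = N" "tgt C (\<I> N) = N"
    using XA by (auto simp: N arr_simps)
  have p: "parallel C (\<I> N) (W \<otimes>\<^sub>1 Y)"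
    using I V W sY by (simp add: parallel_def arr_simps N)
  have rN: "r \<in> Hom C (\<I> N) (W \<otimes>\<^sub>1 Y)"
    using r by (simp add: N)
  note ra = adj_closed[OF p rN] parallel_sym[OF p]
  let ?z = "adj C r \<cdot> r" and ?k = "complex_of_real ((norm (\<one> Y \<otimes> r))\<^sup>2)"
  have z: "?z \<in> object_center C (src C X)"
    using vcomp_closed[OF p ra(2) rN ra(1)] by (simp add: object_center_def N)
  show ?thesis
  proof (cases "\<one> Y = 0")
    case True
    then have 0: "r = 0"
      using zero_arrow_solution[of Y W r] V W r sY by simp
    have "?z = 0"
      using vcomp_zero_right[OF p ra(2) ra(1)] 0 by simp
    moreover have "\<one> Y \<otimes> r = 0"
      using hcomp_zero_right[OF p, of Y Y "\<one> Y"] V sY I by (simp add: 0 id2_closed N)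
    ultimately show ?thesis
      using whisker_center_linear(2)[OF XA, of 0 0] z by simp
  next
    case False
    have "w \<noteq> 0"
      using False V vcomp_zero_right[of Y X Y "adj C w"] by auto
    have zL: "\<one> X \<otimes> ?z \<in> left_center C X"
      using z by (auto simp: left_center_def)
    have zH: "\<one> X \<otimes> ?z \<in> Hom C X X"
      using whisker_center_closed[OF XA z] .
    obtain c where c: "\<one> X \<otimes> ?z = (\<Sum>e\<in>L.minproj. c e *\<^sub>C e)"
      using L.minproj_expansion[OF zL] by auto
    have ce: "(\<one> X \<otimes> ?z) \<cdot> e' = c e' *\<^sub>C e'" if "e' \<in> left_minimal C X" for e'
      unfolding c using that by (intro L.expansion_mul) (simp flip: left_minimal_eq)
    have c0: "c e' = 0" if e': "e' \<in> left_minimal C X" "e' \<noteq> e" for e'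
    proof -
      note E' = minimalD[OF e'(1)] and E = minimalD[OF e(1)]
      obtain q where q: "e' = \<one> X \<otimes> q" "q \<in> object_center C (src C X)"
        using E'(1) by (auto simp: left_center_def)
      have qY: "\<one> Y \<otimes> q \<in> Hom C Y Y"
        using whisker_center_closed[OF V(6), of q] q sY by simp
      have "w \<cdot> (\<one> Y \<otimes> q) = e' \<cdot> w"
        using whisker_center_natural[OF V(6), of q X w] q sY V by simp
      also have "\<dots> = (e' \<cdot> e) \<cdot> w"
        using vcomp_assoc[of Y X X X w e e'] E E' V e by simp
      also have "\<dots> = 0"
        using minimal_orthogonal(1)[OF e'(1) e(1) e'(2)] vcomp_zero_left[of Y X X w] V by simp
      finally have "adj C w \<cdot> (w \<cdot> (\<one> Y \<otimes> q)) = 0"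
        using V vcomp_zero_right[of Y X Y "adj C w"] by simp
      then have q0: "\<one> Y \<otimes> q = 0"
        using V qY vcomp_assoc[of Y Y X Y "\<one> Y \<otimes> q" w "adj C w"] vcomp_id_left[of Y Y "\<one> Y \<otimes> q"] by simp
      have qI: "q \<in> Hom C (\<I> N) (\<I> N)"
        using q by (simp add: object_center_def N)
      let ?r = "Cell (\<I> N) r (W \<otimes>\<^sub>1 Y)" and ?q = "Cell (\<I> N) q (\<I> N)"
      have cc: "cell ?r" "cell ?q"
        using p rN qI I by (auto intro: cellI)
      have W': "src C Y = N" "tgt C W = N"
        using W sY N by auto
      have "?r \<bullet> ?q = (idc W \<star> (idc Y \<star> ?q)) \<bullet> ?r"
        using hc_whisker[of ?r ?q] cc I V W W' by (simp add: typing hc_id hc_assoc flip: idc_hc)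
      then have "r \<cdot> q = (\<one> W \<otimes> (\<one> Y \<otimes> q)) \<cdot> r"
        by (auto dest!: arg_cong[of _ _ cval])
      also have "\<dots> = 0"
        using hcomp_zero_right[of Y Y W W "\<one> W"] W V q0 vcomp_zero_left[OF p parallel_simps[OF parallel_Arr(2)[OF p]] rN] by (simp add: id2_closed)
      finally have "?z \<cdot> q = 0"
        using vcomp_assoc[of "\<I> N" "\<I> N" "W \<otimes>\<^sub>1 Y" "\<I> N" q r "adj C r"] p ra rN qI I vcomp_zero_right[OF p ra(2,1)] by simp
      then have "c e' *\<^sub>C e' = \<one> X \<otimes> 0"
        using ce[OF e'(1)] whisker_center_mult[OF XA z q(2)] q by simp
      also have "\<dots> = 0"
        using whisker_center_linear(2)[OF XA z, of 0] by simp
      finally show ?thesis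
        using E'(5) by simp
    qed
    have "c e *\<^sub>C w = (c e *\<^sub>C e) \<cdot> w"
      using V minimalD[OF e(1)] e by (simp add: vcomp_scaleC_left[of Y X X])
    also have "\<dots> = (\<one> X \<otimes> ?z) \<cdot> (e \<cdot> w)"
      unfolding ce[OF e(1), symmetric] using vcomp_assoc[of Y X X X w e "\<one> X \<otimes> ?z"] V zH minimalD[OF e(1)] by simp
    also have "\<dots> = w \<cdot> (\<one> Y \<otimes> ?z)"
      using whisker_center_natural[OF V(6), of ?z X w] z sY V e by simp
    also have "\<dots> = ?k *\<^sub>C w"
      using simple_square[OF Y W] r sY V by (simp add: vcomp_scaleC_right[of Y Y X] id2_closed vcomp_id_right[of Y X])
    finally have "c e = ?k"
      using \<open>w \<noteq> 0\<close> by simp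
    have "\<one> X \<otimes> ?z = (\<Sum>e'\<in>left_minimal C X. if e' = e then ?k *\<^sub>C e else 0)"
      unfolding c left_minimal_eq[symmetric] using c0 \<open>c e = ?k\<close> by (intro sum.cong) auto
    then show ?thesis
      using e(1) finite_minimal by simp
  qed
qed

text \<open>\<open>left_inverse_map_sum\<close> removes the cross terms, and by
  \<open>simple_piece\<close> every constituent contributes a multiple of the same
  \<open>e\<close>.\<close>

lemma left_inverse_simple_sum:
  assumes v: "isometry C S X v" "e \<in> left_minimal C X" "e \<cdot> v = v" and W: "W \<in> Arr C" "src C W = tgt C S" "tgt C W = src C S"
    and Y: "\<And>h. h < (n::nat) \<Longrightarrow> simple_arrow C (Y h)" and u: "\<And>h. h < n \<Longrightarrow> isometry C (Y h) S (u h)"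
    and u': "\<And>h. h < n \<Longrightarrow> isometry C (Y' h) W (u' h)" and uu': "(\<Sum>h<n. u' h \<cdot> adj C (u' h)) = \<one> W"
    and rh: "\<And>h. h < n \<Longrightarrow> rh h \<in> Hom C (\<I> (src C S)) (Y' h \<otimes>\<^sub>1 Y h)"
    and q: "q = (\<Sum>h<n. (u' h \<otimes> u h) \<cdot> rh h)" and s: "s \<in> Hom C S S"
    and c: "\<And>h. h < n \<Longrightarrow> adj C (u h) \<cdot> s \<cdot> u h = c h *\<^sub>C \<one> (Y h)"
  shows "\<one> X \<otimes> left_inverse_map C W q s = (\<Sum>h<n. c h * complex_of_real ((norm (\<one> (Y h) \<otimes> rh h))\<^sup>2)) *\<^sub>C e"
proof -
  note V = isometryD[OF v(1)] and U = isometryD[OF u] and U' = isometryD[OF u']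
  have SX: "src C S = src C X" "tgt C S = tgt C X"
    using V(1) by (auto simp: parallel_def)
  have sY: "src C (Y h) = src C S" "tgt C (Y h) = tgt C S" "Y' h \<in> Arr C" "src C (Y' h) = tgt C S" "tgt C (Y' h) = src C S"
    if "h < n" for h
    using U(1)[OF that] U'(1)[OF that] W by (auto simp: parallel_def)
  have "\<one> W \<cdot> u' h = u' h" if "h < n" for h
    using vcomp_id_left[OF U'(1,2)[OF that]] .
  then have orth: "adj C (u' h) \<cdot> u' j = 0" if "h < n" "j < n" "h \<noteq> j" for h j
    using isometries_orthogonal[of "{..<n}" Y' W u' "\<one> W" h j] that u' uu' by simp
  have rr: "adj C (rh h) \<cdot> rh h \<in> object_center C (src C X)" if h: "h < n" for h
    using left_inverse_map_closed[of "Y h" "Y' h" "rh h" "\<one> (Y h)"] left_inverse_map_one[of "Y h" "Y' h" "rh h"]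
      rh[OF h] sY[OF h] U[OF h] SX by (simp add: id2_closed)
  have "left_inverse_map C W q s =
      (\<Sum>h<n. complex_of_real (1\<^sup>2) *\<^sub>C left_inverse_map C (Y' h) (rh h) (adj C (u h) \<cdot> s \<cdot> u h))"
    using W V U u' orth rh s
    by (intro left_inverse_map_sum[where X = S and X' = W and Y = Y and Y' = Y' and v = u and v' = u']) (auto simp: q)
  also have "\<dots> = (\<Sum>h<n. c h *\<^sub>C (adj C (rh h) \<cdot> rh h))"
  proof (intro sum.cong refl)
    fix h assume "h \<in> {..<n}"
    then have h: "h < n"
      by simp
    show "complex_of_real (1\<^sup>2) *\<^sub>C left_inverse_map C (Y' h) (rh h) (adj C (u h) \<cdot> s \<cdot> u h) = c h *\<^sub>C (adj C (rh h) \<cdot> rh h)"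
      unfolding c[OF h] using left_inverse_map_scale[of "Y h" "Y' h" "rh h" "\<one> (Y h)" "c h"]
        left_inverse_map_one[of "Y h" "Y' h" "rh h"] rh[OF h] sY[OF h] U[OF h] by (simp add: id2_closed)
  qed
  finally have "\<one> X \<otimes> left_inverse_map C W q s = (\<Sum>h<n. \<one> X \<otimes> (c h *\<^sub>C (adj C (rh h) \<cdot> rh h)))"
    using whisker_center_linear(3)[OF XA object_center_scale[OF arr_simps(1)[OF XA] rr], of "{..<n}" _ c] by simp
  also have "\<dots> = (\<Sum>h<n. (c h * complex_of_real ((norm (\<one> (Y h) \<otimes> rh h))\<^sup>2)) *\<^sub>C e)"
  proof (intro sum.cong refl)
    fix h assume "h \<in> {..<n}"
    then have h: "h < n"
      by simp
    have "e \<cdot> (v \<cdot> u h) = v \<cdot> u h"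
      using vcomp_assoc[of "Y h" S X X "u h" v e] U[OF h] V v minimalD[OF v(2)] by simp
    then have "\<one> X \<otimes> (adj C (rh h) \<cdot> rh h) = complex_of_real ((norm (\<one> (Y h) \<otimes> rh h))\<^sup>2) *\<^sub>C e"
      using simple_piece[OF Y[OF h] isometry_comp(1)[OF u[OF h] v(1)] v(2), of "Y' h" "rh h"] sY[OF h] rh[OF h] SX by simp
    then show "\<one> X \<otimes> (c h *\<^sub>C (adj C (rh h) \<cdot> rh h)) = (c h * complex_of_real ((norm (\<one> (Y h) \<otimes> rh h))\<^sup>2)) *\<^sub>C e"
      using whisker_center_linear(2)[OF XA rr[OF h]] by (simp add: scaleC_scaleC)
  qed
  finally show ?thesis
    by (simp add: complex_vs.scale_sum_left)
qed

text \<open>The same \<open>k\<close> serves both sides because each simple constituent carries a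
  normalized solution, whose two norms agree.\<close>

lemma factorial_piece:
  assumes f: "f \<in> right_minimal C X" and e: "e \<in> left_minimal C X" and v: "isometry_onto C S X v (f \<cdot> e)"
    and q: "standard_solution_factorial C S S' q q'" and s: "s \<in> Hom C S S"
  shows "\<exists>k. \<one> X \<otimes> left_inverse_map C S' q s = k *\<^sub>C e \<and> right_inverse_map C S' q' s \<otimes> \<one> X = k *\<^sub>C f"
proof -
  interpret h: category_arrow "hop C" X
    by (rule hop_arrow)
  have S': "S' \<in> Arr C" "src C S' = tgt C S" "tgt C S' = src C S"
    using q by (auto simp: standard_solution_factorial_def)
  obtain n :: nat and Y Y' u u' rh rh' where
    Y: "\<And>h. h < n \<Longrightarrow> simple_arrow C (Y h)" "\<And>h. h < n \<Longrightarrow> isometry C (Y h) S (u h)"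
      "\<And>h. h < n \<Longrightarrow> isometry C (Y' h) S' (u' h)"
      "\<And>h. h < n \<Longrightarrow> normalized_solution C (Y h) (Y' h) (rh h) (rh' h)"
    and uu: "(\<Sum>h<n. u h \<cdot> adj C (u h)) = \<one> S" and uu': "(\<Sum>h<n. u' h \<cdot> adj C (u' h)) = \<one> S'"
    and qq: "q = (\<Sum>h<n. (u' h \<otimes> u h) \<cdot> rh h)" "q' = (\<Sum>h<n. (u h \<otimes> u' h) \<cdot> rh' h)"
    using q unfolding standard_solution_factorial_def by blast
  note U = isometryD[OF Y(2)]
  have vi: "isometry C S X v"
    using v by (simp add: isometry_onto_def)
  have "adj C (u h) \<cdot> s \<cdot> u h \<in> Hom C (Y h) (Y h)" if "h < n" for h
    using Hom_I[of "st (Cell (Y h) (u h) S) \<bullet> Cell S s S \<bullet> Cell (Y h) (u h) S" "Y h" "Y h"] cellI[OF U(1,2)[OF that]] cellI[of S S s] s U[OF that]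
    by (simp add: typing)
  then have "\<exists>c. adj C (u h) \<cdot> s \<cdot> u h = c *\<^sub>C \<one> (Y h)" if "h < n" for h
    using simple_scalar[OF Y(1)[OF that]] that by blast
  then obtain c where c: "\<And>h. h < n \<Longrightarrow> adj C (u h) \<cdot> s \<cdot> u h = c h *\<^sub>C \<one> (Y h)"
    by metis
  have sol: "conjugate_solution C (Y h) (Y' h) (rh h) (rh' h)" "norm (\<one> (Y h) \<otimes> rh h) = norm (rh' h \<otimes> \<one> (Y h))" if "h < n" for h
    using Y(4)[OF that] by (auto simp: normalized_solution_def)
  have sY: "src C (Y h) = src C S" "tgt C (Y h) = tgt C S" if "h < n" for h
    using U(1)[OF that] by (auto simp: parallel_def)
  have rh: "rh h \<in> Hom C (\<I> (src C S)) (Y' h \<otimes>\<^sub>1 Y h)" "rh' h \<in> Hom C (\<I> (tgt C S)) (Y h \<otimes>\<^sub>1 Y' h)" if "h < n" for h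
    using sol(1)[OF that] sY[OF that] by (auto simp: conjugate_solution_def)
  let ?k = "\<Sum>h<n. c h * complex_of_real ((norm (\<one> (Y h) \<otimes> rh h))\<^sup>2)"
  have "\<one> X \<otimes> left_inverse_map C S' q s = ?k *\<^sub>C e"
    by (rule left_inverse_simple_sum[OF vi e sub_absorb(2)[OF f e v] S' Y(1) Y(2) Y(3) uu' rh(1) qq(1) s c])
  moreover have "right_inverse_map C S' q' s \<otimes> \<one> X = (\<Sum>h<n. c h * complex_of_real ((norm (rh' h \<otimes> \<one> (Y h)))\<^sup>2)) *\<^sub>C f"
    unfolding right_inverse_map_hop
    using h.left_inverse_simple_sum[of S v f S' n Y u Y' u' rh' q' s c] vi f sub_absorb(1)[OF f e v] S' Y(1-3) uu' rh(2) qq(2) s c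
    by simp
  ultimately show ?thesis
    using sol(2) by (intro exI[of _ ?k]) (simp cong: sum.cong_simp)
qed

lemma product_orthogonal:
  assumes "f \<in> right_minimal C X" "e \<in> left_minimal C X" "f' \<in> right_minimal C X" "e' \<in> left_minimal C X"
    and "f \<noteq> f' \<or> e \<noteq> e'"
  shows "(f \<cdot> e) \<cdot> (f' \<cdot> e') = 0"
proof -
  note H = right_minimalD(2)[OF assms(1)] minimalD(2)[OF assms(2)] right_minimalD(2)[OF assms(3)] minimalD(2)[OF assms(4)]
  let ?c = "\<lambda>t. Cell X t X"
  have c: "cell (?c f)" "cell (?c e)" "cell (?c f')" "cell (?c e')"
    using H XA by (auto intro!: cellI)
  have z: "0 \<cdot> t = 0" "t \<cdot> 0 = 0" if "t \<in> Hom C X X" for t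
    using that XA vcomp_zero_left[of X X X t] vcomp_zero_right[of X X X t] by auto
  have comm: "e \<cdot> f' = f' \<cdot> e"
    using product_projection(1)[OF assms(3,2)] by simp
  have ef: "?c e \<bullet> ?c f' = ?c f' \<bullet> ?c e"
    using comm by (intro cell_eqI) auto
  have "(?c f \<bullet> ?c e) \<bullet> (?c f' \<bullet> ?c e') = ?c f \<bullet> ((?c e \<bullet> ?c f') \<bullet> ?c e')"
    using c by (simp add: vc_assoc typing)
  also have "\<dots> = (?c f \<bullet> ?c f') \<bullet> (?c e \<bullet> ?c e')"
    unfolding ef using c by (simp add: vc_assoc typing)
  finally have "(f \<cdot> e) \<cdot> (f' \<cdot> e') = (f \<cdot> f') \<cdot> (e \<cdot> e')"
    by (auto dest!: arg_cong[of _ _ cval])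
  moreover have "f \<cdot> f' \<in> Hom C X X" "e \<cdot> e' \<in> Hom C X X"
    using H XA by (auto intro: vcomp_closed[of X X X])
  ultimately show ?thesis
    using assms minimal_orthogonal z by metis
qed

text \<open>The range prescribed for an isometry into \<open>X'\<close> is the image under
  \<open>bullet\<close> of the range in \<open>X\<close>; as \<open>bullet\<close> reverses
  products, orthogonality passes from \<open>X\<close> to \<open>X'\<close>.\<close>

lemma bimodule_projection:
  assumes s: "conjugate_solution C X X' r r'" and N: "N = src C X" and M: "M = tgt C X"
    and p: "p \<in> object_center C M" and q: "q \<in> object_center C N"
  shows "p \<otimes> \<one> X \<otimes> q = (p \<otimes> \<one> X) \<cdot> (\<one> X \<otimes> q)"
    "q \<otimes> \<one> X' \<otimes> p = conjugate_pair.bullet C X X' (Cell (\<I> N) r (X' \<otimes>\<^sub>1 X)) ((p \<otimes> \<one> X) \<cdot> (\<one> X \<otimes> q))"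
proof -
  interpret P: conjugate_pair C N M X X' "Cell (\<I> N) r (X' \<otimes>\<^sub>1 X)" "Cell (\<I> M) r' (X \<otimes>\<^sub>1 X')"
    using s N M by (intro conjugate_solution_pair two_C_star_category_axioms)
  let ?p = "Cell (\<I> M) p (\<I> M)" and ?q = "Cell (\<I> N) q (\<I> N)"
  have c: "cell ?p" "cell ?q"
    using p q by (auto intro!: cellI simp: object_center_def)
  have "(?p \<star> idc X) \<star> ?q = (?p \<star> idc X) \<bullet> (idc X \<star> ?q)"
    using hc_whisker(1)[of "?p \<star> idc X" ?q] c by (simp add: typing hc_id)
  then show "p \<otimes> \<one> X \<otimes> q = (p \<otimes> \<one> X) \<cdot> (\<one> X \<otimes> q)"
    by (auto dest!: arg_cong[of _ _ cval])
  have "(?q \<star> idc X') \<star> ?p = (?q \<star> idc X') \<bullet> (idc X' \<star> ?p)"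
    using hc_whisker(1)[of "?q \<star> idc X'" ?p] c by (simp add: typing hc_id)
  then have 1: "q \<otimes> \<one> X' \<otimes> p = (q \<otimes> \<one> X') \<cdot> (\<one> X' \<otimes> p)"
    by (auto dest!: arg_cong[of _ _ cval])
  have "p \<otimes> \<one> X \<in> Hom C X X" "\<one> X \<otimes> q \<in> Hom C X X"
    using Hom_I[of "?p \<star> idc X" X X] Hom_I[of "idc X \<star> ?q" X X] c by (simp_all add: typing)
  then show "q \<otimes> \<one> X' \<otimes> p = P.bullet ((p \<otimes> \<one> X) \<cdot> (\<one> X \<otimes> q))"
    unfolding 1 using p q by (simp add: P.bullet_mult P.bullet_left_center P.bullet_right_center object_center_def)
qed

lemma standard_spherical:
  assumes con: "connected_arrow C X" and st: "standard_solution C X X' r r'"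
  shows "spherical C X X' r r'"
  unfolding spherical_def
proof
  fix t assume t: "t \<in> Hom C X X"
  let ?E = "left_minimal C X" and ?F = "right_minimal C X"
  interpret h: category_arrow "hop C" X
    by (rule hop_arrow)
  obtain p q Xs Xs' v v' rs rs' where body:
    "(\<forall>f\<in>?F. p f \<in> object_center C (tgt C X) \<and> p f \<otimes> \<one> X = f) \<and>
     (\<forall>e\<in>?E. q e \<in> object_center C (src C X) \<and> \<one> X \<otimes> q e = e) \<and>
     (\<forall>f\<in>?F. \<forall>e\<in>?E. isometry_onto C (Xs f e) X (v f e) (p f \<otimes> \<one> X \<otimes> q e) \<and>
        isometry_onto C (Xs' f e) X' (v' f e) (q e \<otimes> \<one> X' \<otimes> p f) \<and>
        standard_solution_factorial C (Xs f e) (Xs' f e) (rs f e) (rs' f e)) \<and>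
     r = (\<Sum>f\<in>?F. \<Sum>e\<in>?E. (sqrt (sqrt_mu C X f) / sqrt (sqrt_nu C X e)) *\<^sub>R ((v' f e \<otimes> v f e) \<cdot> rs f e)) \<and>
     r' = (\<Sum>f\<in>?F. \<Sum>e\<in>?E. (sqrt (sqrt_nu C X e) / sqrt (sqrt_mu C X f)) *\<^sub>R ((v f e \<otimes> v' f e) \<cdot> rs' f e))"
    using st unfolding standard_solution_def by (elim conjE exE) (rule that, intro conjI; assumption)
  have p: "\<And>f. f \<in> ?F \<Longrightarrow> p f \<in> object_center C (tgt C X) \<and> p f \<otimes> \<one> X = f"
    and q: "\<And>e. e \<in> ?E \<Longrightarrow> q e \<in> object_center C (src C X) \<and> \<one> X \<otimes> q e = e"
    and pcs: "\<And>f e. f \<in> ?F \<Longrightarrow> e \<in> ?E \<Longrightarrow> isometry_onto C (Xs f e) X (v f e) (p f \<otimes> \<one> X \<otimes> q e) \<and>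
        isometry_onto C (Xs' f e) X' (v' f e) (q e \<otimes> \<one> X' \<otimes> p f) \<and>
        standard_solution_factorial C (Xs f e) (Xs' f e) (rs f e) (rs' f e)"
    and r: "r = (\<Sum>f\<in>?F. \<Sum>e\<in>?E. (sqrt (sqrt_mu C X f) / sqrt (sqrt_nu C X e)) *\<^sub>R ((v' f e \<otimes> v f e) \<cdot> rs f e))"
    and r': "r' = (\<Sum>f\<in>?F. \<Sum>e\<in>?E. (sqrt (sqrt_nu C X e) / sqrt (sqrt_mu C X f)) *\<^sub>R ((v f e \<otimes> v' f e) \<cdot> rs' f e))"
    using body by auto
  have sol: "conjugate_solution C X X' r r'"
    using st by (simp add: standard_solution_def)
  define N M where NM: "N = src C X" "M = tgt C X"
  interpret P: conjugate_pair C N M X X' "Cell (\<I> N) r (X' \<otimes>\<^sub>1 X)" "Cell (\<I> M) r' (X \<otimes>\<^sub>1 X')"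
    using sol NM by (intro conjugate_solution_pair two_C_star_category_axioms)
  have X': "X' \<in> Arr C" "src C X' = tgt C X" "tgt C X' = src C X"
    using sol by (auto simp: conjugate_solution_def)
  have v: "isometry_onto C (Xs f e) X (v f e) (f \<cdot> e)" and v': "isometry_onto C (Xs' f e) X' (v' f e) (P.bullet (f \<cdot> e))"
    and sf: "standard_solution_factorial C (Xs f e) (Xs' f e) (rs f e) (rs' f e)" if "f \<in> ?F" "e \<in> ?E" for f e
  proof -
    have "p f \<otimes> \<one> X \<otimes> q e = f \<cdot> e" "q e \<otimes> \<one> X' \<otimes> p f = P.bullet (f \<cdot> e)"
      using bimodule_projection[OF sol NM, of "p f" "q e"] p[OF that(1)] q[OF that(2)] by simp_all
    then show "isometry_onto C (Xs f e) X (v f e) (f \<cdot> e)" "isometry_onto C (Xs' f e) X' (v' f e) (P.bullet (f \<cdot> e))"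
      "standard_solution_factorial C (Xs f e) (Xs' f e) (rs f e) (rs' f e)"
      using pcs[OF that] by simp_all
  qed
  \<comment> \<open>A pair \<open>k\<close> of row \<open>fst k\<close> and column
    \<open>snd k\<close> stands for one factorial piece, so the double sums become single
    sums.\<close>
  let ?K = "?F \<times> ?E"
  have K: "finite ?K"
    using finite_minimal by simp
  have pairs: "(\<Sum>f\<in>?F. \<Sum>e\<in>?E. g f e) = (\<Sum>k\<in>?K. g (fst k) (snd k))" for g :: "'t \<Rightarrow> 't \<Rightarrow> 't"
    by (simp add: sum.cartesian_product case_prod_unfold)
  have vi: "isometry C (Xs (fst k) (snd k)) X (v (fst k) (snd k))" and vi': "isometry C (Xs' (fst k) (snd k)) X' (v' (fst k) (snd k))"
    if "k \<in> ?K" for k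
    using v[of "fst k" "snd k"] v'[of "fst k" "snd k"] that by (auto simp: isometry_onto_def)
  note V = isometryD[OF vi] and V' = isometryD[OF vi']
  have rs: "rs (fst k) (snd k) \<in> Hom C (\<I> (src C X)) (Xs' (fst k) (snd k) \<otimes>\<^sub>1 Xs (fst k) (snd k))"
     "rs' (fst k) (snd k) \<in> Hom C (\<I> (tgt C X)) (Xs (fst k) (snd k) \<otimes>\<^sub>1 Xs' (fst k) (snd k))" if k: "k \<in> ?K" for k
    using standard_factorial_Hom[OF sf[of "fst k" "snd k"]] k V(1)[OF k] by (auto simp: parallel_def)
  have feH: "f \<cdot> e \<in> Hom C X X" if "f \<in> ?F" "e \<in> ?E" for f e
    using product_projection(2)[OF that] .
  have orth: "adj C (v (fst k) (snd k)) \<cdot> v (fst l) (snd l) = 0 \<and> adj C (v' (fst k) (snd k)) \<cdot> v' (fst l) (snd l) = 0"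
    if kl: "k \<in> ?K" "l \<in> ?K" "k \<noteq> l" for k l
  proof -
    let ?g = "\<lambda>k. fst k \<cdot> snd k"
    have ne: "fst k \<noteq> fst l \<or> snd k \<noteq> snd l"
      using kl(3) by (auto simp: prod_eq_iff)
    have 0: "?g k \<cdot> ?g l = 0" "?g l \<cdot> ?g k = 0"
      using product_orthogonal[of "fst k" "snd k" "fst l" "snd l"] product_orthogonal[of "fst l" "snd l" "fst k" "snd k"] kl ne by auto
    have b0: "P.bullet (?g k) \<cdot> P.bullet (?g l) = 0"
      using P.bullet_mult[of "?g l" "?g k"] 0 feH kl P.bullet_zero by auto
    show ?thesis
      using orthogonal_ranges[of "Xs (fst k) (snd k)" X "v (fst k) (snd k)" "?g k" "Xs (fst l) (snd l)" "v (fst l) (snd l)" "?g l"]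
        orthogonal_ranges[of "Xs' (fst k) (snd k)" X' "v' (fst k) (snd k)" "P.bullet (?g k)" "Xs' (fst l) (snd l)" "v' (fst l) (snd l)" "P.bullet (?g l)"]
        v[of "fst k" "snd k"] v[of "fst l" "snd l"] v'[of "fst k" "snd k"] v'[of "fst l" "snd l"] kl 0 b0 by auto
  qed
  define s where "s k = adj C (v (fst k) (snd k)) \<cdot> t \<cdot> v (fst k) (snd k)" for k
  have sH: "s k \<in> Hom C (Xs (fst k) (snd k)) (Xs (fst k) (snd k))" if k: "k \<in> ?K" for k
    using Hom_I[of "st (Cell (Xs (fst k) (snd k)) (v (fst k) (snd k)) X) \<bullet> Cell X t X \<bullet> Cell (Xs (fst k) (snd k)) (v (fst k) (snd k)) X"
        "Xs (fst k) (snd k)" "Xs (fst k) (snd k)"] cellI[OF V(1,2)[OF k]] cellI[of X X t] t XA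
    by (simp add: typing s_def)
  have "\<exists>\<kappa>. \<one> X \<otimes> left_inverse_map C (Xs' (fst k) (snd k)) (rs (fst k) (snd k)) (s k) = \<kappa> *\<^sub>C snd k \<and>
     right_inverse_map C (Xs' (fst k) (snd k)) (rs' (fst k) (snd k)) (s k) \<otimes> \<one> X = \<kappa> *\<^sub>C fst k"
    if k: "k \<in> ?K" for k
    using factorial_piece[OF _ _ v sf sH[OF k]] k by auto
  then obtain \<kappa> where \<kappa>: "\<And>k. k \<in> ?K \<Longrightarrow> \<one> X \<otimes> left_inverse_map C (Xs' (fst k) (snd k)) (rs (fst k) (snd k)) (s k) = \<kappa> k *\<^sub>C snd k \<and>
     right_inverse_map C (Xs' (fst k) (snd k)) (rs' (fst k) (snd k)) (s k) \<otimes> \<one> X = \<kappa> k *\<^sub>C fst k"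
    by metis
  define l where "l k = sqrt (sqrt_mu C X (fst k)) / sqrt (sqrt_nu C X (snd k))" for k
  define m where "m k = sqrt (sqrt_nu C X (snd k)) / sqrt (sqrt_mu C X (fst k))" for k
  have sX: "Xs (fst k) (snd k) \<in> Arr C" "src C (Xs (fst k) (snd k)) = src C X" "tgt C (Xs (fst k) (snd k)) = tgt C X"
    "Xs' (fst k) (snd k) \<in> Arr C" "src C (Xs' (fst k) (snd k)) = tgt C X" "tgt C (Xs' (fst k) (snd k)) = src C X"
    if k: "k \<in> ?K" for k
    using V(1)[OF k] V'(1)[OF k] X' by (auto simp: parallel_def)
  have lk: "left_inverse_map C (Xs' (fst k) (snd k)) (rs (fst k) (snd k)) (s k) \<in> object_center C (src C X)"
    "right_inverse_map C (Xs' (fst k) (snd k)) (rs' (fst k) (snd k)) (s k) \<in> object_center C (tgt C X)" if k: "k \<in> ?K" for k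
    using left_inverse_map_closed[of "Xs (fst k) (snd k)" "Xs' (fst k) (snd k)" "rs (fst k) (snd k)" "s k"]
      h.left_inverse_map_closed[of "Xs (fst k) (snd k)" "Xs' (fst k) (snd k)" "rs' (fst k) (snd k)" "s k"] sX[OF k] rs[OF k] sH[OF k]
    by (auto simp: right_inverse_map_hop)
  have rK: "r = (\<Sum>k\<in>?K. complex_of_real (l k) *\<^sub>C ((v' (fst k) (snd k) \<otimes> v (fst k) (snd k)) \<cdot> rs (fst k) (snd k)))"
    "r' = (\<Sum>k\<in>?K. complex_of_real (m k) *\<^sub>C ((v (fst k) (snd k) \<otimes> v' (fst k) (snd k)) \<cdot> rs' (fst k) (snd k)))"
    unfolding r r' pairs l_def m_def by (simp_all only: scaleC_of_real)
  have "left_inverse_map C X' r t = (\<Sum>k\<in>?K. complex_of_real ((l k)\<^sup>2) *\<^sub>C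
      left_inverse_map C (Xs' (fst k) (snd k)) (rs (fst k) (snd k)) (s k))"
    unfolding s_def
    by (rule left_inverse_map_sum[where Y = "\<lambda>k. Xs (fst k) (snd k)", OF K XA X' _ vi' _ rs(1)])
      (use V orth t rK(1) in auto)
  then have "\<one> X \<otimes> left_inverse_map C X' r t = (\<Sum>k\<in>?K. (complex_of_real ((l k)\<^sup>2) * \<kappa> k) *\<^sub>C snd k)"
    using lk \<kappa> object_center_scale[OF arr_simps(1)[OF XA]]
    by (simp add: whisker_center_linear[OF XA] scaleC_scaleC del: of_real_power)
  then have left: "left_state C X (\<one> X \<otimes> left_inverse_map C X' r t) =
      (\<Sum>k\<in>?K. complex_of_real ((l k)\<^sup>2) * \<kappa> k * complex_of_real ((sqrt_nu C X (snd k))\<^sup>2))"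
    using left_state_sum[OF K, of snd] by (simp add: mem_Times_iff del: of_real_power)
  have "left_inverse_map (hop C) X' r' t = (\<Sum>k\<in>?K. complex_of_real ((m k)\<^sup>2) *\<^sub>C
      left_inverse_map (hop C) (Xs' (fst k) (snd k)) (rs' (fst k) (snd k)) (s k))"
    unfolding s_def
    using h.left_inverse_map_sum[of ?K X X' "\<lambda>k. Xs (fst k) (snd k)" "\<lambda>k. v (fst k) (snd k)" "\<lambda>k. Xs' (fst k) (snd k)"
        "\<lambda>k. v' (fst k) (snd k)" "\<lambda>k. rs' (fst k) (snd k)" r' m t] K XA X' V vi' orth rs t rK(2)
    by simp
  then have "right_inverse_map C X' r' t \<otimes> \<one> X = (\<Sum>k\<in>?K. (complex_of_real ((m k)\<^sup>2) * \<kappa> k) *\<^sub>C fst k)"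
    using lk \<kappa> object_center_scale[OF arr_simps(2)[OF XA]] XA
      h.whisker_center_linear(2)[of X] h.whisker_center_linear(3)[of X ?K]
    by (simp add: right_inverse_map_hop scaleC_scaleC del: of_real_power)
  then have right: "right_state C X (right_inverse_map C X' r' t \<otimes> \<one> X) =
      (\<Sum>k\<in>?K. complex_of_real ((m k)\<^sup>2) * \<kappa> k * complex_of_real ((sqrt_mu C X (fst k))\<^sup>2))"
    using right_state_sum[OF K, of fst] by (simp add: mem_Times_iff del: of_real_power)
  \<comment> \<open>The square of \<open>l k\<close> is \<open>sqrt_mu / sqrt_nu\<close> and that of
    \<open>m k\<close> is its inverse, so both sides equal \<open>sqrt_mu * sqrt_nu\<close>.\<close>
  have "(l k)\<^sup>2 * (sqrt_nu C X (snd k))\<^sup>2 = (m k)\<^sup>2 * (sqrt_mu C X (fst k))\<^sup>2" if k: "k \<in> ?K" for k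
    using sqrt_nu_pos[OF con, of "snd k"] sqrt_mu_pos[OF con, of "fst k"] k
    by (auto simp: l_def m_def power_divide power2_eq_square)
  then have "complex_of_real ((l k)\<^sup>2) * \<kappa> k * complex_of_real ((sqrt_nu C X (snd k))\<^sup>2) =
      complex_of_real ((m k)\<^sup>2) * \<kappa> k * complex_of_real ((sqrt_mu C X (fst k))\<^sup>2)" if k: "k \<in> ?K" for k
    using k by (simp add: mult.commute mult.left_commute del: of_real_power flip: of_real_mult)
  then show "left_state C X (\<one> X \<otimes> left_inverse_map C X' r t) = right_state C X (right_inverse_map C X' r' t \<otimes> \<one> X)"
    unfolding left right by (intro sum.cong refl)
qed

end

section \<open>Spherical solutions are standard\<close>

context two_C_star_category
begin

lemma left_inverse_map_add:
  assumes Y: "Y \<in> Arr C" and W: "W \<in> Arr C" "src C W = tgt C Y" "tgt C W = src C Y"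
    and r: "r \<in> Hom C (\<I> (src C Y)) (W \<otimes>\<^sub>1 Y)" and t: "t \<in> Hom C Y Y" "s \<in> Hom C Y Y"
  shows "left_inverse_map C W r (t + s) = left_inverse_map C W r t + left_inverse_map C W r s"
proof -
  let ?WY = "W \<otimes>\<^sub>1 Y"
  have p: "parallel C (\<I> (src C Y)) ?WY" "?WY \<in> Arr C"
    using Y W by (simp_all add: parallel_def arr_simps)
  have t': "\<one> W \<otimes> x \<in> Hom C ?WY ?WY" if "x \<in> Hom C Y Y" for x
    using Hom_I[of "idc W \<star> Cell Y x Y" ?WY ?WY] cellI[of Y Y x] Y W that by (simp add: typing)
  note ra = adj_closed[OF p(1) r] parallel_sym[OF p(1)]
  have c: "adj C r \<cdot> (\<one> W \<otimes> x) \<in> Hom C ?WY (\<I> (src C Y))" if "x \<in> Hom C Y Y" for x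
    using t'[OF that] p ra by (auto intro: vcomp_closed[of ?WY ?WY "\<I> (src C Y)"])
  show ?thesis
    unfolding left_inverse_map_def
    using hcomp_add_right[of Y Y W W t s "\<one> W"] Y W t t'[OF t(1)] t'[OF t(2)] c[OF t(1)] c[OF t(2)] p ra r
      vcomp_add_right[of ?WY ?WY "\<I> (src C Y)" "\<one> W \<otimes> t" "\<one> W \<otimes> s" "adj C r"]
      vcomp_add_left[of "\<I> (src C Y)" ?WY "\<I> (src C Y)" r "adj C r \<cdot> (\<one> W \<otimes> t)" "adj C r \<cdot> (\<one> W \<otimes> s)"]
    by (simp add: id2_closed)
qed

lemma vcomp_sum_both:
  assumes p: "parallel C V T" and a: "a \<in> Hom C T V" and b: "b \<in> Hom C V T" and x: "\<And>i. i \<in> I \<Longrightarrow> x i \<in> Hom C T T"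
  shows "a \<cdot> (\<Sum>i\<in>I. x i) \<cdot> b = (\<Sum>i\<in>I. a \<cdot> x i \<cdot> b)"
proof -
  note P = p parallel_sym[OF p] parallel_Arr[OF p]
  have ax: "a \<cdot> x i \<in> Hom C T V" if "i \<in> I" for i
    using P a x[OF that] by (auto intro: vcomp_closed[of T T V])
  have "a \<cdot> (\<Sum>i\<in>I. x i) = (\<Sum>i\<in>I. a \<cdot> x i)"
    using P a x by (intro vcomp_sum_right[of T T V]) auto
  then show ?thesis
    using P b ax vcomp_sum_left[of V T V b I "\<lambda>i. a \<cdot> x i"] by simp
qed

lemma factor_isometry:
  assumes v: "isometry_onto C S X v p" and w: "isometry C Y X w" "p \<cdot> w = w"
  shows "isometry C Y S (adj C v \<cdot> w)" "v \<cdot> (adj C v \<cdot> w) = w"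
    "(adj C v \<cdot> w) \<cdot> adj C (adj C v \<cdot> w) = adj C v \<cdot> (w \<cdot> adj C w) \<cdot> v"
proof -
  have i: "isometry C S X v" "v \<cdot> adj C v = p"
    using v by (auto simp: isometry_onto_def)
  note V = isometryD[OF i(1)] and W = isometryD[OF w(1)]
  let ?v = "Cell S v X" and ?w = "Cell Y w X"
  have c: "cell ?v" "cell ?w"
    using V W by (auto intro: cellI)
  have u: "st ?w \<bullet> ?w = idc Y" "(?v \<bullet> st ?v) \<bullet> ?w = ?w"
    using W w i by (auto intro!: cell_eqI)
  show 1: "v \<cdot> (adj C v \<cdot> w) = w"
    using vcomp_assoc[of Y X S X w "adj C v" v] V W i w by simp
  have "st (st ?v \<bullet> ?w) \<bullet> (st ?v \<bullet> ?w) = st ?w \<bullet> ((?v \<bullet> st ?v) \<bullet> ?w)"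
    using c by (simp add: typing st_vc st_st vc_assoc)
  also have "\<dots> = idc Y"
    unfolding u ..
  finally have "adj C (adj C v \<cdot> w) \<cdot> (adj C v \<cdot> w) = \<one> Y"
    by (auto dest!: arg_cong[of _ _ cval])
  then show "isometry C Y S (adj C v \<cdot> w)"
    using V W parallel_trans[OF W(1) V(4)] vcomp_closed[of Y X S w "adj C v"] by (simp add: isometry_def)
  have "(st ?v \<bullet> ?w) \<bullet> st (st ?v \<bullet> ?w) = st ?v \<bullet> (?w \<bullet> st ?w) \<bullet> ?v"
    using c by (simp add: typing st_vc st_st vc_assoc)
  then show "(adj C v \<cdot> w) \<cdot> adj C (adj C v \<cdot> w) = adj C v \<cdot> (w \<cdot> adj C w) \<cdot> v"
    by (auto dest!: arg_cong[of _ _ cval])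
qed

lemma isometry_range_projection:
  assumes "isometry C Y X w"
  shows "projection C X (w \<cdot> adj C w)"
proof -
  note W = isometryD[OF assms]
  let ?w = "Cell Y w X"
  have c: "cell ?w" "st ?w \<bullet> ?w = idc Y"
    using W by (auto intro!: cellI cell_eqI)
  have "(?w \<bullet> st ?w) \<bullet> (?w \<bullet> st ?w) = ?w \<bullet> ((st ?w \<bullet> ?w) \<bullet> st ?w)"
    using c(1) by (simp add: typing vc_assoc)
  also have "\<dots> = ?w \<bullet> st ?w"
    unfolding c(2) using c(1) by (simp add: typing vc_id)
  finally have "(w \<cdot> adj C w) \<cdot> (w \<cdot> adj C w) = w \<cdot> adj C w"
    by (auto dest!: arg_cong[of _ _ cval])
  moreover have "adj C (w \<cdot> adj C w) = w \<cdot> adj C w"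
    using W adj_vcomp[of X Y X "adj C w" w] by (simp add: adj_adj[of Y X])
  moreover have "w \<cdot> adj C w \<in> Hom C X X"
    using W by (auto intro: vcomp_closed[of X Y X])
  ultimately show ?thesis
    by (simp add: projection_def)
qed

end

section \<open>The functional \<open>tau\<close> and its modular automorphism\<close>

context category_arrow
begin

lemma left_state_add:
  assumes "a \<in> left_center C X" "b \<in> left_center C X"
  shows "left_state C X (a + b) = left_state C X a + left_state C X b"
proof -
  obtain c where a: "a = (\<Sum>e\<in>left_minimal C X. c e *\<^sub>C e)"
    using L.minproj_expansion[OF assms(1)] unfolding left_minimal_eq by blast
  obtain d where b: "b = (\<Sum>e\<in>left_minimal C X. d e *\<^sub>C e)"
    using L.minproj_expansion[OF assms(2)] unfolding left_minimal_eq by blast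
  have "a + b = (\<Sum>e\<in>left_minimal C X. (c e + d e) *\<^sub>C e)"
    by (simp add: a b scaleC_add_left sum.distrib)
  then show ?thesis
    unfolding a b by (simp add: left_state_expansion distrib_right sum.distrib)
qed

lemma left_state_scale:
  assumes "a \<in> left_center C X"
  shows "left_state C X (k *\<^sub>C a) = k * left_state C X a"
proof -
  obtain c where a: "a = (\<Sum>e\<in>left_minimal C X. c e *\<^sub>C e)"
    using L.minproj_expansion[OF assms] unfolding left_minimal_eq by blast
  have "k *\<^sub>C a = (\<Sum>e\<in>left_minimal C X. (k * c e) *\<^sub>C e)"
    by (simp add: a complex_vs.scale_sum_right scaleC_scaleC)
  then show ?thesis
    unfolding a by (simp add: left_state_expansion sum_distrib_left mult.assoc)
qed

end

locale conjugate_category_arrow = category_arrow C X + conjugate_pair C N M X X' r r'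
  for C :: "('o, 'a, 't :: complex_normed_space) two_category" (structure)
    and N M :: 'o and X X' :: 'a and r r' :: "('a, 't) cell"
begin

definition tau :: "'t \<Rightarrow> complex" where
  "tau t = left_state C X (\<one> X \<otimes> left_inverse_map C X' (cval r) t)"

lemma left_inverse_closed: "t \<in> Hom C X X \<Longrightarrow> left_inverse_map C X' (cval r) t \<in> object_center C N"
  using left_inverse_map_closed[of X X' "cval r" t] by simp

lemma whisker_left_center: "z \<in> object_center C N \<Longrightarrow> \<one> X \<otimes> z \<in> left_center C X"
  by (auto simp: left_center_def)

lemma tau_add: "t \<in> Hom C X X \<Longrightarrow> s \<in> Hom C X X \<Longrightarrow> tau (t + s) = tau t + tau s"
  using left_inverse_closed[of t] left_inverse_closed[of s] whisker_left_center
    left_inverse_map_add[of X X' "cval r" t s]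
  by (simp add: tau_def whisker_center_linear left_state_add)

lemma tau_scale: "t \<in> Hom C X X \<Longrightarrow> tau (k *\<^sub>C t) = k * tau t"
  using left_inverse_closed[of t] whisker_left_center
    left_inverse_map_scale[of X X' "cval r" t k]
  by (simp add: tau_def whisker_center_linear left_state_scale)

lemma tau_diff: "t \<in> Hom C X X \<Longrightarrow> s \<in> Hom C X X \<Longrightarrow> tau (t - s) = tau t - tau s"
  using tau_add[of "t - s" s] by (simp add: Hom_diff)

lemma left_inverse_square:
  assumes "a \<in> Hom C X X"
  shows "left_inverse_map C X' (cval r) (adj C a \<cdot> a) = adj C (unfrob a) \<cdot> unfrob a"
proof -
  let ?a = "Cell X a X"
  have [simp]: "cell ?a"
    using assms by (auto intro!: cellI)
  have "st r \<bullet> (idc X' \<star> (st ?a \<bullet> ?a)) \<bullet> r = st ((idc X' \<star> ?a) \<bullet> r) \<bullet> ((idc X' \<star> ?a) \<bullet> r)"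
    using whiskered_square_left[of r ?a X'] by (simp add: typing vc_assoc)
  then show ?thesis
    by (auto simp: left_inverse_map_def unfrob_def dest!: arg_cong[of _ _ cval])
qed

text \<open>With \<open>T = 1 \<otimes> unfrob a\<close> the state is evaluated at the square of
  \<open>T\<close>, whose coefficient at a minimal projection \<open>e\<close> is nonnegative
  because \<open>T \<cdot> e\<close> has that multiple of \<open>e\<close> as its square.
  Faithfulness combines positivity of \<open>\<nu>\<close> with injectivity of reciprocity.\<close>

lemma tau_square:
  assumes con: "connected_arrow C X" and a: "a \<in> Hom C X X"
  shows "\<exists>s\<ge>0. tau (adj C a \<cdot> a) = complex_of_real s \<and> (s = 0 \<longrightarrow> a = 0)"
proof -
  let ?y = "unfrob a" and ?W = "X \<otimes>\<^sub>1 (X' \<otimes>\<^sub>1 X)"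
  have y: "?y \<in> H"
    using a by simp
  define T where "T = \<one> X \<otimes> ?y"
  have T: "T \<in> Hom C X ?W"
    unfolding T_def by (rule whisk_x[OF y])
  have TT: "adj C T \<cdot> T = \<one> X \<otimes> (adj C ?y \<cdot> ?y)"
    unfolding T_def using whisker_square(3)[of X X' ?y] y by simp
  have z: "adj C ?y \<cdot> ?y \<in> object_center C N"
    using y by (simp add: object_center_def)
  obtain c where c: "adj C T \<cdot> T = (\<Sum>e\<in>left_minimal C X. c e *\<^sub>C e)"
    using L.minproj_expansion[OF whisker_left_center[OF z]] unfolding TT left_minimal_eq by auto
  have TTH: "adj C T \<cdot> T \<in> Hom C X X"
    unfolding TT using whisker_center_closed[of X] z by simp
  have "\<exists>d\<ge>0. c e = complex_of_real d" if e: "e \<in> left_minimal C X" for e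
  proof -
    note E = minimalD[OF e]
    have ce: "(adj C T \<cdot> T) \<cdot> e = c e *\<^sub>C e"
      unfolding c left_minimal_eq using e by (intro L.expansion_mul) (simp flip: left_minimal_eq)
    have "st (Cell X T ?W \<bullet> Cell X e X) \<bullet> (Cell X T ?W \<bullet> Cell X e X) = st (Cell X e X) \<bullet> ((st (Cell X T ?W) \<bullet> Cell X T ?W) \<bullet> Cell X e X)"
      using cellI[OF parallel_conj1(1) T] cellI[of X X e] E by (simp add: typing st_vc vc_assoc)
    then have "adj C (T \<cdot> e) \<cdot> (T \<cdot> e) = e \<cdot> ((adj C T \<cdot> T) \<cdot> e)"
      using E(4) by (auto dest!: arg_cong[of _ _ cval])
    also have "\<dots> = c e *\<^sub>C e"
      unfolding ce using E by (simp add: vcomp_scaleC_right[of X X X])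
    finally have eq: "adj C (T \<cdot> e) \<cdot> (T \<cdot> e) = c e *\<^sub>C e" .
    have "T \<cdot> e \<in> Hom C X ?W"
      using T E by (auto intro: vcomp_closed[of X X ?W])
    then show ?thesis
      using square_multiple_nonneg[OF _ parallel_conj1(1) _ E(6,5) eq] by auto
  qed
  then obtain d where d: "\<And>e. e \<in> left_minimal C X \<Longrightarrow> 0 \<le> d e \<and> c e = complex_of_real (d e)"
    by metis
  define s where "s = (\<Sum>e\<in>left_minimal C X. d e * (sqrt_nu C X e)\<^sup>2)"
  have "tau (adj C a \<cdot> a) = left_state C X (\<Sum>e\<in>left_minimal C X. c e *\<^sub>C e)"
    unfolding tau_def left_inverse_square[OF a] TT[symmetric] c ..
  also have "\<dots> = complex_of_real s"
    unfolding left_state_expansion s_def using d by simp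
  finally have "tau (adj C a \<cdot> a) = complex_of_real s" .
  moreover have "0 \<le> s"
    unfolding s_def using d by (intro sum_nonneg) auto
  moreover have "a = 0" if "s = 0"
  proof -
    have "d e * (sqrt_nu C X e)\<^sup>2 = 0" if "e \<in> left_minimal C X" for e
      using \<open>s = 0\<close> that d sum_nonneg_eq_0_iff[OF finite_minimal(1), of "\<lambda>e. d e * (sqrt_nu C X e)\<^sup>2"]
      by (simp add: s_def)
    then have "c e = 0" if "e \<in> left_minimal C X" for e
      using that d sqrt_nu_pos[OF con that] by fastforce
    then have "adj C T \<cdot> T = 0"
      unfolding c by simp
    then have "T = 0"
      using star_proper[OF parallel_conj1(1) T] by simp
    then have "frob ?y = 0"
      using vcomp_zero_right[OF parallel_conj1(1,2) whisk_r'] by (simp add: frob_eq T_def)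
    then show "a = 0"
      using frob_unfrob[OF a] by simp
  qed
  ultimately show ?thesis
    by blast
qed

text \<open>The modular automorphism \<open>\<sigma>\<close> of \<open>tau\<close>, defined by \<open>tau (t a) = tau (\<sigma>(a) t)\<close>, is positive for the
  inner product \<open>(x, y) \<mapsto> tau (x y\<^sup>*)\<close>. Computing it with \<open>r\<close> and with \<open>r'\<close> gives two
  expressions that are inverse to each other, so sphericality yields \<open>\<sigma>\<^sup>2 = 1\<close> and hence \<open>\<sigma> = 1\<close>.\<close>

lemma spherical_bullet_adj:
  assumes con: "connected_arrow C X" and sph: "spherical C X X' (cval r) (cval r')" and a: "a \<in> Hom C X X"
  shows "bullet (adj C a) = adj C (bullet a)"
proof -
  have ad: "adj C t \<in> Hom C X X" "adj C (adj C t) = t" if "t \<in> Hom C X X" for t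
    using that adj_closed[of X X] adj_adj[of X X] by auto
  have ad': "adj C t \<in> Hom C X' X'" "adj C (adj C t) = t" if "t \<in> Hom C X' X'" for t
    using that adj_closed[of X' X'] adj_adj[of X' X'] by auto
  have mu: "s \<cdot> t \<in> Hom C X X" if "s \<in> Hom C X X" "t \<in> Hom C X X" for s t
    using that by (auto intro: vcomp_closed[of X X X])
  have tau_right: "tau t = right_state C X (right_inverse_map C X' (cval r') t \<otimes> \<one> X)" if "t \<in> Hom C X X" for t
    using sph that by (simp add: spherical_def tau_def)
  \<comment> \<open>Testing with the adjoint of \<open>d\<close> produces a square, to which
    \<open>tau_square\<close> applies.\<close>
  have faithful: "d = 0" if d: "d \<in> Hom C X X" and 0: "\<And>t. t \<in> Hom C X X \<Longrightarrow> tau (d \<cdot> t) = 0" for d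
  proof -
    have "tau (adj C (adj C d) \<cdot> adj C d) = 0"
      using 0[OF ad(1)[OF d]] d by (simp add: ad)
    then have "adj C d = 0"
      using tau_square[OF con ad(1)[OF d]] by auto
    then show "d = 0"
      using ad(2)[OF d] adj_zero[of X X] by simp
  qed
  \<comment> \<open>\<open>c\<close> is \<open>\<sigma>(a)\<close> computed with \<open>r'\<close>,
    and the adjoint of \<open>b\<close> is \<open>\<sigma>(a)\<close> computed with
    \<open>r\<close>; faithfulness identifies them.\<close>
  have modular: "bullet (adj C c) = adj C (bullet a) \<and> tau (t \<cdot> a) = tau (c \<cdot> t)"
    if a: "a \<in> Hom C X X" and c: "c \<in> Hom C X X" "bullet c = adj C (bullet (adj C a))" and t: "t \<in> Hom C X X" for a c t
  proof -
    obtain b where b: "b \<in> Hom C X X" "bullet b = adj C (bullet a)"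
      using bullet_surj[of "adj C (bullet a)"] ad' a by auto
    have l: "tau (t \<cdot> a) = tau (adj C b \<cdot> t)" if "t \<in> Hom C X X" for t
      unfolding tau_def using left_inverse_modular[OF a b(1) that b(2)] by simp
    have rr: "tau (t \<cdot> a) = tau (c \<cdot> t)" if "t \<in> Hom C X X" for t
      using right_inverse_modular[OF a c(1) that c(2)] tau_right[OF mu[OF that a]] tau_right[OF mu[OF c(1) that]] by simp
    have "tau ((adj C b - c) \<cdot> t) = 0" if "t \<in> Hom C X X" for t
      using l[OF that] rr[OF that] tau_diff[OF mu[OF ad(1)[OF b(1)] that] mu[OF c(1) that]] that ad(1)[OF b(1)] c(1)
      by (simp add: vcomp_diff_left[of X X X])
    then have "adj C b - c = 0"
      using ad(1)[OF b(1)] c(1) by (intro faithful Hom_diff) auto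
    then have "adj C c = b"
      using ad(2)[OF b(1)] by simp
    then show ?thesis
      using b rr[OF t] by simp
  qed
  obtain c where c: "c \<in> Hom C X X" "bullet c = adj C (bullet (adj C a))"
    using bullet_surj[of "adj C (bullet (adj C a))"] ad ad' a by auto
  have c': "bullet (adj C c) = adj C (bullet a)"
    using modular[OF a c a] by simp
  \<comment> \<open>By \<open>c\<close> and \<open>c'\<close> the automorphism exchanges
    \<open>a\<close> and \<open>c\<close>, so \<open>\<sigma>(x) = - x\<close>.\<close>
  define x where "x = a - c"
  have x: "x \<in> Hom C X X"
    unfolding x_def using a c by (simp add: Hom_diff)
  have mx: "- x \<in> Hom C X X"
    using Hom_scale[of X X x "-1"] x by simp
  have "bullet (- x) = bullet c - bullet a"
    using bullet_diff[OF c(1) a] by (simp add: x_def)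
  moreover have "adj C (bullet (adj C x)) = adj C (bullet (adj C a)) - adj C (bullet (adj C c))"
    unfolding x_def using a c ad by (simp add: adj_diff[of X X] bullet_diff adj_diff[of X' X'])
  ultimately have bx: "bullet (- x) = adj C (bullet (adj C x))"
    using c c' ad'(2)[of "bullet a"] a by simp
  \<comment> \<open>With the adjoint of \<open>x\<close> as \<open>t\<close>, the modular identity
    equates a nonnegative number with the negative of another, so both are 0 and
    \<open>x = 0\<close>.\<close>
  have "tau (adj C x \<cdot> x) = tau ((- x) \<cdot> adj C x)"
    using modular[OF x mx bx ad(1)[OF x]] by simp
  also have "(- x) \<cdot> adj C x = (-1) *\<^sub>C (x \<cdot> adj C x)"
    using vcomp_scaleC_left[of X X X "adj C x" x "-1"] x ad by simp
  also have "tau \<dots> = - tau (adj C (adj C x) \<cdot> adj C x)"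
    using tau_scale[OF mu[OF x ad(1)[OF x]], of "-1"] ad(2)[OF x] by simp
  finally have eq: "tau (adj C x \<cdot> x) = - tau (adj C (adj C x) \<cdot> adj C x)" .
  obtain s where s: "s \<ge> 0" "tau (adj C x \<cdot> x) = complex_of_real s" "s = 0 \<longrightarrow> x = 0"
    using tau_square[OF con x] by blast
  obtain s' where s': "s' \<ge> 0" "tau (adj C (adj C x) \<cdot> adj C x) = complex_of_real s'"
    using tau_square[OF con ad(1)[OF x]] by blast
  have "complex_of_real s = complex_of_real (- s')"
    using eq s s' by simp
  then have "s = - s'"
    using of_real_eq_iff by blast
  then have "x = 0"
    using s s' by simp
  then have "a = c"
    by (simp add: x_def)
  then show ?thesis
    using c' by simp
qed

end

section \<open>Assembling a standard solution from compressed pieces\<close>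

context two_C_star_category
begin

lemma tensor_composite:
  assumes "isometry C S Y v" "isometry C S' Y' v'" "isometry C A S u" "isometry C A' S' u'"
    and Y': "src C Y' = tgt C Y" "tgt C Y' = src C Y" and x: "x \<in> Hom C (\<I> (src C Y)) (A' \<otimes>\<^sub>1 A)"
  shows "(v' \<otimes> v) \<cdot> ((u' \<otimes> u) \<cdot> x) = ((v' \<cdot> u') \<otimes> (v \<cdot> u)) \<cdot> x"
proof -
  note V = isometryD[OF assms(1)] and V' = isometryD[OF assms(2)] and U = isometryD[OF assms(3)] and U' = isometryD[OF assms(4)]
  define n where n: "n = src C Y"
  have s: "n \<in> Ob C" "src C S = n" "tgt C S' = n" "src C S' = tgt C S" "tgt C Y = tgt C S"
    "src C A = n" "tgt C A' = n" "src C A' = tgt C S" "tgt C A = tgt C S"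
    using V(1,7) V'(1) U(1) U'(1) Y' by (auto simp: n parallel_def arr_simps)
  have c: "cell (Cell (\<I> n) x (A' \<otimes>\<^sub>1 A))"
    using x U U' s by (intro cellI) (auto simp: parallel_def n[symmetric] arr_simps)
  have "(Cell S' v' Y' \<star> Cell S v Y) \<bullet> ((Cell A' u' S' \<star> Cell A u S) \<bullet> Cell (\<I> n) x (A' \<otimes>\<^sub>1 A)) =
      ((Cell S' v' Y' \<bullet> Cell A' u' S') \<star> (Cell S v Y \<bullet> Cell A u S)) \<bullet> Cell (\<I> n) x (A' \<otimes>\<^sub>1 A)"
    using cellI[OF V(1,2)] cellI[OF V'(1,2)] cellI[OF U(1,2)] cellI[OF U'(1,2)] c s V V' U U'
    by (simp add: typing hc_vc flip: vc_assoc)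
  then show ?thesis
    by (auto dest!: arg_cong[of _ _ cval])
qed

lemma double_vcomp_sum_left:
  assumes "parallel C X Y" "parallel C Y Z" "r \<in> Hom C X Y" "\<And>i j. i \<in> I \<Longrightarrow> j \<in> J \<Longrightarrow> f i j \<in> Hom C Y Z"
  shows "(\<Sum>i\<in>I. \<Sum>j\<in>J. f i j) \<cdot> r = (\<Sum>i\<in>I. \<Sum>j\<in>J. f i j \<cdot> r)"
proof -
  have "(\<Sum>i\<in>I. \<Sum>j\<in>J. f i j) \<cdot> r = (\<Sum>i\<in>I. (\<Sum>j\<in>J. f i j) \<cdot> r)"
    using assms by (intro vcomp_sum_left[of X Y Z] Hom_sum) auto
  also have "\<dots> = (\<Sum>i\<in>I. \<Sum>j\<in>J. f i j \<cdot> r)"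
    using assms by (intro sum.cong refl vcomp_sum_left[of X Y Z]) auto
  finally show ?thesis .
qed

lemma expand_piece:
  assumes v: "isometry C S X v" and v': "isometry C S' X' v'" and X': "src C X' = tgt C X" "tgt C X' = src C X"
    and u: "\<And>h. h < (n::nat) \<Longrightarrow> isometry C (Y h) S (u h)" and u': "\<And>h. h < n \<Longrightarrow> isometry C (Y' h) S' (u' h)"
    and x: "\<And>h. h < n \<Longrightarrow> x h \<in> Hom C (\<I> (src C X)) (Y' h \<otimes>\<^sub>1 Y h)"
  shows "(v' \<otimes> v) \<cdot> (\<Sum>h<n. (u' h \<otimes> u h) \<cdot> (k *\<^sub>C x h)) = k *\<^sub>C (\<Sum>h<n. ((v' \<cdot> u' h) \<otimes> (v \<cdot> u h)) \<cdot> x h)"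
proof -
  note V = isometryD[OF v] and V' = isometryD[OF v'] and U = isometryD[OF u] and U' = isometryD[OF u']
  have sS: "src C S = src C X" "tgt C S = tgt C X" "src C S' = tgt C S" "tgt C S' = src C S"
    using V(1) V'(1) X' by (auto simp: parallel_def)
  have sY: "src C (Y h) = src C X" "tgt C (Y h) = tgt C X" "src C (Y' h) = tgt C X" "tgt C (Y' h) = src C X" if "h < n" for h
    using U(1)[OF that] U'(1)[OF that] sS by (auto simp: parallel_def)
  have p: "parallel C (\<I> (src C X)) (S' \<otimes>\<^sub>1 S)" "parallel C (S' \<otimes>\<^sub>1 S) (X' \<otimes>\<^sub>1 X)"
    using V V' X' sS by (auto simp: parallel_def arr_simps)
  have vv: "v' \<otimes> v \<in> Hom C (S' \<otimes>\<^sub>1 S) (X' \<otimes>\<^sub>1 X)"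
    using V V' sS by (intro hcomp_closed) auto
  have ux: "(u' h \<otimes> u h) \<cdot> x h \<in> Hom C (\<I> (src C X)) (S' \<otimes>\<^sub>1 S)" if h: "h < n" for h
    using tensor_isometry_Hom[OF u[OF h] u'[OF h] sS(3,4)] x[OF h] sS by simp
  have uxk: "(u' h \<otimes> u h) \<cdot> (k *\<^sub>C x h) = k *\<^sub>C ((u' h \<otimes> u h) \<cdot> x h)" if h: "h < n" for h
  proof (rule vcomp_scaleC_right)
    show "parallel C (\<I> (src C X)) (Y' h \<otimes>\<^sub>1 Y h)" "parallel C (Y' h \<otimes>\<^sub>1 Y h) (S' \<otimes>\<^sub>1 S)"
      using V V' U[OF h] U'[OF h] sS sY[OF h] by (auto simp: parallel_def arr_simps)
    show "u' h \<otimes> u h \<in> Hom C (Y' h \<otimes>\<^sub>1 Y h) (S' \<otimes>\<^sub>1 S)"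
      using U[OF h] U'[OF h] sY[OF h] by (intro hcomp_closed) auto
  qed (rule x[OF h])
  have "(v' \<otimes> v) \<cdot> (\<Sum>h<n. (u' h \<otimes> u h) \<cdot> (k *\<^sub>C x h)) = (\<Sum>h<n. (v' \<otimes> v) \<cdot> (k *\<^sub>C ((u' h \<otimes> u h) \<cdot> x h)))"
    using uxk ux Hom_scale[OF p(1)] vcomp_sum_right[OF p vv, of "{..<n}" "\<lambda>h. k *\<^sub>C ((u' h \<otimes> u h) \<cdot> x h)"] by simp
  also have "\<dots> = (\<Sum>h<n. k *\<^sub>C (((v' \<cdot> u' h) \<otimes> (v \<cdot> u h)) \<cdot> x h))"
  proof (intro sum.cong refl)
    fix h assume "h \<in> {..<n}"
    then have h: "h < n"
      by simp
    show "(v' \<otimes> v) \<cdot> (k *\<^sub>C ((u' h \<otimes> u h) \<cdot> x h)) = k *\<^sub>C (((v' \<cdot> u' h) \<otimes> (v \<cdot> u h)) \<cdot> x h)"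
      using vcomp_scaleC_right[OF p ux[OF h] vv, of k] tensor_composite[OF v v' u[OF h] u'[OF h] X' x[OF h]] by simp
  qed
  finally show ?thesis
    by (simp add: complex_vs.scale_sum_right)
qed

end

context conjugate_category_arrow
begin

text \<open>This is \<open>\<mu>^(1/4) / \<nu>^(1/4)\<close>, as \<open>sqrt_mu\<close> and
  \<open>sqrt_nu\<close> are already square roots.\<close>

definition weight :: "'t \<Rightarrow> 't \<Rightarrow> real" where
  "weight f e = sqrt (sqrt_mu C X f) / sqrt (sqrt_nu C X e)"

text \<open>One block of the sums in \<open>standard_solution\<close>, stated for the compression of
  the given \<open>r\<close> and \<open>r'\<close> by \<open>f \<cdot> e\<close>; the blocks can
  then be built independently.\<close>

definition standard_piece :: "'t \<Rightarrow> 't \<Rightarrow> 'a \<Rightarrow> 't \<Rightarrow> 'a \<Rightarrow> 't \<Rightarrow> 't \<Rightarrow> 't \<Rightarrow> bool" where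
  "standard_piece f e S v S' v' q q' \<longleftrightarrow>
    isometry_onto C S X v (f \<cdot> e) \<and> isometry_onto C S' X' v' (bullet (f \<cdot> e)) \<and> standard_solution_factorial C S S' q q' \<and>
    (\<one> X' \<otimes> (f \<cdot> e)) \<cdot> cval r = complex_of_real (weight f e) *\<^sub>C ((v' \<otimes> v) \<cdot> q) \<and>
    ((f \<cdot> e) \<otimes> \<one> X') \<cdot> cval r' = complex_of_real (1 / weight f e) *\<^sub>C ((v \<otimes> v') \<cdot> q')"

lemma bullet_projection:
  assumes "\<And>a. a \<in> Hom C X X \<Longrightarrow> bullet (adj C a) = adj C (bullet a)" "projection C X p"
  shows "projection C X' (bullet p)"
proof -
  have p: "p \<in> Hom C X X" "p \<cdot> p = p" "adj C p = p"
    using assms(2) by (auto simp: projection_def)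
  show ?thesis
    using bullet_mult[OF p(1) p(1)] assms(1)[OF p(1)] p by (simp add: projection_def)
qed

lemma standard_piece_exists:
  assumes con: "connected_arrow C X" and sph: "spherical C X X' (cval r) (cval r')"
    and f: "f \<in> right_minimal C X" and e: "e \<in> left_minimal C X"
  shows "\<exists>S v S' v' q q'. standard_piece f e S v S' v' q q'"
proof -
  interpret h: category_arrow "hop C" X
    by (rule hop_arrow)
  have star: "bullet (adj C a) = adj C (bullet a)" if "a \<in> Hom C X X" for a
    by (rule spherical_bullet_adj[OF con sph that])
  let ?g = "f \<cdot> e"
  note g = product_projection[OF f e] and E = minimalD[OF e] and F = right_minimalD[OF f]
  obtain S v where v: "isometry_onto C S X v ?g"
    using sub_1_arrows[OF XA g(3)] by auto
  obtain S' v' where v': "isometry_onto C S' X' v' (bullet ?g)"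
    using sub_1_arrows[OF X'(1) bullet_projection[OF star g(3)]] by auto
  have vi: "isometry C S X v" "v \<cdot> adj C v = ?g" and vi': "isometry C S' X' v'" "v' \<cdot> adj C v' = bullet ?g"
    using v v' by (auto simp: isometry_onto_def)
  note V = isometryD[OF vi(1)] and V' = isometryD[OF vi'(1)]
  obtain n :: nat and Y w where w: "\<And>h. h < n \<Longrightarrow> simple_arrow C (Y h) \<and> \<one> (Y h) \<noteq> 0 \<and> isometry C (Y h) X (w h) \<and> ?g \<cdot> w h = w h"
    and sum: "(\<Sum>h<n. w h \<cdot> adj C (w h)) = ?g"
    using simple_decomposition[OF XA g(3)] by blast
  define Q where "Q h = w h \<cdot> adj C (w h)" for h
  have wi: "isometry C (Y h) X (w h)" "isometry_onto C (Y h) X (w h) (Q h)" if "h < n" for h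
    using w[OF that] by (auto simp: isometry_onto_def Q_def)
  note W = isometryD[OF wi(1)]
  have Qp: "projection C X (Q h)" if "h < n" for h
    unfolding Q_def by (rule isometry_range_projection[OF wi(1)[OF that]])
  have QH: "Q h \<in> Hom C X X" "adj C (Q h) = Q h" if "h < n" for h
    using Qp[OF that] by (auto simp: projection_def)
  have "\<exists>Y' w'. isometry_onto C Y' X' w' (bullet (Q h))" if "h < n" for h
    using sub_1_arrows[OF X'(1) bullet_projection[OF star Qp[OF that]]] by auto
  then obtain Y' w' where w': "\<And>h. h < n \<Longrightarrow> isometry_onto C (Y' h) X' (w' h) (bullet (Q h))"
    by metis
  have wi': "isometry C (Y' h) X' (w' h)" "w' h \<cdot> adj C (w' h) = bullet (Q h)" if "h < n" for h
    using w'[OF that] by (auto simp: isometry_onto_def)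
  note W' = isometryD[OF wi'(1)]
  have Qg: "Q h \<cdot> ?g = Q h" if "h < n" for h
  proof -
    have "?g \<cdot> Q h = Q h"
      using vcomp_assoc[of X "Y h" X X "adj C (w h)" "w h" ?g] W[OF that] w[OF that] g(2) by (simp add: Q_def)
    from arg_cong[OF this, of "adj C"] show ?thesis
      using adj_vcomp[of X X X "Q h" ?g] QH[OF that] g(2,3) by (simp add: projection_def)
  qed
  \<comment> \<open>As \<open>bullet\<close> reverses products, \<open>bullet ?g\<close> is absorbed
    on the left of \<open>bullet (Q h)\<close> because \<open>?g\<close> is absorbed on the right of
    \<open>Q h\<close>.\<close>
  have gw': "bullet ?g \<cdot> w' h = w' h" if h: "h < n" for h
  proof -
    have i: "bullet (Q h) \<cdot> w' h = w' h"
      using vcomp_assoc[of "Y' h" X' "Y' h" X' "w' h" "adj C (w' h)" "w' h"] W'[OF h] wi'(2)[OF h]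
        vcomp_id_right[of "Y' h" X' "w' h"] by simp
    have "bullet ?g \<cdot> bullet (Q h) = bullet (Q h)"
      using bullet_mult[OF QH(1)[OF h] g(2)] Qg[OF h] by simp
    then show ?thesis
      using vcomp_assoc[of "Y' h" X' X' X' "w' h" "bullet (Q h)" "bullet ?g"] W'[OF h] i QH[OF h] g(2) by simp
  qed
  define x x' where "x h = (adj C (w' h) \<otimes> adj C (w h)) \<cdot> cval r" and "x' h = (adj C (w h) \<otimes> adj C (w' h)) \<cdot> cval r'" for h
  have r1: "(\<one> X' \<otimes> Q h) \<cdot> cval r = (bullet (Q h) \<otimes> \<one> X) \<cdot> cval r"
    "(Q h \<otimes> \<one> X') \<cdot> cval r' = (\<one> X \<otimes> bullet (Q h)) \<cdot> cval r'" if h: "h < n" for h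
    using bullet_eq[OF QH(1)[OF h]] bullet_right[OF QH(1)[OF h]] star[OF QH(1)[OF h]] QH(2)[OF h] by simp_all
  note comp = compressed_solution[OF solution wi(2) w' r1, folded x_def x'_def]
  have sol: "conjugate_solution C (Y h) (Y' h) (x h) (x' h)" if "h < n" for h
    using comp(1)[OF that that that that] .
  have xr: "(w' h \<otimes> w h) \<cdot> x h = (\<one> X' \<otimes> Q h) \<cdot> cval r" "(w h \<otimes> w' h) \<cdot> x' h = (Q h \<otimes> \<one> X') \<cdot> cval r'"
    "adj C (x h) \<cdot> x h = left_inverse_map C X' (cval r) (Q h)" "adj C (x' h) \<cdot> x' h = right_inverse_map C X' (cval r') (Q h)"
    if "h < n" for h
    using comp(2-5)[OF that that that that] by auto
  have sY: "src C (Y h) = src C X" "tgt C (Y h) = tgt C X" if "h < n" for h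
    using W(1)[OF that] by (auto simp: parallel_def)
  have xH: "x h \<in> Hom C (\<I> (src C X)) (Y' h \<otimes>\<^sub>1 Y h)" "x' h \<in> Hom C (\<I> (tgt C X)) (Y h \<otimes>\<^sub>1 Y' h)"
    "Y' h \<in> Arr C" "src C (Y' h) = tgt C (Y h)" "tgt C (Y' h) = src C (Y h)" if "h < n" for h
    using sol[OF that] sY[OF that] unfolding conjugate_solution_def by auto
  have ew: "e \<cdot> w h = w h" "f \<cdot> w h = w h" if h: "h < n" for h
    using vcomp_assoc[of "Y h" X X X "w h" ?g e] vcomp_assoc[of "Y h" X X X "w h" ?g f] W[OF h] w[OF h] g E F by auto
  let ?l = "weight f e"
  have mn: "0 < sqrt_mu C X f" "0 < sqrt_nu C X e"
    using sqrt_mu_pos[OF con f] sqrt_nu_pos[OF con e] .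
  have l: "0 < ?l" "?l\<^sup>2 = sqrt_mu C X f / sqrt_nu C X e"
    using mn by (simp_all add: weight_def power_divide)
  \<comment> \<open>Sphericality at \<open>Q h\<close>. By \<open>simple_piece\<close> the left
    inverse is a multiple of \<open>e\<close> alone and the right inverse of \<open>f\<close> alone,
    so a single weight enters on each side.\<close>
  have norms: "(norm (\<one> (Y h) \<otimes> x h))\<^sup>2 * (sqrt_nu C X e)\<^sup>2 = (norm (x' h \<otimes> \<one> (Y h)))\<^sup>2 * (sqrt_mu C X f)\<^sup>2" if h: "h < n" for h
  proof -
    have "\<one> X \<otimes> left_inverse_map C X' (cval r) (Q h) = complex_of_real ((norm (\<one> (Y h) \<otimes> x h))\<^sup>2) *\<^sub>C e"
      using simple_piece[of "Y h" "w h" e "Y' h" "x h"] w[OF h] wi(1)[OF h] e ew[OF h] xH[OF h] xr(3)[OF h] by simp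
    then have 1: "left_state C X (\<one> X \<otimes> left_inverse_map C X' (cval r) (Q h)) =
        complex_of_real ((norm (\<one> (Y h) \<otimes> x h))\<^sup>2 * (sqrt_nu C X e)\<^sup>2)"
      using left_state_sum[of "{()}" "\<lambda>_. e" "\<lambda>_. complex_of_real ((norm (\<one> (Y h) \<otimes> x h))\<^sup>2)"] e by simp
    have "right_inverse_map C X' (cval r') (Q h) \<otimes> \<one> X = complex_of_real ((norm (x' h \<otimes> \<one> (Y h)))\<^sup>2) *\<^sub>C f"
      using h.simple_piece[of "Y h" "w h" f "Y' h" "x' h"] w[OF h] wi(1)[OF h] f ew[OF h] xH[OF h] xr(4)[OF h] by simp
    then have 2: "right_state C X (right_inverse_map C X' (cval r') (Q h) \<otimes> \<one> X) =
        complex_of_real ((norm (x' h \<otimes> \<one> (Y h)))\<^sup>2 * (sqrt_mu C X f)\<^sup>2)"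
      using right_state_sum[of "{()}" "\<lambda>_. f" "\<lambda>_. complex_of_real ((norm (x' h \<otimes> \<one> (Y h)))\<^sup>2)"] f by simp
    show ?thesis
      using sph QH(1)[OF h] 1 2 unfolding spherical_def by (metis of_real_eq_iff)
  qed
  \<comment> \<open>By \<open>norms\<close> the two whiskered norms of the unscaled pair have the
    ratio \<open>?l\<close> squared; dividing one 2-arrow by \<open>?l\<close> and multiplying the
    other by it equalizes them and keeps the conjugate equations.\<close>
  define rh rh' where "rh h = complex_of_real (1 / ?l) *\<^sub>C x h" and "rh' h = complex_of_real ?l *\<^sub>C x' h" for h
  have norm_sol: "normalized_solution C (Y h) (Y' h) (rh h) (rh' h)" if h: "h < n" for h
  proof -
    have "conjugate_solution C (Y h) (Y' h) (rh h) (rh' h)"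
      unfolding rh_def rh'_def using l by (intro scale_solution[OF sol[OF h]]) simp
    moreover have "norm (\<one> (Y h) \<otimes> rh h) = norm (rh' h \<otimes> \<one> (Y h))"
    proof -
      define a b where "a = norm (\<one> (Y h) \<otimes> x h)" and "b = norm (x' h \<otimes> \<one> (Y h))"
      have ab: "a * sqrt_nu C X e = b * sqrt_mu C X f"
        using norms[OF h] mn by (simp add: a_def b_def power_eq_iff_eq_base flip: power_mult_distrib)
      then have "a = b * ?l\<^sup>2"
        using mn unfolding l(2) by (simp add: field_simps)
      then have "1 / ?l * a = ?l * b"
        using l(1) by (simp add: power2_eq_square)
      then show ?thesis
        unfolding rh_def rh'_def norm_scale_whisker[OF sol[OF h]] using l(1) by (simp add: a_def b_def)
    qed
    ultimately show ?thesis
      by (simp add: normalized_solution_def)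
  qed
  define u u' where "u h = adj C v \<cdot> w h" and "u' h = adj C v' \<cdot> w' h" for h
  have u: "isometry C (Y h) S (u h)" "v \<cdot> u h = w h" "u h \<cdot> adj C (u h) = adj C v \<cdot> Q h \<cdot> v" if h: "h < n" for h
    using factor_isometry[OF v wi(1)[OF h]] w[OF h] by (auto simp: u_def Q_def)
  have u': "isometry C (Y' h) S' (u' h)" "v' \<cdot> u' h = w' h" "u' h \<cdot> adj C (u' h) = adj C v' \<cdot> bullet (Q h) \<cdot> v'" if h: "h < n" for h
    using factor_isometry[OF v' wi'(1)[OF h] gw'[OF h]] wi'(2)[OF h] by (auto simp: u'_def)
  have "(\<Sum>h<n. u h \<cdot> adj C (u h)) = adj C v \<cdot> (\<Sum>h<n. Q h) \<cdot> v"
    using u(3) QH V by (subst vcomp_sum_both[of S X]) auto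
  also have "(\<Sum>h<n. Q h) = ?g"
    using sum by (simp add: Q_def)
  also have "adj C v \<cdot> ?g \<cdot> v = \<one> S"
    using V isometry_onto_absorb(1)[OF v] vcomp_assoc[of S X X S v ?g "adj C v"] g(2) by simp
  finally have uu: "(\<Sum>h<n. u h \<cdot> adj C (u h)) = \<one> S" .
  have gabs': "bullet ?g \<cdot> v' = v'"
    using vcomp_assoc[of S' X' S' X' v' "adj C v'" v'] V' vi'(2) vcomp_id_right[of S' X' v'] by simp
  have "(\<Sum>h<n. u' h \<cdot> adj C (u' h)) = adj C v' \<cdot> (\<Sum>h<n. bullet (Q h)) \<cdot> v'"
    using u'(3) QH V' by (subst vcomp_sum_both[of S' X']) auto
  also have "(\<Sum>h<n. bullet (Q h)) = bullet ?g"
    using sum bullet_sum[of "{..<n}" Q] QH by (simp add: Q_def)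
  also have "adj C v' \<cdot> bullet ?g \<cdot> v' = \<one> S'"
    using V' gabs' vcomp_assoc[of S' X' X' S' v' "bullet ?g" "adj C v'"] g(2) by simp
  finally have uu': "(\<Sum>h<n. u' h \<cdot> adj C (u' h)) = \<one> S'" .
  define q q' where "q = (\<Sum>h<n. (u' h \<otimes> u h) \<cdot> rh h)" and "q' = (\<Sum>h<n. (u h \<otimes> u' h) \<cdot> rh' h)"
  have sS: "src C S = src C X" "tgt C S = tgt C X" "src C S' = tgt C X" "tgt C S' = src C X"
    using V(1) V'(1) by (auto simp: parallel_def)
  have st: "standard_solution_factorial C S S' q q'"
    unfolding standard_solution_factorial_def
  proof (intro conjI)
    show "\<exists>(n'::nat) Yh Yh' ua ub ra rb.
      (\<forall>h<n'. simple_arrow C (Yh h) \<and> isometry C (Yh h) S (ua h) \<and> isometry C (Yh' h) S' (ub h) \<and>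
        normalized_solution C (Yh h) (Yh' h) (ra h) (rb h)) \<and>
      (\<Sum>h<n'. ua h \<cdot> adj C (ua h)) = \<one> S \<and> (\<Sum>h<n'. ub h \<cdot> adj C (ub h)) = \<one> S' \<and>
      q = (\<Sum>h<n'. (ub h \<otimes> ua h) \<cdot> ra h) \<and> q' = (\<Sum>h<n'. (ua h \<otimes> ub h) \<cdot> rb h)"
      by (rule exI[of _ n], rule exI[of _ Y], rule exI[of _ Y'], rule exI[of _ u], rule exI[of _ u'],
          rule exI[of _ rh], rule exI[of _ rh'])
        (use w u u' norm_sol uu uu' in \<open>simp add: q_def q'_def\<close>)
  qed (use sub_factorial[OF f e v] V' sS in auto)
  have rhH: "rh h \<in> Hom C (\<I> (src C X)) (Y' h \<otimes>\<^sub>1 Y h)" "rh' h \<in> Hom C (\<I> (tgt C X)) (Y h \<otimes>\<^sub>1 Y' h)" if "h < n" for h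
    using norm_sol[OF that] sY[OF that] by (auto simp: normalized_solution_def conjugate_solution_def)
  have sX': "src C X' = tgt C X" "tgt C X' = src C X"
    by simp_all
  have QQ: "(\<Sum>h<n. Q h) = ?g"
    using sum by (simp add: Q_def)
  have "(v' \<otimes> v) \<cdot> q = complex_of_real (1 / ?l) *\<^sub>C (\<Sum>h<n. ((v' \<cdot> u' h) \<otimes> (v \<cdot> u h)) \<cdot> x h)"
    unfolding q_def rh_def by (rule expand_piece[OF vi(1) vi'(1) sX' u(1) u'(1) xH(1)])
  also have "(\<Sum>h<n. ((v' \<cdot> u' h) \<otimes> (v \<cdot> u h)) \<cdot> x h) = (\<Sum>h<n. (\<one> X' \<otimes> Q h) \<cdot> cval r)"
    using u(2) u'(2) xr(1) by simp
  also have "\<dots> = (\<Sum>h<n. \<one> X' \<otimes> Q h) \<cdot> cval r"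
    using whisk_a QH by (intro vcomp_sum_left[of "\<I> N" "X' \<otimes>\<^sub>1 X" "X' \<otimes>\<^sub>1 X", symmetric]) auto
  also have "(\<Sum>h<n. \<one> X' \<otimes> Q h) = \<one> X' \<otimes> ?g"
    unfolding QQ[symmetric] using QH by (intro hcomp_sum_right[of X X X' X', symmetric]) (auto simp: id2_closed)
  finally have left: "(\<one> X' \<otimes> ?g) \<cdot> cval r = complex_of_real ?l *\<^sub>C ((v' \<otimes> v) \<cdot> q)"
    using l(1) by (simp add: scaleC_scaleC flip: of_real_mult)
  interpret s: conjugate_pair C M N X' X r' r
    by (rule swap)
  have QR: "Q h \<otimes> \<one> X' \<in> Hom C (X \<otimes>\<^sub>1 X') (X \<otimes>\<^sub>1 X')" if "h < n" for h
    using s.whisk_b[OF QH(1)[OF that]] .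
  have "(v \<otimes> v') \<cdot> q' = complex_of_real ?l *\<^sub>C (\<Sum>h<n. ((v \<cdot> u h) \<otimes> (v' \<cdot> u' h)) \<cdot> x' h)"
    unfolding q'_def rh'_def
    using h.expand_piece[of S X v S' X' v' n Y u Y' u' x' "complex_of_real ?l"] vi(1) vi'(1) u(1) u'(1) xH(2) by simp
  also have "(\<Sum>h<n. ((v \<cdot> u h) \<otimes> (v' \<cdot> u' h)) \<cdot> x' h) = (\<Sum>h<n. (Q h \<otimes> \<one> X') \<cdot> cval r')"
    using u(2) u'(2) xr(2) by simp
  also have "\<dots> = (\<Sum>h<n. Q h \<otimes> \<one> X') \<cdot> cval r'"
    using QR by (intro vcomp_sum_left[of "\<I> M" "X \<otimes>\<^sub>1 X'" "X \<otimes>\<^sub>1 X'", symmetric]) auto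
  also have "(\<Sum>h<n. Q h \<otimes> \<one> X') = ?g \<otimes> \<one> X'"
    unfolding QQ[symmetric] using QH by (intro hcomp_sum_left[of X' X' X X, symmetric]) (auto simp: id2_closed)
  finally have right: "(?g \<otimes> \<one> X') \<cdot> cval r' = complex_of_real (1 / ?l) *\<^sub>C ((v \<otimes> v') \<cdot> q')"
    using l(1) by (simp add: scaleC_scaleC flip: of_real_mult)
  show ?thesis
    using v v' st left right unfolding standard_piece_def by blast
qed

lemma spherical_standard:
  assumes con: "connected_arrow C X" and sph: "spherical C X X' (cval r) (cval r')"
  shows "standard_solution C X X' (cval r) (cval r')"
proof -
  let ?E = "left_minimal C X" and ?F = "right_minimal C X"
  have "\<exists>p. p \<in> object_center C (tgt C X) \<and> p \<otimes> \<one> X = f" if "f \<in> ?F" for f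
    using right_minimalD(1)[OF that] by (auto simp: right_center_def)
  then obtain p where p: "\<And>f. f \<in> ?F \<Longrightarrow> p f \<in> object_center C (tgt C X) \<and> p f \<otimes> \<one> X = f"
    by metis
  have "\<exists>q. q \<in> object_center C (src C X) \<and> \<one> X \<otimes> q = e" if "e \<in> ?E" for e
    using minimalD(1)[OF that] by (auto simp: left_center_def)
  then obtain q where q: "\<And>e. e \<in> ?E \<Longrightarrow> q e \<in> object_center C (src C X) \<and> \<one> X \<otimes> q e = e"
    by metis
  obtain S v S' v' s s' where piece: "\<And>f e. f \<in> ?F \<Longrightarrow> e \<in> ?E \<Longrightarrow>
      standard_piece f e (S f e) (v f e) (S' f e) (v' f e) (s f e) (s' f e)"
    using standard_piece_exists[OF con sph] by metis
  have feH: "f \<cdot> e \<in> Hom C X X" if "f \<in> ?F" "e \<in> ?E" for f e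
    using product_projection(2)[OF that] .
  \<comment> \<open>Inserted next to \<open>r\<close> and \<open>r'\<close>, this resolution of the
    unit writes each of them as the sum of its compressions, which are the standard pieces.\<close>
  have "\<one> X = (\<Sum>f\<in>?F. f) \<cdot> \<one> X"
    using sum_minimal by (simp add: vcomp_id_left[of X X] id2_closed)
  also have "\<dots> = (\<Sum>f\<in>?F. f \<cdot> (\<Sum>e\<in>?E. e))"
    using right_minimalD(2) sum_minimal by (subst vcomp_sum_left[of X X X]) (auto simp: id2_closed)
  also have "\<dots> = (\<Sum>f\<in>?F. \<Sum>e\<in>?E. f \<cdot> e)"
    using right_minimalD(2) minimalD(2) by (intro sum.cong refl vcomp_sum_right[of X X X]) auto
  finally have one: "\<one> X = (\<Sum>f\<in>?F. \<Sum>e\<in>?E. f \<cdot> e)" .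
  have feS: "(\<Sum>e\<in>?E. f \<cdot> e) \<in> Hom C X X" if "f \<in> ?F" for f
    using feH that by (intro Hom_sum) auto
  interpret w: conjugate_pair C M N X' X r' r
    by (rule swap)
  have "cval r = (\<one> X' \<otimes> \<one> X) \<cdot> cval r"
    using hcomp_id2[of X X'] vcomp_id_left[OF parallel_IXX(1) cval_r] by simp
  also have "\<dots> = (\<Sum>f\<in>?F. \<Sum>e\<in>?E. (\<one> X' \<otimes> (f \<cdot> e)) \<cdot> cval r)"
  proof -
    have "\<one> X' \<otimes> \<one> X = (\<Sum>f\<in>?F. \<Sum>e\<in>?E. \<one> X' \<otimes> (f \<cdot> e))"
      unfolding one using feH feS by (simp add: hcomp_sum_right[of X X X' X'] id2_closed)
    then show ?thesis
      by (simp only: double_vcomp_sum_left[OF parallel_IXX(1) parallel_conj1(3) cval_r whisk_a[OF feH]])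
  qed
  also have "\<dots> = (\<Sum>f\<in>?F. \<Sum>e\<in>?E. (sqrt (sqrt_mu C X f) / sqrt (sqrt_nu C X e)) *\<^sub>R ((v' f e \<otimes> v f e) \<cdot> s f e))"
    using piece by (intro sum.cong refl) (simp add: standard_piece_def weight_def flip: scaleC_of_real)
  finally have r_eq: "cval r = (\<Sum>f\<in>?F. \<Sum>e\<in>?E. (sqrt (sqrt_mu C X f) / sqrt (sqrt_nu C X e)) *\<^sub>R ((v' f e \<otimes> v f e) \<cdot> s f e))" .
  have "cval r' = (\<one> X \<otimes> \<one> X') \<cdot> cval r'"
    using hcomp_id2[of X' X] vcomp_id_left[OF w.parallel_IXX(1) w.cval_r] by simp
  also have "\<dots> = (\<Sum>f\<in>?F. \<Sum>e\<in>?E. ((f \<cdot> e) \<otimes> \<one> X') \<cdot> cval r')"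
  proof -
    have "\<one> X \<otimes> \<one> X' = (\<Sum>f\<in>?F. \<Sum>e\<in>?E. (f \<cdot> e) \<otimes> \<one> X')"
      unfolding one using feH feS by (simp add: hcomp_sum_left[of X' X' X X] id2_closed)
    then show ?thesis
      by (simp only: double_vcomp_sum_left[OF w.parallel_IXX(1) w.parallel_conj1(3) w.cval_r w.whisk_b[OF feH]])
  qed
  also have "\<dots> = (\<Sum>f\<in>?F. \<Sum>e\<in>?E. (sqrt (sqrt_nu C X e) / sqrt (sqrt_mu C X f)) *\<^sub>R ((v f e \<otimes> v' f e) \<cdot> s' f e))"
    using piece by (intro sum.cong refl) (simp add: standard_piece_def weight_def flip: scaleC_of_real)
  finally have r'_eq: "cval r' = (\<Sum>f\<in>?F. \<Sum>e\<in>?E. (sqrt (sqrt_nu C X e) / sqrt (sqrt_mu C X f)) *\<^sub>R ((v f e \<otimes> v' f e) \<cdot> s' f e))" .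
  have r_cell: "Cell (\<I> N) (cval r) (X' \<otimes>\<^sub>1 X) = r"
    by (intro cell_eqI) simp_all
  have "p f \<otimes> \<one> X \<otimes> q e = f \<cdot> e" "q e \<otimes> \<one> X' \<otimes> p f = bullet (f \<cdot> e)" if "f \<in> ?F" "e \<in> ?E" for f e
    using bimodule_projection[OF solution, of N M "p f" "q e"] p[OF that(1)] q[OF that(2)] by (simp_all add: r_cell)
  then have pieces: "\<forall>f\<in>?F. \<forall>e\<in>?E. isometry_onto C (S f e) X (v f e) (p f \<otimes> \<one> X \<otimes> q e) \<and>
      isometry_onto C (S' f e) X' (v' f e) (q e \<otimes> \<one> X' \<otimes> p f) \<and>
      standard_solution_factorial C (S f e) (S' f e) (s f e) (s' f e)"
    using piece by (simp add: standard_piece_def)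
  have ps: "\<forall>f\<in>?F. p f \<in> object_center C (tgt C X) \<and> p f \<otimes> \<one> X = f"
    and qs: "\<forall>e\<in>?E. q e \<in> object_center C (src C X) \<and> \<one> X \<otimes> q e = e"
    using p q by blast+
  show ?thesis
    unfolding standard_solution_def
    by (intro conjI[OF solution], rule exI[of _ p], rule exI[of _ q], rule exI[of _ S], rule exI[of _ S'], rule exI[of _ v],
        rule exI[of _ v'], rule exI[of _ s], rule exI[of _ s'])
      (intro conjI ps qs pieces r_eq r'_eq)
qed

end

text \<open>A zero 1-arrow satisfies \<open>connected_arrow\<close>, since both centers and the
  scalars reduce to 0; \<open>nonzero\<close> excludes it, in accordance with the convention that
  the matrix dimension belongs to nonzero connected 1-arrows.\<close>

theorem theorem7p39:
  fixes C :: "('o, 'a, 't :: complex_normed_space) two_category"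
    and X X' :: 'a
  assumes "two_C_star_category C"
    and "rigid C"
    and "finite_dimensional_centers C"
    and "conjugate_arrows C X X'"
    and "connected_arrow C X"
    and "connected_arrow C X'"
    and nonzero: "\<one>\<^bsub>C\<^esub> X \<noteq> 0"
  shows "(\<forall>r r'. standard_solution C X X' r r' \<longrightarrow> spherical C X X' r r') \<and>
    (\<forall>r r'. conjugate_solution C X X' r r' \<and> spherical C X X' r r' \<longrightarrow>
      standard_solution C X X' r r')"
proof (intro conjI allI impI)
  interpret rigid_category C
    using assms by (simp add: rigid_category_def rigid_category_axioms_def)
  interpret category_arrow C X
    using assms by unfold_locales (auto simp: connected_arrow_def)
  show "spherical C X X' r r'" if "standard_solution C X X' r r'" for r r'
    using standard_spherical assms(5) that by blast
  show "standard_solution C X X' r r'" if "conjugate_solution C X X' r r' \<and> spherical C X X' r r'" for r r'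
  proof -
    define N M where NM: "N = src C X" "M = tgt C X"
    interpret P: conjugate_category_arrow C N M X X' "Cell (id1 C N) r (comp1 C X' X)" "Cell (id1 C M) r' (comp1 C X X')"
      using conjugate_solution_pair[OF assms(1) _ NM] that category_arrow_axioms
      by (intro conjugate_category_arrow.intro) auto
    show ?thesis
      using P.spherical_standard[OF assms(5)] that by simp
  qed
qed

end
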